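(* Let $B$ be a non-zero finite skew brace such that $(B,\cdot)$ is nilpotent. Then $B*B\neq B$ and $\partial(B)\neq B$.
   Context: A skew brace is a triple $B=(B,+,\cdot)$ such that $(B,+)$ and $(B,\cdot)$ are groups (neither assumed abelian) on the same underlying set and $a\cdot(b+c)=a\cdot b-a+a\cdot c$ for all $a,b,c\in B$. The two identity elements coincide and are denoted by $0$; "non-zero" means $|B|>1$. For $a\in B$, $\lambda_a(b)=-a+a\cdot b$ defines an automorphism of $(B,+)$. Put $a*b=\lambda_a(b)-b$, and let $B*B$ be the subgroup of $(B,+)$ generated by all $a*b$ with $a,b\in B$. A left ideal of $B$ is a subgroup $I\leq (B,+)$ with $\lambda_b(I)=I$ for every $b\in B$. An ideal of $B$ is a left ideal that is normal in both $(B,+)$ and $(B,\cdot)$. Finally, $\partial(B)=[B,B]_B$ is the ideal of $B$ generated by $[B,B]_+\cup[B,B]_\cdot\cup\{\,a\cdot b-(a+b)\mid a,b\in B\,\}$, where $[B,B]_+$ and $[B,B]_\cdot$ are the commutator subgroups of $(B,+)$ and $(B,\cdot)$. *)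

theory Defs
  imports "HOL-Algebra.Generated_Groups" "HOL-Algebra.Ring"
begin

text \<open>A skew brace is carried by a record of type \<open>ring\<close>, used only for its two operations:
  \<open>add_monoid B\<close> is the additive group (not assumed abelian) and \<open>B\<close> itself, read as a
  monoid record, is the multiplicative group, on the same carrier.\<close>

locale skew_brace =
  fixes B (structure)
  assumes add_group: "group (add_monoid B)"
    and mult_group: "group B"
    and brace_distrib:
      "\<lbrakk>a \<in> carrier B; b \<in> carrier B; c \<in> carrier B\<rbrakk>
        \<Longrightarrow> a \<otimes> (b \<oplus> c) = ((a \<otimes> b) \<oplus> (\<ominus> a)) \<oplus> (a \<otimes> c)"

lemma (in skew_brace) zero_eq_one: "\<zero> = \<one>"
proof -
  interpret add: group "add_monoid B" by (rule add_group)
  interpret mult: group B by (rule mult_group)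
  have z: "\<zero> \<in> carrier B" using add.one_closed by simp
  have oz: "\<one> \<oplus> \<zero> = \<one>" using add.r_one[of \<one>] by simp
  have zz: "\<zero> \<oplus> \<zero> = \<zero>" using add.r_one[of \<zero>] z by simp
  have inv_closed: "\<ominus> \<one> \<in> carrier B"
    using add.inv_closed[of \<one>] by (simp add: a_inv_def)
  have "\<zero> = (\<zero> \<oplus> (\<ominus> \<one>)) \<oplus> \<zero>"
    using brace_distrib[OF mult.one_closed z z] zz z by simp
  also have "\<dots> = \<ominus> \<one>"
    using add.l_one[of "\<ominus> \<one>"] add.r_one[of "\<ominus> \<one>"] inv_closed by simp
  finally have "\<ominus> \<one> = \<zero>" by simp
  then show ?thesis
    using add.r_inv[of \<one>] oz by (simp add: a_inv_def)
qed

definition brace_lambda :: "('a, 'm) ring_scheme \<Rightarrow> 'a \<Rightarrow> 'a \<Rightarrow> 'a" where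
  "brace_lambda B a b = (\<ominus>\<^bsub>B\<^esub> a) \<oplus>\<^bsub>B\<^esub> (a \<otimes>\<^bsub>B\<^esub> b)"

definition brace_star :: "('a, 'm) ring_scheme \<Rightarrow> 'a \<Rightarrow> 'a \<Rightarrow> 'a" where
  "brace_star B a b = brace_lambda B a b \<oplus>\<^bsub>B\<^esub> (\<ominus>\<^bsub>B\<^esub> b)"

definition brace_star_square :: "('a, 'm) ring_scheme \<Rightarrow> 'a set" where
  "brace_star_square B =
    generate (add_monoid B) {brace_star B a b | a b. a \<in> carrier B \<and> b \<in> carrier B}"

definition brace_left_ideal :: "'a set \<Rightarrow> ('a, 'm) ring_scheme \<Rightarrow> bool" where
  "brace_left_ideal I B \<longleftrightarrow>
    subgroup I (add_monoid B) \<and> (\<forall>b \<in> carrier B. brace_lambda B b ` I = I)"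

definition brace_ideal :: "'a set \<Rightarrow> ('a, 'm) ring_scheme \<Rightarrow> bool" where
  "brace_ideal I B \<longleftrightarrow> brace_left_ideal I B \<and> I \<lhd> add_monoid B \<and> I \<lhd> B"

definition brace_genideal :: "('a, 'm) ring_scheme \<Rightarrow> 'a set \<Rightarrow> 'a set" where
  "brace_genideal B S = \<Inter>{I. brace_ideal I B \<and> S \<subseteq> I}"

definition brace_derived :: "('a, 'm) ring_scheme \<Rightarrow> 'a set" where
  "brace_derived B = brace_genideal B
    (derived (add_monoid B) (carrier B) \<union> derived B (carrier B) \<union>
     {(a \<otimes>\<^bsub>B\<^esub> b) \<oplus>\<^bsub>B\<^esub> (\<ominus>\<^bsub>B\<^esub> (a \<oplus>\<^bsub>B\<^esub> b)) | a b. a \<in> carrier B \<and> b \<in> carrier B})"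

primrec lower_central_series :: "('a, 'm) monoid_scheme \<Rightarrow> nat \<Rightarrow> 'a set" where
  "lower_central_series G 0 = carrier G"
| "lower_central_series G (Suc n) =
    generate G {x \<otimes>\<^bsub>G\<^esub> y \<otimes>\<^bsub>G\<^esub> inv\<^bsub>G\<^esub> x \<otimes>\<^bsub>G\<^esub> inv\<^bsub>G\<^esub> y
      | x y. x \<in> lower_central_series G n \<and> y \<in> carrier G}"

definition nilpotent_group :: "('a, 'm) monoid_scheme \<Rightarrow> bool" where
  "nilpotent_group G \<longleftrightarrow> group G \<and> (\<exists>n. lower_central_series G n = {\<one>\<^bsub>G\<^esub>})"

end

theory Submission
imports Defs "Jordan_Normal_Form.Schur_Decomposition" "HOL-Computational_Algebra.Fundamental_Theorem_Algebra"
  "HOL-Algebra.Sylow" "HOL-Algebra.Multiplicative_Group" "HOL-Library.Set_Algebras"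
  "HOL-Combinatorics.Perm" "HOL-Number_Theory.Cong"
begin

text \<open>The maps \<open>x \<mapsto> a + \<lambda>\<^sub>b(x)\<close> form a permutation group \<open>G = TH = TD = DH\<close>, where \<open>T\<close> consists of the
  additive translations, \<open>H\<close> of the maps \<open>\<lambda>\<^sub>b\<close> and \<open>D\<close> of the multiplicative translations. As \<open>D\<close> and \<open>H\<close> are
  images of the nilpotent multiplicative group, \<open>G\<close> is solvable by the theorem of Kegel and Wielandt. Let
  \<open>N\<close> be maximal among the normal subgroups of \<open>G\<close> properly contained in \<open>T\<close>. Then \<open>T/N\<close> is an abelian
  minimal normal subgroup of \<open>G/N\<close>. If it were not central, the images of \<open>D\<close> and \<open>H\<close> would be conjugate
  complements of it, although their product is \<open>G/N\<close>, which is impossible. So \<open>T/N\<close> is central, and \<open>N\<close>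
  corresponds to a proper ideal of the skew brace whose quotient is an abelian group on which the two
  operations agree; it contains both \<open>B * B\<close> and \<open>\<partial>(B)\<close>.

  For Kegel and Wielandt, a minimal counterexample \<open>G = AB\<close> is simple with \<open>A\<close> and \<open>B\<close> of coprime orders.
  If \<open>A\<close> or \<open>B\<close> is a group of prime power order, Burnside's theorem on conjugacy classes of prime power
  size applies. Otherwise one shows that \<open>A\<close> contains the centralizers of its central elements, that
  centralizers of elements of \<open>A\<close> lie in \<open>N(A)\<close>, and finally that \<open>A\<close> is a trivial intersection subgroup,
  so \<open>|A| \<le> |B|\<close>; by symmetry \<open>|A| = |B|\<close>, contradicting coprimality.\<close>

text \<open>In the product theorem, minimality makes a proper subgroup \<open>J\<close> solvable
  only if \<open>J = (J \<inter> A)(J \<inter> B)\<close>. Normalizers need not factorise in this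
  way, and much of the work shows that particular ones do. The gain is that elements of such a
  \<open>J\<close> centralising the normal cores of both \<open>J \<inter> A\<close> and
  \<open>J \<inter> B\<close> split inside these cores, which controls commutators of central
  elements of \<open>A\<close> and \<open>B\<close>. The argument plays a second prime of each order
  against a given one, which is why prime power orders are left to Burnside's theorem. That theorem
  is proved without characters, from idempotents in the centre of the complex group algebra. They
  need not be primitive, so only divisibility by a square root of \<open>p\<close> is obtained,
  which still contradicts the integrality of \<open>1/p\<close>. For the brace, the product theorem
  serves to make \<open>T/N\<close> abelian; centrality then follows from Sylow's theorem and
  counting. Conjugation by \<open>H\<close> turns centrality of \<open>T/N\<close> into invariance
  under all \<open>\<lambda>_b\<close>, so sum and product have the same image in
  \<open>T/N\<close>.\<close>

hide_const (open) up_ring.coeff up_ring.monom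

subsection \<open>Eigenvalues of kernels on finite sets\<close>

lemma nonzero_vecD:
  assumes "v \<in> carrier_vec n" "v \<noteq> 0\<^sub>v n"
  shows "\<exists>i<n. v $ i \<noteq> 0"
proof (rule ccontr)
  assume "\<not> ?thesis"
  then have "v = 0\<^sub>v n" using assms(1) by (intro eq_vecI) auto
  then show False using assms(2) by simp
qed

lemma bij_betw_nat_obtain:
  assumes "bij_betw b {0..<n::nat} G" and "g \<in> G"
  obtains j where "j < n" "g = b j"
proof -
  have "g \<in> b ` {0..<n}" using assms bij_betw_imp_surj_on by blast
  then show ?thesis using that by auto
qed

text \<open>Bridge from functions on a finite set to matrices: the enumeration \<open>b\<close>
  fixes a basis, and eigenvectors of the matrix become eigenfunctions of the operator with kernel
  \<open>k\<close>. The group algebra arguments can then stay free of indices.\<close>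

lemma eigenvalue_kernel:
  fixes k :: "'a \<Rightarrow> 'a \<Rightarrow> 'b::field"
  assumes b: "bij_betw b {0..<n} G"
  shows "eigenvalue (mat n n (\<lambda>(i,j). k (b i) (b j))) d \<longleftrightarrow>
    (\<exists>f. (\<exists>g\<in>G. f g \<noteq> 0) \<and> (\<forall>g\<in>G. (\<Sum>h\<in>G. k g h * f h) = d * f g))" (is "eigenvalue ?A d \<longleftrightarrow> ?R")
proof -
  have bG: "b i \<in> G" if "i < n" for i using b that by (auto simp: bij_betw_def)
  have sm: "(\<Sum>h\<in>G. k (b j) h * f h) = (?A *\<^sub>v vec n (\<lambda>i. f (b i))) $ j" if "j < n" for j f
  proof -
    have "(\<Sum>h\<in>G. k (b j) h * f h) = (\<Sum>i\<in>{0..<n}. k (b j) (b i) * f (b i))"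
      using sum.reindex_bij_betw [OF b, of "\<lambda>h. k (b j) h * f h"] by simp
    also have "\<dots> = (?A *\<^sub>v vec n (\<lambda>i. f (b i))) $ j"
      using that by (auto simp: scalar_prod_def intro!: sum.cong)
    finally show ?thesis .
  qed
  show ?thesis
  proof
    assume "eigenvalue ?A d"
    then obtain v where v: "v \<in> carrier_vec n" "v \<noteq> 0\<^sub>v n" "?A *\<^sub>v v = d \<cdot>\<^sub>v v"
      unfolding eigenvalue_def eigenvector_def by auto
    define f where "f g = v $ (the_inv_into {0..<n} b g)" for g
    have fb: "f (b i) = v $ i" if "i < n" for i
      using that b unfolding f_def bij_betw_def by (simp add: the_inv_into_f_f)
    have vv: "vec n (\<lambda>i. f (b i)) = v" using v(1) fb by (intro eq_vecI) auto
    obtain i where i: "i < n" "v $ i \<noteq> 0" using nonzero_vecD [OF v(1,2)] by blast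
    have "\<exists>g\<in>G. f g \<noteq> 0" using i fb bG by (intro bexI [of _ "b i"]) auto
    moreover have "(\<Sum>h\<in>G. k g h * f h) = d * f g" if gG: "g \<in> G" for g
    proof -
      obtain j where j: "j < n" "g = b j" by (rule bij_betw_nat_obtain [OF b gG])
      show ?thesis unfolding j(2) sm [OF j(1)] vv v(3) using v(1) j fb by simp
    qed
    ultimately show ?R by (intro exI [of _ f]) simp
  next
    assume ?R
    then obtain f where f: "\<exists>g\<in>G. f g \<noteq> 0" "\<And>g. g \<in> G \<Longrightarrow> (\<Sum>h\<in>G. k g h * f h) = d * f g" by blast
    define v where "v = vec n (\<lambda>i. f (b i))"
    have v: "v \<in> carrier_vec n" by (simp add: v_def)
    obtain g where g: "g \<in> G" "f g \<noteq> 0" using f(1) by blast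
    obtain j where "j < n" "g = b j" by (rule bij_betw_nat_obtain [OF b g(1)])
    then have "v $ j \<noteq> 0\<^sub>v n $ j" using g by (simp add: v_def)
    then have "v \<noteq> 0\<^sub>v n" by auto
    moreover have "?A *\<^sub>v v = d \<cdot>\<^sub>v v"
    proof (rule eq_vecI)
      fix i assume "i < dim_vec (d \<cdot>\<^sub>v v)"
      then have i: "i < n" by (simp add: v_def)
      show "(?A *\<^sub>v v) $ i = (d \<cdot>\<^sub>v v) $ i"
        using f(2) [OF bG [OF i]] i unfolding sm [OF i, of f] v_def by simp
    qed (use v in auto)
    ultimately show "eigenvalue ?A d" unfolding eigenvalue_def eigenvector_def using v by auto
  qed
qed

text \<open>Schur triangularisation puts the eigenvalues on the diagonal, and similarity preserves
  the trace. The set \<open>S\<close> is any a priori bound on the eigenvalues, to be checked on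
  eigenfunctions.\<close>

lemma trace_kernel:
  fixes k :: "'a \<Rightarrow> 'a \<Rightarrow> complex"
  assumes fin: "finite G"
    and ev: "\<And>d f. \<lbrakk>\<exists>g\<in>G. f g \<noteq> 0; \<And>g. g \<in> G \<Longrightarrow> (\<Sum>h\<in>G. k g h * f h) = d * f g\<rbrakk> \<Longrightarrow> d \<in> S"
  shows "\<exists>es. set es \<subseteq> S \<and> (\<Sum>g\<in>G. k g g) = sum_list es"
proof -
  define n where "n = card G"
  obtain b where b: "bij_betw b {0..<n} G"
    unfolding n_def using ex_bij_betw_nat_finite [OF fin] by blast
  define A where "A = mat n n (\<lambda>(i,j). k (b i) (b j))"
  have A: "A \<in> carrier_mat n n" by (simp add: A_def)
  have tr: "(\<Sum>i\<in>{0..<n}. A $$ (i,i)) = (\<Sum>g\<in>G. k g g)"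
    using sum.reindex_bij_betw [OF b, of "\<lambda>g. k g g"] by (simp add: A_def)
  obtain es where es: "char_poly A = (\<Prod>a\<leftarrow>es. [:- a, 1:])"
    using char_poly_factorized [OF A] by blast
  obtain B P Q where sd: "schur_decomposition A es = (B, P, Q)"
    by (cases "schur_decomposition A es") auto
  note S = schur_decomposition [OF A es sd]
  have wit: "similar_mat_wit A B P Q" and dg: "diag_mat B = es" using S by auto
  have B: "B \<in> carrier_mat n n" and P: "P \<in> carrier_mat n n" and Q: "Q \<in> carrier_mat n n"
    and QP: "Q * P = 1\<^sub>m n" and AP: "A = P * B * Q"
    using similar_mat_witD2 [OF A wit] by simp_all
  have tc: "(\<Sum>i\<in>{0..<n}. (X * Y) $$ (i,i)) = (\<Sum>i\<in>{0..<n}. (Y * X) $$ (i,i))"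
    if "X \<in> carrier_mat n n" "Y \<in> carrier_mat n n" for X Y :: "complex mat"
  proof -
    have "(\<Sum>i\<in>{0..<n}. (X * Y) $$ (i,i)) = (\<Sum>i\<in>{0..<n}. \<Sum>j\<in>{0..<n}. X $$ (i,j) * Y $$ (j,i))"
      using that by (intro sum.cong) (auto simp: scalar_prod_def)
    also have "\<dots> = (\<Sum>j\<in>{0..<n}. \<Sum>i\<in>{0..<n}. X $$ (i,j) * Y $$ (j,i))" by (rule sum.swap)
    also have "\<dots> = (\<Sum>i\<in>{0..<n}. (Y * X) $$ (i,i))"
      using that by (intro sum.cong) (auto simp: scalar_prod_def mult.commute)
    finally show ?thesis .
  qed
  have "(\<Sum>i\<in>{0..<n}. A $$ (i,i)) = (\<Sum>i\<in>{0..<n}. (Q * (P * B)) $$ (i,i))"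
    unfolding AP by (rule tc) (use B P Q in auto)
  also have "Q * (P * B) = B"
    using assoc_mult_mat [OF Q P B] QP left_mult_one_mat [OF B] by simp
  also have "(\<Sum>i\<in>{0..<n}. B $$ (i,i)) = sum_list es"
    using B dg by (auto simp: diag_mat_def sum_list_sum_nth)
  finally have "(\<Sum>g\<in>G. k g g) = sum_list es" using tr by simp
  moreover have "set es \<subseteq> S"
  proof
    fix d assume "d \<in> set es"
    then have "poly (char_poly A) d = 0" unfolding es by (auto simp: poly_prod_list prod_list_zero_iff)
    then have "eigenvalue A d" using eigenvalue_root_char_poly [OF A] by simp
    then obtain f where "\<exists>g\<in>G. f g \<noteq> 0" "\<And>g. g \<in> G \<Longrightarrow> (\<Sum>h\<in>G. k g h * f h) = d * f g"
      unfolding A_def eigenvalue_kernel [OF b] by blast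
    then show "d \<in> S" by (rule ev)
  qed
  ultimately show ?thesis by blast
qed

lemma kernel_relation:
  fixes F :: "nat \<Rightarrow> 'a \<Rightarrow> 'b::field"
  assumes fin: "finite G"
  shows "\<exists>c. (\<exists>i\<le>card G. c i \<noteq> 0) \<and> (\<forall>g\<in>G. (\<Sum>i\<le>card G. c i * F i g) = 0)"
proof -
  define n where "n = card G"
  obtain b where b: "bij_betw b {0..<n} G"
    unfolding n_def using ex_bij_betw_nat_finite [OF fin] by blast
  \<comment> \<open>The last row is zero padding: it makes the matrix square and forces its
    determinant to vanish.\<close>
  define A where "A = mat (Suc n) (Suc n) (\<lambda>(i,j). if i < n then F j (b i) else 0)"
  have A: "A \<in> carrier_mat (Suc n) (Suc n)" by (simp add: A_def)
  have "det A = 0"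
  proof -
    have "(\<Prod>i = 0..<Suc n. A $$ (p i, i)) = 0" if "p permutes {0..<Suc n}" for p
    proof -
      have "n \<in> p ` {0..<Suc n}" using permutes_image [OF that] by simp
      then obtain i where "i < Suc n" "p i = n" by auto
      then have "A $$ (p i, i) = 0" by (simp add: A_def)
      then show ?thesis using \<open>i < Suc n\<close> by (intro prod_zero) auto
    qed
    then show ?thesis unfolding det_col [OF A] by (intro sum.neutral ballI) (simp only: mem_Collect_eq mult_zero_right atLeast0LessThan)
  qed
  then obtain v where v: "v \<in> carrier_vec (Suc n)" "v \<noteq> 0\<^sub>v (Suc n)" "A *\<^sub>v v = 0\<^sub>v (Suc n)"
    using det_0_iff_vec_prod_zero_field [OF A] by blast
  obtain i where i: "i < Suc n" "v $ i \<noteq> 0" using nonzero_vecD [OF v(1,2)] by blast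
  have "(\<Sum>i\<le>n. v $ i * F i g) = 0" if gG: "g \<in> G" for g
  proof -
    obtain j where j: "j < n" "g = b j" by (rule bij_betw_nat_obtain [OF b gG])
    have "(\<Sum>i\<le>n. v $ i * F i g) = (\<Sum>i\<in>{0..<Suc n}. A $$ (j,i) * v $ i)"
      using j by (intro sum.cong) (auto simp: A_def)
    also have "\<dots> = (A *\<^sub>v v) $ j" using j v(1) A by (simp add: scalar_prod_def)
    also have "\<dots> = 0" using v j by simp
    finally show ?thesis .
  qed
  then show ?thesis using i unfolding n_def [symmetric]
    by (intro exI [of _ "\<lambda>i. v $ i"]) (auto simp: less_Suc_eq_le)
qed

text \<open>The polynomial is the characteristic polynomial of an integer matrix. Both directions of
  the equivalence matter: one makes eigenvalues integral, the other lets a bound on eigenvalues be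
  applied to all algebraic conjugates.\<close>

lemma int_kernel_char_poly:
  fixes k :: "'a \<Rightarrow> 'a \<Rightarrow> int"
  assumes fin: "finite G"
  obtains p :: "int poly" where "lead_coeff p = 1"
    and "\<And>x :: complex. poly (of_int_poly p) x = 0 \<longleftrightarrow>
      (\<exists>f. (\<exists>g\<in>G. f g \<noteq> 0) \<and> (\<forall>g\<in>G. (\<Sum>h\<in>G. of_int (k g h) * f h) = x * f g))"
proof -
  define n where "n = card G"
  obtain b where b: "bij_betw b {0..<n} G"
    unfolding n_def using ex_bij_betw_nat_finite [OF fin] by blast
  define A where "A = mat n n (\<lambda>(i,j). k (b i) (b j))"
  have A: "A \<in> carrier_mat n n" by (simp add: A_def)
  have monic: "lead_coeff (char_poly A) = 1" using degree_monic_char_poly [OF A] by simp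
  have A': "map_mat of_int A = mat n n (\<lambda>(i,j). of_int (k (b i) (b j)) :: complex)"
    by (intro eq_matI) (auto simp: A_def)
  have r: "poly (of_int_poly (char_poly A)) x = 0 \<longleftrightarrow>
      (\<exists>f. (\<exists>g\<in>G. f g \<noteq> 0) \<and> (\<forall>g\<in>G. (\<Sum>h\<in>G. of_int (k g h) * f h) = x * f g))" for x :: complex
    unfolding eigenvalue_kernel [OF b, of "\<lambda>g h. of_int (k g h)" x, symmetric] A' [symmetric]
    by (subst eigenvalue_root_char_poly [of _ n]) (simp_all add: A of_int_hom.char_poly_hom [OF A])
  from monic r show ?thesis by (rule that)
qed

subsection \<open>Algebraic integers\<close>

text \<open>Here \<open>x\<close> is an eigenvalue of an integer matrix with eigenvector
  \<open>f\<close>. This is the usual criterion that multiplication by \<open>x\<close> preserves a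
  non-zero finitely generated module over the integers.\<close>

lemma algebraic_int_span:
  fixes x :: complex and f :: "'i \<Rightarrow> complex" and k :: "'i \<Rightarrow> 'i \<Rightarrow> int"
  assumes "finite I" "i0 \<in> I" "f i0 \<noteq> 0"
    and "\<And>i. i \<in> I \<Longrightarrow> x * f i = (\<Sum>j\<in>I. of_int (k i j) * f j)"
  shows "algebraic_int x"
proof -
  obtain p :: "int poly" where "lead_coeff p = 1"
    and p: "\<And>x :: complex. poly (of_int_poly p) x = 0 \<longleftrightarrow>
      (\<exists>f. (\<exists>g\<in>I. f g \<noteq> 0) \<and> (\<forall>g\<in>I. (\<Sum>h\<in>I. of_int (k g h) * f h) = x * f g))"
    by (rule int_kernel_char_poly [OF assms(1), of k]) blast
  moreover have "poly (of_int_poly p) x = 0" unfolding p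
    using assms(2-4) by (intro exI [of _ f] conjI bexI [of _ i0]) auto
  ultimately show ?thesis unfolding algebraic_int_altdef_ipoly by blast
qed

lemma algebraic_int_reduction:
  fixes x :: complex
  assumes "algebraic_int x"
  shows "\<exists>a c. a > 0 \<and> (\<forall>i<a. x * x ^ i = (\<Sum>l<a. of_int (c i l) * x ^ l))"
proof -
  obtain p where p: "poly (of_int_poly p) x = 0" "lead_coeff p = 1"
    using assms unfolding algebraic_int_altdef_ipoly by blast
  define a where "a = degree p"
  have e: "(\<Sum>l\<le>a. of_int (coeff p l) * x ^ l) = 0"
    using p(1) by (simp add: poly_altdef a_def)
  have a0: "a > 0"
  proof (rule ccontr)
    assume "\<not> a > 0"
    then have "a = 0" by simp
    then show False using e p(2) by (simp add: a_def)
  qed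
  have top: "x ^ a = (\<Sum>l<a. of_int (- coeff p l) * x ^ l)"
    using e p(2) by (simp add: a_def lessThan_Suc_atMost [symmetric] sum_negf eq_neg_iff_add_eq_0 add.commute)
  \<comment> \<open>Rows of the companion matrix: a shift, except that the last power is reduced by
    the equation \<open>top\<close>.\<close>
  define c where "c i l = (if Suc i < a then (if l = Suc i then 1 else 0) else - coeff p l)" for i l
  have "x * x ^ i = (\<Sum>l<a. of_int (c i l) * x ^ l)" if "i < a" for i
  proof (cases "Suc i < a")
    case True
    then show ?thesis by (simp add: c_def if_distrib [of "\<lambda>u. u * _"] if_distrib [of of_int] cong: if_cong)
  next
    case False
    then have "a = Suc i" using that by simp
    then show ?thesis using top False by (simp add: c_def)
  qed
  then show ?thesis using a0 by (intro exI [of _ a] exI [of _ c]) simp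
qed

text \<open>The products \<open>x^i y^j\<close> span a module stable under both numbers. Each number
  acts through one of the two indices, and this yields integer matrices for the sum and the
  product.\<close>

lemma
  fixes x y :: complex
  assumes "algebraic_int x" "algebraic_int y"
  shows algebraic_int_add: "algebraic_int (x + y)"
    and algebraic_int_mult: "algebraic_int (x * y)"
proof -
  obtain a c where a: "a > 0" and c: "\<And>i. i < a \<Longrightarrow> x * x ^ i = (\<Sum>l<a. of_int (c i l) * x ^ l)"
    using algebraic_int_reduction [OF assms(1)] by metis
  obtain b d where b: "b > 0" and d: "\<And>i. i < b \<Longrightarrow> y * y ^ i = (\<Sum>l<b. of_int (d i l) * y ^ l)"
    using algebraic_int_reduction [OF assms(2)] by metis
  define f where "f = (\<lambda>(i,j). x ^ i * y ^ j)"
  have f0: "(0,0) \<in> {..<a} \<times> {..<b}" "f (0,0) \<noteq> 0" using a b by (auto simp: f_def)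
  have fx: "x * f (i,j) = (\<Sum>(l,m)\<in>{..<a} \<times> {..<b}. of_int (c i l * (if m = j then 1 else 0)) * f (l,m))"
    if "i < a" "j < b" for i j
  proof -
    have "x * f (i,j) = (\<Sum>l<a. of_int (c i l) * x ^ l) * y ^ j"
      unfolding c [OF that(1), symmetric] by (simp add: f_def)
    also have "\<dots> = (\<Sum>l<a. \<Sum>m<b. of_int (c i l * (if m = j then 1 else 0)) * f (l,m))"
      unfolding sum_distrib_right
      using that by (intro sum.cong) (auto simp: f_def if_distrib [of "\<lambda>u. _ * u"] if_distrib [of "\<lambda>u. u * _"] if_distrib [of of_int] cong: if_cong)
    finally show ?thesis by (simp only: sum.cartesian_product)
  qed
  have fy: "y * f (i,j) = (\<Sum>(l,m)\<in>{..<a} \<times> {..<b}. of_int ((if l = i then 1 else 0) * d j m) * f (l,m))"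
    if "i < a" "j < b" for i j
  proof -
    have "y * f (i,j) = x ^ i * (\<Sum>m<b. of_int (d j m) * y ^ m)"
      unfolding d [OF that(2), symmetric] by (simp add: f_def)
    also have "\<dots> = (\<Sum>m<b. \<Sum>l<a. of_int ((if l = i then 1 else 0) * d j m) * f (l,m))"
      unfolding sum_distrib_left
      using that by (intro sum.cong) (auto simp: f_def if_distrib [of "\<lambda>u. _ * u"] if_distrib [of "\<lambda>u. u * _"] if_distrib [of of_int] cong: if_cong)
    also have "\<dots> = (\<Sum>l<a. \<Sum>m<b. of_int ((if l = i then 1 else 0) * d j m) * f (l,m))"
      by (rule sum.swap)
    finally show ?thesis by (simp only: sum.cartesian_product)
  qed
  show "algebraic_int (x + y)"
  proof (rule algebraic_int_span [where I = "{..<a} \<times> {..<b}" and f = f and ?i0.0 = "(0,0)", OF _ f0, where k = "\<lambda>(i,j) (l,m). c i l * (if m = j then 1 else 0) + (if l = i then 1 else 0) * d j m"])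
    fix ij assume "ij \<in> {..<a} \<times> {..<b}"
    then obtain i j where ij: "ij = (i,j)" "i < a" "j < b" by auto
    show "(x + y) * f ij = (\<Sum>lm\<in>{..<a} \<times> {..<b}. of_int ((\<lambda>(i,j) (l,m). c i l * (if m = j then 1 else 0) + (if l = i then 1 else 0) * d j m) ij lm) * f lm)"
      unfolding ij(1) distrib_right fx [OF ij(2,3)] fy [OF ij(2,3)] sum.distrib [symmetric]
      by (intro sum.cong) (auto simp: distrib_right)
  qed simp
  show "algebraic_int (x * y)"
  proof (rule algebraic_int_span [where I = "{..<a} \<times> {..<b}" and f = f and ?i0.0 = "(0,0)", OF _ f0, where k = "\<lambda>(i,j) (l,m). c i l * d j m"])
    fix ij assume "ij \<in> {..<a} \<times> {..<b}"
    then obtain i j where ij: "ij = (i,j)" "i < a" "j < b" by auto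
    have "x * y * f ij = (x * x ^ i) * (y * y ^ j)" by (simp add: ij f_def)
    also have "\<dots> = (\<Sum>l<a. \<Sum>m<b. of_int (c i l * d j m) * f (l,m))"
      unfolding c [OF ij(2)] d [OF ij(3)] sum_product by (intro sum.cong) (auto simp: f_def)
    finally show "x * y * f ij = (\<Sum>lm\<in>{..<a} \<times> {..<b}. of_int ((\<lambda>(i,j) (l,m). c i l * d j m) ij lm) * f lm)"
      unfolding ij(1) by (simp add: sum.cartesian_product split_def)
  qed simp
qed

lemma algebraic_int_sum:
  fixes f :: "'i \<Rightarrow> complex"
  assumes "\<And>i. i \<in> I \<Longrightarrow> algebraic_int (f i)"
  shows "algebraic_int (sum f I)"
  using assms by (induction I rule: infinite_finite_induct) (auto intro: algebraic_int_add)

lemma algebraic_int_sum_list: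
  fixes xs :: "complex list"
  assumes "\<And>x. x \<in> set xs \<Longrightarrow> algebraic_int x"
  shows "algebraic_int (sum_list xs)"
  using assms by (induction xs) (auto intro: algebraic_int_add)

lemma algebraic_int_prod_list:
  fixes xs :: "complex list"
  assumes "\<And>x. x \<in> set xs \<Longrightarrow> algebraic_int x"
  shows "algebraic_int (prod_list xs)"
  using assms by (induction xs) (auto intro: algebraic_int_mult)

lemma algebraic_int_root_of_unity:
  fixes x :: complex
  assumes "x ^ n = 1" "n > 0"
  shows "algebraic_int x"
proof (rule algebraic_int_root [of 1 "monom 1 n"])
  show "poly (monom 1 n) x = 1" using assms by (simp add: poly_monom)
qed (use assms in \<open>auto simp: degree_monom_eq\<close>)

text \<open>The minimal polynomial of such a number over the rationals has algebraic integers of modulus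
  at most one as roots, so its constant coefficient is an integer of modulus less than one.\<close>

lemma algebraic_int_small_zero:
  fixes x :: complex and b :: "int poly"
  assumes int: "algebraic_int x" and b: "b \<noteq> 0" "poly (of_int_poly b) x = 0"
    and small: "\<And>r :: complex. poly (of_int_poly b) r = 0 \<Longrightarrow> norm r \<le> 1"
    and x: "norm x < 1"
  shows "x = 0"
proof (rule ccontr)
  assume x0: "x \<noteq> 0"
  let ?h = "map_poly (of_rat :: rat \<Rightarrow> complex)"
  interpret h: map_poly_inj_idom_hom "of_rat :: rat \<Rightarrow> complex" ..
  have oi: "?h (of_int_poly p) = of_int_poly p" for p by (intro poly_eqI) (simp add: coeff_map_poly)
  obtain a where a: "poly (of_int_poly a) x = 0" "lead_coeff a = 1"
    using int unfolding algebraic_int_altdef_ipoly by blast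
  define P where "P m \<longleftrightarrow> m \<noteq> 0 \<and> poly (?h m) x = 0" for m
  have "P (of_int_poly a)" unfolding P_def oi using a by auto
  \<comment> \<open>Up to a scalar \<open>m\<close> is the minimal polynomial of \<open>x\<close>.
    It divides both \<open>a\<close> and \<open>b\<close>, so its roots inherit integrality from the
    one and the bound from the other.\<close>
  then obtain m where m: "P m" and least: "\<And>m'. P m' \<Longrightarrow> degree m \<le> degree m'"
    using ex_has_least_nat [of P _ degree] by blast
  have m0: "m \<noteq> 0" "poly (?h m) x = 0" using m by (auto simp: P_def)
  have dv: "?h m dvd of_int_poly f" if f: "poly (of_int_poly f) x = 0" for f
  proof -
    let ?f = "of_int_poly f :: rat poly"
    have "poly (?h (?f mod m)) x = 0"
    proof -
      have "?h ?f = ?h (m * (?f div m) + ?f mod m)" by simp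
      also have "\<dots> = ?h m * ?h (?f div m) + ?h (?f mod m)" by (simp only: h.hom_add h.hom_mult)
      finally show ?thesis using f m0 unfolding oi by simp
    qed
    then have "?f mod m = 0"
      using least [of "?f mod m"] degree_mod_less' [of m ?f] m0 unfolding P_def by force
    then have "m dvd ?f" by auto
    then have "?h m dvd ?h ?f" by (rule h.hom_dvd)
    then show ?thesis unfolding oi .
  qed
  have "coeff m 0 \<noteq> 0"
  proof
    assume "coeff m 0 = 0"
    then have "m = pCons 0 (poly_shift 1 m)" by (intro poly_eqI) (auto simp: coeff_pCons coeff_poly_shift split: nat.splits)
    then obtain m' where m': "m = pCons 0 m'" by blast
    then have "?h m = pCons 0 (?h m')" by (intro poly_eqI) (simp add: coeff_map_poly coeff_pCons m' split: nat.split)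
    then have "P m'" using m0 x0 m' unfolding P_def by auto
    then have "degree m \<le> degree m'" by (rule least)
    then show False using m' m0 by (auto split: if_splits)
  qed
  define M where "M = ?h m"
  define c where "c = lead_coeff m"
  have c0: "c \<noteq> 0" using m0 by (simp add: c_def)
  have lc: "lead_coeff M = of_rat c" unfolding M_def c_def by simp
  obtain as where as: "smult (lead_coeff M) (\<Prod>a\<leftarrow>as. [:- a, 1:]) = M"
    using fundamental_theorem_algebra_factorized [of M] by blast
  have M0: "M \<noteq> 0" using m0 by (simp add: M_def)
  have root: "poly M r = 0 \<longleftrightarrow> r \<in> set as" for r
  proof -
    have "poly M r = lead_coeff M * poly (\<Prod>a\<leftarrow>as. [:- a, 1:]) r" by (subst as [symmetric]) (simp only: poly_smult)
    then show ?thesis using M0 by (auto simp: poly_prod_list prod_list_zero_iff)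
  qed
  have ra: "algebraic_int r" and rb: "norm r \<le> 1" if "r \<in> set as" for r
  proof -
    have "poly M r = 0" using root that by simp
    then have "poly (of_int_poly a) r = 0" "poly (of_int_poly b) r = 0"
      using dv [OF a(1)] dv [OF b(2)] unfolding M_def by (auto elim!: dvdE)
    then show "algebraic_int r" "norm r \<le> 1" using a(2) small unfolding algebraic_int_altdef_ipoly by auto
  qed
  have "coeff M 0 = poly M 0" by (simp add: poly_0_coeff_0)
  also have "\<dots> = of_rat c * prod_list (map uminus as)"
    by (subst as [symmetric]) (simp add: lc poly_prod_list comp_def)
  finally have e: "of_rat (coeff m 0 / c) = prod_list (map uminus as)"
    using c0 by (simp add: M_def of_rat_divide field_simps)
  have "algebraic_int (prod_list (map uminus as))" by (rule algebraic_int_prod_list) (use ra in auto)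
  then have "prod_list (map uminus as) \<in> \<int>"
    by (rule rational_algebraic_int_is_int) (simp add: e [symmetric])
  then obtain k where k: "prod_list (map uminus as) = of_int k" by (auto elim: Ints_cases)
  have "x \<in> set as" using root m0 by (simp add: M_def)
  have le: "norm (prod_list (map uminus bs)) \<le> 1" if "set bs \<subseteq> set as" for bs
    using that by (induction bs) (auto simp: norm_mult intro!: mult_le_one rb)
  obtain bs cs where bc: "as = bs @ x # cs" using \<open>x \<in> set as\<close> split_list by fast
  have "norm (prod_list (map uminus as)) = (norm (prod_list (map uminus bs)) * norm (prod_list (map uminus cs))) * norm x"
    by (simp add: bc norm_mult)
  also have "\<dots> \<le> 1 * norm x"
    by (intro mult_right_mono mult_le_one le) (auto simp: bc)
  finally have "norm (of_int k :: complex) < 1" using x k by simp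
  then have "k = 0" by simp
  then show False using e k \<open>coeff m 0 \<noteq> 0\<close> c0 by simp
qed

subsection \<open>Groups as a type class\<close>

text \<open>With groups as a class, all subgroups are sets over one operation, so intersections,
  products and conjugates of subgroups need no carriers.\<close>

class grp = monoid_mult + inverse +
  assumes inverse_mult_self: "inverse a * a = 1"
begin

lemma mult_inverse_self: "a * inverse a = 1"
proof -
  have "a * inverse a = (inverse (inverse a) * inverse a) * (a * inverse a)"
    by (simp add: inverse_mult_self)
  also have "\<dots> = inverse (inverse a) * ((inverse a * a) * inverse a)"
    by (simp only: mult.assoc)
  also have "\<dots> = 1" by (simp add: inverse_mult_self)
  finally show ?thesis .
qed

lemma inverse_mult_cancel: "inverse a * (a * b) = b"
  by (simp add: mult.assoc [symmetric] inverse_mult_self)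

lemma mult_inverse_cancel: "a * (inverse a * b) = b"
  by (simp add: mult.assoc [symmetric] mult_inverse_self)

lemma inverse_unique_grp: "a * b = 1 \<Longrightarrow> inverse a = b"
  using inverse_mult_cancel [of a b] by simp

lemma inverse_inverse_grp: "inverse (inverse a) = a"
  by (rule inverse_unique_grp) (rule inverse_mult_self)

lemma inverse_mult_grp: "inverse (a * b) = inverse b * inverse a"
  by (rule inverse_unique_grp) (simp add: mult.assoc mult_inverse_cancel mult_inverse_self)

lemma inverse_one_grp: "inverse 1 = 1"
  by (rule inverse_unique_grp) simp

lemmas grp_simps = mult.assoc inverse_mult_self mult_inverse_self inverse_mult_cancel
  mult_inverse_cancel inverse_inverse_grp inverse_mult_grp inverse_one_grp

lemma mult_left_cancel_grp: "a * b = a * c \<longleftrightarrow> b = c"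
  by (metis inverse_mult_cancel)

lemma mult_right_cancel_grp: "b * a = c * a \<longleftrightarrow> b = c"
  by (metis mult.assoc mult_1_right mult_inverse_self)

end

instance Perm.perm :: (type) grp
  by standard (transfer, simp add: bij_is_inj)

section \<open>Subgroups, conjugation, normalizers and centralizers\<close>

definition sgrp :: "'a::grp set \<Rightarrow> bool" where
  "sgrp H \<longleftrightarrow> 1 \<in> H \<and> (\<forall>x\<in>H. \<forall>y\<in>H. x * y \<in> H) \<and> (\<forall>x\<in>H. inverse x \<in> H)"

text \<open>Conjugation acts from the right: \<open>cj g (cj h x) = cj (h * g) x\<close>. Lemmas
  about left actions are therefore applied to \<open>cj (inverse g)\<close>.\<close>

definition cj :: "'a::grp \<Rightarrow> 'a \<Rightarrow> 'a" where
  "cj g x = inverse g * x * g"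

definition normal_in :: "'a::grp set \<Rightarrow> 'a set \<Rightarrow> bool" where
  "normal_in N J \<longleftrightarrow> sgrp N \<and> N \<subseteq> J \<and> (\<forall>g\<in>J. \<forall>x\<in>N. cj g x \<in> N)"

definition nizer :: "'a::grp set \<Rightarrow> 'a set \<Rightarrow> 'a set" where
  "nizer G X = {g \<in> G. cj g ` X = X}"

definition cizer :: "'a::grp set \<Rightarrow> 'a set \<Rightarrow> 'a set" where
  "cizer G X = {g \<in> G. \<forall>x\<in>X. g * x = x * g}"

definition pel :: "nat \<Rightarrow> 'a::grp \<Rightarrow> bool" where
  "pel p x \<longleftrightarrow> (\<exists>k. x ^ (p ^ k) = 1)"

text \<open>In general only a set; for a finite nilpotent subgroup it is a Sylow subgroup, by
  \<open>sylow_sub_ppart\<close>.\<close>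

definition ppart :: "'a::grp set \<Rightarrow> nat \<Rightarrow> 'a set" where
  "ppart H p = {x \<in> H. pel p x}"

text \<open>For a finite subgroup this is nilpotency.\<close>

definition nilp :: "'a::grp set \<Rightarrow> bool" where
  "nilp H \<longleftrightarrow> (\<forall>x\<in>H. \<forall>y\<in>H. \<forall>p q. prime p \<longrightarrow> prime q \<longrightarrow> p \<noteq> q \<longrightarrow> pel p x \<longrightarrow> pel q y \<longrightarrow> x * y = y * x)"

abbreviation center :: "'a::grp set \<Rightarrow> 'a set" where
  "center H \<equiv> cizer H H"

lemma sgrpD:
  assumes "sgrp H"
  shows "1 \<in> H" "x \<in> H \<Longrightarrow> y \<in> H \<Longrightarrow> x * y \<in> H" "x \<in> H \<Longrightarrow> inverse x \<in> H"
  using assms by (auto simp: sgrp_def)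

lemma sgrp_pow: "sgrp H \<Longrightarrow> x \<in> H \<Longrightarrow> x ^ n \<in> H"
  by (induction n) (auto simp: sgrpD)

lemma sgrp_inverse_iff: "sgrp H \<Longrightarrow> inverse x \<in> H \<longleftrightarrow> x \<in> H"
  by (metis sgrpD(3) inverse_inverse_grp)

lemma sgrp_mult_left_iff: "sgrp H \<Longrightarrow> x \<in> H \<Longrightarrow> x * y \<in> H \<longleftrightarrow> y \<in> H"
  by (metis sgrpD(2,3) inverse_mult_cancel)

lemma sgrp_mult_right_iff: "sgrp H \<Longrightarrow> x \<in> H \<Longrightarrow> y * x \<in> H \<longleftrightarrow> y \<in> H"
  using sgrpD(2) [of H "y * x" "inverse x"] sgrpD(2) [of H y x] sgrpD(3) [of H x]
  by (auto simp: grp_simps)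

lemma sgrp_Int: "sgrp H \<Longrightarrow> sgrp K \<Longrightarrow> sgrp (H \<inter> K)"
  by (auto simp: sgrp_def)

lemma sgrp_Inter: "(\<And>H. H \<in> \<H> \<Longrightarrow> sgrp H) \<Longrightarrow> sgrp (\<Inter>\<H>)"
  by (auto simp: sgrp_def)

lemma sgrp_one: "sgrp {1}"
  by (simp add: sgrp_def inverse_one_grp)

lemma cj_mult: "cj g (x * y) = cj g x * cj g y"
  by (simp add: cj_def grp_simps)

lemma cj_cj: "cj g (cj h x) = cj (h * g) x"
  by (simp add: cj_def grp_simps)

lemma cj_one [simp]: "cj 1 x = x" "cj g 1 = 1"
  by (simp_all add: cj_def grp_simps)

lemma cj_inverse: "cj g (inverse x) = inverse (cj g x)"
  by (simp add: cj_def grp_simps)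

lemma cj_inv_cancel [simp]: "cj (inverse g) (cj g x) = x" "cj g (cj (inverse g) x) = x"
  by (simp_all add: cj_def grp_simps)

lemma cj_pow: "cj g (x ^ n) = cj g x ^ n"
  by (induction n) (simp_all add: cj_mult)

lemma cj_eq_iff [simp]: "cj g x = cj g y \<longleftrightarrow> x = y"
  by (metis cj_inv_cancel(1))

lemma cj_eq_one_iff [simp]: "cj g x = 1 \<longleftrightarrow> x = 1"
  by (metis cj_eq_iff cj_one(2))

lemma cj_fix_iff: "cj g x = x \<longleftrightarrow> g * x = x * g"
  by (metis cj_def inverse_mult_cancel mult.assoc mult_left_cancel_grp)

lemma inj_cj: "inj_on (cj g) X"
  by (simp add: inj_on_def)

lemma card_cj [simp]: "card (cj g ` X) = card X"
  by (simp add: card_image inj_cj)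

lemma cj_image_cj: "cj g ` cj h ` X = cj (h * g) ` X"
  by (simp add: image_image cj_cj)

lemma cj_image_inv [simp]: "cj (inverse g) ` cj g ` X = X" "cj g ` cj (inverse g) ` X = X"
  by (simp_all add: image_image)

lemma mem_cj_image: "x \<in> cj g ` X \<longleftrightarrow> cj (inverse g) x \<in> X"
  by (metis cj_inv_cancel image_iff)

lemma cj_image_mono: "cj g ` X \<subseteq> Y \<longleftrightarrow> X \<subseteq> cj (inverse g) ` Y"
  by (metis cj_image_inv image_mono)

lemma mem_mult_iff: "x \<in> A * B \<longleftrightarrow> (\<exists>a\<in>A. \<exists>b\<in>B. x = a * (b :: 'a::times))"
  by (auto simp: set_times_def)

lemma cj_image_mult: "cj g ` (X * Y) = cj g ` X * cj g ` Y"
  by (simp add: set_eq_iff mem_mult_iff image_iff Bex_def) (metis cj_mult)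

lemma sgrp_cj: "sgrp H \<Longrightarrow> sgrp (cj g ` H)"
  unfolding sgrp_def ball_simps
  by (metis cj_inverse cj_mult cj_one(2) image_eqI)

lemma sgrp_cj_mem: "sgrp H \<Longrightarrow> g \<in> H \<Longrightarrow> x \<in> H \<Longrightarrow> cj g x \<in> H"
  by (simp add: cj_def sgrpD)

lemma sgrp_cj_mem_iff: "sgrp H \<Longrightarrow> g \<in> H \<Longrightarrow> cj g x \<in> H \<longleftrightarrow> x \<in> H"
  by (metis cj_inv_cancel(1) sgrpD(3) sgrp_cj_mem)

lemma sgrp_cj_image: "sgrp H \<Longrightarrow> g \<in> H \<Longrightarrow> cj g ` H = H"
  by (metis image_subsetI cj_image_inv(2) image_mono sgrpD(3) sgrp_cj_mem subset_antisym)

text \<open>Left translation by an element is injective on the finite set, hence onto, and this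
  yields the identity and inverses.\<close>

lemma sgrp_finite_closed:
  assumes "finite H" "H \<noteq> {}" and closed: "\<And>x y. x \<in> H \<Longrightarrow> y \<in> H \<Longrightarrow> x * y \<in> H"
  shows "sgrp H"
proof -
  have inv: "1 \<in> H \<and> inverse x \<in> H" if "x \<in> H" for x
  proof -
    have "(\<lambda>y. x * y) ` H = H"
      by (rule card_subset_eq) (use assms that in \<open>auto simp: card_image inj_on_def mult_left_cancel_grp\<close>)
    with that obtain y z where "y \<in> H" "x = x * y" "z \<in> H" "y = x * z"
      by (metis image_iff)
    then have "y = 1" "inverse x = z"
      by (metis mult_left_cancel_grp mult_1_right, metis inverse_unique_grp mult_left_cancel_grp mult_1_right)
    with \<open>y \<in> H\<close> \<open>z \<in> H\<close> show ?thesis by simp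
  qed
  with assms show ?thesis by (auto simp: sgrp_def)
qed

lemma normal_inD:
  assumes "normal_in N J"
  shows "sgrp N" "N \<subseteq> J" "g \<in> J \<Longrightarrow> x \<in> N \<Longrightarrow> cj g x \<in> N"
  using assms by (auto simp: normal_in_def)

lemma normal_in_self: "sgrp J \<Longrightarrow> normal_in J J"
  by (simp add: normal_in_def sgrp_cj_mem)

lemma cj_image_eqI:
  assumes "sgrp J" "g \<in> J" "\<And>h x. h \<in> J \<Longrightarrow> x \<in> X \<Longrightarrow> cj h x \<in> X"
  shows "cj g ` X = X"
proof
  show "X \<subseteq> cj g ` X"
    using assms(3) [of "inverse g"] assms(1,2) by (auto simp: mem_cj_image sgrpD)
qed (use assms in auto)

lemma normal_in_image: "normal_in N J \<Longrightarrow> sgrp J \<Longrightarrow> g \<in> J \<Longrightarrow> cj g ` N = N"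
  by (rule cj_image_eqI [of J]) (auto simp: normal_in_def)

lemma cj_image_fix_inverse: "cj g ` X = X \<Longrightarrow> cj (inverse g) ` X = X"
  using cj_image_inv(1) [of g X] by simp

lemma sgrp_nizer:
  assumes "sgrp G" shows "sgrp (nizer G X)"
proof -
  have "cj (x * y) ` X = X" if "cj x ` X = X" "cj y ` X = X" for x y
    using cj_image_cj [of y x X] that by simp
  with assms show ?thesis
    by (simp add: sgrp_def nizer_def cj_image_fix_inverse)
qed

lemma sgrp_cizer:
  assumes "sgrp G" shows "sgrp (cizer G X)"
proof -
  have "cj (inverse g) x = x" if "cj g x = x" for g x :: 'a
    using cj_inv_cancel(1) [of g x] that by simp
  moreover have "cj (g * h) x = x" if "cj g x = x" "cj h x = x" for g h x :: 'a
    using cj_cj [of h g x] that by simp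
  ultimately show ?thesis
    using assms by (simp add: sgrp_def cizer_def cj_fix_iff [symmetric])
qed

lemma cizer_iff_cj: "g \<in> cizer G X \<longleftrightarrow> g \<in> G \<and> (\<forall>x\<in>X. cj g x = x)"
  by (simp add: cizer_def cj_fix_iff)

lemma normal_in_cizer:
  assumes "normal_in N J" "sgrp J"
  shows "normal_in (cizer J N) J"
  unfolding normal_in_def
proof (intro conjI ballI)
  fix g x assume g: "g \<in> J" and x: "x \<in> cizer J N"
  have "cj (cj g x) y = y" if "y \<in> N" for y
  proof -
    have "cj (inverse g) y \<in> N" using assms g that by (auto simp: normal_in_def sgrpD)
    then have "cj x (cj (inverse g) y) = cj (inverse g) y" using x by (simp add: cizer_iff_cj)
    then have "cj g (cj x (cj (inverse g) y)) = y" by simp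
    then show ?thesis by (simp add: cj_cj) (simp add: cj_def grp_simps)
  qed
  with x g assms(2) show "cj g x \<in> cizer J N"
    by (auto simp: cizer_iff_cj intro: sgrp_cj_mem)
qed (use assms in \<open>simp_all add: sgrp_cizer, auto simp: cizer_def\<close>)

lemma normal_in_Int: "normal_in N J \<Longrightarrow> normal_in M J \<Longrightarrow> normal_in (N \<inter> M) J"
  by (auto simp: normal_in_def sgrp_Int)

lemma normal_in_mult:
  assumes "normal_in N J" "sgrp J" "sgrp H" "H \<subseteq> J"
  shows "sgrp (N * H)" "N * H \<subseteq> J" "N \<subseteq> N * H" "H \<subseteq> N * H"
proof -
  note N = normal_inD [OF assms(1)]
  show "sgrp (N * H)"
    unfolding sgrp_def
  proof (intro conjI ballI)
    show "1 \<in> N * H" using set_times_intro [of 1 N 1 H] N(1) assms(3) by (simp add: sgrpD)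
    fix x assume "x \<in> N * H"
    then obtain n h where x: "x = n * h" "n \<in> N" "h \<in> H" by (rule set_times_elim)
    have "inverse x = cj h (inverse n) * inverse h" by (simp add: x cj_def grp_simps)
    moreover have "cj h (inverse n) \<in> N" using N x assms(4) by (auto simp: sgrpD)
    ultimately show "inverse x \<in> N * H" using x assms(3) by (metis set_times_intro sgrpD(3))
    fix y assume "y \<in> N * H"
    then obtain m k where y: "y = m * k" "m \<in> N" "k \<in> H" by (rule set_times_elim)
    have "x * y = (n * cj (inverse h) m) * (h * k)" by (simp add: x y cj_def grp_simps)
    moreover have "cj (inverse h) m \<in> N" using x y assms(3,4) by (intro N(3)) (auto dest: sgrpD(3))
    ultimately show "x * y \<in> N * H"
      using x y assms(3) N(1) by (metis set_times_intro sgrpD(2))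
  qed
  show "N * H \<subseteq> J" using N(2) assms(2,4) by (auto simp: mem_mult_iff sgrpD subset_iff)
  show "N \<subseteq> N * H" using sgrpD(1) [OF assms(3)] by (metis mult_1_right set_times_intro subsetI)
  show "H \<subseteq> N * H" using sgrpD(1) [OF N(1)] by (metis mult_1_left set_times_intro subsetI)
qed

subsection \<open>Counting\<close>

text \<open>Bridge to record-based groups, through which Lagrange's theorem, its consequence for
  powers and the existence of Sylow subgroups are imported.\<close>

definition as_monoid :: "'a::grp set \<Rightarrow> 'a monoid" where
  "as_monoid G = \<lparr>carrier = G, monoid.mult = (*), monoid.one = 1\<rparr>"

lemma as_monoid_simps [simp]:
  "carrier (as_monoid G) = G" "x \<otimes>\<^bsub>as_monoid G\<^esub> y = x * y" "\<one>\<^bsub>as_monoid G\<^esub> = 1"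
  by (simp_all add: as_monoid_def)

lemma group_as_monoid: "sgrp G \<Longrightarrow> group (as_monoid G)"
  by (rule groupI) (auto simp: sgrpD mult.assoc intro: bexI [of _ "inverse _"] inverse_mult_self)

lemma inv_as_monoid: "sgrp G \<Longrightarrow> x \<in> G \<Longrightarrow> inv\<^bsub>as_monoid G\<^esub> x = inverse x"
  by (rule group.inv_equality [OF group_as_monoid]) (auto simp: inverse_mult_self sgrpD)

lemma subgroup_as_monoid: "sgrp G \<Longrightarrow> subgroup H (as_monoid G) \<longleftrightarrow> sgrp H \<and> H \<subseteq> G"
proof
  assume G: "sgrp G"
  { assume H: "subgroup H (as_monoid G)"
    have "H \<subseteq> G" using subgroup.subset [OF H] by simp
    then show "sgrp H \<and> H \<subseteq> G"
      using subgroup.m_closed [OF H] subgroup.one_closed [OF H] subgroup.m_inv_closed [OF H] inv_as_monoid [OF G]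
      by (auto simp: sgrp_def subset_iff) }
  show "sgrp H \<and> H \<subseteq> G \<Longrightarrow> subgroup H (as_monoid G)"
    using inv_as_monoid [OF G] by (auto simp: subgroup_def sgrpD subset_iff)
qed

lemma nat_pow_as_monoid: "x [^]\<^bsub>as_monoid G\<^esub> (n::nat) = x ^ n"
  by (induction n) (simp_all add: nat_pow_def power_commutes)

lemma card_dvd_sgrp:
  assumes "sgrp G" "sgrp H" "H \<subseteq> G" "finite G"
  shows "card H dvd card G"
  using group.lagrange [OF group_as_monoid [OF assms(1)], of H] assms
  by (simp add: subgroup_as_monoid Coset.order_def) (metis dvd_triv_right)

lemma pow_card_eq_one:
  assumes "sgrp G" "x \<in> G"
  shows "x ^ card G = 1"
  using group.pow_order_eq_1 [OF group_as_monoid [OF assms(1)], of x] assms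
  by (simp add: Coset.order_def nat_pow_as_monoid)

lemma sylow_exists:
  assumes "sgrp G" "finite G" "prime p"
  obtains S where "sgrp S" "S \<subseteq> G" "card S = p ^ multiplicity p (card G)"
proof -
  have "card G = p ^ multiplicity p (card G) * (card G div p ^ multiplicity p (card G))"
    by (simp add: multiplicity_dvd)
  then show ?thesis
    using sylow_thm [OF assms(3) group_as_monoid [OF assms(1)], of "multiplicity p (card G)"] assms that
    by (auto simp: Coset.order_def subgroup_as_monoid)
qed

lemma card_gt_0_sgrp: "sgrp G \<Longrightarrow> finite G \<Longrightarrow> card G > 0"
  using card_gt_0_iff sgrpD(1) by blast

lemma card_eq_fibre:
  assumes "finite A" "\<And>y. y \<in> f ` A \<Longrightarrow> card {x \<in> A. f x = y} = c"
  shows "card A = c * card (f ` A)"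
proof -
  have "card A = (\<Sum>y\<in>f ` A. \<Sum>x\<in>{x \<in> A. f x = y}. 1)"
    using sum.image_gen [OF assms(1), of "\<lambda>_. 1::nat" f] by simp
  also have "\<dots> = (\<Sum>y\<in>f ` A. c)" by (rule sum.cong) (use assms(2) in auto)
  finally show ?thesis by (simp add: mult.commute)
qed

text \<open>Every fibre of the multiplication map is a copy of \<open>A \<inter> B\<close>: an
  element \<open>t\<close> moves the pair \<open>(a, b)\<close> to
  \<open>(a * t, inverse t * b)\<close>. The product set need not be a subgroup.\<close>

lemma card_mult_Int:
  assumes "sgrp A" "sgrp B" "finite A" "finite B"
  shows "card (A * B) * card (A \<inter> B) = card A * card (B :: 'a::grp set)"
proof -
  let ?f = "\<lambda>(a, b). a * b"
  have im: "?f ` (A \<times> B) = A * B" by (auto simp: set_times_def)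
  have "card (A \<times> B) = card (A \<inter> B) * card (?f ` (A \<times> B))"
  proof (rule card_eq_fibre)
    fix y assume "y \<in> ?f ` (A \<times> B)"
    then obtain a b where y: "y = a * b" "a \<in> A" "b \<in> B" by auto
    have "{x \<in> A \<times> B. ?f x = y} = (\<lambda>t. (a * t, inverse t * b)) ` (A \<inter> B)" (is "?L = ?R")
    proof (intro Set.set_eqI iffI)
      fix x assume "x \<in> ?L"
      then obtain a' b' where x: "x = (a', b')" "a' \<in> A" "b' \<in> B" "a' * b' = a * b"
        using y by auto
      then have "inverse a * a' = b * inverse b'"
        by (metis grp_simps(3) grp_simps(4) mult.assoc mult_1_right)
      moreover have "inverse a * a' \<in> A" "b * inverse b' \<in> B" using x y assms by (simp_all add: sgrpD)
      ultimately have "inverse a * a' \<in> A \<inter> B" by simp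
      moreover have "inverse (inverse a * a') * b = b'"
        using x(4) by (simp add: grp_simps) (metis inverse_mult_cancel)
      ultimately show "x \<in> ?R" using x
        by (intro image_eqI [of _ _ "inverse a * a'"]) (simp_all add: grp_simps)
    qed (use y assms in \<open>auto simp: sgrpD grp_simps\<close>)
    moreover have "inj_on (\<lambda>t. (a * t, inverse t * b)) (A \<inter> B)"
      by (auto simp: inj_on_def mult_left_cancel_grp)
    ultimately show "card {x \<in> A \<times> B. ?f x = y} = card (A \<inter> B)"
      by (simp add: card_image)
  qed (use assms in simp)
  then show ?thesis by (simp add: im card_cartesian_product mult.commute)
qed

lemma finite_mult_set: "finite A \<Longrightarrow> finite B \<Longrightarrow> finite (A * B)"
  by (rule finite_set_times)

text \<open>The fibres of \<open>g \<mapsto> act g w\<close> are left cosets of the stabilizer. The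
  composition law is asked for at the point \<open>w\<close> only, so that it can be applied to any
  single orbit.\<close>

lemma orbit_stabilizer:
  assumes "sgrp P" "finite P"
    and act: "\<And>g h. g \<in> P \<Longrightarrow> h \<in> P \<Longrightarrow> act (g * h) w = act g (act h w)"
    and inj: "\<And>g x y. g \<in> P \<Longrightarrow> act g x = act g y \<Longrightarrow> x = y"
    and one: "act 1 w = w"
  shows "card P = card {g \<in> P. act g w = w} * card ((\<lambda>g. act g w) ` P)"
proof (rule card_eq_fibre)
  fix y assume "y \<in> (\<lambda>g. act g w) ` P"
  then obtain h where h: "h \<in> P" "y = act h w" by auto
  have "{x \<in> P. act x w = y} = (\<lambda>s. h * s) ` {g \<in> P. act g w = w}" (is "?L = ?R")
  proof (intro Set.set_eqI iffI)
    fix x assume x: "x \<in> ?L"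
    then have "act h (act (inverse h * x) w) = act h w"
      using h assms(1) act [of h "inverse h * x"] by (simp add: sgrpD grp_simps)
    then have "act (inverse h * x) w = w" using inj h(1) by blast
    then show "x \<in> ?R" using x h assms(1)
      by (intro image_eqI [of _ _ "inverse h * x"]) (auto simp: sgrpD grp_simps)
  qed (use h act assms(1) in \<open>auto simp: sgrpD\<close>)
  then show "card {x \<in> P. act x w = y} = card {g \<in> P. act g w = w}"
    by (simp add: card_image inj_on_def mult_left_cancel_grp)
qed (fact assms(2))

text \<open>An orbit that moves a point has size divisible by \<open>p\<close>; the induction
  removes one such orbit at a time.\<close>

lemma pgroup_fixed_points:
  assumes "sgrp P" "card P = p ^ k" "prime p" "finite W"
    and clos: "\<And>g w. g \<in> P \<Longrightarrow> w \<in> W \<Longrightarrow> act g w \<in> W"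
    and act: "\<And>g h w. g \<in> P \<Longrightarrow> h \<in> P \<Longrightarrow> act (g * h) w = act g (act h w)"
    and one: "\<And>w. act 1 w = w"
  shows "[card {w \<in> W. \<forall>g\<in>P. act g w = w} = card W] (mod p)"
  using assms(4) clos
proof (induction "card W" arbitrary: W rule: less_induct)
  case less
  have finP: "finite P" using assms(2,3) by (metis card.infinite not_prime_0 power_not_zero)
  have inj: "x = y" if "g \<in> P" "act g x = act g y" for g x y
    using act [of "inverse g" g x] act [of "inverse g" g y] one that assms(1)
    by (simp add: sgrpD inverse_mult_self)
  show ?case
  proof (cases "\<forall>w\<in>W. \<forall>g\<in>P. act g w = w")
    case True
    then have "{w \<in> W. \<forall>g\<in>P. act g w = w} = W" by auto
    then show ?thesis by (simp add: cong_def)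
  next
    case False
    then obtain w where w: "w \<in> W" "\<not> (\<forall>g\<in>P. act g w = w)" by auto
    define Orb where "Orb = (\<lambda>g. act g w) ` P"
    have OW: "Orb \<subseteq> W" using w less.prems by (auto simp: Orb_def)
    have "w \<in> Orb" using one [of w] sgrpD(1) [OF assms(1)] by (force simp: Orb_def)
    have "card Orb dvd p ^ k"
      using orbit_stabilizer [of P act w, OF assms(1) finP act inj one] assms(2)
      by (simp add: Orb_def)
    then obtain j where j: "card Orb = p ^ j" using assms(3) by (metis divides_primepow_nat)
    have "j \<noteq> 0"
    proof
      assume "j = 0"
      then have "card Orb = 1" using j by simp
      then have "Orb = {w}" using \<open>w \<in> Orb\<close> by (metis card_1_singletonE singletonD)
      with w(2) show False by (auto simp: Orb_def)
    qed
    then have pO: "p dvd card Orb" using j by simp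
    have fixO: "\<not> (\<forall>g\<in>P. act g v = v)" if "v \<in> Orb" for v
    proof
      assume v: "\<forall>g\<in>P. act g v = v"
      from that obtain h where h: "h \<in> P" "v = act h w" by (auto simp: Orb_def)
      have "act (inverse h) v = w" using h act [of "inverse h" h w] assms(1) one by (simp add: sgrpD inverse_mult_self)
      then have "w = v" using v h assms(1) by (metis sgrpD(3))
      with v w(2) show False by simp
    qed
    have step: "[card {w \<in> W - Orb. \<forall>g\<in>P. act g w = w} = card (W - Orb)] (mod p)"
    proof (rule less.hyps)
      show "card (W - Orb) < card W"
        using \<open>w \<in> Orb\<close> w(1) less.prems(1) by (intro psubset_card_mono) auto
      fix g v assume g: "g \<in> P" and v: "v \<in> W - Orb"
      show "act g v \<in> W - Orb"
      proof
        show "act g v \<in> W" using less.prems g v by auto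
        show "act g v \<notin> Orb"
        proof
          assume "act g v \<in> Orb"
          then obtain h where h: "h \<in> P" "act g v = act h w" by (auto simp: Orb_def)
          then have "v = act (inverse g * h) w"
            using g act [of "inverse g" h w] act [of "inverse g" g v] one assms(1)
            by (simp add: sgrpD inverse_mult_self)
          then have "v \<in> Orb" using g h assms(1) by (auto simp: Orb_def sgrpD)
          with v show False by simp
        qed
      qed
    qed (use less.prems in auto)
    have "{w \<in> W - Orb. \<forall>g\<in>P. act g w = w} = {w \<in> W. \<forall>g\<in>P. act g w = w}"
      using fixO by auto
    moreover have "card W = card (W - Orb) + card Orb"
      using OW less.prems(1) by (metis card_Diff_subset card_mono finite_subset le_add_diff_inverse2)
    ultimately show ?thesis using step pO
      by (auto simp: cong_def elim!: dvdE)
  qed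
qed

subsection \<open>Elements of prime power order\<close>

lemma pow_cong:
  fixes x :: "'a::monoid_mult"
  assumes "x ^ n = 1" "[i = j] (mod n)"
  shows "x ^ i = x ^ j"
proof -
  have "x ^ i = x ^ (i mod n)" for i
  proof -
    have "x ^ i = x ^ (n * (i div n) + i mod n)" by simp
    also have "\<dots> = x ^ (i mod n)" unfolding power_add power_mult assms(1) by simp
    finally show ?thesis .
  qed
  then show ?thesis using assms(2) by (metis cong_def)
qed

lemma pow_dvd_one: "(x :: 'a::monoid_mult) ^ a = 1 \<Longrightarrow> a dvd b \<Longrightarrow> x ^ b = 1"
  by (auto simp: dvd_def power_mult)

text \<open>The exponents are the Chinese remainder solutions of \<open>(1, 0)\<close> and
  \<open>(0, 1)\<close>. Both parts are powers of \<open>x\<close>, so they stay in every subgroup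
  containing \<open>x\<close>.\<close>

lemma pow_split:
  fixes x :: "'a::monoid_mult"
  assumes "x ^ (a * b) = 1" "coprime a b"
  obtains i j where "x = x ^ i * x ^ j" "(x ^ i) ^ a = 1" "(x ^ j) ^ b = 1"
proof -
  obtain i where i: "[i = 1] (mod a)" "[i = 0] (mod b)"
    using binary_chinese_remainder_nat [OF assms(2), of 1 0] by auto
  obtain j where j: "[j = 0] (mod a)" "[j = 1] (mod b)"
    using binary_chinese_remainder_nat [OF assms(2), of 0 1] by auto
  have "[i + j = 1 + 0] (mod a)" "[i + j = 0 + 1] (mod b)"
    using i j by (metis cong_add)+
  then have "[i + j = 1] (mod a * b)"
    using assms(2) by (simp add: coprime_cong_mult_nat)
  then have "x ^ (i + j) = x ^ 1" by (rule pow_cong [OF assms(1)])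
  then have "x = x ^ i * x ^ j" by (simp add: power_add)
  moreover have "(x ^ i) ^ a = 1"
    using i(2) assms(1) by (simp add: power_mult [symmetric] cong_0_iff)
      (metis mult.commute mult_dvd_mono dvd_refl pow_dvd_one)
  moreover have "(x ^ j) ^ b = 1"
    using j(1) assms(1) by (simp add: power_mult [symmetric] cong_0_iff)
      (metis mult_dvd_mono dvd_refl pow_dvd_one)
  ultimately show ?thesis by (rule that)
qed

lemma pow_coprime_one:
  fixes x :: "'a::monoid_mult"
  assumes "x ^ a = 1" "x ^ b = 1" "coprime a b"
  shows "x = 1"
proof -
  obtain i where i: "[i = 1] (mod a)" "[i = 0] (mod b)"
    using binary_chinese_remainder_nat [OF assms(3), of 1 0] by auto
  have "x ^ i = x ^ 1" "x ^ i = x ^ 0"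
    using pow_cong [OF assms(1) i(1)] pow_cong [OF assms(2) i(2)] by auto
  then show ?thesis by simp
qed

lemma power_mult_commuting:
  fixes x y :: "'a::monoid_mult"
  assumes "x * y = y * x"
  shows "(x * y) ^ n = x ^ n * y ^ n"
proof (induction n)
  case (Suc n)
  have "(x * y) ^ Suc n = x * (y * x ^ n) * y ^ n" using Suc by (simp add: mult.assoc)
  also have "y * x ^ n = x ^ n * y" using power_commuting_commutes [of x y n] assms by simp
  finally show ?case by (simp add: mult.assoc)
qed simp

lemma pel_one [simp]: "pel p 1"
  by (simp add: pel_def)

lemma pel_pow: "pel p x \<Longrightarrow> pel p (x ^ i)"
  unfolding pel_def by (metis mult.commute power_mult power_one)

lemma pel_cj [simp]: "pel p (cj g x) \<longleftrightarrow> pel p x"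
  by (simp add: pel_def cj_pow [symmetric])

lemma pel_distinct: "prime p \<Longrightarrow> prime q \<Longrightarrow> p \<noteq> q \<Longrightarrow> pel p x \<Longrightarrow> pel q x \<Longrightarrow> x = 1"
  unfolding pel_def using pow_coprime_one primes_coprime
  by (metis coprime_power_left_iff coprime_power_right_iff)

lemma pel_imp_one: "prime p \<Longrightarrow> pel p x \<Longrightarrow> x ^ n = 1 \<Longrightarrow> \<not> p dvd n \<Longrightarrow> x = 1"
  unfolding pel_def by (metis pow_coprime_one prime_imp_coprime coprime_power_left_iff)

lemma prime_decompose_nat:
  assumes "prime p" "(n::nat) > 0"
  obtains m where "n = p ^ multiplicity p n * m" "\<not> p dvd m"
proof -
  have "\<not> is_unit p" using assms(1) by (metis not_prime_unit)
  then show ?thesis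
    using assms(2) that by (metis multiplicity_decompose' mult.commute less_irrefl)
qed

lemma multiplicity_pos_iff: "prime p \<Longrightarrow> (n::nat) > 0 \<Longrightarrow> multiplicity p n > 0 \<longleftrightarrow> p dvd n"
  by (simp add: prime_multiplicity_gt_zero_iff prime_imp_prime_elem)

text \<open>An element of finite order is a product of powers of itself that have prime power order;
  the induction splits off one prime. Stated through membership in \<open>S\<close>, this reduces
  inclusions between subgroups to elements of prime power order.\<close>

lemma prime_power_gen:
  assumes "sgrp S" "n > 0" "x ^ n = 1"
    and "\<And>p i. prime p \<Longrightarrow> pel p (x ^ i) \<Longrightarrow> x ^ i \<in> S"
  shows "x \<in> S"
  using assms(2-)
proof (induction n arbitrary: x rule: less_induct)
  case (less n)
  show ?case
  proof (cases "n = 1")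
    case True
    then show ?thesis using less.prems assms(1) by (simp add: sgrpD)
  next
    case False
    then obtain p where p: "prime p" "p dvd n" by (metis prime_factor_nat)
    obtain k m where km: "n = p ^ k * m" "\<not> p dvd m" "k > 0"
      using prime_decompose_nat [OF p(1) less.prems(1)] multiplicity_pos_iff [OF p(1) less.prems(1)] p(2)
      by metis
    have "coprime (p ^ k) m" using km p by (simp add: prime_imp_coprime)
    then obtain i j where ij: "x = x ^ i * x ^ j" "(x ^ i) ^ (p ^ k) = 1" "(x ^ j) ^ m = 1"
      using less.prems(2) unfolding km by (metis pow_split)
    have "x ^ i \<in> S" using ij(2) p(1) less.prems(3) by (auto simp: pel_def)
    moreover have "x ^ j \<in> S"
    proof (rule less.IH [of m])
      show "m < n" using km p(1) less.prems(1)
        by (metis One_nat_def n_less_m_mult_n nat_0_less_mult_iff one_less_power prime_gt_1_nat mult.commute)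
      show "0 < m" using km less.prems(1) by auto
      show "(x ^ j) ^ l \<in> S" if "prime q" "pel q ((x ^ j) ^ l)" for q l
        using less.prems(3) that by (metis power_mult)
    qed (fact ij)
    ultimately show ?thesis using ij(1) assms(1) by (metis sgrpD(2))
  qed
qed

lemma sgrp_prime_power_gen:
  assumes "sgrp S" "sgrp H" "finite H"
    and "\<And>p x. prime p \<Longrightarrow> x \<in> H \<Longrightarrow> pel p x \<Longrightarrow> x \<in> S"
  shows "H \<subseteq> S"
proof
  fix x assume "x \<in> H"
  then show "x \<in> S"
    using prime_power_gen [OF assms(1) card_gt_0_sgrp [OF assms(2,3)] pow_card_eq_one [OF assms(2)]] assms
    by (metis sgrp_pow)
qed

lemma prime_power_nat_cases:
  assumes "prime p" "d dvd (p ^ k :: nat)" "d \<noteq> 1"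
  shows "p dvd d"
  using assms by (metis divides_primepow_nat dvd_refl dvd_power power_0 neq0_conv)

lemma pgroup_pel: "sgrp P \<Longrightarrow> card P = p ^ k \<Longrightarrow> x \<in> P \<Longrightarrow> pel p x"
  unfolding pel_def by (metis pow_card_eq_one)

lemma exists_pel:
  assumes "sgrp G" "finite G" "prime p" "p dvd card G"
  obtains x where "x \<in> G" "pel p x" "x \<noteq> 1"
proof -
  obtain S where S: "sgrp S" "S \<subseteq> G" "card S = p ^ multiplicity p (card G)"
    using sylow_exists [OF assms(1-3)] .
  have "multiplicity p (card G) > 0"
    using multiplicity_pos_iff [OF assms(3) card_gt_0_sgrp [OF assms(1,2)]] assms(4) by simp
  then have "card S > 1" using S(3) prime_gt_1_nat [OF assms(3)] by (metis one_less_power)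
  then have "S \<noteq> {1}" by auto
  then obtain x where "x \<in> S" "x \<noteq> 1" using sgrpD(1) [OF S(1)] by blast
  then show ?thesis using that S pgroup_pel by blast
qed

lemma card_pgroup:
  assumes "sgrp P" "finite P" "prime p" "\<And>x. x \<in> P \<Longrightarrow> pel p x"
  shows "card P = p ^ multiplicity p (card P)"
proof -
  have "card P dvd p ^ multiplicity p (card P)"
  proof (rule multiplicity_le_imp_dvd)
    show "card P \<noteq> 0" using card_gt_0_sgrp assms by blast
    fix q :: nat assume q: "prime q"
    show "multiplicity q (card P) \<le> multiplicity q (p ^ multiplicity p (card P))"
    proof (cases "q = p")
      case True
      then show ?thesis using q by (simp add: prime_elem_multiplicity_power_distrib)
    next
      case False
      have "\<not> q dvd card P"
        using exists_pel [OF assms(1,2) q] assms(4) pel_distinct [OF q assms(3) False] by metis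
      then show ?thesis by (simp add: not_dvd_imp_multiplicity_0)
    qed
  qed
  then show ?thesis by (simp add: dvd_antisym multiplicity_dvd)
qed

lemma sgrp_range_pow:
  assumes "x ^ n = 1" "n > 0"
  shows "sgrp (range (\<lambda>i. x ^ i))" "finite (range (\<lambda>i. (x :: 'a::grp) ^ i))"
proof -
  have "range (\<lambda>i. x ^ i) \<subseteq> (\<lambda>i. x ^ i) ` {..<n}"
  proof safe
    fix i :: nat
    have "x ^ i = x ^ (i mod n)" by (rule pow_cong [OF assms(1)]) (simp add: cong_def)
    then show "x ^ i \<in> (\<lambda>i. x ^ i) ` {..<n}" using assms(2) by auto
  qed
  then show fin: "finite (range (\<lambda>i. x ^ i))" by (rule finite_subset) simp
  show "sgrp (range (\<lambda>i. x ^ i))"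
    by (rule sgrp_finite_closed [OF fin]) (auto simp: power_add [symmetric])
qed

section \<open>Conjugacy of Sylow subgroups\<close>

definition sylow_sub :: "nat \<Rightarrow> 'a::grp set \<Rightarrow> 'a set \<Rightarrow> bool" where
  "sylow_sub p S J \<longleftrightarrow> sgrp S \<and> S \<subseteq> J \<and> card S = p ^ multiplicity p (card J)"

text \<open>\<open>P\<close> acts by translation on the left cosets of \<open>S\<close> in
  \<open>J\<close>. Their number is prime to \<open>p\<close>, so some coset \<open>j S\<close> is
  fixed, and then \<open>j\<close> conjugates \<open>P\<close> into \<open>S\<close>.\<close>

lemma sylow_conj:
  assumes J: "sgrp J" "finite J" and p: "prime p" and S: "sylow_sub p S J"
    and P: "sgrp P" "P \<subseteq> J" "card P = p ^ k"
  obtains j where "j \<in> J" "cj j ` P \<subseteq> S"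
proof -
  have S': "sgrp S" "S \<subseteq> J" "card S = p ^ multiplicity p (card J)"
    using S by (auto simp: sylow_sub_def)
  define W where "W = (\<lambda>g. (\<lambda>s. g * s) ` S) ` J"
  have "card J = card S * card W"
    unfolding W_def
  proof (rule card_eq_fibre [OF J(2)])
    fix y assume "y \<in> (\<lambda>g. (\<lambda>s. g * s) ` S) ` J"
    then obtain g where g: "g \<in> J" "y = (\<lambda>s. g * s) ` S" by auto
    have "{x \<in> J. (\<lambda>s. x * s) ` S = y} = (\<lambda>s. g * s) ` S" (is "?L = ?R")
    proof (intro Set.set_eqI iffI)
      fix x assume x: "x \<in> ?L"
      have "x * 1 \<in> (\<lambda>s. x * s) ` S" using sgrpD(1) [OF S'(1)] by (rule imageI)
      with x have "x \<in> y" by simp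
      then show "x \<in> ?R" using g by blast
    next
      fix x assume "x \<in> ?R"
      then obtain t where t: "t \<in> S" "x = g * t" by auto
      have "(\<lambda>s. t * s) ` S = S"
        using t S'(1) by (auto simp: sgrpD image_iff) (metis mult_inverse_cancel sgrpD(2,3))
      then have "(\<lambda>s. x * s) ` S = (\<lambda>s. g * s) ` S"
        using image_image [of "\<lambda>s. g * s" "\<lambda>s. t * s" S] by (simp add: t mult.assoc)
      then show "x \<in> ?L" using g t J(1) S'(2) by (auto simp: sgrpD)
    qed
    then show "card {x \<in> J. (\<lambda>s. x * s) ` S = y} = card S"
      by (simp add: card_image inj_on_def mult_left_cancel_grp)
  qed
  then have "\<not> p dvd card W"
    using prime_decompose_nat [OF p card_gt_0_sgrp [OF J]] S'(3) card_gt_0_sgrp [OF J]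
    by (metis mult_cancel_left not_gr_zero mult_0)
  moreover have "[card {w \<in> W. \<forall>g\<in>P. (\<lambda>s. g * s) ` w = w} = card W] (mod p)"
  proof (rule pgroup_fixed_points [OF P(1,3) p])
    show "finite W" using J(2) by (simp add: W_def)
    fix g w assume "g \<in> P" "w \<in> W"
    then obtain h where h: "h \<in> J" "w = (\<lambda>s. h * s) ` S" by (auto simp: W_def)
    then have "(\<lambda>s. g * s) ` w = (\<lambda>s. (g * h) * s) ` S" by (simp add: image_image mult.assoc)
    then show "(\<lambda>s. g * s) ` w \<in> W" using \<open>g \<in> P\<close> h P(2) J(1) by (auto simp: W_def sgrpD subset_iff)
  qed (simp_all add: image_image mult.assoc)
  ultimately have "card {w \<in> W. \<forall>g\<in>P. (\<lambda>s. g * s) ` w = w} \<noteq> 0"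
    by (metis cong_0_iff cong_sym)
  then obtain w where w: "w \<in> W" "\<forall>g\<in>P. (\<lambda>s. g * s) ` w = w"
    by (metis (mono_tags, lifting) card.empty empty_Collect_eq)
  then obtain j where j: "j \<in> J" "w = (\<lambda>s. j * s) ` S" by (auto simp: W_def)
  have "cj j g \<in> S" if "g \<in> P" for g
  proof -
    have "j * 1 \<in> w" unfolding j(2) using sgrpD(1) [OF S'(1)] by (rule imageI)
    then have "g * j \<in> w" using w(2) that by (metis image_eqI mult_1_right)
    then obtain s where "s \<in> S" "g * j = j * s" using j by auto
    then show ?thesis by (simp add: cj_def grp_simps)
  qed
  with j(1) show ?thesis using that by blast
qed

lemma cong_dvd_nat: "[a = b] (mod p) \<Longrightarrow> p dvd b \<Longrightarrow> p dvd (a::nat)"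
  by (simp add: cong_def dvd_eq_mod_eq_0)

subsection \<open>Nilpotent and solvable groups\<close>

lemma nilp_subset: "nilp H \<Longrightarrow> K \<subseteq> H \<Longrightarrow> nilp K"
  unfolding nilp_def by blast

lemma nilpD: "nilp H \<Longrightarrow> x \<in> H \<Longrightarrow> y \<in> H \<Longrightarrow> prime p \<Longrightarrow> prime q \<Longrightarrow> p \<noteq> q \<Longrightarrow> pel p x \<Longrightarrow> pel q y \<Longrightarrow> x * y = y * x"
  unfolding nilp_def by blast

lemma sylow_exists_sub:
  assumes "sgrp G" "finite G" "prime p"
  obtains S where "sylow_sub p S G"
  using sylow_exists [OF assms] by (metis sylow_sub_def)

lemma sylow_sub_pel: "sylow_sub p S J \<Longrightarrow> x \<in> S \<Longrightarrow> pel p x"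
  unfolding sylow_sub_def using pgroup_pel by blast

text \<open>The normalizer of a Sylow subgroup \<open>S\<close> contains \<open>S\<close> and, since
  elements belonging to different primes commute, a Sylow subgroup for each other prime. Hence it is
  all of \<open>H\<close>, so \<open>S\<close> is normal and by conjugacy contains every element of
  \<open>p\<close>-power order.\<close>

lemma sylow_sub_ppart:
  assumes H: "sgrp H" "finite H" "nilp H" and p: "prime p"
  shows "sylow_sub p (ppart H p) H"
proof -
  obtain S where S: "sylow_sub p S H" using sylow_exists_sub [OF H(1,2) p] .
  then have S': "sgrp S" "S \<subseteq> H" "card S = p ^ multiplicity p (card H)"
    by (auto simp: sylow_sub_def)
  let ?N = "nizer H S"
  have N: "sgrp ?N" "?N \<subseteq> H" "finite ?N" using sgrp_nizer H by (auto simp: nizer_def)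
  have "card H dvd card ?N"
  proof (rule multiplicity_le_imp_dvd)
    show "card H \<noteq> 0" using card_gt_0_sgrp [OF H(1,2)] by simp
    fix q :: nat assume q: "prime q"
    obtain T where T: "sylow_sub q T H" using sylow_exists_sub [OF H(1,2) q] .
    then have T': "sgrp T" "T \<subseteq> H" "card T = q ^ multiplicity q (card H)"
      by (auto simp: sylow_sub_def)
    have "\<exists>U. sgrp U \<and> U \<subseteq> ?N \<and> card U = q ^ multiplicity q (card H)"
    proof (cases "q = p")
      case True
      then have "S \<subseteq> ?N" using S'(1,2) by (auto simp: nizer_def sgrp_cj_mem sgrp_cj_image)
      with S' True show ?thesis by blast
    next
      case False
      have "cj x ` S = S" if x: "x \<in> T" for x
      proof -
        have "cj x s = s" if s: "s \<in> S" for s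
          using nilpD [OF H(3), of x s q p] sylow_sub_pel [OF T x] sylow_sub_pel [OF S s] S'(2) T'(2) p q x s False
          by (auto simp: cj_fix_iff)
        then show ?thesis by simp
      qed
      then have "T \<subseteq> ?N" using T'(2) by (auto simp: nizer_def)
      with T' show ?thesis by blast
    qed
    then obtain U where U: "sgrp U" "U \<subseteq> ?N" "card U = q ^ multiplicity q (card H)" by blast
    have "q ^ multiplicity q (card H) dvd card ?N"
      using card_dvd_sgrp [OF N(1) U(1,2) N(3)] U(3) by simp
    then show "multiplicity q (card H) \<le> multiplicity q (card ?N)"
      using card_gt_0_sgrp [OF N(1,3)] q by (metis multiplicity_geI not_prime_unit less_irrefl)
  qed
  then have "card H \<le> card ?N" using card_gt_0_sgrp [OF N(1,3)] dvd_imp_le by blast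
  then have NH: "?N = H" using N(2) H(2) by (metis card_seteq)
  have "ppart H p = S"
  proof
    show "S \<subseteq> ppart H p" using S' sylow_sub_pel [OF S] by (auto simp: ppart_def)
    show "ppart H p \<subseteq> S"
    proof
      fix x assume x: "x \<in> ppart H p"
      let ?P = "range (\<lambda>i. x ^ i)"
      have xH: "x \<in> H" "pel p x" using x by (auto simp: ppart_def)
      have P: "sgrp ?P" "finite ?P"
        using sgrp_range_pow [OF pow_card_eq_one [OF H(1) xH(1)] card_gt_0_sgrp [OF H(1,2)]] by auto
      have "?P \<subseteq> H" using xH H(1) by (auto simp: sgrp_pow)
      moreover have "card ?P = p ^ multiplicity p (card ?P)"
        by (rule card_pgroup [OF P p]) (use xH(2) pel_pow in auto)
      ultimately obtain j where j: "j \<in> H" "cj j ` ?P \<subseteq> S"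
        using sylow_conj [OF H(1,2) p S P(1)] by metis
      have "x ^ 1 \<in> ?P" by blast
      then have "cj j x \<in> S" using j by auto
      have "j \<in> ?N" using NH j(1) by simp
      then have "cj (inverse j) ` S = S" by (simp add: nizer_def cj_image_fix_inverse)
      then show "x \<in> S" using \<open>cj j x \<in> S\<close> by (metis cj_inv_cancel(1) image_eqI)
    qed
  qed
  with S show ?thesis by simp
qed

lemma sgrp_ppart: "sgrp H \<Longrightarrow> finite H \<Longrightarrow> nilp H \<Longrightarrow> prime p \<Longrightarrow> sgrp (ppart H p)"
  and card_ppart: "sgrp H \<Longrightarrow> finite H \<Longrightarrow> nilp H \<Longrightarrow> prime p \<Longrightarrow> card (ppart H p) = p ^ multiplicity p (card H)"
  using sylow_sub_ppart by (auto simp: sylow_sub_def)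

lemma ppart_subset: "ppart H p \<subseteq> H"
  by (auto simp: ppart_def)

lemma normal_in_ppart:
  assumes "normal_in N J" "finite N" "nilp N" "prime p"
  shows "normal_in (ppart N p) J"
  using assms sgrp_ppart [OF normal_inD(1) [OF assms(1)]]
  by (auto simp: normal_in_def ppart_def)

lemma nilp_cizer_prime:
  assumes A: "sgrp A" "finite A" "nilp A" and p: "prime p" and z: "z \<in> A" "pel p z"
    and comm: "\<And>g. g \<in> ppart A p \<Longrightarrow> g * z = z * g"
  shows "z \<in> center A"
proof -
  have "A \<subseteq> cizer A {z}"
  proof (rule sgrp_prime_power_gen [OF sgrp_cizer [OF A(1)] A(1,2)])
    fix q g assume g: "prime q" "g \<in> A" "pel q g"
    show "g \<in> cizer A {z}"
    proof (cases "q = p")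
      case True
      then show ?thesis using comm g by (auto simp: cizer_def ppart_def)
    next
      case False
      then show ?thesis using nilpD [OF A(3) g(2) z(1) g(1) p False g(3) z(2)] g(2)
        by (auto simp: cizer_def)
    qed
  qed
  with z show ?thesis by (auto simp: cizer_def)
qed

text \<open>The \<open>p\<close>-part of \<open>A\<close> acts on the \<open>p\<close>-part of
  \<open>N\<close>, whose order is divisible by \<open>p\<close>, so it fixes a point other than
  \<open>1\<close>. The parts for other primes commute with this point anyway.\<close>

lemma nilp_center_elem:
  assumes A: "sgrp A" "finite A" "nilp A" and N: "normal_in N A" and p: "prime p" "p dvd card N"
  obtains z where "z \<in> N" "z \<noteq> 1" "pel p z" "z \<in> center A"
proof -
  note N' = normal_inD [OF N]
  have finN: "finite N" "nilp N" using N'(2) A finite_subset nilp_subset by auto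
  let ?P = "ppart A p" and ?W = "ppart N p"
  have W: "card ?W = p ^ multiplicity p (card N)" by (rule card_ppart [OF N'(1) finN p(1)])
  have "multiplicity p (card N) > 0"
    using multiplicity_pos_iff [OF p(1) card_gt_0_sgrp [OF N'(1) finN(1)]] p(2) by simp
  then have pW: "p dvd card ?W" using W by simp
  have "[card {w \<in> ?W. \<forall>g\<in>?P. cj (inverse g) w = w} = card ?W] (mod p)"
  proof (rule pgroup_fixed_points)
    show "sgrp ?P" by (rule sgrp_ppart [OF A p(1)])
    show "card ?P = p ^ multiplicity p (card A)" by (rule card_ppart [OF A p(1)])
    show "finite ?W" using finN(1) by (simp add: ppart_def)
    fix g w assume "g \<in> ?P" "w \<in> ?W"
    then show "cj (inverse g) w \<in> ?W" using N'(3) A(1) by (auto simp: ppart_def sgrpD)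
  qed (use p in \<open>auto simp: cj_cj grp_simps\<close>)
  then have "p dvd card {w \<in> ?W. \<forall>g\<in>?P. cj (inverse g) w = w}" (is "p dvd card ?F")
    using pW by (rule cong_dvd_nat)
  moreover have "1 \<in> ?F" using N'(1) by (auto simp: ppart_def sgrpD)
  ultimately have "?F \<noteq> {1}" using p(1) by (auto simp: not_prime_unit)
  then obtain z where z: "z \<in> ?F" "z \<noteq> 1" using \<open>1 \<in> ?F\<close> by blast
  have "z \<in> center A"
  proof (rule nilp_cizer_prime [OF A p(1)])
    show "z \<in> A" "pel p z" using z N'(2) by (auto simp: ppart_def)
    fix g assume "g \<in> ?P"
    then have "inverse g \<in> ?P" using sgrpD(3) [OF sgrp_ppart [OF A p(1)]] by blast
    then have "cj (inverse (inverse g)) z = z" using z(1) by blast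
    then show "g * z = z * g" by (simp add: grp_simps cj_fix_iff)
  qed
  with z that show ?thesis by (auto simp: ppart_def)
qed

section \<open>Derived subgroups and solvability\<close>

definition dcomm :: "'a::grp set \<Rightarrow> 'a set" where
  "dcomm K = \<Inter>{M. sgrp M \<and> (\<forall>x\<in>K. \<forall>y\<in>K. inverse x * cj y x \<in> M)}"

text \<open>For a subgroup \<open>K\<close> the set \<open>dcomm K\<close> is its derived subgroup, so for finite \<open>H\<close> this is solvability.\<close>

definition solv :: "'a::grp set \<Rightarrow> bool" where
  "solv H \<longleftrightarrow> (\<forall>K. sgrp K \<longrightarrow> K \<subseteq> H \<longrightarrow> dcomm K = K \<longrightarrow> K = {1})"

lemma sgrp_dcomm: "sgrp (dcomm K)"
  unfolding dcomm_def by (rule sgrp_Inter) auto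

lemma dcomm_mem: "x \<in> K \<Longrightarrow> y \<in> K \<Longrightarrow> inverse x * cj y x \<in> dcomm K"
  by (auto simp: dcomm_def)

lemma dcomm_least: "sgrp M \<Longrightarrow> (\<And>x y. x \<in> K \<Longrightarrow> y \<in> K \<Longrightarrow> inverse x * cj y x \<in> M) \<Longrightarrow> dcomm K \<subseteq> M"
  by (auto simp: dcomm_def)

lemma dcomm_subset: "sgrp K \<Longrightarrow> dcomm K \<subseteq> K"
  by (rule dcomm_least) (auto simp: sgrpD sgrp_cj_mem)

lemma normal_in_dcomm:
  assumes "normal_in K J" "sgrp J"
  shows "normal_in (dcomm K) J"
  unfolding normal_in_def
proof (intro conjI ballI)
  note K = normal_inD [OF assms(1)]
  show "sgrp (dcomm K)" by (rule sgrp_dcomm)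
  show "dcomm K \<subseteq> J" using dcomm_subset K by blast
  fix g x assume g: "g \<in> J" and x: "x \<in> dcomm K"
  have "dcomm K \<subseteq> cj (inverse g) ` dcomm K"
  proof (rule dcomm_least)
    show "sgrp (cj (inverse g) ` dcomm K)" by (simp add: sgrp_cj sgrp_dcomm)
    fix a b assume "a \<in> K" "b \<in> K"
    then have "inverse (cj g a) * cj (cj g b) (cj g a) \<in> dcomm K"
      using K(3) g by (intro dcomm_mem) auto
    moreover have "inverse (cj g a) * cj (cj g b) (cj g a) = cj g (inverse a * cj b a)"
      by (simp add: cj_def grp_simps)
    ultimately show "inverse a * cj b a \<in> cj (inverse g) ` dcomm K"
      by (simp add: mem_cj_image grp_simps)
  qed
  then show "cj g x \<in> dcomm K" using x by (auto simp: cj_image_mono mem_cj_image)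
qed

lemma solv_subset: "solv H \<Longrightarrow> K \<subseteq> H \<Longrightarrow> solv K"
  unfolding solv_def by blast

text \<open>A perfect subgroup has a perfect image, which must be trivial; so the subgroup lies in
  the kernel and is trivial as well.\<close>

lemma solv_extension:
  assumes H: "sgrp H" and f: "\<And>x y. x \<in> H \<Longrightarrow> y \<in> H \<Longrightarrow> f (x * y) = f x * f y"
    and "solv (f ` H)" "solv {x \<in> H. f x = 1}"
  shows "solv H"
  unfolding solv_def
proof (intro allI impI)
  fix K assume K: "sgrp K" "K \<subseteq> H" "dcomm K = K"
  have "f 1 * f 1 = f 1 * 1" using f [of 1 1] H by (simp add: sgrpD)
  then have f1: "f 1 = 1" by (simp only: mult_left_cancel_grp)
  have finv: "f (inverse x) = inverse (f x)" if "x \<in> H" for x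
  proof -
    have "f x * f (inverse x) = 1" using f [of x "inverse x"] that H f1 by (simp add: sgrpD grp_simps)
    then show ?thesis by (rule inverse_unique_grp [symmetric])
  qed
  have fcj: "f (cj y x) = cj (f y) (f x)" if "x \<in> H" "y \<in> H" for x y
    using that H by (simp add: cj_def sgrpD f finv)
  have "f x * f y \<in> f ` K" if "x \<in> K" "y \<in> K" for x y
  proof -
    have "f (x * y) \<in> f ` K" by (rule imageI) (rule sgrpD(2) [OF K(1) that])
    then show ?thesis using f [of x y] that K(2) by (simp add: subset_iff)
  qed
  moreover have "inverse (f x) \<in> f ` K" if "x \<in> K" for x
  proof -
    have "f (inverse x) \<in> f ` K" by (rule imageI) (rule sgrpD(3) [OF K(1) that])
    then show ?thesis using finv [of x] that K(2) by (simp add: subset_iff)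
  qed
  moreover have "1 \<in> f ` K" using f1 sgrpD(1) [OF K(1)] by (metis image_eqI)
  ultimately have sfK: "sgrp (f ` K)" by (auto simp: sgrp_def)
  have "dcomm (f ` K) = f ` K"
  proof
    show "dcomm (f ` K) \<subseteq> f ` K" by (rule dcomm_subset [OF sfK])
    have "dcomm K \<subseteq> {x \<in> K. f x \<in> dcomm (f ` K)}"
    proof (rule dcomm_least)
      show "sgrp {x \<in> K. f x \<in> dcomm (f ` K)}"
        using K f f1 finv sgrp_dcomm [of "f ` K"] by (auto simp: sgrp_def subset_iff)
      fix x y assume xy: "x \<in> K" "y \<in> K"
      then have "f (inverse x * cj y x) = inverse (f x) * cj (f y) (f x)"
        using K(2) H by (subst f) (auto simp: sgrpD sgrp_cj_mem finv fcj subset_iff)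
      then show "inverse x * cj y x \<in> {x \<in> K. f x \<in> dcomm (f ` K)}"
        using xy K(1) dcomm_mem [of "f x" "f ` K" "f y"] by (auto simp: sgrpD sgrp_cj_mem)
    qed
    then show "f ` K \<subseteq> dcomm (f ` K)" using K(3) by auto
  qed
  then have "f ` K = {1}" using assms(3) sfK K(2) unfolding solv_def by blast
  then have "K \<subseteq> {x \<in> H. f x = 1}" using K(2) by auto
  with K assms(4) show "K = {1}" unfolding solv_def by blast
qed

text \<open>\<open>M\<close> is maximal among the subgroups normal in \<open>A\<close> and properly
  contained in \<open>Q\<close>. Some non-trivial element of \<open>Q/M\<close> is central in
  \<open>A/M\<close>, so by maximality all of \<open>Q/M\<close> is. Then every subgroup between
  \<open>M\<close> and \<open>Q\<close> is normal in \<open>A\<close>, which gives the last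
  conclusion.\<close>

lemma nilp_max_sub:
  assumes A: "sgrp A" "finite A" "nilp A" and Q: "normal_in Q A" "Q \<noteq> {1}"
  obtains M s u where "normal_in M A" "M \<subseteq> Q" "\<And>x g. x \<in> Q \<Longrightarrow> g \<in> A \<Longrightarrow> inverse x * cj g x \<in> M"
    "prime s" "u \<in> Q" "pel s u" "u \<notin> M"
    "\<And>M'. sgrp M' \<Longrightarrow> M \<subseteq> M' \<Longrightarrow> M' \<subseteq> Q \<Longrightarrow> M' = M \<or> M' = Q"
proof -
  note Q' = normal_inD [OF Q(1)]
  have finQ: "finite Q" "nilp Q" using Q'(2) A finite_subset nilp_subset by auto
  let ?S = "\<lambda>M. normal_in M A \<and> M \<subset> Q"
  have S1: "?S {1}" using Q Q' A by (auto simp: normal_in_def sgrp_one sgrpD)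
  have "\<forall>M. ?S M \<longrightarrow> card M < card Q" using finQ(1) by (simp add: psubset_card_mono)
  then have "\<exists>M. ?S M \<and> (\<forall>M'. ?S M' \<longrightarrow> card M' \<le> card M)"
    by (rule ex_has_greatest_nat [of ?S "{1}" card, OF S1])
  then obtain M where M: "normal_in M A" "M \<subset> Q" and max: "\<forall>M'. ?S M' \<longrightarrow> card M' \<le> card M"
    by (elim exE conjE)
  note M' = normal_inD [OF M(1)]
  obtain s u where u: "prime s" "u \<in> Q" "pel s u" "u \<notin> M"
    using sgrp_prime_power_gen [OF M'(1) Q'(1) finQ(1)] M(2) by blast
  \<comment> \<open>Preimage of the elements of \<open>Q/M\<close> that are central in
    \<open>A/M\<close>.\<close>
  define C where "C = {x \<in> Q. \<forall>g\<in>A. inverse x * cj g x \<in> M}"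
  have C_normal: "normal_in C A"
    unfolding normal_in_def
  proof (intro conjI ballI)
    show "C \<subseteq> A" using Q' by (auto simp: C_def)
    show "sgrp C"
    proof (rule sgrp_finite_closed)
      show "finite C" using finQ by (simp add: C_def)
      show "C \<noteq> {}" using sgrpD(1) [OF Q'(1)] sgrpD(1) [OF M'(1)] by (auto simp: C_def grp_simps)
      fix x y assume xy: "x \<in> C" "y \<in> C"
      have "inverse (x * y) * cj g (x * y) \<in> M" if g: "g \<in> A" for g
      proof -
        have "cj y (inverse x * cj g x) \<in> M" using xy g M'(3) Q'(2) by (auto simp: C_def)
        moreover have "inverse y * cj g y \<in> M" using xy g by (auto simp: C_def)
        ultimately have "cj y (inverse x * cj g x) * (inverse y * cj g y) \<in> M" using M'(1) by (simp add: sgrpD)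
        moreover have "cj y (inverse x * cj g x) * (inverse y * cj g y) = inverse (x * y) * cj g (x * y)"
          by (simp add: cj_def grp_simps)
        ultimately show ?thesis by simp
      qed
      then show "x * y \<in> C" using xy Q'(1) by (simp add: C_def sgrpD)
    qed
    fix h x assume h: "h \<in> A" and x: "x \<in> C"
    have "inverse (cj h x) * cj g (cj h x) \<in> M" if g: "g \<in> A" for g
    proof -
      have "h * g * inverse h \<in> A" using g h A(1) by (simp add: sgrpD)
      then have "cj h (inverse x * cj (h * g * inverse h) x) \<in> M" using M'(3) h x by (auto simp: C_def)
      moreover have "cj h (inverse x * cj (h * g * inverse h) x) = inverse (cj h x) * cj g (cj h x)"
        by (simp add: cj_def grp_simps)
      ultimately show ?thesis by simp
    qed
    then show "cj h x \<in> C" using h x Q'(3) by (simp add: C_def)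
  qed
  have MC: "M \<subseteq> C" using M(2) M' by (auto simp: C_def sgrpD)
  let ?P = "ppart A s" and ?Qs = "ppart Q s"
  \<comment> \<open>Cosets of \<open>M\<close> represented by \<open>s\<close>-elements of
    \<open>Q\<close>. Their number is a power of \<open>s\<close> and not \<open>1\<close>, so the
    \<open>s\<close>-part of \<open>A\<close> fixes a coset besides \<open>M\<close>.\<close>
  define W where "W = (\<lambda>x. (\<lambda>m. x * m) ` M) ` ?Qs"
  have Qs: "sgrp ?Qs" "finite ?Qs" "card ?Qs = s ^ multiplicity s (card Q)"
    using sgrp_ppart [OF Q'(1) finQ u(1)] card_ppart [OF Q'(1) finQ u(1)] finQ(1) by (auto simp: ppart_def)
  have coset_eq: "(\<lambda>m. x * m) ` M = (\<lambda>m. y * m) ` M \<longleftrightarrow> inverse y * x \<in> M" for x y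
  proof
    assume *: "(\<lambda>m. x * m) ` M = (\<lambda>m. y * m) ` M"
    have "x * 1 \<in> (\<lambda>m. x * m) ` M" by (rule imageI) (rule sgrpD(1) [OF M'(1)])
    then have "x \<in> (\<lambda>m. y * m) ` M" using * by simp
    then show "inverse y * x \<in> M" by (auto simp: grp_simps)
  next
    assume *: "inverse y * x \<in> M"
    have sub: "(\<lambda>m. a * m) ` M \<subseteq> (\<lambda>m. b * m) ` M" if "inverse b * a \<in> M" for a b
    proof
      fix z assume "z \<in> (\<lambda>m. a * m) ` M"
      then obtain m where "m \<in> M" "z = b * ((inverse b * a) * m)" by (auto simp: grp_simps)
      then show "z \<in> (\<lambda>m. b * m) ` M" using that M'(1) by (auto simp: sgrpD)
    qed
    have "inverse (inverse y * x) \<in> M" using * M'(1) by (rule sgrpD(3) [rotated])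
    then have "inverse x * y \<in> M" by (simp add: grp_simps)
    then show "(\<lambda>m. x * m) ` M = (\<lambda>m. y * m) ` M" using sub * by blast
  qed
  have "card ?Qs = card (?Qs \<inter> M) * card W"
    unfolding W_def
  proof (rule card_eq_fibre [OF Qs(2)])
    fix y assume "y \<in> (\<lambda>x. (\<lambda>m. x * m) ` M) ` ?Qs"
    then obtain x where x: "x \<in> ?Qs" "y = (\<lambda>m. x * m) ` M" by auto
    have "{z \<in> ?Qs. (\<lambda>m. z * m) ` M = y} = (\<lambda>m. x * m) ` (?Qs \<inter> M)" (is "?L = ?R")
    proof (intro Set.set_eqI iffI)
      fix z assume "z \<in> ?L"
      then have z: "z \<in> ?Qs" "inverse x * z \<in> M" by (auto simp: x coset_eq)
      then have "inverse x * z \<in> ?Qs \<inter> M" using x(1) Qs(1) by (simp add: sgrpD)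
      then have "x * (inverse x * z) \<in> ?R" by (rule imageI)
      then show "z \<in> ?R" by (simp add: grp_simps)
    next
      fix z assume "z \<in> ?R"
      then obtain m where m: "m \<in> ?Qs" "m \<in> M" "z = x * m" by blast
      then have "z \<in> ?Qs" using x(1) Qs(1) by (simp add: sgrpD)
      moreover have "(\<lambda>m. z * m) ` M = y" unfolding x(2) coset_eq using m by (simp add: grp_simps)
      ultimately show "z \<in> ?L" by simp
    qed
    then show "card {z \<in> ?Qs. (\<lambda>m. z * m) ` M = y} = card (?Qs \<inter> M)"
      by (simp add: card_image inj_on_def mult_left_cancel_grp)
  qed
  then have Wdvd: "card W dvd s ^ multiplicity s (card Q)" using Qs(3) by simp
  have MW: "M \<in> W"
    unfolding W_def using sgrpD(1) [OF Qs(1)] by (intro image_eqI [of _ _ 1]) auto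
  have uW: "(\<lambda>m. u * m) ` M \<in> W" unfolding W_def using u by (auto simp: ppart_def)
  have "(\<lambda>m. u * m) ` M \<noteq> M" using coset_eq [of u 1] u(4) by (simp add: grp_simps)
  then have "card W \<noteq> 1" using MW uW by (auto simp: card_1_singleton_iff)
  then have sW: "s dvd card W" by (rule prime_power_nat_cases [OF u(1) Wdvd])
  have cj_coset: "cj g ` (\<lambda>m. x * m) ` M = (\<lambda>m. cj g x * m) ` M" if "g \<in> A" for g x
  proof -
    have "cj g ` (\<lambda>m. x * m) ` M = (\<lambda>m. cj g x * m) ` cj g ` M" by (simp add: image_image cj_mult)
    then show ?thesis using normal_in_image [OF M(1) A(1) that] by simp
  qed
  have "[card {w \<in> W. \<forall>g\<in>?P. cj (inverse g) ` w = w} = card W] (mod s)"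
  proof (rule pgroup_fixed_points [OF sgrp_ppart [OF A u(1)] card_ppart [OF A u(1)] u(1)])
    show "finite W" using Qs(2) by (simp add: W_def)
    fix g w assume g: "g \<in> ?P" and "w \<in> W"
    then obtain x where x: "x \<in> ?Qs" "w = (\<lambda>m. x * m) ` M" by (auto simp: W_def)
    have gA: "inverse g \<in> A" using g A(1) by (simp add: ppart_def sgrpD)
    have "cj (inverse g) x \<in> ?Qs" using x(1) gA Q'(3) by (simp add: ppart_def)
    then show "cj (inverse g) ` w \<in> W" using cj_coset [OF gA, of x] by (simp add: x(2) W_def)
  qed (simp_all add: cj_image_cj grp_simps)
  then have "s dvd card {w \<in> W. \<forall>g\<in>?P. cj (inverse g) ` w = w}" (is "s dvd card ?F")
    using sW by (rule cong_dvd_nat)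
  moreover have "M \<in> ?F"
    using MW A(1) normal_in_image [OF M(1) A(1)] by (auto simp: ppart_def sgrpD)
  ultimately have "?F \<noteq> {M}" using u(1) by (auto simp: not_prime_unit)
  then obtain w where w: "w \<in> ?F" "w \<noteq> M" using \<open>M \<in> ?F\<close> by blast
  then obtain x where x: "x \<in> ?Qs" "w = (\<lambda>m. x * m) ` M" by (auto simp: W_def)
  have xM: "x \<notin> M" using w(2) coset_eq [of x 1] x(2) by (auto simp: grp_simps)
  let ?T = "{g \<in> A. inverse x * cj g x \<in> M}"
  have xA: "x \<in> A" using x(1) Q'(2) by (auto simp: ppart_def)
  have "A \<subseteq> ?T"
  proof (rule sgrp_prime_power_gen [OF _ A(1,2)])
    show "sgrp ?T"
    proof (rule sgrp_finite_closed)
      show "finite ?T" using A(2) by simp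
      show "?T \<noteq> {}" using sgrpD(1) [OF A(1)] sgrpD(1) [OF M'(1)] by (auto intro!: exI [of _ 1] simp: grp_simps)
      fix g h assume gh: "g \<in> ?T" "h \<in> ?T"
      have "(inverse x * cj h x) * cj h (inverse x * cj g x) \<in> M"
        using gh M' by (simp add: sgrpD)
      moreover have "(inverse x * cj h x) * cj h (inverse x * cj g x) = inverse x * cj (g * h) x"
        by (simp add: cj_def grp_simps)
      ultimately show "g * h \<in> ?T" using gh A(1) by (simp add: sgrpD)
    qed
    fix p g assume g: "prime p" "g \<in> A" "pel p g"
    show "g \<in> ?T"
    proof (cases "p = s")
      case True
      then have "inverse g \<in> ?P" using sgrpD(3) [OF sgrp_ppart [OF A u(1)]] g by (auto simp: ppart_def)
      then have "cj (inverse (inverse g)) ` w = w" using w(1) by blast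
      then have "(\<lambda>m. cj g x * m) ` M = (\<lambda>m. x * m) ` M"
        using cj_coset [OF g(2), of x] by (simp add: x(2) grp_simps)
      then show ?thesis using g(2) by (simp add: coset_eq)
    next
      case False
      then have "cj g x = x"
        using nilpD [OF A(3) g(2) xA g(1) u(1)] g(3) x(1) by (simp add: cj_fix_iff ppart_def)
      then show ?thesis using g(2) M'(1) by (simp add: grp_simps sgrpD)
    qed
  qed
  then have "x \<in> C" using x(1) by (auto simp: C_def ppart_def)
  then have "M \<subset> C" using MC xM by blast
  then have "card M < card C" using finQ by (intro psubset_card_mono) (simp_all add: C_def)
  then have "C = Q" using max [rule_format, of C] C_normal by (auto simp: C_def)
  have triv: "inverse x * cj g x \<in> M" if "x \<in> Q" "g \<in> A" for x g
    using that \<open>C = Q\<close> unfolding C_def by blast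
  show ?thesis
  proof (rule that [OF M(1) _ triv u])
    fix M1 assume M1: "sgrp M1" "M \<subseteq> M1" "M1 \<subseteq> Q"
    have "cj g x \<in> M1" if "x \<in> M1" "g \<in> A" for g x
    proof -
      have "inverse x * cj g x \<in> M1" using triv [of x g] that M1(2,3) by blast
      then have "x * (inverse x * cj g x) \<in> M1" by (rule sgrpD(2) [OF M1(1) that(1)])
      then show ?thesis by (simp add: grp_simps)
    qed
    then have "normal_in M1 A" using M1 Q'(2) by (auto simp: normal_in_def)
    then have "M1 \<subset> Q \<longrightarrow> card M1 \<le> card M" using max by blast
    moreover have "finite M1" by (rule finite_subset [OF M1(3) finQ(1)])
    ultimately show "M1 = M \<or> M1 = Q" using M1 card_seteq by blast
  qed (use M(2) in auto)
qed

lemma nilp_solv: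
  assumes "sgrp A" "finite A" "nilp A"
  shows "solv A"
  unfolding solv_def
proof (intro allI impI, rule ccontr)
  fix K assume K: "sgrp K" "K \<subseteq> A" "dcomm K = K" "K \<noteq> {1}"
  have "finite K" "nilp K"
    by (rule finite_subset [OF K(2) assms(2)], rule nilp_subset [OF assms(3) K(2)])
  then obtain M s u where "normal_in M K" "M \<subseteq> K" "\<And>x g. x \<in> K \<Longrightarrow> g \<in> K \<Longrightarrow> inverse x * cj g x \<in> M"
    "u \<in> K" "u \<notin> M"
    using nilp_max_sub [OF K(1) _ _ normal_in_self [OF K(1)] K(4)] by (metis (no_types))
  then have "dcomm K \<subseteq> M" by (intro dcomm_least) (auto simp: normal_in_def)
  with K(3) \<open>u \<in> K\<close> \<open>u \<notin> M\<close> show False by blast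
qed

text \<open>Let \<open>K\<close> have least order among the normal subgroups of \<open>J\<close>
  that lie inside \<open>C\<close> but not inside \<open>Z\<close>. Its derived subgroup is smaller
  by solvability and again normal in \<open>J\<close>, so it falls into \<open>Z\<close>.\<close>

lemma solv_normal_step:
  assumes J: "sgrp J" "finite J" "solv J" and C: "normal_in C J" and Z: "sgrp Z" "\<not> C \<subseteq> Z"
  obtains K where "normal_in K J" "K \<subseteq> C" "\<not> K \<subseteq> Z" "\<And>x y. x \<in> K \<Longrightarrow> y \<in> K \<Longrightarrow> inverse x * cj y x \<in> Z"
proof -
  let ?S = "\<lambda>K. normal_in K J \<and> K \<subseteq> C \<and> \<not> K \<subseteq> Z"
  have "\<exists>K. ?S K \<and> (\<forall>K'. ?S K' \<longrightarrow> card K \<le> card K')"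
    by (rule ex_has_least_nat [of ?S C card]) (use C Z(2) in auto)
  then obtain K where K: "normal_in K J" "K \<subseteq> C" "\<not> K \<subseteq> Z" and min: "\<forall>K'. ?S K' \<longrightarrow> card K \<le> card K'"
    by (elim exE conjE)
  have "sgrp K" "K \<subseteq> J" using K by (auto simp: normal_in_def)
  have "K \<noteq> {1}" using K sgrpD(1) [OF Z(1)] by auto
  then have "dcomm K \<noteq> K" using J(3) \<open>sgrp K\<close> \<open>K \<subseteq> J\<close> by (auto simp: solv_def)
  then have "dcomm K \<subset> K" using dcomm_subset [OF \<open>sgrp K\<close>] by blast
  then have "card (dcomm K) < card K" using J(2) \<open>K \<subseteq> J\<close> finite_subset psubset_card_mono by metis
  then have "\<not> ?S (dcomm K)" using min [rule_format, of "dcomm K"] by auto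
  moreover have "normal_in (dcomm K) J" by (rule normal_in_dcomm) (use K J in auto)
  ultimately have Z': "dcomm K \<subseteq> Z" using K \<open>dcomm K \<subset> K\<close> by auto
  show ?thesis
  proof (rule that [of K])
    fix x y assume "x \<in> K" "y \<in> K"
    then have "inverse x * cj y x \<in> dcomm K" by (rule dcomm_mem)
    then show "inverse x * cj y x \<in> Z" using Z' by auto
  qed (use K in auto)
qed

subsection \<open>Factorised subgroups\<close>

text \<open>When \<open>A\<close> and \<open>B\<close> meet trivially, this says \<open>J = (J \<inter> A)(J \<inter> B)\<close>.\<close>

definition fac :: "'a::grp set \<Rightarrow> 'a set \<Rightarrow> 'a set \<Rightarrow> bool" where
  "fac A B J \<longleftrightarrow> sgrp J \<and> card J = card (J \<inter> A) * card (J \<inter> B)"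

text \<open>The normal core: for subgroups \<open>J\<close> and \<open>A\<close> it is the largest
  normal subgroup of \<open>J\<close> contained in \<open>A\<close>.\<close>

definition core :: "'a::grp set \<Rightarrow> 'a set \<Rightarrow> 'a set" where
  "core J A = {x. \<forall>g\<in>J. cj g x \<in> J \<inter> A}"

lemma fac_commute: "fac A B J \<longleftrightarrow> fac B A J"
  by (simp add: fac_def mult.commute)

lemma coprime_nat_primeI:
  assumes "\<And>p. prime p \<Longrightarrow> p dvd a \<Longrightarrow> p dvd b \<Longrightarrow> False"
  shows "coprime a (b::nat)"
proof (rule ccontr)
  assume "\<not> coprime a b"
  then have "gcd a b \<noteq> 1" by (simp add: coprime_iff_gcd_eq_1)
  then obtain p where "prime p" "p dvd gcd a b" by (metis prime_factor_nat)
  then show False using assms by auto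
qed

lemma coprime_prime_not_dvd: "coprime a (b::nat) \<Longrightarrow> prime p \<Longrightarrow> p dvd b \<Longrightarrow> \<not> p dvd a"
  using coprime_common_divisor [of a b p] not_prime_unit [of p] by blast

lemma coprime_Int_trivial:
  assumes "sgrp A" "sgrp B" "finite A" "finite B" "coprime (card A) (card B)"
  shows "A \<inter> B = {1}"
proof -
  have "x = 1" if "x \<in> A" "x \<in> B" for x
    using pow_coprime_one [OF pow_card_eq_one [OF assms(1) that(1)] pow_card_eq_one [OF assms(2) that(2)] assms(5)] .
  then show ?thesis using assms(1,2) by (auto simp: sgrpD)
qed

lemma core_normal:
  assumes "sgrp J" "sgrp A"
  shows "normal_in (core J A) J"
  unfolding normal_in_def
proof (intro conjI ballI)
  show "sgrp (core J A)"
    using assms by (auto simp: sgrp_def core_def cj_mult cj_inverse)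
  show "core J A \<subseteq> J" using sgrpD(1) [OF assms(1)] by (force simp: core_def)
  fix g x assume "g \<in> J" "x \<in> core J A"
  then show "cj g x \<in> core J A" using assms by (auto simp: core_def cj_cj sgrpD)
qed

lemma core_subset: "sgrp J \<Longrightarrow> core J A \<subseteq> J \<inter> A"
  using sgrpD(1) [of J] by (force simp: core_def)

lemma core_greatest: "normal_in R J \<Longrightarrow> R \<subseteq> A \<Longrightarrow> R \<subseteq> core J A"
  by (auto simp: core_def normal_in_def)

text \<open>The index \<open>e\<close> of \<open>J \<inter> A\<close> in
  \<open>R (J \<inter> A)\<close> divides \<open>card R\<close>. By the factorisation it also
  divides \<open>card (J \<inter> B)\<close>, so it is \<open>1\<close>.\<close>

lemma fac_normal_sub:
  assumes "fac A B J" "finite J" and sg: "sgrp A" "sgrp B" "finite B"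
    and R: "normal_in R J" "coprime (card R) (card B)"
  shows "R \<subseteq> A"
proof -
  have J: "sgrp J" "card J = card (J \<inter> A) * card (J \<inter> B)" using assms(1) by (auto simp: fac_def)
  let ?H = "J \<inter> A"
  have H: "sgrp ?H" "finite ?H" using J(1) sg assms(2) by (auto simp: sgrp_Int)
  note R' = normal_inD [OF R(1)]
  have finR: "finite R" using R'(2) assms(2) finite_subset by blast
  have RH: "sgrp (R * ?H)" "R * ?H \<subseteq> J" "?H \<subseteq> R * ?H"
    using normal_in_mult [OF R(1) J(1) H(1)] by auto
  have finRH: "finite (R * ?H)" using RH(2) assms(2) finite_subset by blast
  have c: "card (R * ?H) * card (R \<inter> ?H) = card R * card ?H"
    by (rule card_mult_Int [OF R'(1) H(1) finR H(2)])
  obtain e where e: "card (R * ?H) = card ?H * e"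
    using card_dvd_sgrp [OF RH(1) H(1) RH(3) finRH] by (auto simp: dvd_def)
  have "card ?H > 0" using card_gt_0_sgrp [OF H] .
  then have "e * card (R \<inter> ?H) = card R" using c e by (simp add: mult.commute)
  then have "e dvd card R" by (metis dvd_triv_left)
  moreover have "card ?H * e dvd card ?H * card (J \<inter> B)"
    using card_dvd_sgrp [OF J(1) RH(1,2) assms(2)] J(2) e by simp
  then have "e dvd card (J \<inter> B)" using \<open>card ?H > 0\<close> by simp
  then have "e dvd card B"
    using card_dvd_sgrp [OF sg(2) sgrp_Int [OF J(1) sg(2)] _ sg(3)] dvd_trans by blast
  ultimately have "e = 1" using coprime_common_divisor [OF R(2)] by auto
  then have "card (R \<inter> ?H) = card R" using \<open>e * card (R \<inter> ?H) = card R\<close> by simp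
  then have "R \<inter> ?H = R" using finR by (intro card_subset_eq) auto
  then show ?thesis by blast
qed

lemma fac_elem:
  assumes "fac A B J" "finite J" "sgrp A" "sgrp B" "finite A" "finite B" "coprime (card A) (card B)" "g \<in> J"
  obtains a b where "a \<in> J" "a \<in> A" "b \<in> J" "b \<in> B" "g = a * b"
proof -
  have J: "sgrp J" "card J = card (J \<inter> A) * card (J \<inter> B)" using assms(1) by (auto simp: fac_def)
  have sJ: "sgrp (J \<inter> A)" "sgrp (J \<inter> B)" using J(1) assms(3,4) by (auto simp: sgrp_Int)
  have "(J \<inter> A) \<inter> (J \<inter> B) = {1}"
    using coprime_Int_trivial [OF assms(3-7)] sgrpD(1) [OF J(1)] by blast
  then have "card ((J \<inter> A) * (J \<inter> B)) = card J"
    using card_mult_Int [OF sJ] assms(2) J(2) by simp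
  moreover have "(J \<inter> A) * (J \<inter> B) \<subseteq> J" using J(1) by (auto simp: mem_mult_iff sgrpD)
  ultimately have "(J \<inter> A) * (J \<inter> B) = J" using assms(2) by (metis card_subset_eq)
  then have "g \<in> (J \<inter> A) * (J \<inter> B)" using assms(8) by simp
  then show ?thesis using that by (auto simp: mem_mult_iff)
qed

lemma facI:
  assumes J: "sgrp J" "finite J" and "sgrp A" "sgrp B" "A \<inter> B = {1}"
    and "\<And>g. g \<in> J \<Longrightarrow> \<exists>a\<in>J \<inter> A. \<exists>b\<in>J \<inter> B. g = a * b"
  shows "fac A B J"
proof -
  have sJ: "sgrp (J \<inter> A)" "sgrp (J \<inter> B)" using assms by (auto simp: sgrp_Int)
  have "(J \<inter> A) \<inter> (J \<inter> B) = {1}" using assms(5) sgrpD(1) [OF J(1)] by blast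
  moreover have "J = (J \<inter> A) * (J \<inter> B)"
  proof
    show "J \<subseteq> (J \<inter> A) * (J \<inter> B)" using assms(6) by (auto simp: mem_mult_iff)
    show "(J \<inter> A) * (J \<inter> B) \<subseteq> J" using J(1) by (auto simp: mem_mult_iff sgrpD)
  qed
  ultimately show ?thesis using card_mult_Int [OF sJ] J by (simp add: fac_def)
qed

text \<open>Element form of computing a power in the quotient by \<open>F\<close>.\<close>

lemma normal_pow:
  assumes "normal_in F N" "sgrp N" "x \<in> N" "f \<in> F"
  shows "\<exists>f'\<in>F. (f * x) ^ n = f' * x ^ n"
proof (induction n)
  case 0
  then show ?case using normal_inD(1) [OF assms(1)] by (auto simp: sgrpD intro!: bexI [of _ 1])
next
  case (Suc n)
  then obtain f' where f': "f' \<in> F" "(f * x) ^ n = f' * x ^ n" by blast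
  have "cj (inverse x) f' \<in> F" using normal_inD(3) [OF assms(1)] assms(2,3) f'(1) by (simp add: sgrpD)
  moreover have "(f * x) ^ Suc n = (f * cj (inverse x) f') * x ^ Suc n"
    using f'(2) by (simp add: cj_def grp_simps)
  ultimately show ?case using assms(4) sgrpD(2) [OF normal_inD(1) [OF assms(1)]] by metis
qed

text \<open>Otherwise \<open>solv_normal_step\<close> yields a normal subgroup \<open>K\<close> of
  \<open>J\<close> inside \<open>C\<close> that is not central in \<open>C\<close> but whose
  commutators are. Such a \<open>K\<close> is nilpotent, and each of its Sylow subgroups is normal
  in \<open>J\<close> with order prime to one of the two factors, so it lies in one of the cores. As
  \<open>C\<close> centralises both cores, \<open>K\<close> is central after all.\<close>

lemma fac_bicentralizer_abelian:
  assumes J: "fac A B J" "finite J" "solv J" and A: "sgrp A" "finite A" and B: "sgrp B" "finite B"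
    and cop: "coprime (card A) (card B)"
    and C: "C = cizer J (core J A) \<inter> cizer J (core J B)"
    and xy: "x \<in> C" "y \<in> C"
  shows "x * y = y * x"
proof (rule ccontr)
  assume "x * y \<noteq> y * x"
  have sJ: "sgrp J" using J(1) by (simp add: fac_def)
  have Cn: "normal_in C J"
    unfolding C using core_normal normal_in_cizer normal_in_Int sJ A(1) B(1) by metis
  note C' = normal_inD [OF Cn]
  let ?Z = "center C"
  have Z: "sgrp ?Z" by (rule sgrp_cizer [OF C'(1)])
  have "\<not> C \<subseteq> ?Z" using xy \<open>x * y \<noteq> y * x\<close> by (auto simp: cizer_def)
  then obtain K where K: "normal_in K J" "K \<subseteq> C" "\<not> K \<subseteq> ?Z"
    and com: "\<And>x y. x \<in> K \<Longrightarrow> y \<in> K \<Longrightarrow> inverse x * cj y x \<in> ?Z"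
    using solv_normal_step [OF sJ J(2,3) Cn Z] by metis
  note K' = normal_inD [OF K(1)]
  have finK: "finite K" by (rule finite_subset [OF K'(2) J(2)])
  have nilpK: "nilp K"
    \<comment> \<open>The commutator \<open>c\<close> is central in \<open>C\<close>. Comparing
      powers of \<open>x\<close> and of \<open>y\<close> with those of their conjugates shows that
      \<open>c\<close> is killed by a power of \<open>p\<close> and by a power of
      \<open>q\<close>.\<close>
    unfolding nilp_def
  proof (intro ballI allI impI)
    fix x y p q assume x: "x \<in> K" and y: "y \<in> K" and p: "prime p" "prime q" "p \<noteq> q" and pel: "pel p x" "pel q y"
    define c where "c = inverse x * cj y x"
    have cZ: "c \<in> ?Z" unfolding c_def by (rule com [OF x y])
    have cx: "c * x = x * c" and cy: "c * y = y * c"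
      using cZ x y K(2) by (auto simp: cizer_def)
    obtain i j where ij: "x ^ (p ^ i) = 1" "y ^ (q ^ j) = 1" using pel by (auto simp: pel_def)
    have "x * c = cj y x" by (simp add: c_def grp_simps)
    then have "(x * c) ^ (p ^ i) = 1" using ij(1) by (simp add: cj_pow [symmetric])
    then have c1: "c ^ (p ^ i) = 1" using power_mult_commuting [OF cx [symmetric]] ij(1) by simp
    have "c * cj x y = (inverse x * inverse y * x * y) * (inverse x * y * x)" by (simp add: c_def cj_def grp_simps)
    have xy: "x * y = y * x * c" by (simp add: c_def cj_def grp_simps)
    have "cj x y * c = y"
    proof -
      have "x * (cj x y * c) = x * y" unfolding xy by (simp add: cj_def grp_simps)
      then show ?thesis by (simp only: mult_left_cancel_grp)
    qed
    moreover have "c * cj x y = cj x y * c"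
      using cZ x y K(2) K'(1) by (auto simp: cizer_def sgrp_cj_mem subset_iff)
    ultimately have "y ^ (q ^ j) = cj x y ^ (q ^ j) * c ^ (q ^ j)"
      using power_mult_commuting [of "cj x y" c "q ^ j"] by simp
    then have c2: "c ^ (q ^ j) = 1" using ij(2) by (simp add: cj_pow [symmetric])
    have "coprime (p ^ i) (q ^ j)" using p by (simp add: primes_coprime)
    then have "c = 1" using pow_coprime_one c1 c2 by blast
    then show "x * y = y * x" using xy by simp
  qed
  have "K \<subseteq> ?Z"
  proof (rule sgrp_prime_power_gen [OF Z K'(1) finK])
    fix t z assume t: "prime t" "z \<in> K" "pel t z"
    let ?R = "ppart K t"
    have R: "normal_in ?R J" by (rule normal_in_ppart [OF K(1) finK nilpK t(1)])
    have cR: "card ?R = t ^ multiplicity t (card K)" by (rule card_ppart [OF K'(1) finK nilpK t(1)])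
    have "?R \<subseteq> core J A \<or> ?R \<subseteq> core J B"
    proof (cases "t dvd card B")
      case True
      then have "\<not> t dvd card A" using coprime_prime_not_dvd [OF cop t(1)] by blast
      then have "coprime (card ?R) (card A)" unfolding cR using t(1) by (simp add: prime_imp_coprime)
      then have "?R \<subseteq> B"
        using fac_normal_sub [of B A J ?R] J(1,2) A B R by (simp add: fac_commute)
      then show ?thesis using core_greatest [OF R] by blast
    next
      case False
      then have "coprime (card ?R) (card B)" unfolding cR using t(1) by (simp add: prime_imp_coprime)
      then have "?R \<subseteq> A" using fac_normal_sub [OF J(1,2) A(1) B R] by blast
      then show ?thesis using core_greatest [OF R] by blast
    qed
    moreover have z: "z \<in> ?R" "z \<in> C" using t K(2) by (auto simp: ppart_def)
    ultimately have "\<forall>c\<in>C. c * z = z * c" unfolding C by (auto simp: cizer_def)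
    then show "z \<in> ?Z" using z(2) by (simp add: cizer_def)
  qed
  with K(3) show False by simp
qed

text \<open>In the abelian group \<open>C\<close> the elements killed by \<open>card A\<close> form
  a subgroup. It is normal in \<open>J\<close> with order prime to \<open>card B\<close>, hence lies
  in \<open>core J A\<close>; likewise for \<open>B\<close>. The two parts of \<open>e\<close> are
  powers of it belonging to the coprime orders.\<close>

lemma fac_bicentralizer_split:
  assumes J: "fac A B J" "finite J" "solv J" and A: "sgrp A" "finite A" and B: "sgrp B" "finite B"
    and cop: "coprime (card A) (card B)"
    and e: "e \<in> cizer J (core J A)" "e \<in> cizer J (core J B)"
  obtains eA eB i j where "eA \<in> core J A" "eB \<in> core J B" "e = eA * eB" "eA = e ^ i" "eB = e ^ j"
proof -
  define C where "C = cizer J (core J A) \<inter> cizer J (core J B)"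
  have ab: "\<And>x y. x \<in> C \<Longrightarrow> y \<in> C \<Longrightarrow> x * y = y * x"
    using fac_bicentralizer_abelian [OF J A B cop C_def] by blast
  have sJ: "sgrp J" using J(1) by (simp add: fac_def)
  have Cn: "normal_in C J"
    unfolding C_def using core_normal normal_in_cizer normal_in_Int sJ A(1) B(1) by metis
  note C' = normal_inD [OF Cn]
  have eC: "e \<in> C" using e by (simp add: C_def)
  have sub: "{c \<in> C. c ^ card A' = 1} \<subseteq> core J A'"
    if fac: "fac A' B' J" and s: "sgrp A'" "finite A'" "sgrp B'" "finite B'" and cop': "coprime (card A') (card B')"
    for A' B'
  proof -
    let ?R = "{c \<in> C. c ^ card A' = 1}"
    have "sgrp ?R"
    proof (rule sgrp_finite_closed)
      show "finite ?R" by (rule finite_subset [OF _ J(2)]) (use C'(2) in auto)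
      show "?R \<noteq> {}" using sgrpD(1) [OF C'(1)] by auto
      show "x * y \<in> ?R" if "x \<in> ?R" "y \<in> ?R" for x y
        using that power_mult_commuting [OF ab, of x y "card A'"] C'(1) by (auto simp: sgrpD)
    qed
    then have R: "normal_in ?R J"
      using C' by (auto simp: normal_in_def cj_pow [symmetric])
    have "coprime (card ?R) (card B')"
    proof (rule coprime_nat_primeI)
      fix p assume p: "prime p" "p dvd card ?R" "p dvd card B'"
      have "finite ?R" by (rule finite_subset [OF normal_inD(2) [OF R] J(2)])
      then obtain x where x: "x \<in> ?R" "pel p x" "x \<noteq> 1"
        using exists_pel [OF \<open>sgrp ?R\<close> _ p(1,2)] by metis
      moreover have "\<not> p dvd card A'" using coprime_prime_not_dvd [OF cop' p(1,3)] .
      ultimately show False using pel_imp_one [OF p(1)] by blast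
    qed
    then have "?R \<subseteq> A'" using fac_normal_sub [OF fac J(2) s(1,3,4) R] by blast
    then show ?thesis by (rule core_greatest [OF R])
  qed
  have "card J dvd card A * card B"
    using J(1) card_dvd_sgrp [OF A(1) sgrp_Int [OF sJ A(1)] _ A(2)] card_dvd_sgrp [OF B(1) sgrp_Int [OF sJ B(1)] _ B(2)]
    by (simp add: fac_def mult_dvd_mono)
  moreover have "e ^ card J = 1" using pow_card_eq_one [OF sJ] eC C'(2) by blast
  ultimately have "e ^ (card A * card B) = 1" by (rule pow_dvd_one [rotated])
  then obtain i j where ij: "e = e ^ i * e ^ j" "(e ^ i) ^ card A = 1" "(e ^ j) ^ card B = 1"
    using pow_split [OF _ cop] by metis
  have "e ^ i \<in> core J A" using sub [OF J(1) A B cop] ij(2) sgrp_pow [OF C'(1) eC] by blast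
  moreover have "e ^ j \<in> core J B"
    using sub [of B A] J(1) A B cop ij(3) sgrp_pow [OF C'(1) eC] by (auto simp: fac_commute coprime_commute)
  ultimately show ?thesis using that ij(1) by blast
qed

lemma inverse_pow_grp: "inverse x ^ n = inverse (x ^ n :: 'a::grp)"
proof (induction n)
  case (Suc n)
  have "inverse x ^ Suc n = inverse x ^ n * inverse x" by (simp only: power_Suc2)
  then show ?case using Suc by (simp add: inverse_mult_grp)
qed (simp add: inverse_one_grp)

lemma nilp_coprime_comm:
  assumes B: "sgrp B" "finite B" "nilp B" and b: "b \<in> B" "prime t" "pel t b"
    and x: "x \<in> B" "x ^ m = 1" "m > 0" "\<not> t dvd m"
  shows "x * b = b * x"
proof -
  have "x \<in> cizer B {b}"
  proof (rule prime_power_gen [OF sgrp_cizer [OF B(1)] x(3,2)])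
    fix p i assume p: "prime p" "pel p (x ^ i)"
    have xi: "x ^ i \<in> B" by (rule sgrp_pow [OF B(1) x(1)])
    show "x ^ i \<in> cizer B {b}"
    proof (cases "p = t")
      case True
      have "(x ^ i) ^ m = 1" using x(2) by (metis mult.commute power_mult power_one)
      then have "x ^ i = 1" using pel_imp_one [OF p] x(4) True by blast
      then show ?thesis using sgrpD(1) [OF B(1)] by (simp add: cizer_def)
    next
      case False
      then show ?thesis using nilpD [OF B(3) xi b(1) p(1) b(2)] p(2) b(3) xi by (simp add: cizer_def)
    qed
  qed
  then show ?thesis by (simp add: cizer_def)
qed

text \<open>The commutator is a product of conjugates of \<open>y\<close> or its inverse, and also
  one of conjugates of \<open>b\<close> or its inverse, so it centralises both cores and splits. For
  the orders, modulo \<open>core J B\<close> the conjugate \<open>cj b y\<close> equals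
  \<open>y * eA\<close> with commuting factors. So \<open>y ^ n = 1\<close> puts
  \<open>eA ^ n\<close> into \<open>A \<inter> B\<close>; the argument for \<open>eB\<close> is
  symmetric.\<close>

lemma fac_commutator_split:
  assumes J: "fac A B J" "finite J" "solv J" and A: "sgrp A" "finite A" and B: "sgrp B" "finite B"
    and cop: "coprime (card A) (card B)"
    and y: "y \<in> cizer J (core J A)" and b: "b \<in> cizer J (core J B)"
  obtains eA eB where "eA \<in> core J A" "eB \<in> core J B" "inverse y * cj b y = eA * eB"
    "\<And>n. y ^ n = 1 \<Longrightarrow> eA ^ n = 1" "\<And>n. b ^ n = 1 \<Longrightarrow> eB ^ n = 1"
proof -
  have sJ: "sgrp J" using J(1) by (simp add: fac_def)
  have nA: "normal_in (core J A) J" and nB: "normal_in (core J B) J"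
    using core_normal sJ A B by auto
  note cA = normal_inD [OF normal_in_cizer [OF nA sJ]] and cB = normal_inD [OF normal_in_cizer [OF nB sJ]]
  have yJ: "y \<in> J" and bJ: "b \<in> J" using y b by (auto simp: cizer_def)
  let ?e = "inverse y * cj b y"
  have e2: "?e = cj y (inverse b) * b" by (simp add: cj_def grp_simps)
  have "?e \<in> cizer J (core J A)" using y bJ cA by (simp add: sgrpD)
  moreover have "?e \<in> cizer J (core J B)" unfolding e2 using b yJ cB by (simp add: sgrpD)
  ultimately obtain eA eB i j where e: "eA \<in> core J A" "eB \<in> core J B" "?e = eA * eB" "eA = ?e ^ i" "eB = ?e ^ j"
    using fac_bicentralizer_split [OF J A B cop] by metis
  have AB1: "x = 1" if "x \<in> A" "x \<in> B" for x
    using coprime_Int_trivial [OF A(1) B(1) A(2) B(2) cop] that by blast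
  have eJ: "eA \<in> J" "eA \<in> A" "eB \<in> J" "eB \<in> B" using e core_subset [OF sJ] by blast+
  have comm: "eA * eB = eB * eA" unfolding e(4,5) by (simp add: power_add [symmetric] add.commute)
  show ?thesis
  proof (rule that [OF e(1-3)])
    fix n assume n: "y ^ n = 1"
    define x where "x = y * eA"
    have xJ: "x \<in> J" using yJ eJ sJ by (simp add: x_def sgrpD)
    have "cj (inverse x) eB \<in> core J B" using nB e(2) xJ sJ by (simp add: normal_inD sgrpD)
    then obtain f where f: "f \<in> core J B" "(cj (inverse x) eB * x) ^ n = f * x ^ n"
      using normal_pow [OF nB sJ xJ] by metis
    have "cj (inverse x) eB * x = cj b y"
    proof -
      have "cj b y = y * ?e" by (simp add: grp_simps)
      also have "\<dots> = cj (inverse x) eB * x" unfolding e(3) by (simp add: x_def cj_def grp_simps)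
      finally show ?thesis by simp
    qed
    then have "f * x ^ n = 1" using f(2) n by (simp add: cj_pow [symmetric])
    then have "inverse f = x ^ n" by (rule inverse_unique_grp)
    moreover have "y * eA = eA * y" using y e(1) by (simp add: cizer_def)
    then have "x ^ n = eA ^ n" using n by (simp add: x_def power_mult_commuting)
    ultimately have "eA ^ n \<in> B" using f(1) core_subset [OF sJ] B(1) by (metis IntD2 sgrpD(3) subsetD)
    moreover have "eA ^ n \<in> A" using eJ A(1) by (simp add: sgrp_pow)
    ultimately show "eA ^ n = 1" using AB1 by blast
  next
    fix n assume n: "b ^ n = 1"
    define x where "x = eB * inverse b"
    have xJ: "x \<in> J" using bJ eJ sJ by (simp add: x_def sgrpD)
    obtain f where f: "f \<in> core J A" "(eA * x) ^ n = f * x ^ n"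
      using normal_pow [OF nA sJ xJ e(1)] by metis
    have "eA * x = cj y (inverse b)"
    proof -
      have "eA * x = ?e * inverse b" unfolding e(3) by (simp add: x_def grp_simps)
      then show ?thesis unfolding e2 by (simp add: grp_simps)
    qed
    then have "f * x ^ n = 1" using f(2) n by (simp add: cj_pow [symmetric] inverse_pow_grp inverse_one_grp)
    then have "inverse f = x ^ n" by (rule inverse_unique_grp)
    moreover have "b * eB = eB * b" using b e(2) by (simp add: cizer_def)
    then have "inverse b * eB = eB * inverse b"
      by (metis cj_fix_iff cj_image_fix_inverse cj_inv_cancel(1))
    then have "x ^ n = eB ^ n" using n by (simp add: x_def power_mult_commuting inverse_pow_grp inverse_one_grp)
    ultimately have "eB ^ n \<in> A" using f(1) core_subset [OF sJ] A(1) by (metis IntD2 sgrpD(3) subsetD)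
    moreover have "eB ^ n \<in> B" using eJ B(1) by (simp add: sgrp_pow)
    ultimately show "eB ^ n = 1" using AB1 by blast
  qed
qed

subsection \<open>Products of nilpotent groups of coprime order\<close>

text \<open>What remains of a minimal counterexample after Burnside's theorem; refuted by
  \<open>impossible\<close>. Solvability is assumed for every proper factorised subgroup, since
  normalizers containing neither factor occur. The parameter of \<open>two_primes_A\<close> need not
  be prime, and the value \<open>0\<close> just says that \<open>A\<close> is not trivial.\<close>

locale wielandt =
  fixes G A B :: "'a::grp set"
  assumes sG: "sgrp G" and fG: "finite G"
    and sA: "sgrp A" and AG: "A \<subseteq> G" and sB: "sgrp B" and BG: "B \<subseteq> G"
    and nA: "nilp A" and nB: "nilp B"
    and cop: "coprime (card A) (card B)"
    and facG: "fac A B G"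
    and simple: "\<And>N. normal_in N G \<Longrightarrow> N = {1} \<or> N = G"
    and solvJ: "\<And>J. fac A B J \<Longrightarrow> J \<subseteq> G \<Longrightarrow> J \<noteq> G \<Longrightarrow> solv J"
    and two_primes_A: "\<And>p. \<exists>q. prime q \<and> q \<noteq> p \<and> q dvd card A"
    and two_primes_B: "\<And>p. \<exists>q. prime q \<and> q \<noteq> p \<and> q dvd card B"
begin

lemma swap: "wielandt G B A"
  by unfold_locales
    (use sG fG sA AG sB BG nA nB cop facG simple solvJ two_primes_A two_primes_B in
      \<open>auto simp: fac_commute [of B A] coprime_commute\<close>)

lemma fA: "finite A" and fB: "finite B"
  using AG BG fG finite_subset by auto

lemma AB1: "x \<in> A \<Longrightarrow> x \<in> B \<Longrightarrow> x = 1"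
  using coprime_Int_trivial [OF sA sB fA fB cop] by blast

lemma decompose: "g \<in> G \<Longrightarrow> \<exists>a\<in>A. \<exists>b\<in>B. g = a * b"
  using fac_elem [OF facG fG sA sB fA fB cop] by metis

lemma fac_superset:
  assumes "sgrp H" "A \<subseteq> H" "H \<subseteq> G"
  shows "fac A B H"
proof (rule facI [OF assms(1) finite_subset [OF assms(3) fG] sA sB])
  show "A \<inter> B = {1}" by (rule coprime_Int_trivial [OF sA sB fA fB cop])
  fix g assume g: "g \<in> H"
  then obtain a b where ab: "a \<in> A" "b \<in> B" "g = a * b" using decompose assms(3) by blast
  then have "b \<in> H" using g assms(1,2) sgrp_mult_left_iff by blast
  then show "\<exists>a\<in>H \<inter> A. \<exists>b\<in>H \<inter> B. g = a * b" using ab assms(2) by blast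
qed

lemma B_proper: "B \<noteq> G"
proof
  assume "B = G"
  then have "A = {1}" using AG AB1 sgrpD(1) [OF sA] by auto
  then show False using two_primes_A [of 0] by auto
qed

lemma A_proper: "A \<noteq> G"
  using wielandt.B_proper [OF swap] .

lemma proper_core_trivial:
  assumes "sgrp H" "H \<subseteq> G" "H \<noteq> G"
  shows "core G H = {1}"
proof -
  have "core G H \<subseteq> H" using core_subset [OF sG] by blast
  then show ?thesis using simple [OF core_normal [OF sG assms(1)]] assms(2,3) by auto
qed

text \<open>As \<open>G = B A\<close> and \<open>b\<close> is central in \<open>B\<close>, all
  conjugates of \<open>b\<close> are conjugates under \<open>A\<close>, and these stay inside
  \<open>H\<close>. So \<open>b\<close> lies in the core of a proper subgroup of a simple
  group.\<close>

lemma center_elem_proper: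
  assumes "sgrp H" "H \<subseteq> G" "H \<noteq> G" "A \<subseteq> H" "b \<in> H" "b \<in> center B"
  shows "b = 1"
proof -
  have "cj g b \<in> H" if "g \<in> G" for g
  proof -
    obtain b' a where g: "b' \<in> B" "a \<in> A" "g = b' * a"
      using wielandt.decompose [OF swap \<open>g \<in> G\<close>] by blast
    have "cj b' b = b" using assms(6) g(1) by (auto simp: cizer_def cj_fix_iff)
    then have "cj g b = cj a b" using g(3) by (metis cj_cj)
    then show ?thesis using g(2) assms(1,4,5) by (simp add: sgrp_cj_mem subset_iff)
  qed
  then have "b \<in> core G H" using assms(2) by (auto simp: core_def)
  then show ?thesis using proper_core_trivial [OF assms(1-3)] by simp
qed

text \<open>As \<open>G = A B\<close>, an \<open>A\<close>-invariant subset of \<open>B\<close> has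
  all its conjugates in \<open>B\<close>, so it lies in the trivial core.\<close>

lemma invariant_sub_trivial:
  assumes "Y \<subseteq> B" "\<And>a y. a \<in> A \<Longrightarrow> y \<in> Y \<Longrightarrow> cj a y \<in> Y" "y \<in> Y"
  shows "y = 1"
proof -
  have "cj g y \<in> B" if "g \<in> G" for g
  proof -
    obtain a b where g: "a \<in> A" "b \<in> B" "g = a * b" using decompose \<open>g \<in> G\<close> by blast
    have "cj a y \<in> B" using assms g(1) by blast
    then show ?thesis using g(2) sgrp_cj_mem [OF sB g(2)] by (simp add: g(3) cj_cj [symmetric])
  qed
  then have "y \<in> core G B" using BG by (auto simp: core_def)
  then show ?thesis using proper_core_trivial [OF sB BG B_proper] by simp
qed

lemma cizer_proper:
  assumes "y \<in> A" "y \<noteq> 1"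
  shows "cizer G {y} \<noteq> G"
proof
  assume *: "cizer G {y} = G"
  have "cj g y = y" if "g \<in> G" for g
  proof -
    have "g \<in> cizer G {y}" using that * by simp
    then show ?thesis by (simp add: cizer_iff_cj)
  qed
  then have "y \<in> core G A" using assms(1) AG by (auto simp: core_def)
  then show False using proper_core_trivial [OF sA AG A_proper] assms(2) by simp
qed

lemma ppart_gen_A:
  assumes "sgrp H" "\<And>p. prime p \<Longrightarrow> ppart A p \<subseteq> H"
  shows "A \<subseteq> H"
  by (rule sgrp_prime_power_gen [OF assms(1) sA fA]) (use assms(2) in \<open>auto simp: ppart_def\<close>)

lemma exists_center:
  assumes "prime p" "p dvd card A"
  obtains z where "z \<in> center A" "z \<noteq> 1" "pel p z" "z \<in> A"
  using nilp_center_elem [OF sA fA nA normal_in_self [OF sA] assms] by metis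

lemma sylow_ppart:
  assumes "prime p" "p dvd card A" "sgrp J" "ppart A p \<subseteq> J" "J \<subseteq> G"
  shows "sylow_sub p (ppart A p) J"
proof -
  have c: "card (ppart A p) = p ^ multiplicity p (card A)" by (rule card_ppart [OF sA fA nA assms(1)])
  have fJ: "finite J" using assms(5) fG finite_subset by blast
  have "card G = card A * card B" using facG AG BG by (simp add: fac_def Int_absorb1)
  moreover have "\<not> p dvd card B"
    using coprime_prime_not_dvd [of "card B" "card A" p] cop assms(1,2) by (simp add: coprime_commute)
  ultimately have "multiplicity p (card G) = multiplicity p (card A)"
    using assms(1) card_gt_0_sgrp [OF sA fA] card_gt_0_sgrp [OF sB fB]
    by (simp add: prime_elem_multiplicity_mult_distrib not_dvd_imp_multiplicity_0)
  moreover have "multiplicity p (card J) \<le> multiplicity p (card G)"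
    using card_dvd_sgrp [OF sG assms(3,5) fG] card_gt_0_sgrp [OF sG fG] by (intro dvd_imp_multiplicity_le) auto
  moreover have "p ^ multiplicity p (card A) dvd card J"
    using card_dvd_sgrp [OF assms(3) sgrp_ppart [OF sA fA nA assms(1)] assms(4) fJ] c by simp
  then have "multiplicity p (card A) \<le> multiplicity p (card J)"
    using card_gt_0_sgrp [OF assms(3) fJ] assms(1) by (intro multiplicity_geI) (auto simp: not_prime_unit)
  ultimately show ?thesis
    using assms(4) sgrp_ppart [OF sA fA nA assms(1)] c by (simp add: sylow_sub_def)
qed

text \<open>The witness is the normalizer of the \<open>p\<close>-part of \<open>core J A\<close>.
  It contains \<open>J\<close>, in particular the \<open>p\<close>-part of \<open>A\<close>, while
  the other parts of \<open>A\<close> centralise that group; simplicity makes it proper.\<close>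

lemma core_ppart_normalizer:
  assumes "fac A B J" "J \<subseteq> G" "prime p" "ppart A p \<subseteq> J" "ppart (core J A) p \<noteq> {1}"
  shows "\<exists>N. sgrp N \<and> N \<subseteq> G \<and> N \<noteq> G \<and> A \<subseteq> N \<and> J \<subseteq> N"
proof -
  have sJ: "sgrp J" using assms(1) by (simp add: fac_def)
  have cJ: "core J A \<subseteq> A" using core_subset [OF sJ] by blast
  let ?R = "ppart (core J A) p" and ?N = "nizer G (ppart (core J A) p)"
  have R: "normal_in ?R J"
    by (rule normal_in_ppart [OF core_normal [OF sJ sA] finite_subset [OF cJ fA] nilp_subset [OF nA cJ] assms(3)])
  have JN: "J \<subseteq> ?N" using normal_in_image [OF R sJ] assms(2) by (auto simp: nizer_def)
  have sN: "sgrp ?N" by (rule sgrp_nizer [OF sG])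
  have "A \<subseteq> ?N"
  proof (rule ppart_gen_A [OF sN])
    fix t :: nat assume t: "prime t"
    show "ppart A t \<subseteq> ?N"
    proof (cases "t = p")
      case True
      then show ?thesis using assms(4) JN by blast
    next
      case False
      show ?thesis
      proof
        fix x assume x: "x \<in> ppart A t"
        have "cj x r = r" if "r \<in> ?R" for r
          using nilpD [OF nA, of x r t p] x that cJ t assms(3) False by (auto simp: cj_fix_iff ppart_def)
        then show "x \<in> ?N" using x AG by (auto simp: nizer_def ppart_def)
      qed
    qed
  qed
  moreover have "?N \<noteq> G"
  proof
    assume "?N = G"
    then have "cj g ` ?R = ?R" if "g \<in> G" for g using that by (auto simp: nizer_def)
    then have "normal_in ?R G"
      using normal_inD(1,2) [OF R] assms(2) unfolding normal_in_def by blast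
    then have "?R = G" using simple assms(5) by blast
    then show False using cJ AG A_proper ppart_subset by blast
  qed
  moreover have "?N \<subseteq> G" by (auto simp: nizer_def)
  ultimately show ?thesis using sN JN by blast
qed

text \<open>Let \<open>y\<close> and \<open>b\<close> be central elements of \<open>A\<close> and
  \<open>B\<close> in these Sylow subgroups. A non-trivial \<open>p\<close>-part of
  \<open>core J A\<close> would place \<open>A\<close> and \<open>b\<close> in a proper subgroup,
  against \<open>center_elem_proper\<close>, and symmetrically for \<open>B\<close>. So the split
  commutator of \<open>y\<close> and \<open>b\<close> is trivial, and \<open>cizer G {y}\<close> is
  a proper subgroup containing \<open>A\<close> and \<open>b\<close>, which is again
  excluded.\<close>

lemma no_two_sylows:
  assumes "fac A B J" "J \<subseteq> G" "J \<noteq> G"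
    and p: "prime p" "p dvd card A" "ppart A p \<subseteq> J" and s: "prime s" "s dvd card B" "ppart B s \<subseteq> J"
  shows False
proof -
  interpret S: wielandt G B A by (rule swap)
  have sJ: "sgrp J" using assms(1) by (simp add: fac_def)
  obtain y where y: "y \<in> center A" "y \<noteq> 1" "pel p y" "y \<in> A" using exists_center [OF p(1,2)] .
  obtain b where b: "b \<in> center B" "b \<noteq> 1" "pel s b" "b \<in> B" using S.exists_center [OF s(1,2)] .
  have yJ: "y \<in> J" using y p(3) by (auto simp: ppart_def)
  have bJ: "b \<in> J" using b s(3) by (auto simp: ppart_def)
  have pA: "ppart (core J A) p = {1}"
    using core_ppart_normalizer [OF assms(1,2) p(1,3)] center_elem_proper b(1,2) bJ by blast
  have sB': "ppart (core J B) s = {1}"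
    using S.core_ppart_normalizer [OF _ assms(2) s(1,3)] S.center_elem_proper y(1,2) yJ assms(1)
    by (metis fac_commute subsetD)
  have "y \<in> cizer J (core J A)" using y yJ core_subset [OF sJ, of A] by (auto simp: cizer_def)
  moreover have "b \<in> cizer J (core J B)" using b bJ core_subset [OF sJ, of B] by (auto simp: cizer_def)
  ultimately obtain eA eB where e: "eA \<in> core J A" "eB \<in> core J B" "inverse y * cj b y = eA * eB"
    "\<And>n. y ^ n = 1 \<Longrightarrow> eA ^ n = 1" "\<And>n. b ^ n = 1 \<Longrightarrow> eB ^ n = 1"
    using fac_commutator_split [OF assms(1) finite_subset [OF assms(2) fG] solvJ [OF assms(1-3)] sA fA sB fB cop]
    by metis
  have "pel p eA" "pel s eB" using e(4,5) y(3) b(3) by (auto simp: pel_def)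
  then have "eA = 1" "eB = 1" using pA sB' e(1,2) by (auto simp: ppart_def)
  then have "y * (inverse y * cj b y) = y" using e(3) by simp
  then have "b * y = y * b" by (simp add: grp_simps cj_fix_iff)
  then have "b \<in> cizer G {y}" using bJ assms(2) by (auto simp: cizer_def)
  moreover have "A \<subseteq> cizer G {y}" using y(1) AG by (auto simp: cizer_def)
  moreover have "cizer G {y} \<noteq> G" by (rule cizer_proper [OF y(4,2)])
  ultimately show False
    using center_elem_proper [OF sgrp_cizer [OF sG], of "{y}" b] b by (auto simp: cizer_def)
qed

end

lemma cj_image_finite_eq: "finite X \<Longrightarrow> cj g ` X \<subseteq> X \<Longrightarrow> cj g ` X = X"
  by (rule card_subset_eq) auto

lemma cizer_subset: "cizer G X \<subseteq> G"
  by (auto simp: cizer_def)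

lemma nizer_subset: "nizer G X \<subseteq> G"
  by (auto simp: nizer_def)

section \<open>Centralizers of central elements of a factor\<close>

context wielandt
begin

lemma nizer_proper:
  assumes "sgrp T" "T \<subseteq> B" "T \<noteq> {1}"
  shows "nizer G T \<noteq> G"
proof
  assume *: "nizer G T = G"
  have "cj g ` T = T" if "g \<in> G" for g using that * by (auto simp: nizer_def)
  then have "normal_in T G" using assms BG unfolding normal_in_def by blast
  then have "T = G" using simple assms(3) by blast
  then show False using assms(2) BG B_proper by blast
qed

lemma A_sub_nizer: "prime p \<Longrightarrow> A \<subseteq> nizer G (ppart A p)"
  using normal_in_image [OF normal_in_ppart [OF normal_in_self [OF sA] fA nA] sA] AG
  by (auto simp: nizer_def)

lemma ppart_sub_nizer:
  assumes "T \<subseteq> B" "\<And>t. t \<in> T \<Longrightarrow> pel q t" "prime q" "prime r" "r \<noteq> q"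
  shows "ppart B r \<subseteq> nizer G T"
proof
  fix x assume x: "x \<in> ppart B r"
  have "cj x t = t" if "t \<in> T" for t
    using nilpD [OF nB, of x t r q] x assms that by (auto simp: ppart_def cj_fix_iff)
  then show "x \<in> nizer G T" using x BG by (auto simp: nizer_def ppart_def)
qed

lemma ppart_eq_one:
  assumes "sgrp T" "finite T" "T \<noteq> {1}"
  obtains q where "prime q" "ppart T q \<noteq> {1}"
proof -
  have "\<not> T \<subseteq> {1}" using assms(1,3) sgrpD(1) by blast
  then obtain q x where "prime q" "x \<in> T" "pel q x" "x \<noteq> 1"
    using sgrp_prime_power_gen [OF sgrp_one assms(1,2)] by blast
  then show ?thesis using that by (auto simp: ppart_def)
qed

text \<open>The normalizer of the \<open>q\<close>-part \<open>?T\<close> of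
  \<open>cizer B {a}\<close> factorises, and its core in \<open>B\<close> is a
  \<open>q\<close>-group, which \<open>b\<close> centralises. Splitting the commutator of
  \<open>a\<close> and \<open>b\<close> leaves an \<open>r\<close>-element in that core, so only the
  part in \<open>A\<close> survives.\<close>

lemma conj_center_elem:
  assumes a: "a \<in> center A" "a \<in> A" "a \<noteq> 1"
    and q: "prime q" "ppart (cizer B {a}) q \<noteq> {1}" and b: "prime r" "r \<noteq> q" "b \<in> B" "pel r b"
  shows "cj b a \<in> A"
proof -
  interpret S: wielandt G B A by (rule swap)
  let ?V = "cizer B {a}" let ?T = "ppart ?V q" let ?N = "nizer G ?T"
  have V: "sgrp ?V" "?V \<subseteq> B" by (rule sgrp_cizer [OF sB], rule cizer_subset)
  have fV: "finite ?V" "nilp ?V" using V(2) fB nB finite_subset nilp_subset by auto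
  have T: "sgrp ?T" "?T \<subseteq> B" "finite ?T"
    using sgrp_ppart [OF V(1) fV q(1)] V(2) fV(1) by (auto simp: ppart_def)
  have N: "sgrp ?N" "?N \<subseteq> G" "?N \<noteq> G"
    using sgrp_nizer [OF sG] nizer_proper [OF T(1,2) q(2)] by (auto simp: nizer_def)
  have comm_a: "cj x a = a" if "x \<in> A" for x using a(1) that by (auto simp: cizer_def cj_fix_iff)
  \<comment> \<open>For \<open>g = x * y\<close> normalising \<open>?T\<close>, the conjugate
    \<open>cj x t\<close> lies in \<open>B\<close> because \<open>cj g t\<close> does, and it still
    commutes with \<open>a\<close> because \<open>x\<close> does. So \<open>x\<close> normalises
    \<open>?T\<close>, and therefore so does \<open>y\<close>.\<close>
  have facN: "fac A B ?N"
  proof (rule facI [OF N(1) finite_subset [OF N(2) fG] sA sB])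
    show "A \<inter> B = {1}" by (rule coprime_Int_trivial [OF sA sB fA fB cop])
    fix g assume g: "g \<in> ?N"
    then obtain x y where xy: "x \<in> A" "y \<in> B" "g = x * y" using decompose N(2) by blast
    have gT: "cj g ` ?T = ?T" using g by (auto simp: nizer_def)
    have "cj x t \<in> ?T" if t: "t \<in> ?T" for t
    proof -
      have "cj g t \<in> B" using gT t T(2) by blast
      moreover have "cj x t = cj (inverse y) (cj g t)" unfolding xy(3) by (simp add: cj_cj grp_simps)
      ultimately have "cj x t \<in> B" using xy(2) sB by (simp add: sgrp_cj_mem sgrpD)
      moreover have "cj x t * a = a * cj x t"
      proof -
        have "t * a = a * t" using t by (auto simp: ppart_def cizer_def)
        then have "cj x (t * a) = cj x (a * t)" by simp
        then show ?thesis using comm_a [OF xy(1)] by (simp add: cj_mult)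
      qed
      ultimately show ?thesis using t by (simp add: ppart_def cizer_def)
    qed
    then have "cj x ` ?T = ?T" using T(3) by (intro cj_image_finite_eq) auto
    then have "x \<in> ?N" using xy(1) AG by (auto simp: nizer_def)
    moreover from this have "y \<in> ?N" using g N(1) xy(3) sgrp_mult_left_iff by blast
    ultimately show "\<exists>x\<in>?N \<inter> A. \<exists>y\<in>?N \<inter> B. g = x * y" using xy by blast
  qed
  have aN: "a \<in> ?N"
  proof -
    have "cj a t = t" if "t \<in> ?T" for t using that by (auto simp: ppart_def cizer_def cj_fix_iff)
    then show ?thesis using a(2) AG by (auto simp: nizer_def)
  qed
  \<comment> \<open>Otherwise a proper subgroup would contain \<open>B\<close>, \<open>?N\<close>
    and hence \<open>a\<close>, which is central in \<open>A\<close>; the mirror image of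
    \<open>center_elem_proper\<close> forbids this.\<close>
  have rest: "ppart (core ?N B) s = {1}" if s: "prime s" "s \<noteq> q" for s
  proof (rule ccontr)
    assume "ppart (core ?N B) s \<noteq> {1}"
    moreover have "ppart B s \<subseteq> ?N"
      by (rule ppart_sub_nizer [OF T(2) _ q(1) s]) (auto simp: ppart_def)
    ultimately obtain N' where "sgrp N'" "N' \<subseteq> G" "N' \<noteq> G" "B \<subseteq> N'" "?N \<subseteq> N'"
      using S.core_ppart_normalizer [of ?N s] facN N(2) s(1) by (auto simp: fac_commute)
    then show False using S.center_elem_proper [of N' a] aN a by blast
  qed
  have cN: "core ?N B \<subseteq> ?N \<inter> B" by (rule core_subset [OF N(1)])
  have "core ?N B \<subseteq> cizer (core ?N B) {b}"
  proof (rule sgrp_prime_power_gen)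
    show "sgrp (core ?N B)" by (rule normal_inD(1) [OF core_normal [OF N(1) sB]])
    then show "sgrp (cizer (core ?N B) {b})" by (rule sgrp_cizer)
    show "finite (core ?N B)" using cN fB finite_subset by blast
    fix s x assume s: "prime s" "x \<in> core ?N B" "pel s x"
    show "x \<in> cizer (core ?N B) {b}"
    proof (cases "s = q")
      case True
      then show ?thesis using nilpD [OF nB, of x b q r] s b cN q(1) by (auto simp: cizer_def)
    next
      case False
      then have "x = 1" using rest [OF s(1)] s by (auto simp: ppart_def)
      then show ?thesis using s(2) by (simp add: cizer_def)
    qed
  qed
  moreover have bN: "b \<in> ?N"
    using ppart_sub_nizer [OF T(2) _ q(1) b(1,2)] b by (auto simp: ppart_def)
  ultimately have "b \<in> cizer ?N (core ?N B)" by (auto simp: cizer_def)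
  moreover have "a \<in> cizer ?N (core ?N A)" using a(1) aN core_subset [OF N(1), of A] by (auto simp: cizer_def)
  ultimately obtain eA eB where e: "eA \<in> core ?N A" "eB \<in> core ?N B" "inverse a * cj b a = eA * eB"
    "\<And>n. b ^ n = 1 \<Longrightarrow> eB ^ n = 1"
    using fac_commutator_split [OF facN finite_subset [OF N(2) fG] solvJ [OF facN N(2,3)] sA fA sB fB cop]
    by metis
  have "pel r eB" using e(4) b(4) by (auto simp: pel_def)
  then have "eB = 1" using rest [OF b(1,2)] e(2) by (auto simp: ppart_def)
  then have "a * (inverse a * cj b a) = a * eA" using e(3) by simp
  then have "cj b a = a * eA" by (simp add: grp_simps)
  moreover have "eA \<in> A" using e(1) core_subset [OF N(1)] by blast
  ultimately show ?thesis using a(2) sA by (simp add: sgrpD)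
qed

lemma centralizer_times_normalizer:
  assumes a: "a \<in> center A" "a \<in> A" "prime p" "pel p a" and b: "b \<in> B" "cj b a \<in> A"
    and p2: "prime p2" "p2 \<noteq> p" "p2 dvd card A"
  shows "\<exists>v\<in>cizer B {a}. v * b \<in> nizer G (ppart A p2)"
proof -
  interpret S: wielandt G B A by (rule swap)
  let ?P = "ppart A p2" let ?K = "cizer G {a}"
  have P: "sgrp ?P" "card ?P = p2 ^ multiplicity p2 (card A)" "finite ?P"
    using sgrp_ppart [OF sA fA nA p2(1)] card_ppart [OF sA fA nA p2(1)] fA by (auto simp: ppart_def)
  have K: "sgrp ?K" "?K \<subseteq> G" by (rule sgrp_cizer [OF sG], rule cizer_subset)
  have "A \<subseteq> ?K" using a(1) AG by (auto simp: cizer_def)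
  note K = K this
  have PK: "?P \<subseteq> ?K" using K(3) by (auto simp: ppart_def)
  have bG: "b \<in> G" using b(1) BG by blast
  let ?Q = "cj (inverse b) ` ?P"
  have "?Q \<subseteq> ?K"
  proof
    fix x assume "x \<in> ?Q"
    then obtain u where u: "u \<in> ?P" "x = cj (inverse b) u" by blast
    have "u * cj b a = cj b a * u"
      using nilpD [OF nA _ b(2) p2(1) a(3) p2(2)] u(1) a(4) by (auto simp: ppart_def)
    then have "cj (inverse b) (u * cj b a) = cj (inverse b) (cj b a * u)" by simp
    then have "x * a = a * x" unfolding u(2) by (simp add: cj_mult)
    moreover have "x \<in> G" using u bG AG sG by (auto simp: ppart_def sgrp_cj_mem sgrpD)
    ultimately show "x \<in> ?K" by (simp add: cizer_def)
  qed
  moreover have "card ?Q = p2 ^ multiplicity p2 (card A)" using P(2) by simp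
  ultimately obtain k where k: "k \<in> ?K" "cj k ` ?Q \<subseteq> ?P"
    using sylow_conj [OF K(1) finite_subset [OF K(2) fG] p2(1) sylow_ppart [OF p2(1,3) K(1) PK K(2)] sgrp_cj [OF P(1)]]
    by metis
  have "fac B A ?K" using fac_superset [OF K(1,3,2)] by (simp add: fac_commute)
  then obtain v x where vx: "v \<in> ?K" "v \<in> B" "x \<in> A" "k = v * x"
    using fac_elem [OF _ finite_subset [OF K(2) fG] sB sA fB fA _ k(1)] cop by (metis coprime_commute)
  have Px: "cj (inverse x) ` ?P = ?P"
    by (rule normal_in_image [OF normal_in_ppart [OF normal_in_self [OF sA] fA nA p2(1)] sA]) (use vx sA in \<open>simp add: sgrpD\<close>)
  have "cj (inverse x) ` cj k ` ?Q \<subseteq> cj (inverse x) ` ?P" using k(2) by (rule image_mono)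
  then have "cj (inverse b * v) ` ?P \<subseteq> ?P" unfolding Px by (simp add: cj_image_cj vx(4) grp_simps)
  then have "cj (inverse b * v) ` ?P = ?P" using P(3) by (rule cj_image_finite_eq [rotated])
  then have "inverse b * v \<in> nizer G ?P" using bG vx(2) BG sG by (auto simp: nizer_def sgrpD)
  then have "inverse (inverse b * v) \<in> nizer G ?P" using sgrp_nizer [OF sG] sgrpD(3) by blast
  then have "inverse v * b \<in> nizer G ?P" by (simp add: grp_simps)
  moreover have "inverse v \<in> cizer B {a}"
    using vx(1,2) sgrpD(3) [OF sgrp_cizer [OF sB, of "{a}"], of v] by (auto simp: cizer_def)
  ultimately show ?thesis by blast
qed

text \<open>Let \<open>?H\<close> be the normalizer of a Sylow subgroup of \<open>A\<close> for a
  prime other than \<open>p\<close>. If \<open>?V\<close> involves one prime \<open>q\<close>, then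
  \<open>?H\<close> contains \<open>A\<close> and a Sylow subgroup of \<open>B\<close>, against
  \<open>no_two_sylows\<close>. If it involves two primes, \<open>key\<close> applies to elements of
  \<open>B\<close> of any prime power order, and all conjugates of \<open>a\<close> end up in
  \<open>?H\<close>.\<close>

lemma centralizer_center_trivial:
  assumes a: "a \<in> center A" "a \<in> A" "a \<noteq> 1" "prime p" "pel p a"
  shows "cizer B {a} = {1}"
proof (rule ccontr)
  let ?V = "cizer B {a}"
  assume V1: "?V \<noteq> {1}"
  interpret S: wielandt G B A by (rule swap)
  have V: "sgrp ?V" "?V \<subseteq> B" by (rule sgrp_cizer [OF sB], rule cizer_subset)
  have fV: "finite ?V" "nilp ?V" using V(2) fB nB finite_subset nilp_subset by auto
  obtain q where q: "prime q" "ppart ?V q \<noteq> {1}" using ppart_eq_one [OF V(1) fV(1) V1] .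
  obtain p2 where p2: "prime p2" "p2 \<noteq> p" "p2 dvd card A" using two_primes_A by blast
  let ?P = "ppart A p2" let ?H = "nizer G ?P"
  have P: "sgrp ?P" "?P \<subseteq> A" using sgrp_ppart [OF sA fA nA p2(1)] by (auto simp: ppart_def)
  have "?P \<noteq> {1}"
  proof -
    obtain z where "z \<in> A" "pel p2 z" "z \<noteq> 1" using exists_pel [OF sA fA p2(1,3)] .
    then show ?thesis by (auto simp: ppart_def)
  qed
  then have "?H \<noteq> G" by (rule S.nizer_proper [OF P])
  then have H: "sgrp ?H" "?H \<subseteq> G" "?H \<noteq> G" "A \<subseteq> ?H"
    using sgrp_nizer [OF sG] nizer_subset A_sub_nizer [OF p2(1)] by blast+
  have key: "\<exists>v\<in>?V. v * b \<in> ?H" if "prime t" "t \<noteq> s" "prime s" "ppart ?V s \<noteq> {1}" "b \<in> B" "pel t b" for s t b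
    using centralizer_times_normalizer [OF a(1,2,4,5) that(5) conj_center_elem [OF a(1-3) that(3,4,1,2,5,6)] p2] .
  show False
  proof (cases "\<exists>r. prime r \<and> r \<noteq> q \<and> ppart ?V r \<noteq> {1}")
    case False
    obtain r where r: "prime r" "r \<noteq> q" "r dvd card B" using two_primes_B by blast
    have Vq: "pel q v" if "v \<in> ?V" for v
    proof -
      have "?V \<subseteq> ppart ?V q"
      proof (rule sgrp_prime_power_gen [OF sgrp_ppart [OF V(1) fV q(1)] V(1) fV(1)])
        fix s x assume s: "prime s" "x \<in> ?V" "pel s x"
        show "x \<in> ppart ?V q"
        proof (cases "s = q")
          case False
          then have "x = 1" using \<open>\<not> (\<exists>r. _ r)\<close> s by (auto simp: ppart_def)
          then show ?thesis using s(2) by (simp add: ppart_def)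
        qed (use s in \<open>simp add: ppart_def\<close>)
      qed
      then show ?thesis using that by (auto simp: ppart_def)
    qed
    have "ppart B r \<subseteq> ?H"
    proof
      fix b assume "b \<in> ppart B r"
      then have b: "b \<in> B" "pel r b" by (auto simp: ppart_def)
      obtain v where v: "v \<in> ?V" "v * b \<in> ?H" using key [OF r(1,2) q b] by blast
      obtain i j where ij: "v ^ (q ^ i) = 1" "b ^ (r ^ j) = 1" using Vq [OF v(1)] b(2) by (auto simp: pel_def)
      \<comment> \<open>Since \<open>v\<close> and \<open>b\<close> commute and have coprime orders,
        \<open>b\<close> is a power of \<open>v * b\<close>.\<close>
      have "v * b = b * v" using nilpD [OF nB _ b(1) q(1) r(1) r(2) [symmetric] Vq [OF v(1)] b(2)] v(1) V(2) by blast
      then have "(v * b) ^ (q ^ i) = b ^ (q ^ i)" using ij(1) by (simp add: power_mult_commuting)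
      then have 1: "b ^ (q ^ i) \<in> ?H" using sgrp_pow [OF H(1) v(2)] by metis
      have "coprime (q ^ i) (r ^ j)" using q(1) r(1,2) by (simp add: primes_coprime)
      then obtain m where "[q ^ i * m = 1] (mod r ^ j)" using cong_solve_coprime_nat [of "q ^ i" "r ^ j"] by auto
      then have "b ^ (q ^ i * m) = b ^ 1" by (rule pow_cong [OF ij(2)])
      then show "b \<in> ?H" using sgrp_pow [OF H(1) 1, of m] by (simp add: power_mult)
    qed
    then show False
      using no_two_sylows [OF fac_superset [OF H(1,4,2)] H(2,3) p2(1,3) _ r(1,3)] H(4) P(2) by blast
  next
    case True
    then obtain r where r: "prime r" "r \<noteq> q" "ppart ?V r \<noteq> {1}" by blast
    have key2: "\<exists>v\<in>?V. v * b \<in> ?H" if "prime t" "b \<in> B" "pel t b" for t b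
      using key [OF that(1) _ q that(2,3)] key [OF that(1) _ r(1,3) that(2,3)] r(2) by metis
    \<comment> \<open>The goal is that every \<open>B\<close>-conjugate of \<open>a\<close> is
      already a conjugate under \<open>?H \<inter> B\<close>. Stability under elements of prime
      power order is enough for this.\<close>
    let ?Orb = "(\<lambda>w. cj w a) ` (?H \<inter> B)"
    have sHB: "sgrp (?H \<inter> B)" by (rule sgrp_Int [OF H(1) sB])
    have stable: "cj b x \<in> ?Orb" if t: "prime t" "b \<in> B" "pel t b" and "x \<in> ?Orb" for t b x
    proof -
      obtain w where w: "w \<in> ?H" "w \<in> B" "x = cj w a" using \<open>x \<in> ?Orb\<close> by blast
      have cB: "card B > 0" by (rule card_gt_0_sgrp [OF sB fB])
      obtain m where m: "card B = t ^ multiplicity t (card B) * m" "\<not> t dvd m"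
        using prime_decompose_nat [OF t(1) cB] .
      have "w ^ (t ^ multiplicity t (card B) * m) = 1" using pow_card_eq_one [OF sB w(2)] m(1) by simp
      moreover have "coprime (t ^ multiplicity t (card B)) m" using m(2) t(1) by (simp add: prime_imp_coprime)
      ultimately obtain i j where ij: "w = w ^ i * w ^ j" "(w ^ i) ^ (t ^ multiplicity t (card B)) = 1" "(w ^ j) ^ m = 1"
        by (rule pow_split)
      have wi: "w ^ i \<in> B" "w ^ i \<in> ?H" "w ^ j \<in> B" "w ^ j \<in> ?H"
        using w sgrp_pow [OF sB] sgrp_pow [OF H(1)] by blast+
      have "m > 0" using m(1) cB by (metis mult_0_right neq0_conv)
      then have comm: "w ^ j * b = b * w ^ j"
        using nilp_coprime_comm [OF sB fB nB t(2,1,3) wi(3) ij(3)] m(2) by blast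
      have "w ^ i * b \<in> ppart B t"
        using sgrpD(2) [OF sgrp_ppart [OF sB fB nB t(1)], of "w ^ i" b] wi(1) t ij(2)
        by (auto simp: ppart_def pel_def)
      then obtain v where v: "v \<in> ?V" "v * (w ^ i * b) \<in> ?H" using key2 [OF t(1)] by (auto simp: ppart_def)
      \<comment> \<open>A substitute for \<open>w * b\<close> inside \<open>?H \<inter> B\<close>.
        The \<open>t\<close>-part \<open>w ^ i\<close> is merged with \<open>b\<close> and corrected
        by \<open>v\<close>, which fixes \<open>a\<close>; the part \<open>w ^ j\<close> of order
        prime to \<open>t\<close> commutes with \<open>b\<close>.\<close>
      define u where "u = v * (w ^ i * b) * w ^ j"
      have "u \<in> ?H" unfolding u_def using v(2) wi(4) H(1) by (simp add: sgrpD)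
      moreover have "u \<in> B" unfolding u_def using v(1) V(2) wi t(2) sB by (auto simp: sgrpD)
      moreover have "cj v a = a" using v(1) by (simp add: cizer_def cj_fix_iff)
      then have "cj u a = cj (w ^ i * b * w ^ j) a"
        using cj_cj [of "w ^ i * b * w ^ j" v a] by (simp add: u_def mult.assoc)
      moreover have "w ^ i * b * w ^ j = w * b"
      proof -
        have "w ^ i * b * w ^ j = w ^ i * w ^ j * b" using comm by (simp add: mult.assoc)
        then show ?thesis using ij(1) by simp
      qed
      ultimately have "cj b x = cj u a" "u \<in> ?H \<inter> B" by (simp_all add: cj_cj w(3))
      then show ?thesis by blast
    qed
    have "B \<subseteq> {b \<in> B. \<forall>x\<in>?Orb. cj b x \<in> ?Orb}" (is "B \<subseteq> ?S")
    proof (rule sgrp_prime_power_gen [OF _ sB fB])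
      show "sgrp ?S"
      proof (rule sgrp_finite_closed)
        show "finite ?S" using fB by simp
        show "?S \<noteq> {}" using sgrpD(1) [OF sB] by (auto intro!: exI [of _ 1])
        fix b c assume bc: "b \<in> ?S" "c \<in> ?S"
        have "cj (b * c) x \<in> ?Orb" if "x \<in> ?Orb" for x
        proof -
          have "cj b x \<in> ?Orb" using bc(1) that by blast
          then have "cj c (cj b x) \<in> ?Orb" using bc(2) by blast
          then show ?thesis by (simp only: cj_cj)
        qed
        then show "b * c \<in> ?S" using bc sB by (simp add: sgrpD)
      qed
    qed (use stable in blast)
    moreover have "a \<in> ?Orb" using sgrpD(1) [OF sHB] by (auto intro!: image_eqI [of _ _ 1])
    ultimately have orb: "cj b a \<in> ?Orb" if "b \<in> B" for b using that by blast
    have "cj g a \<in> ?H" if "g \<in> G" for g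
    proof -
      obtain x b where xb: "x \<in> A" "b \<in> B" "g = x * b" using decompose \<open>g \<in> G\<close> by blast
      have "cj x a = a" using a(1) xb(1) by (auto simp: cizer_def cj_fix_iff)
      then have "cj g a = cj b a" unfolding xb(3) by (metis cj_cj)
      moreover obtain w where w: "w \<in> ?H" "cj b a = cj w a" using orb [OF xb(2)] by blast
      moreover have "cj w a \<in> ?H" by (rule sgrp_cj_mem [OF H(1) w(1)]) (use H(4) a(2) in blast)
      ultimately show ?thesis by simp
    qed
    then have "a \<in> core G ?H" using H(2) by (auto simp: core_def)
    then show False using proper_core_trivial [OF H(1-3)] a(3) by simp
  qed
qed

lemma centralizer_center:
  assumes "a \<in> center A" "a \<noteq> 1"
  shows "cizer G {a} = A"
proof -
  have aA: "a \<in> A" using assms(1) by (simp add: cizer_def)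
  obtain p i where p: "prime p" "pel p (a ^ i)" "a ^ i \<noteq> 1"
    using prime_power_gen [OF sgrp_one card_gt_0_sgrp [OF sA fA] pow_card_eq_one [OF sA aA]] assms(2) by blast
  have ai: "a ^ i \<in> center A" "a ^ i \<in> A" using sgrp_pow [OF sgrp_cizer [OF sA] assms(1)] sgrp_pow [OF sA aA] by auto
  have tr: "cizer B {a ^ i} = {1}" by (rule centralizer_center_trivial [OF ai p(3,1,2)])
  show ?thesis
  proof
    show "A \<subseteq> cizer G {a}" using assms(1) AG by (auto simp: cizer_def)
    show "cizer G {a} \<subseteq> A"
    proof
      fix g assume g: "g \<in> cizer G {a}"
      then have "g \<in> G" by (simp add: cizer_def)
      then obtain x b where xb: "x \<in> A" "b \<in> B" "g = x * b" using decompose by blast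
      have ga: "cj g a = a" "cj x a = a" using g assms(1) xb(1) by (auto simp: cizer_def cj_fix_iff)
      then have "cj b a = a" unfolding xb(3) by (metis cj_cj)
      then have "cj b (a ^ i) = a ^ i" by (simp add: cj_pow)
      then have "b \<in> cizer B {a ^ i}" using xb(2) by (simp add: cizer_iff_cj)
      then show "g \<in> A" using tr xb by simp
    qed
  qed
qed

end

subsection \<open>Transfer and normal complements\<close>

lemma pow_mem_iff:
  assumes M: "sgrp M" "u \<notin> M" "u ^ s \<in> M" "prime s"
  shows "u ^ n \<in> M \<longleftrightarrow> s dvd n"
proof
  assume n: "u ^ n \<in> M"
  show "s dvd n"
  proof (rule ccontr)
    assume nd: "\<not> s dvd n"
    then have "n \<noteq> 0" by (metis dvd_0_right)
    then obtain x y where xy: "n * x = s * y + gcd n s" using bezout_nat by blast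
    have "gcd n s = 1" using nd M(4) by (metis gcd.commute prime_imp_coprime coprime_imp_gcd_eq_1)
    then have "(u ^ n) ^ x = (u ^ s) ^ y * u"
      unfolding power_mult [symmetric] xy by (simp only: power_add power_one_right)
    then show False
      using sgrp_pow [OF M(1) n, of x] sgrp_pow [OF M(1,3), of y] sgrp_mult_left_iff [OF M(1)] M(2) by metis
  qed
qed (use M sgrp_pow in \<open>auto simp: dvd_def power_mult\<close>)

text \<open>A homomorphism of \<open>Q\<close> onto the integers modulo \<open>s\<close>, encoded by
  natural numbers up to congruence: \<open>Q\<close> is generated by \<open>u\<close> over
  \<open>M\<close> from \<open>nilp_max_sub\<close>, and \<open>\<phi> x\<close> is an exponent of
  \<open>u\<close> in the coset of \<open>x\<close>. Invariance under \<open>A\<close> holds because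
  \<open>Q/M\<close> is central.\<close>

lemma nilp_char:
  assumes A: "sgrp A" "finite A" "nilp A" and Q: "normal_in Q A" "Q \<noteq> {1}"
  obtains s u and \<phi> :: "'a::grp \<Rightarrow> nat" where "prime s" "u \<in> Q" "pel s u" "\<not> s dvd \<phi> u"
    "\<And>x y. x \<in> Q \<Longrightarrow> y \<in> Q \<Longrightarrow> [\<phi> (x * y) = \<phi> x + \<phi> y] (mod s)"
    "\<And>x g. x \<in> Q \<Longrightarrow> g \<in> A \<Longrightarrow> [\<phi> (cj g x) = \<phi> x] (mod s)"
proof -
  note Q' = normal_inD [OF Q(1)]
  obtain M s u0 where M: "normal_in M A" "M \<subseteq> Q" "\<And>x g. x \<in> Q \<Longrightarrow> g \<in> A \<Longrightarrow> inverse x * cj g x \<in> M"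
    and u0: "prime s" "u0 \<in> Q" "pel s u0" "u0 \<notin> M"
    and max: "\<And>M'. sgrp M' \<Longrightarrow> M \<subseteq> M' \<Longrightarrow> M' \<subseteq> Q \<Longrightarrow> M' = M \<or> M' = Q"
    using nilp_max_sub [OF A Q] by (metis (no_types, lifting))
  note M' = normal_inD [OF M(1)]
  \<comment> \<open>The generator \<open>u\<close> is the last iterated \<open>s\<close>-th power of
    \<open>u0\<close> outside \<open>M\<close>, so that \<open>u ^ s\<close> lies in
    \<open>M\<close>.\<close>
  define P where "P j \<longleftrightarrow> u0 ^ (s ^ j) \<in> M" for j
  have "\<exists>j. P j" using u0(3) sgrpD(1) [OF M'(1)] by (auto simp: pel_def P_def) metis
  then have PL: "P (LEAST j. P j)" by (rule LeastI_ex)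
  have "\<not> P 0" using u0(4) by (simp add: P_def)
  then obtain j where j: "(LEAST j. P j) = Suc j" using PL by (metis not0_implies_Suc)
  define u where "u = u0 ^ (s ^ j)"
  have "\<not> P j" using not_less_Least [of j P] j by simp
  then have uM: "u \<notin> M" by (simp add: u_def P_def)
  have "P (Suc j)" using PL j by simp
  then have usM: "u ^ s \<in> M" by (simp add: P_def u_def power_mult [symmetric] mult.commute)
  have uQ: "u \<in> Q" "pel s u" unfolding u_def using u0 Q'(1) by (auto simp: sgrp_pow pel_pow)
  note pm = pow_mem_iff [OF M'(1) uM usM u0(1)]
  define D where "D = {x. \<exists>i. \<exists>m\<in>M. x = u ^ i * m}"
  have DQ: "D \<subseteq> Q" using uQ(1) M(2) Q'(1) by (auto simp: D_def sgrp_pow sgrpD subset_iff)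
  have upA: "u ^ j \<in> A" for j using uQ(1) Q' by (meson sgrp_pow subsetD)
  have step: "\<exists>m''\<in>M. (u ^ i * m) * (u ^ j * m') = u ^ (i + j) * m''" if "m \<in> M" "m' \<in> M" for i j m m'
  proof -
    have "cj (u ^ j) m * m' \<in> M" using M'(1) M'(3) [OF upA that(1)] that(2) by (simp add: sgrpD)
    moreover have "(u ^ i * m) * (u ^ j * m') = u ^ (i + j) * (cj (u ^ j) m * m')"
      by (simp add: cj_def power_add grp_simps)
    ultimately show ?thesis by blast
  qed
  have "sgrp D"
  proof (rule sgrp_finite_closed)
    show "finite D" by (rule finite_subset [OF DQ finite_subset [OF Q'(2) A(2)]])
    show "D \<noteq> {}" using sgrpD(1) [OF M'(1)] by (auto simp: D_def)
    show "x * y \<in> D" if "x \<in> D" "y \<in> D" for x y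
      using that step unfolding D_def by blast
  qed
  moreover have "M \<subseteq> D"
  proof
    fix m assume "m \<in> M" then have "m = u ^ 0 * m" "m \<in> M" by simp_all
    then show "m \<in> D" unfolding D_def by blast
  qed
  moreover have "u \<in> D"
  proof -
    have "u = u ^ 1 * 1" "1 \<in> M" using M'(1) by (simp_all add: sgrpD)
    then show ?thesis unfolding D_def by blast
  qed
  ultimately have DQ: "D = Q" using max DQ uM by blast
  define \<phi> where "\<phi> x = (SOME i. \<exists>m\<in>M. x = u ^ i * m)" for x
  have ex: "\<exists>m\<in>M. x = u ^ \<phi> x * m" if "x \<in> Q" for x
    unfolding \<phi>_def by (rule someI_ex) (use that DQ in \<open>auto simp: D_def\<close>)
  have uniq': "[i = j] (mod s)" if "u ^ i * m = u ^ j * m'" "m \<in> M" "m' \<in> M" "i \<le> j" for i j m m'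
  proof -
    have "u ^ i * m = u ^ i * (u ^ (j - i) * m')"
      using that(1,4) by (simp add: mult.assoc [symmetric] power_add [symmetric])
    then have "u ^ (j - i) * m' \<in> M" using that(2) by (simp only: mult_left_cancel_grp)
    then have "s dvd j - i" using pm that(3) sgrp_mult_right_iff [OF M'(1)] by blast
    then show ?thesis using that(4) by (metis cong_altdef_nat cong_sym)
  qed
  have uniq: "[\<phi> x = i] (mod s)" if x: "x \<in> Q" "x = u ^ i * m" "m \<in> M" for x i m
  proof -
    obtain m' where m': "m' \<in> M" "x = u ^ \<phi> x * m'" using ex [OF x(1)] by blast
    then have "u ^ \<phi> x * m' = u ^ i * m" using x(2) by simp
    then show ?thesis using uniq' [of "\<phi> x" m' i m] uniq' [of i m "\<phi> x" m'] m'(1) x(3)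
      by (metis cong_sym nat_le_linear)
  qed
  show ?thesis
  proof (rule that [of s u \<phi>])
    have "[\<phi> u = 1] (mod s)" by (rule uniq [OF uQ(1), of 1 1]) (use M'(1) in \<open>simp_all add: sgrpD\<close>)
    then show "\<not> s dvd \<phi> u" using u0(1) by (metis cong_dvd_iff cong_dvd_nat cong_sym not_prime_unit)
    fix x assume x: "x \<in> Q"
    obtain m where m: "m \<in> M" "x = u ^ \<phi> x * m" using ex [OF x] by blast
    show "[\<phi> (x * y) = \<phi> x + \<phi> y] (mod s)" if y: "y \<in> Q" for y
    proof -
      obtain m' where m': "m' \<in> M" "y = u ^ \<phi> y * m'" using ex [OF y] by blast
      obtain m'' where "m'' \<in> M" "(u ^ \<phi> x * m) * (u ^ \<phi> y * m') = u ^ (\<phi> x + \<phi> y) * m''"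
        using step [OF m(1) m'(1)] by blast
      then have "x * y = u ^ (\<phi> x + \<phi> y) * m''" "m'' \<in> M" using m(2) m'(2) by auto
      moreover have "x * y \<in> Q" by (rule sgrpD(2) [OF Q'(1) x y])
      ultimately show ?thesis using uniq by blast
    qed
    show "[\<phi> (cj g x) = \<phi> x] (mod s)" if g: "g \<in> A" for g
    proof -
      have "cj g x = x * (inverse x * cj g x)" by (simp add: grp_simps)
      also have "\<dots> = u ^ \<phi> x * (m * (inverse x * cj g x))" by (subst m(2)) (simp only: mult.assoc)
      finally show ?thesis
        using uniq [of "cj g x" "\<phi> x" "m * (inverse x * cj g x)"] M(3) [OF x g] M'(1) m(1) Q'(3) [OF g x]
        by (simp add: sgrpD)
    qed
  qed (use u0(1) uQ in auto)
qed

text \<open>\<open>\<tau>\<close> is the transfer of \<open>K\<close> into \<open>Q\<close> followed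
  by \<open>\<phi>\<close>. Fusion is required for powers of the single element \<open>u\<close>
  only, the one at which \<open>\<tau>\<close> is evaluated.\<close>

lemma transfer_exists:
  fixes \<phi> :: "'a::grp \<Rightarrow> nat"
  assumes K: "sgrp K" "finite K" and Q: "sgrp Q" "Q \<subseteq> K"
    and hom: "\<And>x y. x \<in> Q \<Longrightarrow> y \<in> Q \<Longrightarrow> [\<phi> (x * y) = \<phi> x + \<phi> y] (mod s)"
    and u: "u \<in> Q"
    and fusion: "\<And>k n. k \<in> K \<Longrightarrow> cj k (u ^ n) \<in> Q \<Longrightarrow> [\<phi> (cj k (u ^ n)) = \<phi> (u ^ n)] (mod s)"
  obtains \<tau> :: "'a \<Rightarrow> nat" where
    "\<And>x y. x \<in> K \<Longrightarrow> y \<in> K \<Longrightarrow> [\<tau> (x * y) = \<tau> x + \<tau> y] (mod s)"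
    "[\<tau> u = (card K div card Q) * \<phi> u] (mod s)"
proof -
  define lc where "lc x = (\<lambda>q. x * q) ` Q" for x
  define tr where "tr x X = (\<lambda>q. x * q) ` X" for x :: 'a and X
  define W where "W = lc ` K"
  define r where "r X = (SOME x. x \<in> X)" for X :: "'a set"
  have lc_eq: "lc x = lc y \<longleftrightarrow> inverse y * x \<in> Q" for x y
  proof
    assume *: "lc x = lc y"
    have "x * 1 \<in> lc x" unfolding lc_def by (rule imageI) (rule sgrpD(1) [OF Q(1)])
    then have "x \<in> lc y" using * by simp
    then show "inverse y * x \<in> Q" by (auto simp: lc_def grp_simps)
  next
    have sub: "lc a \<subseteq> lc b" if "inverse b * a \<in> Q" for a b
    proof
      fix z assume "z \<in> lc a"
      then obtain m where "m \<in> Q" "z = b * ((inverse b * a) * m)" by (auto simp: lc_def grp_simps)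
      then show "z \<in> lc b" using that Q(1) by (auto simp: lc_def sgrpD)
    qed
    assume *: "inverse y * x \<in> Q"
    then have "inverse (inverse y * x) \<in> Q" by (rule sgrpD(3) [OF Q(1)])
    then have "inverse x * y \<in> Q" by (simp add: grp_simps)
    then show "lc x = lc y" using sub * by blast
  qed
  have fW: "finite W" using K(2) by (simp add: W_def)
  have trlc: "tr x (lc y) = lc (x * y)" for x y by (simp add: tr_def lc_def image_image mult.assoc)
  have trtr: "tr x (tr y X) = tr (x * y) X" for x y X by (simp add: tr_def image_image mult.assoc)
  have trW: "tr x X \<in> W" if "x \<in> K" "X \<in> W" for x X
    using that K(1) trlc by (auto simp: W_def sgrpD)
  have tr_inj: "tr x X = tr x Y \<Longrightarrow> X = Y" for x X Y
    using trtr [of "inverse x" x X] trtr [of "inverse x" x Y] by (simp add: grp_simps tr_def)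
  have rX: "r X \<in> K" "lc (r X) = X" if X: "X \<in> W" for X
  proof -
    obtain x where x: "x \<in> K" "X = lc x" using X by (auto simp: W_def)
    have "x * 1 \<in> X" unfolding x(2) lc_def by (rule imageI) (rule sgrpD(1) [OF Q(1)])
    then have "r X \<in> X" unfolding r_def by (rule someI)
    then obtain q where q: "q \<in> Q" "r X = x * q" by (auto simp: x(2) lc_def)
    then show "r X \<in> K" using x(1) K(1) Q(2) by (auto simp: sgrpD)
    show "lc (r X) = X" unfolding x(2) lc_eq using q by (simp add: x(2) grp_simps)
  qed
  \<comment> \<open>The element of \<open>Q\<close> comparing \<open>k\<close> times the chosen
    representative of \<open>X\<close> with the representative of the translated coset. It satisfies
    the cocycle rule \<open>cmult\<close>, so summing over cosets gives a homomorphism.\<close>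
  define c where "c k X = inverse (r (tr k X)) * k * r X" for k X
  have cQ: "c k X \<in> Q" if "k \<in> K" "X \<in> W" for k X
  proof -
    have "lc (k * r X) = tr k X" using trlc [of k "r X"] rX(2) [OF that(2)] by simp
    also have "\<dots> = lc (r (tr k X))" using rX(2) [OF trW [OF that]] by simp
    finally show ?thesis unfolding lc_eq by (simp add: c_def mult.assoc)
  qed
  have cmult: "c (k * l) X = c k (tr l X) * c l X" for k l X
    by (simp add: c_def trtr grp_simps)
  define \<tau> where "\<tau> k = (\<Sum>X\<in>W. \<phi> (c k X))" for k
  have "[\<tau> (k * l) = \<tau> k + \<tau> l] (mod s)" if "k \<in> K" "l \<in> K" for k l
  proof -
    have bij: "bij_betw (tr l) W W"
      unfolding bij_betw_def
    proof
      show "inj_on (tr l) W" using tr_inj by (auto simp: inj_on_def)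
      then show "tr l ` W = W"
        by (intro card_subset_eq [OF fW]) (use trW that in \<open>auto simp: card_image\<close>)
    qed
    have "[\<tau> (k * l) = (\<Sum>X\<in>W. \<phi> (c k (tr l X)) + \<phi> (c l X))] (mod s)"
      unfolding \<tau>_def cmult by (rule cong_sum) (use hom cQ trW that in blast)
    also have "(\<Sum>X\<in>W. \<phi> (c k (tr l X)) + \<phi> (c l X)) = \<tau> k + \<tau> l"
      unfolding \<tau>_def sum.distrib using sum.reindex_bij_betw [OF bij, of "\<lambda>X. \<phi> (c k X)"] by simp
    finally show ?thesis .
  qed
  moreover have "[\<tau> u = (card K div card Q) * \<phi> u] (mod s)"
  proof -
    have uK: "u \<in> K" using u Q(2) by blast
    have up: "u ^ n \<in> K" "u ^ n \<in> Q" for n using sgrp_pow [OF K(1) uK] sgrp_pow [OF Q(1) u] by auto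
    have phi1: "[\<phi> 1 = 0] (mod s)"
    proof -
      have "[\<phi> 1 + 0 = \<phi> 1 + \<phi> 1] (mod s)" using hom [of 1 1] sgrpD(1) [OF Q(1)] by simp
      then show ?thesis by (simp only: cong_add_lcancel_nat cong_sym)
    qed
    have phi_pow: "[\<phi> (u ^ n) = n * \<phi> u] (mod s)" for n
    proof (induction n)
      case (Suc n)
      have "[\<phi> (u ^ Suc n) = \<phi> u + \<phi> (u ^ n)] (mod s)" using hom [OF u up(2)] by simp
      also have "[\<phi> u + \<phi> (u ^ n) = \<phi> u + n * \<phi> u] (mod s)" by (rule cong_add [OF cong_refl Suc])
      finally show ?case by simp
    qed (use phi1 in simp)
    have tele: "[(\<Sum>i<n. \<phi> (c u (tr (u ^ i) X))) = \<phi> (c (u ^ n) X)] (mod s)" if X: "X \<in> W" for X n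
    proof (induction n)
      case 0
      have "tr 1 X = X" by (simp add: tr_def)
      then have "c 1 X = 1" by (simp add: c_def grp_simps)
      then show ?case using phi1 by (simp add: cong_sym)
    next
      case (Suc n)
      have "[(\<Sum>i<Suc n. \<phi> (c u (tr (u ^ i) X))) = \<phi> (c (u ^ n) X) + \<phi> (c u (tr (u ^ n) X))] (mod s)"
        using cong_add [OF Suc cong_refl] by simp
      also have "[\<phi> (c (u ^ n) X) + \<phi> (c u (tr (u ^ n) X)) = \<phi> (c (u ^ Suc n) X)] (mod s)"
        using hom [OF cQ [OF uK trW [OF up(1) X]] cQ [OF up(1) X]]
        by (simp add: cmult add.commute cong_sym)
      finally show ?case .
    qed
    \<comment> \<open>Cosets are grouped into orbits under \<open>u\<close>. By \<open>tele\<close>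
      an orbit of length \<open>n\<close> contributes \<open>\<phi>\<close> of a conjugate of
      \<open>u ^ n\<close>, which \<open>fusion\<close> evaluates to
      \<open>n * \<phi> u\<close>.\<close>
    have orbits: "[(\<Sum>X\<in>V. \<phi> (c u X)) = card V * \<phi> u] (mod s)"
      if "V \<subseteq> W" "\<And>X. X \<in> V \<Longrightarrow> tr u X \<in> V" for V
      using that
    proof (induction "card V" arbitrary: V rule: less_induct)
      case less
      have fV: "finite V" using less.prems(1) fW finite_subset by blast
      show ?case
      proof (cases "V = {}")
        case False
        then obtain X where X: "X \<in> V" by blast
        have XW: "X \<in> W" using X less.prems by blast
        define P where "P n \<longleftrightarrow> n > 0 \<and> tr (u ^ n) X = X" for n
        have "P (card K)" using pow_card_eq_one [OF K(1) uK] card_gt_0_sgrp [OF K] by (simp add: P_def tr_def)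
        then have Pn: "P (LEAST n. P n)" by (rule LeastI)
        define n where "n = (LEAST n. P n)"
        have n: "n > 0" "tr (u ^ n) X = X" using Pn by (auto simp: n_def P_def)
        let ?f = "\<lambda>i. tr (u ^ i) X"
        have inj': "i = j" if "i \<le> j" "j < n" "?f i = ?f j" for i j
        proof (rule ccontr)
          assume "i \<noteq> j"
          have "tr (u ^ i) (tr (u ^ (j - i)) X) = tr (u ^ i) X"
            using that by (simp add: trtr power_add [symmetric])
          then have "P (j - i)" using tr_inj that(1) \<open>i \<noteq> j\<close> by (auto simp: P_def)
          then have "n \<le> j - i" unfolding n_def by (rule Least_le)
          then show False using that(2) by simp
        qed
        have inj: "inj_on ?f {..<n}"
          unfolding inj_on_def using inj' by (metis lessThan_iff nat_le_linear)
        define Ob where "Ob = ?f ` {..<n}"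
        have cO: "card Ob = n" unfolding Ob_def by (simp add: card_image [OF inj])
        have OV: "Ob \<subseteq> V"
        proof -
          have "?f i \<in> V" for i
          proof (induction i)
            case (Suc i)
            then have "tr u (?f i) \<in> V" by (rule less.prems(2))
            then show ?case by (simp add: trtr)
          qed (use X in \<open>simp add: tr_def\<close>)
          then show ?thesis by (auto simp: Ob_def)
        qed
        have sO: "[(\<Sum>X\<in>Ob. \<phi> (c u X)) = n * \<phi> u] (mod s)"
        proof -
          have "(\<Sum>X\<in>Ob. \<phi> (c u X)) = (\<Sum>i<n. \<phi> (c u (tr (u ^ i) X)))"
            unfolding Ob_def by (simp add: sum.reindex [OF inj])
          moreover have "c (u ^ n) X = cj (r X) (u ^ n)" by (simp add: c_def n(2) cj_def)
          ultimately have "[(\<Sum>X\<in>Ob. \<phi> (c u X)) = \<phi> (cj (r X) (u ^ n))] (mod s)" "cj (r X) (u ^ n) \<in> Q"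
            using tele [OF XW, of n] cQ [OF up(1) XW, of n] by auto
          then show ?thesis using fusion [OF rX(1) [OF XW]] phi_pow cong_trans by blast
        qed
        have sub: "[(\<Sum>X\<in>V - Ob. \<phi> (c u X)) = card (V - Ob) * \<phi> u] (mod s)"
        proof (rule less.hyps)
          show "card (V - Ob) < card V" using n(1) cO OV fV
            by (metis card_Diff_subset card_gt_0_iff diff_less finite_subset card_mono le_0_eq neq0_conv less_le_trans)
          show "V - Ob \<subseteq> W" using less.prems by blast
          fix Y assume Y: "Y \<in> V - Ob"
          have "tr u Y \<notin> Ob"
          proof
            assume "tr u Y \<in> Ob"
            then obtain i where i: "i < n" "tr u Y = ?f i" by (auto simp: Ob_def)
            have "\<exists>i'<n. tr u Y = tr u (?f i')"
            proof (cases i)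
              case 0
              have "tr u (?f (n - 1)) = X" using n by (simp add: trtr power_Suc [symmetric] del: power_Suc)
              then show ?thesis using i 0 n(1) by (intro exI [of _ "n - 1"]) (simp add: tr_def)
            next
              case (Suc i')
              then show ?thesis using i by (intro exI [of _ i']) (simp add: trtr)
            qed
            then have "Y \<in> Ob" using tr_inj by (auto simp: Ob_def)
            with Y show False by blast
          qed
          then show "tr u Y \<in> V - Ob" using less.prems Y by blast
        qed
        have "(\<Sum>X\<in>V. \<phi> (c u X)) = (\<Sum>X\<in>V - Ob. \<phi> (c u X)) + (\<Sum>X\<in>Ob. \<phi> (c u X))"
          using sum.subset_diff [OF OV fV] by blast
        moreover have "card V = card (V - Ob) + n"
          using cO OV fV by (metis card_Diff_subset card_mono finite_subset le_add_diff_inverse2)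
        ultimately show ?thesis using cong_add [OF sub sO] by (simp add: add_mult_distrib)
      qed (simp add: cong_def)
    qed
    have "card K = card Q * card W"
      unfolding W_def
    proof (rule card_eq_fibre [OF K(2)])
      fix y assume "y \<in> lc ` K"
      then obtain x where x: "x \<in> K" "y = lc x" by blast
      have "{z \<in> K. lc z = y} = (\<lambda>q. x * q) ` Q"
      proof (intro Set.set_eqI iffI)
        fix z assume "z \<in> {z \<in> K. lc z = y}"
        then have "inverse x * z \<in> Q" by (simp add: x lc_eq)
        then have "x * (inverse x * z) \<in> (\<lambda>q. x * q) ` Q" by (rule imageI)
        then show "z \<in> (\<lambda>q. x * q) ` Q" by (simp add: grp_simps)
      next
        fix z assume "z \<in> (\<lambda>q. x * q) ` Q"
        then obtain q where "q \<in> Q" "z = x * q" by blast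
        then show "z \<in> {z \<in> K. lc z = y}" using x K(1) Q(2) by (auto simp: lc_eq grp_simps sgrpD)
      qed
      then show "card {z \<in> K. lc z = y} = card Q"
        by (simp add: card_image inj_on_def mult_left_cancel_grp)
    qed
    then have "card W = card K div card Q"
      using card_gt_0_sgrp [OF Q(1) finite_subset [OF Q(2) K(2)]] by simp
    then show ?thesis using orbits [of W] trW uK by (simp add: \<tau>_def)
  qed
  ultimately show ?thesis using that by blast
qed

lemma dvd_sylowI:
  assumes "n > 0" "m > 0" "\<And>p::nat. prime p \<Longrightarrow> p ^ multiplicity p n dvd m"
  shows "n dvd (m::nat)"
proof (rule multiplicity_le_imp_dvd)
  fix p :: nat assume p: "prime p"
  show "multiplicity p n \<le> multiplicity p m"
    by (rule multiplicity_geI) (use p assms in \<open>auto simp: not_prime_unit\<close>)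
qed (use assms in simp)

text \<open>Take \<open>K\<close> of least order among the normal subgroups with
  \<open>K * H = J\<close>. If \<open>K \<inter> H\<close> were non-trivial, transfer would give a
  homomorphism on \<open>K\<close> modulo some \<open>s\<close> that does not vanish on a suitable
  \<open>u\<close> in \<open>K \<inter> H\<close>, the index being prime to \<open>s\<close>. Its
  kernel then produces a smaller supplement.\<close>

lemma nilp_hall_complement:
  assumes J: "sgrp J" "finite J" and H: "sgrp H" "H \<subseteq> J" "nilp H"
    and hall: "coprime (card H) (card J div card H)"
    and fusion: "\<And>s x k. prime s \<Longrightarrow> x \<in> H \<Longrightarrow> pel s x \<Longrightarrow> k \<in> J \<Longrightarrow> cj k x \<in> H \<Longrightarrow> \<exists>h\<in>H. cj k x = cj h x"
  obtains R where "normal_in R J" "R * H = J" "R \<inter> H = {1}"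
proof -
  have fH: "finite H" by (rule finite_subset [OF H(2) J(2)])
  let ?S = "\<lambda>K. normal_in K J \<and> K * H = J"
  have "J * H = J" using normal_in_mult(2,3) [OF normal_in_self [OF J(1)] J(1) H(1,2)] by blast
  then have "?S J" using normal_in_self [OF J(1)] by simp
  then have "\<exists>K. ?S K \<and> (\<forall>K'. ?S K' \<longrightarrow> card K \<le> card K')" by (rule ex_has_least_nat [of ?S J card])
  then obtain K where K: "normal_in K J" "K * H = J" and min: "\<forall>K'. ?S K' \<longrightarrow> card K \<le> card K'"
    by (elim exE conjE)
  note K' = normal_inD [OF K(1)]
  have fK: "finite K" by (rule finite_subset [OF K'(2) J(2)])
  let ?Q = "K \<inter> H"
  have sQ: "sgrp ?Q" by (rule sgrp_Int [OF K'(1) H(1)])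
  have Q: "normal_in ?Q H"
    using sQ K'(3) H(1,2) by (auto simp: normal_in_def sgrp_cj_mem)
  have cardJ: "card J * card ?Q = card K * card H"
    using card_mult_Int [OF K'(1) H(1) fK fH] K(2) by simp
  have pos: "card H > 0" "card ?Q > 0" "card J > 0" "card K > 0"
    using card_gt_0_sgrp J(1,2) H(1) fH sQ K'(1) fK by blast+
  obtain m where m: "card J = card H * m" using card_dvd_sgrp [OF J(1) H(1,2) J(2)] by (auto simp: dvd_def)
  have cm: "coprime (card H) m" using hall pos(1) by (simp add: m)
  have cardK: "card K = m * card ?Q"
    using cardJ pos(1) unfolding m by (metis mult.assoc mult.commute mult_left_cancel less_irrefl)
  have "?Q = {1}"
  proof (rule ccontr)
    assume Q1: "?Q \<noteq> {1}"
    obtain s u \<phi> where su: "prime s" "u \<in> ?Q" "pel s u" "\<not> s dvd \<phi> u"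
      and hom: "\<And>x y. x \<in> ?Q \<Longrightarrow> y \<in> ?Q \<Longrightarrow> [\<phi> (x * y) = \<phi> x + \<phi> y] (mod s)"
      and inv: "\<And>x g. x \<in> ?Q \<Longrightarrow> g \<in> H \<Longrightarrow> [\<phi> (cj g x) = \<phi> x] (mod s)"
      using nilp_char [OF H(1) fH H(3) Q Q1] by metis
    have un: "u ^ n \<in> ?Q" for n by (rule sgrp_pow [OF sQ su(2)])
    have fus: "[\<phi> (cj k (u ^ n)) = \<phi> (u ^ n)] (mod s)" if "k \<in> K" "cj k (u ^ n) \<in> ?Q" for k n
    proof -
      have "\<exists>h\<in>H. cj k (u ^ n) = cj h (u ^ n)"
        by (rule fusion [OF su(1) _ pel_pow [OF su(3)]]) (use un [of n] that K'(2) in auto)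
      then obtain h where "h \<in> H" "cj k (u ^ n) = cj h (u ^ n)" by blast
      then show ?thesis using inv [OF un] by simp
    qed
    obtain \<tau> where tau: "\<And>x y. x \<in> K \<Longrightarrow> y \<in> K \<Longrightarrow> [\<tau> (x * y) = \<tau> x + \<tau> y] (mod s)"
      and tu: "[\<tau> u = (card K div card ?Q) * \<phi> u] (mod s)"
      by (rule transfer_exists [OF K'(1) fK sQ _ hom su(2) fus]) auto
    have s1: "s \<noteq> 1" using su(1) by auto
    have "s dvd card H"
    proof (rule ccontr)
      assume "\<not> s dvd card H"
      then have "u = 1" using pel_imp_one [OF su(1,3) pow_card_eq_one [OF H(1)]] su(2) by blast
      then have "[\<phi> u + 0 = \<phi> u + \<phi> u] (mod s)" using hom [OF su(2,2)] by simp
      then have "[0 = \<phi> u] (mod s)" by (simp only: cong_add_lcancel_nat)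
      then have "[\<phi> u = 0] (mod s)" by (rule cong_sym)
      then show False using su(4) by (simp add: cong_0_iff)
    qed
    then have "\<not> s dvd m" using coprime_prime_not_dvd [of m "card H" s] cm su(1) by (simp add: coprime_commute)
    moreover have "card K div card ?Q = m" unfolding cardK using pos(2) by simp
    ultimately have "\<not> s dvd (card K div card ?Q) * \<phi> u" using su(1,4) by (simp add: prime_dvd_mult_iff)
    then have tu0: "\<not> s dvd \<tau> u" using tu by (metis cong_dvd_nat cong_sym)
    have t1: "[\<tau> 1 = 0] (mod s)"
    proof -
      have "[\<tau> 1 + 0 = \<tau> 1 + \<tau> 1] (mod s)" using tau [of 1 1] sgrpD(1) [OF K'(1)] by simp
      then show ?thesis by (simp only: cong_add_lcancel_nat cong_sym)
    qed
    have tpow: "[\<tau> (x ^ n) = n * \<tau> x] (mod s)" if x: "x \<in> K" for x n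
    proof (induction n)
      case (Suc n)
      have "[\<tau> (x ^ Suc n) = \<tau> x + \<tau> (x ^ n)] (mod s)" using tau [OF x sgrp_pow [OF K'(1) x]] by simp
      also have "[\<tau> x + \<tau> (x ^ n) = \<tau> x + n * \<tau> x] (mod s)" by (rule cong_add [OF cong_refl Suc])
      finally show ?case by simp
    qed (use t1 in simp)
    \<comment> \<open>The kernel of \<open>\<tau>\<close> need not be normal in \<open>J\<close>, so
      its core is used. The core still contains all elements of \<open>K\<close> of prime power
      order prime to \<open>s\<close>, which is enough for it to supplement
      \<open>H\<close>.\<close>
    let ?K2 = "{k \<in> K. s dvd \<tau> k}" let ?K3 = "core J ?K2"
    have sK2: "sgrp ?K2"
    proof (rule sgrp_finite_closed)
      show "finite ?K2" using fK by simp
      show "?K2 \<noteq> {}" using sgrpD(1) [OF K'(1)] t1 by (auto simp: cong_0_iff)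
      show "x * y \<in> ?K2" if "x \<in> ?K2" "y \<in> ?K2" for x y
        using that cong_dvd_nat [OF tau [of x y]] K'(1) by (auto simp: sgrpD)
    qed
    have K3: "normal_in ?K3 J" by (rule core_normal [OF J(1) sK2])
    have K3K: "?K3 \<subseteq> ?K2" using core_subset [OF J(1)] by blast
    have other: "x \<in> ?K3" if x: "x \<in> K" "prime t" "t \<noteq> s" "pel t x" for x t
    proof -
      have "cj g x \<in> ?K2" if g: "g \<in> J" for g
      proof -
        have gx: "cj g x \<in> K" "pel t (cj g x)" using K'(3) [OF g x(1)] x(4) by auto
        then obtain j where "cj g x ^ (t ^ j) = 1" by (auto simp: pel_def)
        then have "[t ^ j * \<tau> (cj g x) = 0] (mod s)" using tpow [OF gx(1), of "t ^ j"] t1 by (metis cong_sym cong_trans)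
        then have "s dvd t ^ j * \<tau> (cj g x)" by (simp add: cong_0_iff)
        moreover have "\<not> s dvd t ^ j" using x(2,3) su(1) by (metis prime_dvd_power primes_dvd_imp_eq)
        ultimately show ?thesis using gx(1) su(1) by (auto simp: prime_dvd_mult_iff)
      qed
      then show ?thesis using K'(2) by (auto simp: core_def)
    qed
    have K3H: "sgrp (?K3 * H)" "?K3 * H \<subseteq> J" "?K3 \<subseteq> ?K3 * H" "H \<subseteq> ?K3 * H"
      using normal_in_mult [OF K3 J(1) H(1,2)] by auto
    have fK3H: "finite (?K3 * H)" by (rule finite_subset [OF K3H(2) J(2)])
    have "card J dvd card (?K3 * H)"
    proof (rule dvd_sylowI [OF pos(3) card_gt_0_sgrp [OF K3H(1) fK3H]])
      fix t :: nat assume t: "prime t"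
      show "t ^ multiplicity t (card J) dvd card (?K3 * H)"
      proof (cases "t dvd card H")
        case True
        then have "\<not> t dvd m" using coprime_prime_not_dvd [of m "card H" t] cm t by (simp add: coprime_commute)
        then have "multiplicity t (card J) = multiplicity t (card H)"
          unfolding m using t pos(1,3) m by (subst prime_elem_multiplicity_mult_distrib) (auto simp: not_dvd_imp_multiplicity_0)
        then have "t ^ multiplicity t (card J) dvd card H" by (simp add: multiplicity_dvd)
        then show ?thesis using card_dvd_sgrp [OF K3H(1) H(1) K3H(4) fK3H] dvd_trans by blast
      next
        case False
        then have "t \<noteq> s" using \<open>s dvd card H\<close> by blast
        obtain T where T: "sylow_sub t T K" using sylow_exists_sub [OF K'(1) fK t] .
        then have T': "sgrp T" "T \<subseteq> K" "card T = t ^ multiplicity t (card K)" by (auto simp: sylow_sub_def)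
        have "T \<subseteq> ?K3" using other T'(2) t \<open>t \<noteq> s\<close> sylow_sub_pel [OF T] by blast
        then have "card T dvd card (?K3 * H)"
          using card_dvd_sgrp [OF K3H(1) T'(1) _ fK3H] K3H(3) by blast
        moreover have "\<not> t dvd card ?Q"
          using False card_dvd_sgrp [OF H(1) sQ _ fH] dvd_trans by blast
        then have "multiplicity t (card J) = multiplicity t (card K)"
          unfolding m cardK using t pos m False
          by (simp add: prime_elem_multiplicity_mult_distrib not_dvd_imp_multiplicity_0)
        ultimately show ?thesis using T'(3) by simp
      qed
    qed
    then have "card J \<le> card (?K3 * H)" using card_gt_0_sgrp [OF K3H(1) fK3H] by (rule dvd_imp_le)
    then have "?K3 * H = J" using K3H(2) J(2) card_seteq by blast
    then have "card K \<le> card ?K3" using min K3 by blast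
    moreover have "?K3 \<subseteq> K" "u \<notin> ?K3" "u \<in> K" using K3K su(2) tu0 by auto
    then have "?K3 \<subset> K" by (metis psubsetI)
    then have "card ?K3 < card K" by (rule psubset_card_mono [OF fK])
    ultimately show False by simp
  qed
  then show ?thesis using that [OF K] by blast
qed

subsection \<open>Normalizers of the factors\<close>

lemma cizer_cj: "cizer G {cj g x} = cj g ` cizer G {x}" if "sgrp G" "g \<in> G" for G :: "'a::grp set"
proof (intro Set.set_eqI)
  fix y
  have "y * cj g x = cj g x * y \<longleftrightarrow> cj (inverse g) y * x = x * cj (inverse g) y"
    using cj_eq_iff [of "inverse g" "y * cj g x" "cj g x * y"] by (simp add: cj_mult)
  then show "y \<in> cizer G {cj g x} \<longleftrightarrow> y \<in> cj g ` cizer G {x}"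
    using that by (simp add: mem_cj_image cizer_def sgrp_cj_mem_iff sgrpD)
qed

lemma cizer_sub_nizer_pow: "cizer G {x} \<subseteq> nizer G (range (\<lambda>i. x ^ i))"
proof
  fix g assume g: "g \<in> cizer G {x}"
  then have "cj g (x ^ i) = x ^ i" for i by (simp add: cizer_iff_cj cj_pow)
  then show "g \<in> nizer G (range (\<lambda>i. x ^ i))" using g by (simp add: nizer_def cizer_def image_image)
qed

context wielandt
begin

text \<open>\<open>core H B\<close> is an \<open>A\<close>-invariant subset of \<open>B\<close>,
  hence trivial. So \<open>z\<close> centralises both cores, and its splitting has no part in
  \<open>B\<close>.\<close>

lemma center_in_core:
  assumes H: "sgrp H" "A \<subseteq> H" "H \<subseteq> G" "H \<noteq> G" and z: "z \<in> center A"
  shows "z \<in> core H A"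
proof -
  have fH: "finite H" by (rule finite_subset [OF H(3) fG])
  have fac: "fac A B H" by (rule fac_superset [OF H(1-3)])
  have cB: "core H B \<subseteq> H \<inter> B" by (rule core_subset [OF H(1)])
  have nB': "normal_in (core H B) H" by (rule core_normal [OF H(1) sB])
  have triv: "y = 1" if "y \<in> core H B" for y
    by (rule invariant_sub_trivial [OF _ _ that]) (use cB normal_inD(3) [OF nB'] H(2) in auto)
  have zH: "z \<in> H" "z \<in> A" using z H(2) by (auto simp: cizer_def)
  have "z \<in> cizer H (core H A)" using z zH core_subset [OF H(1), of A] by (auto simp: cizer_def)
  moreover have "z \<in> cizer H (core H B)"
  proof -
    have "z * y = y * z" if "y \<in> core H B" for y using triv [OF that] by simp
    then show ?thesis using zH by (simp add: cizer_def)
  qed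
  ultimately obtain zA zB where "zA \<in> core H A" "zB \<in> core H B" "z = zA * zB"
    using fac_bicentralizer_split [OF fac fH solvJ [OF fac H(3,4)] sA fA sB fB cop] by metis
  then show ?thesis using triv by force
qed

text \<open>The \<open>t\<close>-part of \<open>A\<close> commutes with the \<open>p\<close>-element
  \<open>cj g z\<close> of \<open>A\<close>, whose centralizer is the conjugate of \<open>A\<close>
  by \<open>g\<close>. So it lies in that conjugate, and orders agree.\<close>

lemma ppart_conj_eq:
  assumes g: "g \<in> G" and z: "z \<in> center A" "z \<noteq> 1" "prime p" "pel p z" "cj g z \<in> A"
    and t: "prime t" "t \<noteq> p"
  shows "cj g ` ppart A t = ppart A t"
proof -
  have "ppart A t \<subseteq> cj g ` ppart A t"
  proof
    fix x assume x: "x \<in> ppart A t"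
    have "x * cj g z = cj g z * x"
      using nilpD [OF nA _ z(5) t(1) z(3) t(2)] x z(4) by (auto simp: ppart_def)
    then have "x \<in> cizer G {cj g z}" using x AG by (auto simp: cizer_def ppart_def)
    then have "x \<in> cj g ` A" using cizer_cj [OF sG g, of z] centralizer_center [OF z(1,2)] by simp
    then show "x \<in> cj g ` ppart A t" using x by (auto simp: ppart_def)
  qed
  then show ?thesis
    by (intro card_subset_eq [symmetric]) (use fA in \<open>auto simp: ppart_def\<close>)
qed

text \<open>For each prime \<open>t\<close> choose a central element \<open>z\<close> of
  \<open>A\<close> for another prime. It lies in the normal core of \<open>A\<close> in
  \<open>H\<close>, so conjugation by \<open>h\<close> keeps it in \<open>A\<close>, and
  \<open>ppart_conj_eq\<close> shows that \<open>h\<close> normalises the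
  \<open>t\<close>-part.\<close>

lemma over_A:
  assumes H: "sgrp H" "A \<subseteq> H" "H \<subseteq> G" "H \<noteq> G"
  shows "H \<subseteq> nizer G A"
proof
  fix h assume h: "h \<in> H"
  then have hG: "h \<in> G" using H(3) by blast
  have "A \<subseteq> cj h ` A"
  proof (rule ppart_gen_A [OF sgrp_cj [OF sA]])
    fix t :: nat assume t: "prime t"
    obtain p where p: "prime p" "p \<noteq> t" "p dvd card A" using two_primes_A by blast
    obtain z where z: "z \<in> center A" "z \<noteq> 1" "pel p z" using exists_center [OF p(1,3)] .
    have "cj h z \<in> A"
      using center_in_core [OF H z(1)] normal_inD(3) [OF core_normal [OF H(1) sA] h] core_subset [OF H(1)] by blast
    then have "cj h ` ppart A t = ppart A t"
      using ppart_conj_eq [OF hG z(1,2) p(1) z(3) _ t] p(2) by blast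
    then show "ppart A t \<subseteq> cj h ` A" using ppart_subset [of A t] by blast
  qed
  then have "A = cj h ` A" by (rule card_subset_eq [rotated]) (use fA in auto)
  then show "h \<in> nizer G A" using hG by (simp add: nizer_def)
qed

lemma A_nizer: "sgrp (nizer G A)" "A \<subseteq> nizer G A" "nizer G A \<subseteq> G" "nizer G A \<noteq> G" "normal_in A (nizer G A)"
proof -
  show "sgrp (nizer G A)" by (rule sgrp_nizer [OF sG])
  show 1: "A \<subseteq> nizer G A" using AG sgrp_cj_image [OF sA] by (auto simp: nizer_def)
  show "nizer G A \<subseteq> G" by (rule nizer_subset)
  have "A \<noteq> {1}" using two_primes_A [of 0] by auto
  then show "nizer G A \<noteq> G" by (rule wielandt.nizer_proper [OF swap sA subset_refl])
  show "normal_in A (nizer G A)" unfolding normal_in_def using sA 1 by (auto simp: nizer_def)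
qed

text \<open>After passing to a power of prime power order, \<open>g\<close> normalises the
  \<open>t\<close>-part of \<open>A\<close> for some other prime \<open>t\<close>. The normalizer of
  that part is proper and contains \<open>A\<close>, so \<open>over_A\<close> applies.\<close>

lemma center_conj:
  assumes g: "g \<in> G" and z: "z \<in> center A" "z \<noteq> 1" "cj g z \<in> A"
  shows "g \<in> nizer G A"
proof -
  have zA: "z \<in> A" using z(1) by (simp add: cizer_def)
  obtain p i where p: "prime p" "pel p (z ^ i)" "z ^ i \<noteq> 1"
    using prime_power_gen [OF sgrp_one card_gt_0_sgrp [OF sA fA] pow_card_eq_one [OF sA zA]] z(2) by blast
  obtain t where t: "prime t" "t \<noteq> p" "t dvd card A" using two_primes_A by blast
  have zi: "z ^ i \<in> center A" by (rule sgrp_pow [OF sgrp_cizer [OF sA] z(1)])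
  have "cj g (z ^ i) \<in> A" using sgrp_pow [OF sA z(3)] by (simp add: cj_pow)
  then have "cj g ` ppart A t = ppart A t" using ppart_conj_eq [OF g zi p(3,1,2) _ t(1,2)] by blast
  then have "g \<in> nizer G (ppart A t)" using g by (simp add: nizer_def)
  moreover have "nizer G (ppart A t) \<subseteq> nizer G A"
  proof (rule over_A [OF sgrp_nizer [OF sG] A_sub_nizer [OF t(1)] nizer_subset])
    obtain y where "y \<in> A" "pel t y" "y \<noteq> 1" using exists_pel [OF sA fA t(1,3)] .
    then have "ppart A t \<noteq> {1}" by (auto simp: ppart_def)
    then show "nizer G (ppart A t) \<noteq> G"
      using wielandt.nizer_proper [OF swap sgrp_ppart [OF sA fA nA t(1)] ppart_subset] by blast
  qed
  ultimately show ?thesis by blast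
qed

text \<open>Choose a Sylow subgroup of \<open>J\<close> containing \<open>z\<close> and conjugate it
  into \<open>A\<close> within \<open>G\<close>. The conjugate of \<open>z\<close> lies in
  \<open>A\<close>, so by \<open>center_conj\<close> the conjugating element normalises
  \<open>A\<close>, and the Sylow subgroup was inside \<open>A\<close> from the start.\<close>

lemma sylow_in_A:
  assumes J: "sgrp J" "J \<subseteq> G" and z: "z \<in> J" "z \<in> center A" "z \<noteq> 1" "pel p z" and p: "prime p" "p dvd card A"
  shows "sylow_sub p (ppart (J \<inter> A) p) J"
proof -
  have fJ: "finite J" by (rule finite_subset [OF J(2) fG])
  obtain S0 where S0: "sylow_sub p S0 J" using sylow_exists_sub [OF J(1) fJ p(1)] .
  let ?Z = "range (\<lambda>i. z ^ i)"
  have Z: "sgrp ?Z" "finite ?Z"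
    using sgrp_range_pow [OF pow_card_eq_one [OF J(1) z(1)] card_gt_0_sgrp [OF J(1) fJ]] by auto
  have ZJ: "?Z \<subseteq> J" using sgrp_pow [OF J(1) z(1)] by blast
  have "card ?Z = p ^ multiplicity p (card ?Z)"
    by (rule card_pgroup [OF Z p(1)]) (use z(4) pel_pow in auto)
  then obtain j where j: "j \<in> J" "cj j ` ?Z \<subseteq> S0"
    using sylow_conj [OF J(1) fJ p(1) S0 Z(1) ZJ] by metis
  define S where "S = cj (inverse j) ` S0"
  have "z ^ 1 \<in> ?Z" by blast
  then have "cj j z \<in> S0" using j(2) by auto
  then have zS: "z \<in> S" unfolding S_def by (metis cj_inv_cancel(1) image_eqI)
  have S0': "sgrp S0" "S0 \<subseteq> J" "card S0 = p ^ multiplicity p (card J)" using S0 by (auto simp: sylow_sub_def)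
  have S: "sgrp S" "card S = p ^ multiplicity p (card J)" unfolding S_def using S0' by (simp_all add: sgrp_cj)
  have SJ: "S \<subseteq> J" unfolding S_def using S0'(2) j(1) J(1) by (auto simp: sgrp_cj_mem sgrpD subset_iff)
  have sylG: "sylow_sub p (ppart A p) G"
    by (rule sylow_ppart [OF p sG _ subset_refl]) (use ppart_subset AG in blast)
  obtain g where g: "g \<in> G" "cj g ` S \<subseteq> ppart A p"
    using sylow_conj [OF sG fG p(1) sylG S(1) _ S(2)] SJ J(2) by (metis subset_trans)
  have "cj g z \<in> A" using g(2) zS ppart_subset by blast
  then have "g \<in> nizer G A" using center_conj [OF g(1) z(2,3)] by blast
  then have "cj (inverse g) ` A = A" by (simp add: nizer_def cj_image_fix_inverse)
  moreover have "cj g ` S \<subseteq> A" using g(2) ppart_subset by blast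
  ultimately have SA: "S \<subseteq> A" using cj_image_mono [of g S A] by simp
  have JA: "sgrp (J \<inter> A)" "finite (J \<inter> A)" "nilp (J \<inter> A)"
    using sgrp_Int [OF J(1) sA] fJ nilp_subset [OF nA] by auto
  have Sp: "S \<subseteq> ppart (J \<inter> A) p" using SJ SA pgroup_pel [OF S] by (auto simp: ppart_def)
  have "card (ppart (J \<inter> A) p) = p ^ multiplicity p (card (J \<inter> A))" by (rule card_ppart [OF JA p(1)])
  also have "\<dots> \<le> p ^ multiplicity p (card J)"
  proof -
    have "multiplicity p (card (J \<inter> A)) \<le> multiplicity p (card J)"
      using card_dvd_sgrp [OF J(1) JA(1) _ fJ] card_gt_0_sgrp [OF J(1) fJ] by (intro dvd_imp_multiplicity_le) auto
    then show ?thesis using prime_gt_0_nat [OF p(1)] by (simp add: power_increasing)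
  qed
  finally have "ppart (J \<inter> A) p = S"
    using card_seteq [OF finite_subset [OF ppart_subset JA(2)] Sp] S(2) by simp
  then show ?thesis using S SJ by (simp add: sylow_sub_def)
qed

lemma mult_le_of_sylow:
  assumes "sylow_sub p (ppart (J \<inter> A) p) J" "sgrp J" "J \<subseteq> G" "prime p"
  shows "p ^ multiplicity p (card J) dvd card (J \<inter> A)"
proof -
  have S: "sgrp (ppart (J \<inter> A) p)" "card (ppart (J \<inter> A) p) = p ^ multiplicity p (card J)"
    using assms(1) by (auto simp: sylow_sub_def)
  show ?thesis
    using card_dvd_sgrp [OF sgrp_Int [OF assms(2) sA] S(1) ppart_subset] fA unfolding S(2) by simp
qed

text \<open>By \<open>sylow_in_A\<close> and its mirror image the given central elements put a full
  Sylow subgroup of \<open>J\<close>, for each prime, into \<open>J \<inter> A\<close> or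
  \<open>J \<inter> B\<close>; the orders then agree prime by prime. Normalizers are often shown to
  factorise in this way.\<close>

lemma fac_of_centers:
  assumes J: "sgrp J" "J \<subseteq> G"
    and zA: "\<And>p. prime p \<Longrightarrow> p dvd card A \<Longrightarrow> \<exists>z\<in>J. z \<in> center A \<and> z \<noteq> 1 \<and> pel p z"
    and zB: "\<And>p. prime p \<Longrightarrow> p dvd card B \<Longrightarrow> \<exists>z\<in>J. z \<in> center B \<and> z \<noteq> 1 \<and> pel p z"
  shows "fac A B J"
proof -
  interpret S: wielandt G B A by (rule swap)
  have fJ: "finite J" by (rule finite_subset [OF J(2) fG])
  have JA: "sgrp (J \<inter> A)" and JB: "sgrp (J \<inter> B)" using sgrp_Int J(1) sA sB by auto
  have dA: "card (J \<inter> A) dvd card J" and dB: "card (J \<inter> B) dvd card J"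
    using card_dvd_sgrp [OF J(1) _ _ fJ] JA JB by auto
  have posJ: "card J > 0" by (rule card_gt_0_sgrp [OF J(1) fJ])
  have pos: "card (J \<inter> A) * card (J \<inter> B) > 0"
    using card_gt_0_sgrp JA JB fJ by auto
  have "coprime (card (J \<inter> A)) (card (J \<inter> B))"
  proof (rule coprime_nat_primeI)
    fix p :: nat assume p: "prime p" "p dvd card (J \<inter> A)" "p dvd card (J \<inter> B)"
    have "p dvd card A" "p dvd card B"
      using p card_dvd_sgrp [OF sA JA _ fA] card_dvd_sgrp [OF sB JB _ fB] dvd_trans by blast+
    then show False using coprime_prime_not_dvd [OF cop p(1)] by blast
  qed
  then have "card (J \<inter> A) * card (J \<inter> B) dvd card J" using dA dB by (simp add: divides_mult)
  moreover have "card J dvd card (J \<inter> A) * card (J \<inter> B)"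
  proof (rule dvd_sylowI [OF posJ pos])
    fix p :: nat assume p: "prime p"
    consider "p dvd card A" | "p dvd card B" | "\<not> p dvd card J"
    proof -
      have "card J dvd card A * card B"
        using card_dvd_sgrp [OF sG J fG] facG AG BG by (simp add: fac_def Int_absorb1)
      then show ?thesis using that p by (metis dvd_trans prime_dvd_mult_iff)
    qed
    then show "p ^ multiplicity p (card J) dvd card (J \<inter> A) * card (J \<inter> B)"
    proof cases
      case 1
      then obtain z where z: "z \<in> J" "z \<in> center A" "z \<noteq> 1" "pel p z" using zA p by blast
      show ?thesis by (rule dvd_mult2) (rule mult_le_of_sylow [OF sylow_in_A [OF J z p 1] J p])
    next
      case 2
      then obtain z where z: "z \<in> J" "z \<in> center B" "z \<noteq> 1" "pel p z" using zB p by blast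
      show ?thesis by (rule dvd_mult) (rule S.mult_le_of_sylow [OF S.sylow_in_A [OF J z p 2] J p])
    next
      case 3
      then show ?thesis by (simp add: not_dvd_imp_multiplicity_0)
    qed
  qed
  ultimately show ?thesis using J(1) by (simp add: fac_def dvd_antisym)
qed

text \<open>As \<open>G = B A\<close> and \<open>A\<close> normalises its \<open>p\<close>-part,
  some \<open>b\<close> in \<open>B\<close> conjugates \<open>R\<close> to a subgroup
  \<open>Q\<close> of \<open>A\<close>. The normalizer of \<open>Q\<close> contains the centres of
  \<open>A\<close> and \<open>B\<close>, so it factorises; it also contains the
  \<open>s\<close>-part of \<open>B\<close> and a \<open>t\<close>-part of \<open>A\<close> with
  \<open>t \<noteq> p\<close>, against \<open>no_two_sylows\<close>.\<close>

lemma no_invariant_pgroup: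
  assumes p: "prime p" "p dvd card A" and R: "sgrp R" "R \<subseteq> G" "\<And>x. x \<in> R \<Longrightarrow> pel p x" "R \<noteq> {1}"
    and s: "prime s" "s dvd card B" and N: "center B \<subseteq> nizer G R" "ppart B s \<subseteq> nizer G R"
  shows False
proof -
  interpret S: wielandt G B A by (rule swap)
  have fR: "finite R" by (rule finite_subset [OF R(2) fG])
  have cR: "card R = p ^ multiplicity p (card R)" by (rule card_pgroup [OF R(1) fR p(1) R(3)])
  have sylG: "sylow_sub p (ppart A p) G"
    by (rule sylow_ppart [OF p sG _ subset_refl]) (use ppart_subset AG in blast)
  obtain g where g: "g \<in> G" "cj g ` R \<subseteq> ppart A p"
    using sylow_conj [OF sG fG p(1) sylG R(1,2) cR] by metis
  obtain b a where ba: "b \<in> B" "a \<in> A" "g = b * a" using S.decompose [OF g(1)] by blast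
  define Q where "Q = cj b ` R"
  have "cj (inverse a) ` ppart A p = ppart A p"
  proof -
    have "a \<in> nizer G (ppart A p)" using A_sub_nizer [OF p(1)] ba(2) by blast
    then show ?thesis by (simp add: nizer_def cj_image_fix_inverse)
  qed
  moreover have "cj a ` Q \<subseteq> ppart A p" using g(2) by (simp add: Q_def cj_image_cj ba(3))
  ultimately have Qp: "Q \<subseteq> ppart A p" using cj_image_mono [of a Q] by simp
  have Q: "sgrp Q" "Q \<subseteq> A" "Q \<noteq> {1}"
  proof -
    show "sgrp Q" unfolding Q_def by (rule sgrp_cj [OF R(1)])
    show "Q \<subseteq> A" using Qp ppart_subset by blast
    obtain x where "x \<in> R" "x \<noteq> 1" using R(1,4) sgrpD(1) by blast
    then have "cj b x \<in> Q" "cj b x \<noteq> 1" by (simp_all add: Q_def)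
    then show "Q \<noteq> {1}" by blast
  qed
  let ?J = "nizer G Q"
  have bG: "b \<in> G" using ba(1) BG by blast
  have move: "cj b x \<in> ?J" if x: "x \<in> nizer G R" for x
  proof -
    have "cj (cj b x) ` Q = cj b ` cj x ` R"
      unfolding Q_def by (simp add: cj_image_cj) (simp add: cj_def grp_simps)
    also have "\<dots> = Q" using x by (simp add: nizer_def Q_def)
    finally show ?thesis using x bG sG by (simp add: nizer_def sgrp_cj_mem)
  qed
  have J: "sgrp ?J" "?J \<subseteq> G" "?J \<noteq> G"
    by (rule sgrp_nizer [OF sG], rule nizer_subset, rule S.nizer_proper [OF Q])
  have cB: "x \<in> ?J" if "x \<in> center B" for x
  proof -
    have "cj b x = x" using that ba(1) by (auto simp: cizer_def cj_fix_iff)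
    then show ?thesis using move [of x] that N(1) by auto
  qed
  have pB: "ppart B s \<subseteq> ?J"
  proof
    fix x assume x: "x \<in> ppart B s"
    then have "cj (inverse b) x \<in> ppart B s" using ba(1) sB by (simp add: ppart_def sgrp_cj_mem sgrpD)
    then have "cj b (cj (inverse b) x) \<in> ?J" using move N(2) by blast
    then show "x \<in> ?J" by simp
  qed
  have pA: "ppart A t \<subseteq> ?J" if "prime t" "t \<noteq> p" for t
    by (rule S.ppart_sub_nizer [OF Q(2) _ p(1) that]) (use Qp in \<open>auto simp: ppart_def\<close>)
  have cA: "x \<in> ?J" if "x \<in> center A" for x
  proof -
    have "cj x y = y" if "y \<in> Q" for y using that Q(2) \<open>x \<in> center A\<close> by (auto simp: cizer_def cj_fix_iff)
    then show ?thesis using that AG by (auto simp: nizer_def cizer_def)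
  qed
  have "fac A B ?J"
  proof (rule fac_of_centers [OF J(1,2)])
    show "\<exists>z\<in>?J. z \<in> center A \<and> z \<noteq> 1 \<and> pel t z" if "prime t" "t dvd card A" for t
      using exists_center [OF that] cA by metis
    show "\<exists>z\<in>?J. z \<in> center B \<and> z \<noteq> 1 \<and> pel t z" if "prime t" "t dvd card B" for t
      using S.exists_center [OF that] cB by metis
  qed
  moreover obtain t where t: "prime t" "t \<noteq> p" "t dvd card A" using two_primes_A by blast
  ultimately show False using no_two_sylows [OF _ J(2,3) t(1,3) pA [OF t(1,2)] s pB] by blast
qed

end

lemma card_conjugates_dvd:
  assumes "sgrp R" "finite R"
  shows "card ((\<lambda>r. cj (inverse r) ` X) ` R) dvd card R"
  using orbit_stabilizer [of R "\<lambda>r Y. cj (inverse r) ` Y" X, OF assms]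
  by (metis (no_types, lifting) cj_image_cj cj_image_inv(2) cj_one(1) dvd_triv_right image_ident inverse_mult_grp inverse_one_grp image_cong)

section \<open>Centralizers of arbitrary elements of a factor\<close>

context wielandt
begin

text \<open>The normalizer of \<open>T\<close> factorises because the commutators that arise lie in
  \<open>A \<inter> B\<close>. Its core in \<open>A\<close> is trivial by
  \<open>no_invariant_pgroup\<close>. Were its core in \<open>B\<close> a \<open>q\<close>-group, an
  \<open>r\<close>-element of \<open>B\<close> would centralise both cores and thus lie in that
  core. So the core has a part for another prime, whose normalizer is a proper subgroup containing
  \<open>B\<close>, and \<open>over_A\<close> applies to it.\<close>

lemma normalizer_in_nizer_B:
  assumes T: "sgrp T" "T \<subseteq> nizer G A" "T \<subseteq> B" "T \<noteq> {1}" and q: "prime q" "\<And>t. t \<in> T \<Longrightarrow> pel q t"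
  shows "nizer G T \<subseteq> nizer G B"
proof -
  interpret S: wielandt G B A by (rule swap)
  let ?N = "nizer G T"
  have N: "sgrp ?N" "?N \<subseteq> G" "?N \<noteq> G"
    by (rule sgrp_nizer [OF sG], rule nizer_subset, rule nizer_proper [OF T(1,3,4)])
  have fN: "finite ?N" by (rule finite_subset [OF N(2) fG])
  have facN: "fac A B ?N"
  proof (rule facI [OF N(1) fN sA sB])
    show "A \<inter> B = {1}" by (rule coprime_Int_trivial [OF sA sB fA fB cop])
    fix g assume g: "g \<in> ?N"
    then obtain x y where xy: "x \<in> A" "y \<in> B" "g = x * y" using decompose N(2) by blast
    have gT: "cj g ` T = T" using g by (auto simp: nizer_def)
    have "cj x t = t" if t: "t \<in> T" for t
    proof -
      have "cj g t \<in> B" using gT t T(3) by blast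
      moreover have "cj x t = cj (inverse y) (cj g t)" unfolding xy(3) by (simp add: cj_cj grp_simps)
      ultimately have "cj x t \<in> B" using xy(2) sB by (simp add: sgrp_cj_mem sgrpD)
      then have 1: "inverse t * cj x t \<in> B" using t T(3) sB by (auto simp: sgrpD)
      have "cj t (inverse x) \<in> A" using normal_inD(3) [OF A_nizer(5)] t T(2) xy(1) sA by (auto simp: sgrpD)
      moreover have "inverse t * cj x t = cj t (inverse x) * x" by (simp add: cj_def grp_simps)
      ultimately have "inverse t * cj x t \<in> A" using xy(1) sA by (simp add: sgrpD)
      then have "inverse t * cj x t = 1" using 1 AB1 by blast
      then have "t * (inverse t * cj x t) = t" by simp
      then show ?thesis by (simp add: grp_simps)
    qed
    then have "x \<in> ?N" using xy(1) AG by (auto simp: nizer_def)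
    moreover from this have "y \<in> ?N" using g N(1) xy(3) sgrp_mult_left_iff by blast
    ultimately show "\<exists>x\<in>?N \<inter> A. \<exists>y\<in>?N \<inter> B. g = x * y" using xy by blast
  qed
  have pB: "ppart B r \<subseteq> ?N" if "prime r" "r \<noteq> q" for r
    by (rule ppart_sub_nizer [OF T(3) q(2,1) that])
  have cB: "center B \<subseteq> ?N"
  proof
    fix z assume z: "z \<in> center B"
    have "cj z t = t" if "t \<in> T" for t using z that T(3) by (auto simp: cizer_def cj_fix_iff)
    then show "z \<in> ?N" using z BG by (auto simp: nizer_def cizer_def)
  qed
  obtain r where r: "prime r" "r \<noteq> q" "r dvd card B" using two_primes_B by blast
  have cA: "core ?N A \<subseteq> A" and cBB: "core ?N B \<subseteq> B" using core_subset [OF N(1)] by blast+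
  note nA' = core_normal [OF N(1) sA] and nB' = core_normal [OF N(1) sB]
  have coreA: "core ?N A = {1}"
  proof (rule ccontr)
    assume "core ?N A \<noteq> {1}"
    then obtain p where p: "prime p" "ppart (core ?N A) p \<noteq> {1}"
      using ppart_eq_one [OF normal_inD(1) [OF nA'] finite_subset [OF cA fA]] by metis
    let ?R = "ppart (core ?N A) p"
    have R: "normal_in ?R ?N"
      by (rule normal_in_ppart [OF nA' finite_subset [OF cA fA] nilp_subset [OF nA cA] p(1)])
    have RN: "?N \<subseteq> nizer G ?R" using normal_in_image [OF R N(1)] N(2) by (auto simp: nizer_def)
    have "p dvd card A"
    proof (rule ccontr)
      assume np: "\<not> p dvd card A"
      have "x = 1" if "x \<in> ?R" for x
        using that pel_imp_one [OF p(1) _ pow_card_eq_one [OF sA] np] cA by (auto simp: ppart_def)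
      then show False using p(2) sgrpD(1) [OF normal_inD(1) [OF R]] by blast
    qed
    moreover have "?R \<subseteq> G" using normal_inD(2) [OF R] N(2) by (rule subset_trans)
    moreover have "pel p x" if "x \<in> ?R" for x using that by (simp add: ppart_def)
    moreover have "center B \<subseteq> nizer G ?R" using cB RN by (rule subset_trans)
    moreover have "ppart B r \<subseteq> nizer G ?R" using pB [OF r(1,2)] RN by (rule subset_trans)
    ultimately show False
      using no_invariant_pgroup [OF p(1) _ normal_inD(1) [OF R] _ _ p(2) r(1,3)] by blast
  qed
  show ?thesis
  proof (cases "\<forall>s. prime s \<longrightarrow> s \<noteq> q \<longrightarrow> ppart (core ?N B) s = {1}")
    case True
    obtain b where b: "b \<in> B" "pel r b" "b \<noteq> 1" using exists_pel [OF sB fB r(1,3)] .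
    have bN: "b \<in> ?N" using pB [OF r(1,2)] b by (auto simp: ppart_def)
    have sc: "sgrp (core ?N B)" by (rule normal_inD(1) [OF nB'])
    have "core ?N B \<subseteq> cizer (core ?N B) {b}"
    proof (rule sgrp_prime_power_gen [OF sgrp_cizer [OF sc] sc finite_subset [OF cBB fB]])
      fix s x assume s: "prime s" "x \<in> core ?N B" "pel s x"
      show "x \<in> cizer (core ?N B) {b}"
      proof (cases "s = q")
        case True
        then show ?thesis using nilpD [OF nB, of x b q r] s b cBB q(1) r by (auto simp: cizer_def)
      next
        case False
        then have "x \<in> ppart (core ?N B) s" using s by (simp add: ppart_def)
        then have "x = 1" using True s(1) False by simp
        then show ?thesis using s(2) by (simp add: cizer_def)
      qed
    qed
    then have "b \<in> cizer ?N (core ?N B)" using bN by (auto simp: cizer_def)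
    moreover have "b \<in> cizer ?N (core ?N A)" unfolding coreA using bN by (simp add: cizer_def)
    ultimately obtain eA eB where "eA \<in> core ?N A" "eB \<in> core ?N B" "b = eA * eB"
      using fac_bicentralizer_split [OF facN fN solvJ [OF facN N(2,3)] sA fA sB fB cop] by metis
    then have "b \<in> core ?N B" using coreA by simp
    then have "b \<in> ppart (core ?N B) r" using b(2) by (simp add: ppart_def)
    then show ?thesis using True r(1,2) b(3) by simp
  next
    case False
    then obtain s where s: "prime s" "s \<noteq> q" "ppart (core ?N B) s \<noteq> {1}" by blast
    then obtain N' where N': "sgrp N'" "N' \<subseteq> G" "N' \<noteq> G" "B \<subseteq> N'" "?N \<subseteq> N'"
      using S.core_ppart_normalizer [of ?N s] facN N(2) pB by (auto simp: fac_commute)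
    then show ?thesis using S.over_A [OF N'(1,4,2,3)] by blast
  qed
qed

text \<open>Modulo \<open>A\<close> the element \<open>v\<close> equals its factor \<open>y\<close>
  from \<open>B\<close>. A \<open>q\<close>-power of \<open>y\<close> then lies in
  \<open>A \<inter> B\<close>, so \<open>y\<close> is a \<open>q\<close>-element of \<open>B\<close>
  and hence trivial.\<close>

lemma prime_power_in_nizer_A:
  assumes v: "v \<in> nizer G A" "prime q" "pel q v" "\<not> q dvd card B"
  shows "v \<in> A"
proof -
  obtain x y where xy: "x \<in> A" "y \<in> B" "v = x * y" using decompose v(1) A_nizer(3) by blast
  have y: "y \<in> nizer G A" using v(1) xy A_nizer(1,2) sgrp_mult_left_iff by blast
  obtain k where k: "v ^ (q ^ k) = 1" using v(3) by (auto simp: pel_def)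
  obtain f where f: "f \<in> A" "(x * y) ^ (q ^ k) = f * y ^ (q ^ k)"
    using normal_pow [OF A_nizer(5,1) y xy(1)] by blast
  then have "inverse f = y ^ (q ^ k)" using k xy(3) by (metis inverse_unique_grp)
  then have "y ^ (q ^ k) \<in> A" using sgrpD(3) [OF sA f(1)] by simp
  then have "y ^ (q ^ k) = 1" using AB1 sgrp_pow [OF sB xy(2)] by blast
  then have "y = 1" using pel_imp_one [OF v(2) _ pow_card_eq_one [OF sB xy(2)] v(4)] by (auto simp: pel_def)
  then show ?thesis using xy by simp
qed

text \<open>Sylow conjugacy in the normalizer of \<open>A\<close> moves \<open>v\<close> into
  \<open>B\<close> while \<open>x\<close> stays in \<open>A\<close>. Two applications of
  \<open>normalizer_in_nizer_B\<close> follow: the one to the powers of \<open>v'\<close> shows that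
  \<open>x'\<close> normalises \<open>B\<close>, and the mirrored one to the powers of
  \<open>x'\<close> gives the claim up to conjugation.\<close>

lemma centralizer_in_nizer_A_1:
  assumes x: "x \<in> A" "x \<noteq> 1" "prime p" "pel p x"
    and v: "v \<in> cizer G {x}" "v \<in> nizer G A" "v \<noteq> 1" "prime q" "pel q v" "q dvd card B"
  shows "cizer G {x} \<subseteq> nizer G A"
proof -
  interpret S: wielandt G B A by (rule swap)
  let ?M = "nizer G A"
  have fM: "finite ?M" by (rule finite_subset [OF A_nizer(3) fG])
  have facM: "fac A B ?M" by (rule fac_superset [OF A_nizer(1-3)])
  have MB: "sgrp (?M \<inter> B)" "finite (?M \<inter> B)" "nilp (?M \<inter> B)"
    using sgrp_Int [OF A_nizer(1) sB] fM nilp_subset [OF nB] by auto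
  have "\<not> q dvd card A" using coprime_prime_not_dvd [OF cop v(4,6)] .
  then have "multiplicity q (card ?M) = multiplicity q (card (?M \<inter> B))"
    using facM A_nizer(2) card_gt_0_sgrp [OF sA fA] card_gt_0_sgrp [OF MB(1,2)] v(4)
    by (simp add: fac_def Int_absorb1 prime_elem_multiplicity_mult_distrib not_dvd_imp_multiplicity_0)
  then have syl: "sylow_sub q (ppart (?M \<inter> B) q) ?M"
    using sgrp_ppart [OF MB v(4)] card_ppart [OF MB v(4)] by (auto simp: sylow_sub_def ppart_def)
  let ?V = "range (\<lambda>i. v ^ i)"
  have V: "sgrp ?V" "finite ?V"
    using sgrp_range_pow [OF pow_card_eq_one [OF A_nizer(1) v(2)] card_gt_0_sgrp [OF A_nizer(1) fM]] by auto
  have "card ?V = q ^ multiplicity q (card ?V)"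
    by (rule card_pgroup [OF V v(4)]) (use v(5) pel_pow in auto)
  then obtain n where n: "n \<in> ?M" "cj n ` ?V \<subseteq> ppart (?M \<inter> B) q"
    using sylow_conj [OF A_nizer(1) fM v(4) syl V(1)] sgrp_pow [OF A_nizer(1) v(2)] by blast
  have nG: "n \<in> G" using n(1) A_nizer(3) by blast
  define x' where "x' = cj n x"
  define v' where "v' = cj n v"
  have x': "x' \<in> A" "x' \<noteq> 1" "pel p x'"
    unfolding x'_def using normal_inD(3) [OF A_nizer(5) n(1) x(1)] x by auto
  have "v ^ 1 \<in> ?V" by blast
  then have "v' \<in> ppart (?M \<inter> B) q" unfolding v'_def using n(2) by auto
  then have v': "v' \<in> ?M" "v' \<in> B" "v' \<noteq> 1" "pel q v'"
    unfolding v'_def using v(3) by (auto simp: ppart_def)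
  have "cj n (v * x) = cj n (x * v)" using v(1) by (simp add: cizer_def)
  then have vx: "v' * x' = x' * v'" by (simp add: v'_def x'_def cj_mult)
  let ?T = "range (\<lambda>i. v' ^ i)" and ?X = "range (\<lambda>i. x' ^ i)"
  have one: "range (\<lambda>i. y ^ i) \<noteq> {1}" if "y \<noteq> 1" for y :: 'a
  proof -
    have "y ^ 1 \<in> range (\<lambda>i. y ^ i)" by blast
    then show ?thesis using that by auto
  qed
  have T: "sgrp ?T"
    using sgrp_range_pow(1) [OF pow_card_eq_one [OF sB v'(2)] card_gt_0_sgrp [OF sB fB]] .
  have X: "sgrp ?X"
    using sgrp_range_pow(1) [OF pow_card_eq_one [OF sA x'(1)] card_gt_0_sgrp [OF sA fA]] .
  have "nizer G ?T \<subseteq> nizer G B"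
    by (rule normalizer_in_nizer_B [OF T _ _ one [OF v'(3)] v(4)])
      (use sgrp_pow [OF A_nizer(1) v'(1)] sgrp_pow [OF sB v'(2)] pel_pow [OF v'(4)] in auto)
  moreover have "x' \<in> cizer G {v'}" using x'(1) AG vx by (auto simp: cizer_def)
  ultimately have x'B: "x' \<in> nizer G B" using cizer_sub_nizer_pow by blast
  have "nizer G ?X \<subseteq> ?M"
    by (rule S.normalizer_in_nizer_B [OF X _ _ one [OF x'(2)] x(3)])
      (use sgrp_pow [OF S.A_nizer(1) x'B] sgrp_pow [OF sA x'(1)] pel_pow [OF x'(3)] in auto)
  then have c': "cizer G {x'} \<subseteq> ?M" using cizer_sub_nizer_pow by blast
  show ?thesis
  proof
    fix g assume "g \<in> cizer G {x}"
    then have "cj n g \<in> cizer G {x'}" unfolding x'_def cizer_cj [OF sG nG] by blast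
    then show "g \<in> ?M" using c' sgrp_cj_mem_iff [OF A_nizer(1) n(1)] by blast
  qed
qed

text \<open>If \<open>C(x)\<close> meets \<open>N(A)\<close> only inside \<open>A\<close>, then \<open>C(x) \<inter> A\<close> controls its own fusion in \<open>C(x)\<close>, so transfer
  gives a normal complement; Frattini's argument applied to one of its Sylow subgroups produces a subgroup
  excluded by \<open>no_invariant_pgroup\<close>.\<close>

lemma centralizer_in_nizer_A:
  assumes x: "x \<in> A" "x \<noteq> 1" "prime p" "pel p x"
  shows "cizer G {x} \<subseteq> nizer G A"
proof (cases "\<exists>v q. v \<in> cizer G {x} \<and> v \<in> nizer G A \<and> v \<noteq> 1 \<and> prime q \<and> pel q v \<and> q dvd card B")
  case True
  then show ?thesis using centralizer_in_nizer_A_1 [OF x] by blast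
next
  case False
  interpret S: wielandt G B A by (rule swap)
  let ?J = "cizer G {x}" let ?H = "?J \<inter> A"
  have J: "sgrp ?J" "?J \<subseteq> G" by (rule sgrp_cizer [OF sG], rule cizer_subset)
  have fJ: "finite ?J" by (rule finite_subset [OF J(2) fG])
  have H: "sgrp ?H" "finite ?H" "nilp ?H" "?H \<subseteq> ?J"
    using sgrp_Int [OF J(1) sA] fJ nilp_subset [OF nA] by auto
  have posH: "card ?H > 0" "card ?J > 0" using card_gt_0_sgrp H J(1) fJ by blast+
  have dH: "card ?H dvd card A" by (rule card_dvd_sgrp [OF sA H(1) _ fA]) simp
  \<comment> \<open>In the remaining case the only primes left for elements of this intersection do
    not divide \<open>card B\<close>, so \<open>prime_power_in_nizer_A\<close> applies.\<close>
  have JM: "?J \<inter> nizer G A \<subseteq> A"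
  proof (rule sgrp_prime_power_gen [OF sA sgrp_Int [OF J(1) A_nizer(1)]])
    show "finite (?J \<inter> nizer G A)" using fJ by simp
    fix q v assume "prime q" "v \<in> ?J \<inter> nizer G A" "pel q v"
    then show "v \<in> A" using False prime_power_in_nizer_A [of v q] sgrpD(1) [OF sA] by blast
  qed
  have cJ: "center A \<subseteq> ?J" using x(1) AG by (auto simp: cizer_def)
  have syl: "sylow_sub t (ppart ?H t) ?J" if t: "prime t" "t dvd card A" for t
  proof -
    obtain z where "z \<in> center A" "z \<noteq> 1" "pel t z" using exists_center [OF t] .
    then show ?thesis using sylow_in_A [OF J _ _ _ _ t] cJ by blast
  qed
  have hall: "coprime (card ?H) (card ?J div card ?H)"
  proof (rule coprime_nat_primeI)
    fix t :: nat assume t: "prime t" "t dvd card ?H" "t dvd card ?J div card ?H"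
    obtain m where m: "card ?J = card ?H * m" using card_dvd_sgrp [OF J(1) H(1,4) fJ] by (auto simp: dvd_def)
    have "t dvd m" using t(3) posH(1) by (simp add: m)
    moreover have "m > 0" using posH(2) m by (metis mult_0_right neq0_conv)
    ultimately have "multiplicity t (card ?J) > multiplicity t (card ?H)"
      using t(1) posH by (simp add: m prime_elem_multiplicity_mult_distrib multiplicity_pos_iff)
    moreover have "t ^ multiplicity t (card ?J) dvd card ?H"
      by (rule mult_le_of_sylow [OF syl [OF t(1)] J t(1)]) (use t(2) dH dvd_trans in blast)
    then have "multiplicity t (card ?J) \<le> multiplicity t (card ?H)"
      using posH(1) t(1) by (intro multiplicity_geI) (auto simp: not_prime_unit)
    ultimately show False by simp
  qed
  \<comment> \<open>For a prime \<open>t \<noteq> s\<close> the \<open>t\<close>-part of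
    \<open>?H\<close> and its conjugate by \<open>k\<close> both centralise \<open>cj k u\<close>,
    so some \<open>c\<close> centralising \<open>cj k u\<close> returns the conjugate to the
    original. Then \<open>k * c\<close> conjugates a central element of \<open>A\<close> into
    \<open>A\<close>, hence normalises \<open>A\<close> and lies in \<open>?H\<close>.\<close>
  have fusion: "\<exists>h\<in>?H. cj k u = cj h u"
    if u: "prime s" "u \<in> ?H" "pel s u" and k: "k \<in> ?J" "cj k u \<in> ?H" for s u k
  proof -
    obtain t where t: "prime t" "t \<noteq> s" "t dvd card A" using two_primes_A by blast
    obtain z where z: "z \<in> center A" "z \<noteq> 1" "pel t z" "z \<in> A" using exists_center [OF t(1,3)] .
    let ?P = "ppart ?H t" and ?D = "cizer ?J {cj k u}"
    have P: "sgrp ?P" "?P \<subseteq> ?J" "card ?P = t ^ multiplicity t (card ?J)"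
      using syl [OF t(1,3)] by (auto simp: sylow_sub_def)
    have zP: "z \<in> ?P" using z cJ by (auto simp: ppart_def)
    have D: "sgrp ?D" "?D \<subseteq> ?J" by (rule sgrp_cizer [OF J(1)], rule cizer_subset)
    have fD: "finite ?D" by (rule finite_subset [OF D(2) fJ])
    have comm: "y * w = w * y" if "y \<in> ?P" "w \<in> A" "pel s w" for y w
      using nilpD [OF nA _ that(2) t(1) u(1) t(2) _ that(3)] that(1) by (auto simp: ppart_def)
    have PD: "?P \<subseteq> ?D"
    proof
      fix y assume y: "y \<in> ?P"
      have "y * cj k u = cj k u * y" by (rule comm [OF y]) (use k u in auto)
      then show "y \<in> ?D" using y P(2) by (auto simp: cizer_def)
    qed
    have kPD: "cj k ` ?P \<subseteq> ?D"
    proof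
      fix w assume "w \<in> cj k ` ?P"
      then obtain y where y: "y \<in> ?P" "w = cj k y" by blast
      have "y * u = u * y" by (rule comm [OF y(1)]) (use u in auto)
      then have "cj k (y * u) = cj k (u * y)" by simp
      then have "w * cj k u = cj k u * w" by (simp add: y(2) cj_mult)
      moreover have "w \<in> ?J" unfolding y(2) by (rule sgrp_cj_mem [OF J(1) k(1)]) (use y(1) P(2) in blast)
      ultimately show "w \<in> ?D" by (simp add: cizer_def)
    qed
    have "multiplicity t (card ?D) = multiplicity t (card ?J)"
    proof (rule antisym)
      show "multiplicity t (card ?D) \<le> multiplicity t (card ?J)"
        by (rule dvd_imp_multiplicity_le) (use card_dvd_sgrp [OF J(1) D fJ] posH(2) in auto)
      show "multiplicity t (card ?J) \<le> multiplicity t (card ?D)"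
        using card_dvd_sgrp [OF D(1) P(1) PD fD] card_gt_0_sgrp [OF D(1) fD] t(1)
        unfolding P(3) by (intro multiplicity_geI) (auto simp: not_prime_unit)
    qed
    then have "sylow_sub t ?P ?D" using P PD by (simp add: sylow_sub_def)
    moreover have "card (cj k ` ?P) = t ^ multiplicity t (card ?J)" using P(3) by simp
    ultimately obtain c where c: "c \<in> ?D" "cj c ` cj k ` ?P \<subseteq> ?P"
      using sylow_conj [OF D(1) fD t(1) _ sgrp_cj [OF P(1)] kPD] by metis
    have kcJ: "k * c \<in> ?J" using k(1) c(1) D(2) J(1) by (blast intro: sgrpD(2))
    have "cj (k * c) z \<in> ?P" using c(2) zP by (metis cj_image_cj image_subset_iff)
    then have "k * c \<in> nizer G A"
      using center_conj [of "k * c" z] z(1,2) kcJ J(2) by (auto simp: ppart_def)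
    then have "k * c \<in> ?H" using JM kcJ by blast
    moreover have "cj (k * c) u = cj k u"
      using c(1) cj_cj [of c k u] by (simp add: cizer_iff_cj)
    ultimately show ?thesis by metis
  qed
  obtain R where R: "normal_in R ?J" "R * ?H = ?J" "R \<inter> ?H = {1}"
    by (rule nilp_hall_complement [OF J(1) fJ H(1,4,3) hall fusion])
  note R' = normal_inD [OF R(1)]
  have fR: "finite R" by (rule finite_subset [OF R'(2) fJ])
  show ?thesis
  proof (cases "R = {1}")
    case True
    then have "?J \<subseteq> A" using R(2) by (auto simp: mem_mult_iff)
    then show ?thesis using A_nizer(2) by blast
  next
    case False
    \<comment> \<open>A non-trivial \<open>t\<close>-element of \<open>R\<close> would be conjugate
      in \<open>?J\<close> into the Sylow subgroup inside \<open>?H\<close>, although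
      \<open>R\<close> is normal and meets \<open>?H\<close> trivially.\<close>
    have RA: "\<not> t dvd card R" if t: "prime t" "t dvd card A" for t
    proof
      assume "t dvd card R"
      then obtain y where y: "y \<in> R" "pel t y" "y \<noteq> 1" using exists_pel [OF R'(1) fR t(1)] by metis
      let ?Y = "range (\<lambda>i. y ^ i)"
      have Y: "sgrp ?Y" "finite ?Y"
        using sgrp_range_pow [OF pow_card_eq_one [OF R'(1) y(1)] card_gt_0_sgrp [OF R'(1) fR]] by auto
      have YJ: "?Y \<subseteq> ?J" using sgrp_pow [OF R'(1) y(1)] R'(2) by blast
      have "card ?Y = t ^ multiplicity t (card ?Y)"
        by (rule card_pgroup [OF Y t(1)]) (use y(2) pel_pow in auto)
      then obtain j where j: "j \<in> ?J" "cj j ` ?Y \<subseteq> ppart ?H t"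
        using sylow_conj [OF J(1) fJ t(1) syl [OF t] Y(1) YJ] by metis
      have "y ^ 1 \<in> ?Y" by blast
      then have "cj j y \<in> ppart ?H t" using j(2) by auto
      then have "cj j y \<in> R \<inter> ?H" using R'(3) [OF j(1) y(1)] ppart_subset by blast
      then show False using R(3) y(3) by auto
    qed
    obtain p2 where p2: "prime p2" "p2 \<noteq> p" "p2 dvd card A" using two_primes_A by blast
    let ?P = "ppart A p2"
    have PJ: "?P \<subseteq> ?J"
    proof
      fix y assume y: "y \<in> ?P"
      then have "y * x = x * y" using nilpD [OF nA _ x(1) p2(1) x(3) p2(2) _ x(4)] by (auto simp: ppart_def)
      then show "y \<in> ?J" using y AG by (auto simp: cizer_def ppart_def)
    qed
    have P: "sgrp ?P" "card ?P = p2 ^ multiplicity p2 (card A)"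
      using sgrp_ppart [OF sA fA nA p2(1)] card_ppart [OF sA fA nA p2(1)] by auto
    have PH: "?P \<subseteq> ?H" using PJ ppart_subset by blast
    obtain q where q: "prime q" "q dvd card R"
    proof -
      have "card R \<noteq> 1" using False sgrpD(1) [OF R'(1)] by (auto simp: card_1_singleton_iff)
      then show ?thesis using that prime_factor_nat by blast
    qed
    have qB: "q dvd card B"
    proof -
      have "card R dvd card G" using card_dvd_sgrp [OF sG R'(1) _ fG] R'(2) J(2) by blast
      then have "q dvd card A * card B" using q(2) facG AG BG dvd_trans by (auto simp: fac_def Int_absorb1)
      then show ?thesis using q RA prime_dvd_mult_iff by blast
    qed
    obtain Q0 where Q0: "sylow_sub q Q0 R" using sylow_exists_sub [OF R'(1) fR q(1)] .
    have Q0': "sgrp Q0" "Q0 \<subseteq> R" "card Q0 = q ^ multiplicity q (card R)" using Q0 by (auto simp: sylow_sub_def)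
    have conjR: "\<exists>r\<in>R. Q = cj (inverse r) ` Q0" if Q: "sylow_sub q Q R" for Q
    proof -
      have Q': "sgrp Q" "Q \<subseteq> R" "card Q = q ^ multiplicity q (card R)" using Q by (auto simp: sylow_sub_def)
      obtain r where r: "r \<in> R" "cj r ` Q \<subseteq> Q0" using sylow_conj [OF R'(1) fR q(1) Q0 Q'] .
      have "cj r ` Q = Q0" by (rule card_subset_eq) (use r(2) Q0' Q'(3) fR finite_subset in auto)
      then have "Q = cj (inverse r) ` Q0" by auto
      with r(1) show ?thesis by blast
    qed
    have sylR: "sylow_sub q (cj g ` Q) R" if Q: "sylow_sub q Q R" and g: "g \<in> ?J" for Q g
      using Q R'(3) [OF g] by (auto simp: sylow_sub_def sgrp_cj)
    let ?W = "(\<lambda>r. cj (inverse r) ` Q0) ` R"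
    have W_iff: "Q \<in> ?W \<longleftrightarrow> sylow_sub q Q R" for Q
    proof
      assume "Q \<in> ?W"
      then obtain r where r: "r \<in> R" "Q = cj (inverse r) ` Q0" by blast
      have "inverse r \<in> ?J" using sgrpD(3) [OF R'(1) r(1)] R'(2) by blast
      then show "sylow_sub q Q R" unfolding r(2) by (rule sylR [OF Q0])
    next
      assume "sylow_sub q Q R"
      then show "Q \<in> ?W" using conjR by blast
    qed
    \<comment> \<open>The \<open>p2\<close>-part of \<open>A\<close> acts on the Sylow
      \<open>q\<close>-subgroups of \<open>R\<close>. Their number divides \<open>card R\<close> and
      is prime to \<open>p2\<close>, so one of them is invariant.\<close>
    have "[card {Q \<in> ?W. \<forall>g\<in>?P. cj (inverse g) ` Q = Q} = card ?W] (mod p2)"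
    proof (rule pgroup_fixed_points [OF P p2(1)])
      show "finite ?W" using fR by simp
      show "cj (inverse g) ` Q \<in> ?W" if "g \<in> ?P" "Q \<in> ?W" for g Q
        using that sylR [of Q "inverse g"] PJ sgrpD(3) [OF J(1)] unfolding W_iff by blast
    qed (simp_all add: cj_image_cj grp_simps)
    moreover have "\<not> p2 dvd card ?W"
      using card_conjugates_dvd [OF R'(1) fR, of Q0] RA [OF p2(1,3)] dvd_trans by blast
    ultimately have "card {Q \<in> ?W. \<forall>g\<in>?P. cj (inverse g) ` Q = Q} \<noteq> 0"
      by (metis cong_dvd_nat cong_sym dvd_0_right)
    then have "{Q \<in> ?W. \<forall>g\<in>?P. cj (inverse g) ` Q = Q} \<noteq> {}" by (metis card.empty)
    then obtain Q where Q: "sylow_sub q Q R" "\<forall>g\<in>?P. cj (inverse g) ` Q = Q" using W_iff by blast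
    have Q': "sgrp Q" "Q \<subseteq> R" "card Q = q ^ multiplicity q (card R)" using Q(1) by (auto simp: sylow_sub_def)
    have PQ: "cj g ` Q = Q" if "g \<in> ?P" for g
      using Q(2) sgrpD(3) [OF P(1) that] by (metis inverse_inverse_grp)
    have RP: "sgrp (R * ?P)" "R * ?P \<subseteq> ?J" "R \<subseteq> R * ?P" "?P \<subseteq> R * ?P"
      using normal_in_mult [OF R(1) J(1) P(1) PJ] by auto
    obtain z where z: "z \<in> center A" "z \<noteq> 1" "pel p2 z" "z \<in> A" using exists_center [OF p2(1,3)] .
    have zP: "z \<in> ?P" using z by (auto simp: ppart_def)
    \<comment> \<open>There is only one Sylow \<open>q\<close>-subgroup of \<open>R\<close>
      invariant under \<open>?P\<close>; since \<open>?H\<close> normalises \<open>?P\<close>, it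
      must preserve that subgroup. This replaces a direct argument that \<open>?H\<close> fixes a
      point.\<close>
    have uniq: "cj r ` Q = Q" if r: "r \<in> R" and inv: "\<forall>g\<in>?P. cj g ` cj r ` Q = cj r ` Q" for r
    proof -
      let ?E = "nizer (R * ?P) Q"
      have E: "sgrp ?E" "?E \<subseteq> R * ?P" by (rule sgrp_nizer [OF RP(1)], rule nizer_subset)
      have fE: "finite ?E" by (rule finite_subset [OF subset_trans [OF E(2) RP(2)] fJ])
      have rRP: "r \<in> R * ?P" using r RP(3) by blast
      have PE: "?P \<subseteq> ?E" using PQ RP(4) by (auto simp: nizer_def)
      have syE: "sylow_sub p2 ?P ?E"
        by (rule sylow_ppart [OF p2(1,3) E(1) PE]) (use E(2) RP(2) J(2) in blast)
      have "cj (inverse r) ` ?P \<subseteq> ?E"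
      proof
        fix y assume "y \<in> cj (inverse r) ` ?P"
        then obtain g where g: "g \<in> ?P" "y = cj (inverse r) g" by blast
        have "cj y ` Q = cj (inverse r) ` cj g ` cj r ` Q"
          unfolding g(2) by (simp add: cj_image_cj) (simp add: cj_def grp_simps)
        also have "\<dots> = Q" using inv g(1) by simp
        finally show "y \<in> ?E"
          using sgrp_cj_mem [OF RP(1) sgrpD(3) [OF RP(1) rRP], of g] g RP(4) by (auto simp: nizer_def)
      qed
      then obtain n where n: "n \<in> ?E" "cj n ` cj (inverse r) ` ?P \<subseteq> ?P"
        using sylow_conj [OF E(1) fE p2(1) syE sgrp_cj [OF P(1)]] P(2) by (metis card_cj)
      have "n \<in> R * ?P" using n(1) E(2) by blast
      then obtain r' w where rw: "n = r' * w" "r' \<in> R" "w \<in> ?P" by (rule set_times_elim)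
      have "cj (inverse r * r') z \<in> A"
      proof -
        have "cj w (cj (inverse r * r') z) \<in> ?P"
          using n(2) zP by (auto simp: cj_image_cj cj_cj rw(1) mult.assoc)
        then have "cj w (cj (inverse r * r') z) \<in> A" using ppart_subset by blast
        then show ?thesis using sgrp_cj_mem_iff [OF sA] rw(3) ppart_subset by blast
      qed
      moreover have rr: "inverse r * r' \<in> R" using r rw(2) R'(1) by (simp add: sgrpD)
      ultimately have "inverse r * r' \<in> nizer G A"
        using center_conj [OF _ z(1,2)] R'(2) J(2) by blast
      then have "inverse r * r' \<in> R \<inter> ?H" using rr JM R'(2) by blast
      then have "inverse r * r' = 1" using R(3) by simp
      then have "r' = r" by (metis inverse_unique_grp inverse_inverse_grp)
      then have "cj w ` cj r ` Q = Q" using n(1) rw(1) by (simp add: nizer_def cj_image_cj)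
      then show ?thesis using inv rw(3) by simp
    qed
    have HQ: "?H \<subseteq> nizer G Q"
    proof
      fix h assume h: "h \<in> ?H"
      then have hJ: "h \<in> ?J" "h \<in> A" by auto
      obtain r1 where r1: "r1 \<in> R" "Q = cj (inverse r1) ` Q0" using conjR [OF Q(1)] by blast
      obtain r2 where r2: "r2 \<in> R" "cj h ` Q = cj (inverse r2) ` Q0" using conjR [OF sylR [OF Q(1) hJ(1)]] by blast
      have hQ: "cj h ` Q = cj (r1 * inverse r2) ` Q"
        unfolding r2(2) by (subst r1(2)) (simp add: cj_image_cj grp_simps)
      have rR: "r1 * inverse r2 \<in> R" using r1(1) r2(1) R'(1) by (simp add: sgrpD)
      have "cj g ` cj h ` Q = cj h ` Q" if g: "g \<in> ?P" for g
      proof -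
        have "cj (inverse h) g \<in> ?P"
          using normal_inD(3) [OF normal_in_ppart [OF normal_in_self [OF sA] fA nA p2(1)]] hJ(2) g sA by (simp add: sgrpD)
        then have "cj h ` cj (cj (inverse h) g) ` Q = cj h ` Q" using PQ by simp
        moreover have "cj h ` cj (cj (inverse h) g) ` Q = cj g ` cj h ` Q"
          by (simp add: cj_image_cj) (simp add: cj_def grp_simps)
        ultimately show ?thesis by simp
      qed
      then have "cj (r1 * inverse r2) ` Q = Q" using uniq [OF rR] hQ by simp
      then show "h \<in> nizer G Q" using hQ hJ(2) AG by (auto simp: nizer_def)
    qed
    have "Q \<noteq> {1}"
    proof
      assume "Q = {1}"
      then have "q ^ multiplicity q (card R) = 1" using Q'(3) by simp
      moreover have "multiplicity q (card R) > 0"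
        using multiplicity_pos_iff [OF q(1) card_gt_0_sgrp [OF R'(1) fR]] q(2) by simp
      ultimately show False using prime_gt_1_nat [OF q(1)] by (metis one_less_power less_irrefl)
    qed
    moreover have "center A \<subseteq> nizer G Q" using HQ cJ by (auto simp: cizer_def)
    moreover have "Q \<subseteq> G" using Q'(2) R'(2) J(2) by blast
    ultimately have False
      using S.no_invariant_pgroup [OF q(1) qB Q'(1) _ _ _ p2(1,3)] sylow_sub_pel [OF Q(1)] PH HQ by blast
    then show ?thesis ..
  qed
qed

text \<open>\<open>A\<close> is a trivial intersection subgroup, so it has room for a disjoint conjugate: \<open>|A|\<^sup>2 \<le> |A||B|\<close>.\<close>

lemma card_A_le_B: "card A \<le> card B"
proof -
  obtain g where g: "g \<in> G" "g \<notin> nizer G A" using A_nizer(3,4) by blast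
  have "A \<inter> cj g ` A \<subseteq> {1}"
  proof (rule sgrp_prime_power_gen [OF sgrp_one sgrp_Int [OF sA sgrp_cj [OF sA]]])
    show "finite (A \<inter> cj g ` A)" using fA by simp
    fix p x assume p: "prime p" and x: "x \<in> A \<inter> cj g ` A" "pel p x"
    show "x \<in> {1}"
    proof (rule ccontr)
      assume "x \<notin> {1}"
      then have J: "cizer G {x} \<subseteq> nizer G A" using centralizer_in_nizer_A [OF _ _ p x(2)] x(1) by blast
      obtain q where q: "prime q" "q dvd card A" using two_primes_A by blast
      obtain z where z: "z \<in> center A" "z \<noteq> 1" "pel q z" "z \<in> A" using exists_center [OF q] .
      obtain y where y: "y \<in> A" "x = cj g y" using x(1) by blast
      \<comment> \<open>As \<open>x\<close> lies in the conjugate of \<open>A\<close> by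
        \<open>g\<close>, it commutes with the central element \<open>cj g z\<close> of that
        conjugate. So \<open>cj g z\<close> normalises \<open>A\<close>, and being a
        \<open>q\<close>-element it lies in \<open>A\<close>.\<close>
      have "cj g (z * y) = cj g (y * z)" using z(1) y(1) by (simp add: cizer_def)
      then have "cj g z * x = x * cj g z" by (simp add: y(2) cj_mult)
      then have "cj g z \<in> cizer G {x}" using z(4) AG g(1) sG by (auto simp: cizer_def sgrp_cj_mem)
      then have "cj g z \<in> nizer G A" using J by blast
      moreover have "\<not> q dvd card B" using coprime_prime_not_dvd [of "card B" "card A" q] cop q by (simp add: coprime_commute)
      ultimately have "cj g z \<in> A" using prime_power_in_nizer_A [OF _ q(1)] z(3) by simp
      then show False using center_conj [OF g(1) z(1,2)] g(2) by blast
    qed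
  qed
  then have "A \<inter> cj g ` A = {1}" using sgrpD(1) [OF sA] sgrpD(1) [OF sgrp_cj [OF sA]] by blast
  then have "card (A * cj g ` A) = card A * card A"
    using card_mult_Int [OF sA sgrp_cj [OF sA] fA finite_imageI [OF fA], of g] by simp
  moreover have "A * cj g ` A \<subseteq> G" using AG g(1) sG by (auto simp: mem_mult_iff sgrpD sgrp_cj_mem subset_iff)
  then have "card (A * cj g ` A) \<le> card G" by (rule card_mono [OF fG])
  moreover have "card G = card A * card B" using facG AG BG by (simp add: fac_def Int_absorb1)
  ultimately show ?thesis using card_gt_0_sgrp [OF sA fA] by simp
qed

theorem impossible: False
proof -
  have "card A = card B" using card_A_le_B wielandt.card_A_le_B [OF swap] by (rule antisym)
  then have "card A = 1" using cop by simp
  then show False using two_primes_A [of 0] by auto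
qed

end

subsection \<open>Permutation representations and quotients\<close>

text \<open>All finite groups of the inductive arguments below are realised inside the single type \<open>nat perm\<close>,
  so that a group and its quotients have the same type.\<close>

lemma perm_embedding:
  assumes fin: "finite \<Omega>" and act: "\<And>x. x \<in> X \<Longrightarrow> bij_betw (act x) \<Omega> \<Omega>"
  obtains \<phi> :: "'x \<Rightarrow> nat perm" where
    "\<And>x y z. x \<in> X \<Longrightarrow> y \<in> X \<Longrightarrow> z \<in> X \<Longrightarrow> (\<And>w. w \<in> \<Omega> \<Longrightarrow> act z w = act x (act y w)) \<Longrightarrow> \<phi> z = \<phi> x * \<phi> y"
    "\<And>x. x \<in> X \<Longrightarrow> \<phi> x = 1 \<longleftrightarrow> (\<forall>w\<in>\<Omega>. act x w = w)"
    "\<And>x y. x \<in> X \<Longrightarrow> y \<in> X \<Longrightarrow> \<phi> x = \<phi> y \<longleftrightarrow> (\<forall>w\<in>\<Omega>. act x w = act y w)"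
proof -
  obtain h where h: "bij_betw h \<Omega> {0..<card \<Omega>}" using ex_bij_betw_finite_nat [OF fin] by blast
  define k where "k = the_inv_into \<Omega> h"
  have kh: "k (h w) = w" if "w \<in> \<Omega>" for w
    unfolding k_def using h that by (simp add: bij_betw_def the_inv_into_f_f)
  have k: "k i \<in> \<Omega>" "h (k i) = i" if "i < card \<Omega>" for i
    using h that unfolding k_def bij_betw_def
    by (auto intro: the_inv_into_into f_the_inv_into_f)
  have hlt: "h w < card \<Omega>" if "w \<in> \<Omega>" for w using h that by (auto simp: bij_betw_def)
  \<comment> \<open>The action is transported to an initial segment and extended by the identity, so
    that only finitely many numbers are moved.\<close>
  define F where "F x i = (if i < card \<Omega> then h (act x (k i)) else i)" for x i
  have actO: "act x w \<in> \<Omega>" if "x \<in> X" "w \<in> \<Omega>" for x w using act [OF that(1)] that(2) by (auto simp: bij_betw_def)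
  have Flt: "F x i < card \<Omega> \<longleftrightarrow> i < card \<Omega>" if "x \<in> X" for x i
    using hlt actO [OF that] k by (simp add: F_def)
  have bijF: "bij (F x)" if x: "x \<in> X" for x
  proof (rule bijI)
    have aux: "i = j" if ij: "i < card \<Omega>" "j < card \<Omega>" "F x i = F x j" for i j
    proof -
      have "k (h (act x (k i))) = k (h (act x (k j)))" using ij by (simp add: F_def)
      then have "act x (k i) = act x (k j)" using kh actO [OF x] k ij by simp
      then have "k i = k j" using act [OF x] k ij by (auto simp: bij_betw_def inj_on_def)
      then show ?thesis using k ij by metis
    qed
    show "inj (F x)"
    proof (rule injI)
      fix i j assume eq: "F x i = F x j"
      then have "i < card \<Omega> \<longleftrightarrow> j < card \<Omega>" using Flt [OF x] by metis
      then show "i = j" using aux eq by (cases "i < card \<Omega>") (simp_all add: F_def)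
    qed
    show "surj (F x)"
      unfolding surj_def
    proof
      fix j
      show "\<exists>i. j = F x i"
      proof (cases "j < card \<Omega>")
        case True
        then have "k j \<in> act x ` \<Omega>" using act [OF x] k [OF True] by (simp add: bij_betw_def)
        then obtain w where w: "w \<in> \<Omega>" "act x w = k j" by auto
        then have "F x (h w) = j" using k [OF True] hlt kh by (simp add: F_def)
        then show ?thesis by blast
      next
        case False
        then have "F x j = j" by (simp add: F_def)
        then show ?thesis by metis
      qed
    qed
  qed
  define \<phi> where "\<phi> x = Perm (F x)" for x
  have app: "apply (\<phi> x) = F x" if x: "x \<in> X" for x
  proof -
    have "{i. F x i \<noteq> i} \<subseteq> {..<card \<Omega>}" by (auto simp: F_def)
    then have "finite {i. F x i \<noteq> i}" by (rule finite_subset) simp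
    then show ?thesis unfolding \<phi>_def using bijF [OF x] by (simp add: Perm_inverse)
  qed
  have eqF: "F x = F y \<longleftrightarrow> (\<forall>w\<in>\<Omega>. act x w = act y w)" if xy: "x \<in> X" "y \<in> X" for x y
  proof
    assume eq: "F x = F y"
    show "\<forall>w\<in>\<Omega>. act x w = act y w"
    proof
      fix w assume w: "w \<in> \<Omega>"
      have "F x (h w) = F y (h w)" using eq by simp
      then have "h (act x w) = h (act y w)" using hlt w kh by (simp add: F_def)
      then have "k (h (act x w)) = k (h (act y w))" by simp
      then show "act x w = act y w" using kh actO xy w by simp
    qed
  qed (use k in \<open>auto simp: F_def\<close>)
  show ?thesis
  proof (rule that [of \<phi>])
    fix x y z assume xyz: "x \<in> X" "y \<in> X" "z \<in> X" and eq: "\<And>w. w \<in> \<Omega> \<Longrightarrow> act z w = act x (act y w)"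
    have "F z i = F x (F y i)" for i
    proof (cases "i < card \<Omega>")
      case True
      then show ?thesis using Flt [OF xyz(2), of i] eq k kh actO [OF xyz(2)] hlt by (simp add: F_def)
    qed (simp add: F_def)
    then show "\<phi> z = \<phi> x * \<phi> y"
      by (intro perm_eqI) (simp add: apply_times app xyz)
  next
    fix x assume x: "x \<in> X"
    have "\<phi> x = 1 \<longleftrightarrow> F x = id" using app [OF x] by (metis apply_inject apply_one)
    also have "\<dots> \<longleftrightarrow> (\<forall>w\<in>\<Omega>. act x w = w)"
    proof
      assume eq: "F x = id"
      show "\<forall>w\<in>\<Omega>. act x w = w"
      proof
        fix w assume w: "w \<in> \<Omega>"
        have "F x (h w) = h w" using eq by simp
        then have "k (h (act x w)) = k (h w)" using hlt w kh by (simp add: F_def)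
        then show "act x w = w" using kh actO x w by simp
      qed
    next
      assume "\<forall>w\<in>\<Omega>. act x w = w"
      then show "F x = id" using k by (auto simp: F_def)
    qed
    finally show "\<phi> x = 1 \<longleftrightarrow> (\<forall>w\<in>\<Omega>. act x w = w)" .
  next
    fix x y assume "x \<in> X" "y \<in> X"
    then show "\<phi> x = \<phi> y \<longleftrightarrow> (\<forall>w\<in>\<Omega>. act x w = act y w)"
      using eqF app by (metis apply_inject)
  qed
qed

lemma sgrp_hom_image:
  fixes f :: "'a::grp \<Rightarrow> 'b::grp"
  assumes "sgrp H" "finite H" "\<And>x y. x \<in> H \<Longrightarrow> y \<in> H \<Longrightarrow> f (x * y) = f x * f y"
  shows "sgrp (f ` H)"
proof (rule sgrp_finite_closed)
  show "finite (f ` H)" "f ` H \<noteq> {}" using assms(1,2) sgrpD(1) by auto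
  show "x * y \<in> f ` H" if xy: "x \<in> f ` H" "y \<in> f ` H" for x y
  proof -
    obtain a b where "a \<in> H" "b \<in> H" "x = f a" "y = f b" using xy by blast
    then have "x * y = f (a * b)" "a * b \<in> H" using assms(1,3) by (auto simp: sgrpD)
    then show ?thesis by blast
  qed
qed

lemma hom_pow:
  fixes f :: "'a::grp \<Rightarrow> 'b::grp"
  assumes "sgrp H" "\<And>x y. x \<in> H \<Longrightarrow> y \<in> H \<Longrightarrow> f (x * y) = f x * f y" "x \<in> H"
  shows "f (x ^ n) = f x ^ n"
proof (induction n)
  case 0
  have "f 1 * f 1 = f 1 * 1" using assms(2) [of 1 1] sgrpD(1) [OF assms(1)] by simp
  then have "f 1 = 1" by (simp only: mult_left_cancel_grp)
  then show ?case by simp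
next
  case (Suc n)
  then show ?case using assms(2) [OF assms(3) sgrp_pow [OF assms(1,3)]] by simp
qed

lemma nilp_hom_image:
  fixes f :: "'a::grp \<Rightarrow> 'b::grp"
  assumes H: "sgrp H" "finite H" "nilp H" and f: "\<And>x y. x \<in> H \<Longrightarrow> y \<in> H \<Longrightarrow> f (x * y) = f x * f y"
  shows "nilp (f ` H)"
proof -
  \<comment> \<open>The lift is \<open>x ^ i\<close> with \<open>i\<close> congruent to
    \<open>1\<close> modulo a high power of \<open>p\<close> and to \<open>0\<close> modulo the part
    of \<open>card H\<close> prime to \<open>p\<close>.\<close>
  have lift: "\<exists>y\<in>H. f y = f x \<and> pel p y" if x: "x \<in> H" and p: "prime p" "pel p (f x)" for x p
  proof -
    have c: "card H > 0" by (rule card_gt_0_sgrp [OF H(1,2)])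
    obtain m where m: "card H = p ^ multiplicity p (card H) * m" "\<not> p dvd m"
      using prime_decompose_nat [OF p(1) c] .
    obtain k where k: "f x ^ (p ^ k) = 1" using p(2) by (auto simp: pel_def)
    let ?q = "p ^ (multiplicity p (card H) + k)"
    have "coprime ?q m" using p(1) m(2) by (simp add: prime_imp_coprime)
    then obtain i where i: "[i = 1] (mod ?q)" "[i = 0] (mod m)"
      using binary_chinese_remainder_nat [of ?q m 1 0] by blast
    have "[i = 1] (mod p ^ k)" by (rule cong_dvd_modulus_nat [OF i(1)]) (simp add: power_add)
    then have "f x ^ i = f x ^ 1" by (rule pow_cong [OF k])
    then have "f (x ^ i) = f x" using hom_pow [OF H(1) f x] by simp
    moreover have "(x ^ i) ^ (p ^ multiplicity p (card H)) = 1"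
    proof -
      have "m dvd i" using i(2) by (simp add: cong_0_iff)
      then have "card H dvd i * p ^ multiplicity p (card H)"
        by (subst m(1)) (simp add: mult.commute)
      then show ?thesis using pow_dvd_one [OF pow_card_eq_one [OF H(1) x]] by (simp add: power_mult [symmetric])
    qed
    ultimately show ?thesis using sgrp_pow [OF H(1) x] by (auto simp: pel_def)
  qed
  show ?thesis
    unfolding nilp_def
  proof (intro ballI allI impI)
    fix a b p q assume ab: "a \<in> f ` H" "b \<in> f ` H" and p: "prime p" "prime q" "p \<noteq> q" "pel p a" "pel q b"
    obtain x where x: "x \<in> H" "f x = a" "pel p x" using lift ab(1) p(1,4) by blast
    obtain y where y: "y \<in> H" "f y = b" "pel q y" using lift ab(2) p(2,5) by blast
    have "x * y = y * x" by (rule nilpD [OF H(3) x(1) y(1) p(1-3) x(3) y(3)])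
    then show "a * b = b * a" using f [OF x(1) y(1)] f [OF y(1) x(1)] x(2) y(2) by simp
  qed
qed

text \<open>The group acts by translation on the left cosets of \<open>N\<close>; normality makes
  \<open>N\<close> the whole kernel.\<close>

lemma quotient_hom:
  fixes G :: "'a::grp set"
  assumes G: "sgrp G" "finite G" and N: "normal_in N G"
  obtains \<phi> :: "'a \<Rightarrow> nat perm" where
    "\<And>x y. x \<in> G \<Longrightarrow> y \<in> G \<Longrightarrow> \<phi> (x * y) = \<phi> x * \<phi> y" "\<And>x. x \<in> G \<Longrightarrow> \<phi> x = 1 \<longleftrightarrow> x \<in> N"
proof -
  note N' = normal_inD [OF N]
  let ?W = "(\<lambda>g. (\<lambda>n. g * n) ` N) ` G"
  let ?act = "\<lambda>x w. (\<lambda>y. x * y) ` w"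
  have bij: "bij_betw (?act x) ?W ?W" if x: "x \<in> G" for x
    unfolding bij_betw_def
  proof
    show inj: "inj_on (?act x) ?W" by (auto simp: inj_on_def inj_image_eq_iff mult_left_cancel_grp inj_def)
    have "?act x ` ?W \<subseteq> ?W"
    proof
      fix w assume "w \<in> ?act x ` ?W"
      then obtain g where "g \<in> G" "w = ?act x ((\<lambda>n. g * n) ` N)" by blast
      then have "w = (\<lambda>n. (x * g) * n) ` N" "x * g \<in> G" using x G(1) by (simp_all add: image_image mult.assoc sgrpD)
      then show "w \<in> ?W" by blast
    qed
    then show "?act x ` ?W = ?W"
      using card_image [OF inj] G(2) by (intro card_subset_eq) auto
  qed
  obtain \<phi> :: "'a \<Rightarrow> nat perm" where \<phi>:
    "\<And>x y z. x \<in> G \<Longrightarrow> y \<in> G \<Longrightarrow> z \<in> G \<Longrightarrow> (\<And>w. w \<in> ?W \<Longrightarrow> ?act z w = ?act x (?act y w)) \<Longrightarrow> \<phi> z = \<phi> x * \<phi> y"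
    "\<And>x. x \<in> G \<Longrightarrow> \<phi> x = 1 \<longleftrightarrow> (\<forall>w\<in>?W. ?act x w = w)"
    by (rule perm_embedding [of ?W G ?act]) (use G(2) bij in auto)
  have fix_iff: "(\<forall>w\<in>?W. ?act x w = w) \<longleftrightarrow> x \<in> N" if x: "x \<in> G" for x
  proof
    assume *: "\<forall>w\<in>?W. ?act x w = w"
    have "(\<lambda>n. 1 * n) ` N \<in> ?W" using sgrpD(1) [OF G(1)] by blast
    then have "?act x ((\<lambda>n. 1 * n) ` N) = (\<lambda>n. 1 * n) ` N" by (rule bspec [OF *])
    then have "?act x N = N" by simp
    moreover have "x * 1 \<in> ?act x N" by (rule imageI) (rule sgrpD(1) [OF N'(1)])
    ultimately show "x \<in> N" by simp
  next
    assume xN: "x \<in> N"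
    have "?act x ((\<lambda>n. g * n) ` N) = (\<lambda>n. g * n) ` N" if g: "g \<in> G" for g
    proof -
      have "?act x ((\<lambda>n. g * n) ` N) = (\<lambda>n. g * n) ` (\<lambda>n. cj g x * n) ` N"
        by (simp add: image_image cj_def grp_simps)
      moreover have "(\<lambda>n. cj g x * n) ` N = N"
      proof
        have c: "cj g x \<in> N" by (rule N'(3) [OF g xN])
        show "(\<lambda>n. cj g x * n) ` N \<subseteq> N" using c N'(1) by (auto simp: sgrpD)
        show "N \<subseteq> (\<lambda>n. cj g x * n) ` N"
        proof
          fix n assume "n \<in> N"
          then have "inverse (cj g x) * n \<in> N" using c N'(1) by (simp add: sgrpD)
          then have "cj g x * (inverse (cj g x) * n) \<in> (\<lambda>n. cj g x * n) ` N" by (rule imageI)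
          then show "n \<in> (\<lambda>n. cj g x * n) ` N" by (simp add: mult_inverse_cancel)
        qed
      qed
      ultimately show ?thesis by simp
    qed
    then show "\<forall>w\<in>?W. ?act x w = w" by blast
  qed
  show ?thesis
  proof (rule that [of \<phi>])
    show "\<phi> (x * y) = \<phi> x * \<phi> y" if "x \<in> G" "y \<in> G" for x y
      by (rule \<phi>(1)) (use that G(1) in \<open>auto simp: sgrpD image_image mult.assoc\<close>)
    show "\<phi> x = 1 \<longleftrightarrow> x \<in> N" if "x \<in> G" for x using \<phi>(2) [OF that] fix_iff [OF that] by blast
  qed
qed

subsection \<open>Sylow subgroups of a product of nilpotent groups\<close>

text \<open>The assumption \<open>least\<close> says that \<open>J\<close> is generated by
  \<open>X\<close> and \<open>Y\<close>. The elements \<open>s\<close> of \<open>J\<close> with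
  \<open>Q s \<subseteq> J Q\<close> form a subgroup containing both, so
  \<open>Q J \<subseteq> J Q\<close>.\<close>

lemma sgrp_join_mult:
  assumes X: "sgrp X" "X \<subseteq> J" and Y: "sgrp Y" "Y \<subseteq> J" and Q: "sgrp Q" and J: "sgrp J" "finite J"
    and least: "\<And>M. sgrp M \<Longrightarrow> X \<subseteq> M \<Longrightarrow> Y \<subseteq> M \<Longrightarrow> J \<subseteq> M" and fQ: "finite Q"
    and XQ: "sgrp (X * Q)" and YQ: "sgrp (Y * Q)"
  shows "sgrp (J * Q)"
proof -
  have Qin: "Q \<subseteq> X * Q" "Q \<subseteq> Y * Q" using sgrpD(1) [OF X(1)] sgrpD(1) [OF Y(1)]
    by (metis mult_1_left set_times_intro subsetI)+
  have Xin: "X \<subseteq> X * Q" "Y \<subseteq> Y * Q" using sgrpD(1) [OF Q] by (metis mult_1_right set_times_intro subsetI)+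
  have mono: "X * Q \<subseteq> J * Q" "Y * Q \<subseteq> J * Q" using X(2) Y(2) by (auto simp: mem_mult_iff subset_iff)
  let ?S = "{s \<in> J. \<forall>q\<in>Q. q * s \<in> J * Q}"
  have sS: "sgrp ?S"
  proof (rule sgrp_finite_closed)
    show "finite ?S" using J(2) by simp
    have "1 * q \<in> J * Q" if "q \<in> Q" for q using sgrpD(1) [OF J(1)] that by (rule set_times_intro)
    then show "?S \<noteq> {}" using sgrpD(1) [OF J(1)] by (auto intro!: exI [of _ 1])
    fix s t assume st: "s \<in> ?S" "t \<in> ?S"
    have "q * (s * t) \<in> J * Q" if q: "q \<in> Q" for q
    proof -
      obtain j1 q1 where 1: "q * s = j1 * q1" "j1 \<in> J" "q1 \<in> Q" using st(1) q by (auto simp: mem_mult_iff)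
      obtain j2 q2 where 2: "q1 * t = j2 * q2" "j2 \<in> J" "q2 \<in> Q" using st(2) 1(3) by (auto simp: mem_mult_iff)
      have "q * (s * t) = (q * s) * t" by (simp only: mult.assoc)
      also have "\<dots> = j1 * (q1 * t)" by (simp only: 1(1) mult.assoc)
      also have "\<dots> = (j1 * j2) * q2" by (simp only: 2(1) mult.assoc)
      finally show ?thesis using sgrpD(2) [OF J(1) 1(2) 2(2)] 2(3) by (metis set_times_intro)
    qed
    then show "s * t \<in> ?S" using st J(1) by (simp add: sgrpD)
  qed
  have "X \<subseteq> ?S"
  proof
    fix x assume x: "x \<in> X"
    have "q * x \<in> J * Q" if "q \<in> Q" for q using sgrpD(2) [OF XQ, of q x] Qin(1) Xin(1) x that mono(1) by blast
    then show "x \<in> ?S" using x X(2) by blast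
  qed
  moreover have "Y \<subseteq> ?S"
  proof
    fix x assume x: "x \<in> Y"
    have "q * x \<in> J * Q" if "q \<in> Q" for q using sgrpD(2) [OF YQ, of q x] Qin(2) Xin(2) x that mono(2) by blast
    then show "x \<in> ?S" using x Y(2) by blast
  qed
  ultimately have JS: "J \<subseteq> ?S" using least [OF sS] by blast
  show ?thesis
  proof (rule sgrp_finite_closed)
    show "finite (J * Q)" by (rule finite_mult_set [OF J(2) fQ])
    show "J * Q \<noteq> {}" using sgrpD(1) [OF J(1)] sgrpD(1) [OF Q] by (auto simp: mem_mult_iff)
    fix a b assume "a \<in> J * Q" "b \<in> J * Q"
    then obtain j1 q1 j2 q2 where ab: "a = j1 * q1" "b = j2 * q2" "j1 \<in> J" "q1 \<in> Q" "j2 \<in> J" "q2 \<in> Q"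
      by (auto simp: mem_mult_iff)
    have "q1 * j2 \<in> J * Q" using JS ab(4,5) by blast
    then obtain j3 q3 where 3: "q1 * j2 = j3 * q3" "j3 \<in> J" "q3 \<in> Q" by (rule set_times_elim)
    have "a * b = j1 * (q1 * j2) * q2" unfolding ab(1,2) by (simp only: mult.assoc)
    also have "\<dots> = (j1 * j3) * (q3 * q2)" unfolding 3(1) by (simp only: mult.assoc)
    finally show "a * b \<in> J * Q"
      using sgrpD(2) [OF J(1) ab(3) 3(2)] sgrpD(2) [OF Q 3(3) ab(6)] by (metis set_times_intro)
  qed
qed

text \<open>A Sylow subgroup contains conjugates of both \<open>p\<close>-parts. Writing the
  relative conjugator as a product from \<open>A\<close> and \<open>B\<close>, which normalise their
  own \<open>p\<close>-parts, gives one Sylow subgroup containing both parts themselves. Comparing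
  orders shows that their product fills it.\<close>

lemma sylow_product:
  assumes G: "sgrp G" "finite G" and A: "sgrp A" "A \<subseteq> G" "nilp A" and B: "sgrp B" "B \<subseteq> G" "nilp B"
    and dec: "\<And>g. g \<in> G \<Longrightarrow> \<exists>a\<in>A. \<exists>b\<in>B. g = a * b" and p: "prime p"
  shows "sgrp (ppart A p * ppart B p)"
proof -
  have fA: "finite A" and fB: "finite B" using A(2) B(2) G(2) finite_subset by auto
  let ?P = "ppart A p" and ?Q = "ppart B p"
  have P: "sgrp ?P" "card ?P = p ^ multiplicity p (card A)" "?P \<subseteq> G" "finite ?P"
    using sgrp_ppart [OF A(1) fA A(3) p] card_ppart [OF A(1) fA A(3) p] A(2) fA by (auto simp: ppart_def)
  have Q: "sgrp ?Q" "card ?Q = p ^ multiplicity p (card B)" "?Q \<subseteq> G" "finite ?Q"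
    using sgrp_ppart [OF B(1) fB B(3) p] card_ppart [OF B(1) fB B(3) p] B(2) fB by (auto simp: ppart_def)
  obtain S1 where S1: "sylow_sub p S1 G" using sylow_exists_sub [OF G p] .
  then have S1': "sgrp S1" "S1 \<subseteq> G" "card S1 = p ^ multiplicity p (card G)" by (auto simp: sylow_sub_def)
  obtain g where g: "g \<in> G" "cj g ` ?P \<subseteq> S1" using sylow_conj [OF G p S1 P(1,3,2)] .
  obtain h where h: "h \<in> G" "cj h ` ?Q \<subseteq> S1" using sylow_conj [OF G p S1 Q(1,3,2)] .
  have "inverse (h * inverse g) \<in> G" using g h G(1) by (simp add: sgrpD)
  then obtain a b where ab: "a \<in> A" "b \<in> B" "inverse (h * inverse g) = a * b" using dec by blast
  have k: "h * inverse g = inverse b * inverse a"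
    using arg_cong [OF ab(3), of inverse] by (simp add: inverse_inverse_grp inverse_mult_grp)
  define S where "S = cj a ` cj (inverse g) ` S1"
  have aG: "a \<in> G" using ab(1) A(2) by blast
  have S: "sgrp S" "card S = p ^ multiplicity p (card G)" unfolding S_def using S1' by (simp_all add: sgrp_cj)
  have Pa: "cj a ` ?P = ?P"
    using normal_in_image [OF normal_in_ppart [OF normal_in_self [OF A(1)] fA A(3) p] A(1) ab(1)] .
  have Qb: "cj (inverse b) ` ?Q = ?Q"
    using normal_in_image [OF normal_in_ppart [OF normal_in_self [OF B(1)] fB B(3) p] B(1)] ab(2) B(1) by (simp add: sgrpD)
  have "?P \<subseteq> cj (inverse g) ` S1" using g(2) by (simp add: cj_image_mono)
  then have PS: "?P \<subseteq> S" unfolding S_def using Pa by (metis image_mono)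
  have "cj (inverse g) ` cj h ` ?Q \<subseteq> cj (inverse g) ` S1" using h(2) by (rule image_mono)
  then have "cj (h * inverse g) ` ?Q \<subseteq> cj (inverse g) ` S1" by (simp add: cj_image_cj)
  then have "cj (inverse a) ` cj (inverse b) ` ?Q \<subseteq> cj (inverse g) ` S1" unfolding k by (simp add: cj_image_cj)
  then have "cj (inverse a) ` ?Q \<subseteq> cj (inverse g) ` S1" unfolding Qb .
  then have QS: "?Q \<subseteq> S" unfolding S_def by (metis cj_image_mono inverse_inverse_grp)
  have fS: "finite S" unfolding S_def using S1'(2) G(2) finite_subset by blast
  have AB: "sgrp (A \<inter> B)" "finite (A \<inter> B)" "nilp (A \<inter> B)"
    using sgrp_Int A(1) B(1) fA nilp_subset [OF A(3)] by auto
  have "A * B = G" using dec A(1,2) B(2) G(1) by (auto simp: mem_mult_iff sgrpD subset_iff)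
  then have cG: "card G * card (A \<inter> B) = card A * card B" using card_mult_Int [OF A(1) B(1) fA fB] by simp
  have pos: "card G > 0" "card (A \<inter> B) > 0" "card A > 0" "card B > 0"
    using card_gt_0_sgrp G A(1) B(1) fA fB AB by blast+
  have m: "multiplicity p (card G) + multiplicity p (card (A \<inter> B)) = multiplicity p (card A) + multiplicity p (card B)"
    using arg_cong [OF cG, of "multiplicity p"] pos p by (simp add: prime_elem_multiplicity_mult_distrib)
  have "?P \<inter> ?Q = ppart (A \<inter> B) p" by (auto simp: ppart_def)
  then have "card (?P * ?Q) * p ^ multiplicity p (card (A \<inter> B)) = p ^ multiplicity p (card A) * p ^ multiplicity p (card B)"
    using card_mult_Int [OF P(1) Q(1) P(4) Q(4)] P(2) Q(2) card_ppart [OF AB p] by simp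
  also have "\<dots> = card S * p ^ multiplicity p (card (A \<inter> B))" unfolding S(2) by (simp add: power_add [symmetric] m)
  finally have "card (?P * ?Q) = card S" using p by (simp add: prime_gt_0_nat)
  moreover have "?P * ?Q \<subseteq> S" using PS QS S(1) by (auto simp: mem_mult_iff sgrpD subset_iff)
  ultimately have "?P * ?Q = S" using fS by (metis card_subset_eq)
  then show ?thesis using S(1) by simp
qed

text \<open>Kegel's argument: a \<open>p\<close>-subgroup maximal among those permuting with all conjugates of \<open>Q0\<close> is normalised by them.\<close>

lemma maximal_permuting_pair:
  assumes G: "sgrp G" "finite G" and p: "prime p"
    and P0: "sgrp P0" "P0 \<subseteq> G" "card P0 = p ^ k0" and Q0: "sgrp Q0" "Q0 \<subseteq> G" "card Q0 = p ^ l0"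
    and perm0: "\<And>g. g \<in> G \<Longrightarrow> sgrp (P0 * cj g ` Q0)"
  obtains P where "sgrp P" "P \<subseteq> G" "P0 \<subseteq> P" "\<exists>k. card P = p ^ k"
    "\<And>g x. g \<in> G \<Longrightarrow> x \<in> cj g ` Q0 \<Longrightarrow> cj x ` P = P"
proof -
  let ?Z = "\<lambda>P. sgrp P \<and> P \<subseteq> G \<and> P0 \<subseteq> P \<and> (\<exists>k. card P = p ^ k) \<and> (\<forall>g\<in>G. sgrp (P * cj g ` Q0))"
  have Z0: "?Z P0" using P0 perm0 by auto
  have "\<forall>P. ?Z P \<longrightarrow> card P < Suc (card G)" using card_mono [OF G(2)] by (simp add: less_Suc_eq_le)
  then have "\<exists>P. ?Z P \<and> (\<forall>P'. ?Z P' \<longrightarrow> card P' \<le> card P)"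
    by (rule ex_has_greatest_nat [of ?Z P0 card, OF Z0])
  then obtain P k where P: "sgrp P" "P \<subseteq> G" "P0 \<subseteq> P" "card P = p ^ k" "\<forall>g\<in>G. sgrp (P * cj g ` Q0)"
    and max: "\<forall>P'. ?Z P' \<longrightarrow> card P' \<le> card P" by (elim exE conjE)
  have fP: "finite P" by (rule finite_subset [OF P(2) G(2)])
  have fQ0: "finite Q0" by (rule finite_subset [OF Q0(2) G(2)])
  have "cj x ` P = P" if g: "g \<in> G" and x: "x \<in> cj g ` Q0" for g x
  proof -
    let ?Q = "cj g ` Q0"
    have Q: "sgrp ?Q" "?Q \<subseteq> G" "card ?Q = p ^ l0" using sgrp_cj [OF Q0(1)] Q0(2,3) g G(1) by (auto simp: sgrp_cj_mem subset_iff)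
    have xG: "x \<in> G" using x Q(2) by blast
    \<comment> \<open>The join of \<open>P\<close> and its conjugate by \<open>x\<close>. It lies in
      the \<open>p\<close>-group \<open>P * ?Q\<close> and permutes with the same conjugates of
      \<open>Q0\<close> as \<open>P\<close>, so by maximality it equals \<open>P\<close>.\<close>
    define P1 where "P1 = \<Inter>{M. sgrp M \<and> P \<subseteq> M \<and> cj x ` P \<subseteq> M}"
    have sP1: "sgrp P1" unfolding P1_def by (rule sgrp_Inter) auto
    have PP1: "P \<subseteq> P1" "cj x ` P \<subseteq> P1" by (auto simp: P1_def)
    have least: "P1 \<subseteq> M" if "sgrp M" "P \<subseteq> M" "cj x ` P \<subseteq> M" for M using that by (auto simp: P1_def)
    have PQ: "sgrp (P * ?Q)" using P(5) g by blast
    have PQin: "P \<subseteq> P * ?Q" "?Q \<subseteq> P * ?Q"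
      using sgrpD(1) [OF P(1)] sgrpD(1) [OF Q(1)] by (metis mult_1_right mult_1_left set_times_intro subsetI)+
    have P1sub: "P1 \<subseteq> P * ?Q"
      by (rule least [OF PQ PQin(1)]) (use PQin x sgrp_cj_mem [OF PQ] in blast)
    have cPQ: "card (P * ?Q) * card (P \<inter> ?Q) = p ^ (k + l0)"
      using card_mult_Int [OF P(1) Q(1) fP] fQ0 P(4) Q(3) by (simp add: power_add)
    have fPQ: "finite (P * ?Q)" using fP fQ0 by (simp add: finite_mult_set)
    have "card P1 dvd card (P * ?Q)" by (rule card_dvd_sgrp [OF PQ sP1 P1sub fPQ])
    then have "card P1 dvd p ^ (k + l0)" using cPQ by (metis dvd_mult2)
    then have cP1: "\<exists>j. card P1 = p ^ j" using p by (auto simp: divides_primepow_nat)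
    have P1G: "P1 \<subseteq> G" by (rule least [OF G(1) P(2)]) (use P(2) xG G(1) in \<open>auto simp: sgrp_cj_mem subset_iff\<close>)
    have fP1: "finite P1" by (rule finite_subset [OF P1G G(2)])
    have "sgrp (P1 * cj h ` Q0)" if h: "h \<in> G" for h
    proof (rule sgrp_join_mult [OF P(1) PP1(1) sgrp_cj [OF P(1)] PP1(2) sgrp_cj [OF Q0(1)] sP1 fP1 least])
      show "sgrp (P * cj h ` Q0)" using P(5) h by blast
      have "sgrp (P * cj (h * inverse x) ` Q0)" using P(5) h xG G(1) by (simp add: sgrpD)
      then have "sgrp (cj x ` (P * cj (h * inverse x) ` Q0))" by (rule sgrp_cj)
      then show "sgrp (cj x ` P * cj h ` Q0)" by (simp add: cj_image_mult cj_image_cj grp_simps)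
    qed (use fQ0 in auto)
    then have "?Z P1" using sP1 P1G P(3) PP1(1) cP1 by auto
    then have "card P1 \<le> card P" using max by blast
    then have "P1 = P" using PP1(1) fP1 card_seteq by blast
    then have "cj x ` P \<subseteq> P" using PP1(2) by simp
    then show ?thesis by (rule cj_image_finite_eq [OF fP])
  qed
  then show ?thesis using that [OF P(1-3)] P(4) by blast
qed

text \<open>The product of two normal \<open>p\<close>-subgroups of \<open>M\<close> is again one,
  so \<open>M\<close> has a largest; being unique, it is invariant under conjugation by
  \<open>G\<close>.\<close>

lemma pgroup_core_normal:
  assumes G: "sgrp G" "finite G" and M: "normal_in M G" and p: "prime p" and X: "normal_in X M" "card X = p ^ k"
  obtains N j where "normal_in N G" "X \<subseteq> N" "card N = p ^ j"
proof -
  note M' = normal_inD [OF M]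
  have fM: "finite M" by (rule finite_subset [OF M'(2) G(2)])
  let ?Z = "\<lambda>N. normal_in N M \<and> (\<exists>k. card N = p ^ k)"
  have ZX: "?Z X" using X by auto
  have "\<forall>N. ?Z N \<longrightarrow> card N < Suc (card M)" using card_mono [OF fM] by (auto simp: less_Suc_eq_le normal_in_def)
  then have "\<exists>N. ?Z N \<and> (\<forall>N'. ?Z N' \<longrightarrow> card N' \<le> card N)"
    by (rule ex_has_greatest_nat [of ?Z X card, OF ZX])
  then obtain N j where N: "normal_in N M" "card N = p ^ j" and max: "\<forall>N'. ?Z N' \<longrightarrow> card N' \<le> card N"
    by (elim exE conjE)
  note N' = normal_inD [OF N(1)]
  have fN: "finite N" by (rule finite_subset [OF N'(2) fM])
  have contains: "Y \<subseteq> N" if Y: "normal_in Y M" "card Y = p ^ l" for Y l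
  proof -
    note Y' = normal_inD [OF Y(1)]
    have fY: "finite Y" by (rule finite_subset [OF Y'(2) fM])
    note NY = normal_in_mult [OF N(1) M'(1) Y'(1,2)]
    have "normal_in (N * Y) M"
      unfolding normal_in_def
    proof (intro conjI ballI)
      fix g x assume g: "g \<in> M" and "x \<in> N * Y"
      then obtain n y where "x = n * y" "n \<in> N" "y \<in> Y" by (auto simp: mem_mult_iff)
      then have "cj g x = cj g n * cj g y" "cj g n \<in> N" "cj g y \<in> Y" using N'(3) Y'(3) g by (simp_all add: cj_mult)
      then show "cj g x \<in> N * Y" by auto
    qed (use NY in auto)
    moreover have "\<exists>k. card (N * Y) = p ^ k"
    proof -
      have "card (N * Y) * card (N \<inter> Y) = p ^ (j + l)"
        using card_mult_Int [OF N'(1) Y'(1) fN fY] N(2) Y(2) by (simp add: power_add)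
      then have "card (N * Y) dvd p ^ (j + l)" by (metis dvd_triv_left)
      then show ?thesis using p by (auto simp: divides_primepow_nat)
    qed
    ultimately have "card (N * Y) \<le> card N" using max by blast
    then have "N * Y = N" using NY(3) fN fY card_seteq [of "N * Y" N] by (simp add: finite_mult_set)
    then show ?thesis using NY(4) by simp
  qed
  have "cj g x \<in> N" if g: "g \<in> G" and x: "x \<in> N" for g x
  proof -
    have "normal_in (cj g ` N) M"
      unfolding normal_in_def
    proof (intro conjI ballI)
      show "sgrp (cj g ` N)" by (rule sgrp_cj [OF N'(1)])
      show "cj g ` N \<subseteq> M" using N'(2) M'(3) [OF g] by blast
      fix h y assume h: "h \<in> M" and "y \<in> cj g ` N"
      then obtain n where n: "n \<in> N" "y = cj g n" by blast
      have "cj (inverse g) h \<in> M" using M'(3) [OF sgrpD(3) [OF G(1) g] h] .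
      then have "cj (cj (inverse g) h) n \<in> N" using N'(3) n(1) by blast
      moreover have "cj h y = cj g (cj (cj (inverse g) h) n)" unfolding n(2) by (simp add: cj_def grp_simps)
      ultimately show "cj h y \<in> cj g ` N" by blast
    qed
    then have "cj g ` N \<subseteq> N" using contains N(2) by simp
    then show ?thesis using x by blast
  qed
  then have "normal_in N G" using N'(1,2) M'(2) by (auto simp: normal_in_def)
  then show ?thesis using that contains [OF X] N(2) by blast
qed

subsection \<open>Central idempotents of the group algebra\<close>

text \<open>Elements of the complex group algebra are functions vanishing off \<open>G\<close>.
  \<open>K\<close> is a conjugation invariant set, later a single class, and plays the part of a
  class sum.\<close>

locale group_algebra =
  fixes G K :: "'a::grp set"
  assumes sG: "sgrp G" and fG: "finite G" and KG: "K \<subseteq> G"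
    and Kcj: "\<lbrakk>g \<in> G; x \<in> K\<rbrakk> \<Longrightarrow> cj g x \<in> K"
begin

definition conv :: "('a \<Rightarrow> complex) \<Rightarrow> ('a \<Rightarrow> complex) \<Rightarrow> 'a \<Rightarrow> complex" where
  "conv f h g = (if g \<in> G then \<Sum>x\<in>G. f x * h (inverse x * g) else 0)"

definition delta :: "'a \<Rightarrow> complex" where
  "delta g = (if g = 1 then 1 else 0)"

text \<open>\<open>csum\<close> is convolution with the class function supported on the inverses of \<open>K\<close>, and \<open>ev p\<close> is the
  value of \<open>p\<close> at that element of the group algebra.\<close>

definition csum :: "('a \<Rightarrow> complex) \<Rightarrow> 'a \<Rightarrow> complex" where
  "csum f g = (if g \<in> G then \<Sum>x\<in>K. f (x * g) else 0)"

definition ev :: "complex poly \<Rightarrow> 'a \<Rightarrow> complex" where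
  "ev p = fold_coeffs (\<lambda>a f g. a * delta g + csum f g) p (\<lambda>_. 0)"

text \<open>The centre of the group algebra. The condition off \<open>G\<close> makes equality of
  functions the same as equality in the algebra.\<close>

definition cls :: "('a \<Rightarrow> complex) \<Rightarrow> bool" where
  "cls f \<longleftrightarrow> (\<forall>g. g \<notin> G \<longrightarrow> f g = 0) \<and> (\<forall>g\<in>G. \<forall>x\<in>G. f (cj g x) = f x)"

lemmas sGs = sgrpD [OF sG]

lemma KG': "x \<in> K \<Longrightarrow> x \<in> G"
  using KG by blast

lemma sum_mult_left: "a \<in> G \<Longrightarrow> (\<Sum>x\<in>G. F (a * x)) = (\<Sum>x\<in>G. F x)"
  by (rule sum.reindex_bij_witness [of _ "\<lambda>x. inverse a * x" "\<lambda>x. a * x"]) (auto simp: grp_simps sGs)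

lemma sum_mult_right: "a \<in> G \<Longrightarrow> (\<Sum>x\<in>G. F (x * a)) = (\<Sum>x\<in>G. F x)"
  by (rule sum.reindex_bij_witness [of _ "\<lambda>x. x * inverse a" "\<lambda>x. x * a"]) (auto simp: grp_simps sGs)

lemma sum_inverse: "(\<Sum>x\<in>G. F (inverse x)) = (\<Sum>x\<in>G. F x)"
  by (rule sum.reindex_bij_witness [of _ inverse inverse]) (auto simp: grp_simps sGs)

lemma sum_class: "g \<in> G \<Longrightarrow> (\<Sum>x\<in>K. F (cj g x)) = (\<Sum>x\<in>K. F x)"
  by (rule sum.reindex_bij_witness [of _ "cj (inverse g)" "cj g"]) (auto simp: Kcj sGs)

lemma clsD:
  assumes "cls f"
  shows "g \<notin> G \<Longrightarrow> f g = 0" "\<lbrakk>g \<in> G; x \<in> G\<rbrakk> \<Longrightarrow> f (cj g x) = f x"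
  using assms by (auto simp: cls_def)

lemma cls_swap:
  assumes "cls f" "x \<in> G" "y \<in> G"
  shows "f (x * y) = f (y * x)"
  using clsD(2) [OF assms(1), of x "x * y"] assms(2,3) by (simp add: cj_def grp_simps sGs)

lemma conv_assoc: "conv (conv f h) k = conv f (conv h k)"
proof
  fix g
  show "conv (conv f h) k g = conv f (conv h k) g"
  proof (cases "g \<in> G")
    case True
    have "conv (conv f h) k g = (\<Sum>y\<in>G. \<Sum>x\<in>G. f x * h (inverse x * y) * k (inverse y * g))"
      using True by (simp add: conv_def sum_distrib_right)
    also have "\<dots> = (\<Sum>x\<in>G. \<Sum>y\<in>G. f x * h (inverse x * y) * k (inverse y * g))"
      by (rule sum.swap)
    also have "\<dots> = (\<Sum>x\<in>G. \<Sum>y\<in>G. f x * h y * k (inverse y * (inverse x * g)))"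
    proof (rule sum.cong [OF refl])
      fix x assume "x \<in> G"
      then show "(\<Sum>y\<in>G. f x * h (inverse x * y) * k (inverse y * g)) =
          (\<Sum>y\<in>G. f x * h y * k (inverse y * (inverse x * g)))"
        using sum_mult_left [of "inverse x" "\<lambda>y. f x * h y * k (inverse y * (inverse x * g))"]
        by (simp add: sGs grp_simps)
    qed
    also have "\<dots> = conv f (conv h k) g"
      using True by (simp add: conv_def sum_distrib_left sGs mult.assoc)
    finally show ?thesis .
  qed (simp add: conv_def)
qed

lemma conv_commute: "cls f \<Longrightarrow> conv f h = conv h f"
proof
  fix g assume f: "cls f"
  show "conv f h g = conv h f g"
  proof (cases "g \<in> G")
    case True
    have "conv f h g = (\<Sum>x\<in>G. f (g * inverse (inverse x * g)) * h (inverse x * g))"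
      using True by (simp add: conv_def grp_simps)
    also have "\<dots> = (\<Sum>x\<in>G. f (g * inverse (x * g)) * h (x * g))"
      by (rule sum_inverse [of "\<lambda>x. f (g * inverse (x * g)) * h (x * g)"])
    also have "\<dots> = (\<Sum>x\<in>G. f (g * inverse x) * h x)"
      by (rule sum_mult_right [OF True])
    also have "\<dots> = conv h f g"
      using True cls_swap [OF f True] by (simp add: conv_def sGs mult.commute)
    finally show ?thesis .
  qed (simp add: conv_def)
qed

lemma csum_conv: "csum (conv f h) = conv (csum f) h"
proof
  fix g
  show "csum (conv f h) g = conv (csum f) h g"
  proof (cases "g \<in> G")
    case True
    have "csum (conv f h) g = (\<Sum>k\<in>K. \<Sum>x\<in>G. f x * h (inverse x * (k * g)))"
      using True by (simp add: csum_def conv_def sGs KG')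
    also have "\<dots> = (\<Sum>k\<in>K. \<Sum>x\<in>G. f (k * x) * h (inverse x * g))"
    proof (rule sum.cong [OF refl])
      fix k assume "k \<in> K"
      then show "(\<Sum>x\<in>G. f x * h (inverse x * (k * g))) = (\<Sum>x\<in>G. f (k * x) * h (inverse x * g))"
        using sum_mult_left [of k "\<lambda>x. f x * h (inverse x * (k * g))"] by (simp add: KG' grp_simps)
    qed
    also have "\<dots> = (\<Sum>x\<in>G. \<Sum>k\<in>K. f (k * x) * h (inverse x * g))" by (rule sum.swap)
    also have "\<dots> = conv (csum f) h g"
      using True by (simp add: csum_def conv_def sum_distrib_right)
    finally show ?thesis .
  qed (simp add: conv_def csum_def)
qed

lemma conv_add_left: "conv (\<lambda>g. f g + f' g) h = (\<lambda>g. conv f h g + conv f' h g)"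
  by (auto simp: conv_def distrib_right sum.distrib)

lemma conv_scale_left: "conv (\<lambda>g. c * f g) h = (\<lambda>g. c * conv f h g)"
  by (auto simp: conv_def sum_distrib_left mult.assoc)

lemma conv_zero [simp]: "conv (\<lambda>_. 0) h = (\<lambda>_. 0)" "conv h (\<lambda>_. 0) = (\<lambda>_. 0)"
  by (auto simp: conv_def)

lemma csum_add: "csum (\<lambda>g. f g + h g) = (\<lambda>g. csum f g + csum h g)"
  by (auto simp: csum_def sum.distrib)

lemma csum_scale: "csum (\<lambda>g. c * f g) = (\<lambda>g. c * csum f g)"
  by (auto simp: csum_def sum_distrib_left)

lemma csum_zero [simp]: "csum (\<lambda>_. 0) = (\<lambda>_. 0)"
  by (auto simp: csum_def)

lemma csum_sum: "csum (\<lambda>g. \<Sum>i\<in>I. f i g) = (\<lambda>g. \<Sum>i\<in>I. csum (f i) g)"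
proof
  fix g
  show "csum (\<lambda>g. \<Sum>i\<in>I. f i g) g = (\<Sum>i\<in>I. csum (f i) g)"
    by (cases "g \<in> G") (simp_all add: csum_def, rule sum.swap)
qed

lemma conv_delta: "(\<And>g. g \<notin> G \<Longrightarrow> h g = 0) \<Longrightarrow> conv delta h = h"
proof
  fix g assume h: "\<And>g. g \<notin> G \<Longrightarrow> h g = 0"
  have "(\<Sum>x\<in>G. delta x * h (inverse x * g)) = (\<Sum>x\<in>G. if x = 1 then h g else 0)"
    by (intro sum.cong) (auto simp: delta_def grp_simps)
  then show "conv delta h g = h g" using h by (simp add: conv_def sGs fG)
qed

lemma cls_delta: "cls delta"
  using sGs by (auto simp: cls_def delta_def)

lemma cls_csum: "cls f \<Longrightarrow> cls (csum f)"
  unfolding cls_def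
proof (intro conjI ballI allI impI)
  fix g x assume f: "(\<forall>g. g \<notin> G \<longrightarrow> f g = 0) \<and> (\<forall>g\<in>G. \<forall>x\<in>G. f (cj g x) = f x)" and g: "g \<in> G" and x: "x \<in> G"
  have "(\<Sum>k\<in>K. f (k * cj g x)) = (\<Sum>k\<in>K. f (cj g k * cj g x))"
    by (rule sum_class [OF g, symmetric])
  also have "\<dots> = (\<Sum>k\<in>K. f (k * x))"
    using f g x by (intro sum.cong) (auto simp: cj_mult [symmetric] sGs KG')
  finally show "csum f (cj g x) = csum f x" using g x by (simp add: csum_def sgrp_cj_mem [OF sG])
qed (simp add: csum_def)

lemma cls_lin: "cls f \<Longrightarrow> cls h \<Longrightarrow> cls (\<lambda>g. a * f g + b * h g)"
  by (simp add: cls_def)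

lemma ev_0 [simp]: "ev 0 = (\<lambda>_. 0)"
  by (simp add: ev_def)

lemma ev_pCons: "ev (pCons a p) = (\<lambda>g. a * delta g + csum (ev p) g)"
  by (cases "p = 0"; cases "a = 0") (auto simp: ev_def)

lemma ev_add: "ev (p + q) = (\<lambda>g. ev p g + ev q g)"
proof (induction p q rule: poly_induct2)
  case (pCons a p b q)
  then show ?case by (simp add: ev_pCons csum_add distrib_right) (simp add: add_ac)
qed simp

lemma ev_smult: "ev (smult a p) = (\<lambda>g. a * ev p g)"
  by (induction p) (simp_all add: ev_pCons csum_scale distrib_left mult.assoc)

lemma ev_sum: "ev (\<Sum>i\<in>I. p i) = (\<lambda>g. \<Sum>i\<in>I. ev (p i) g)"
  by (induction I rule: infinite_finite_induct) (simp_all add: ev_add)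

lemma cls_ev: "cls (ev p)"
proof (induction p)
  case (pCons a p)
  show ?case unfolding ev_pCons using cls_lin [OF cls_delta cls_csum [OF pCons.IH], of a 1] by simp
qed (simp add: cls_def)

lemma ev_supp: "g \<notin> G \<Longrightarrow> ev p g = 0"
  using cls_ev clsD(1) by blast

lemma ev_mult: "ev (p * q) = conv (ev p) (ev q)"
proof (induction p)
  case (pCons a p)
  have "ev (pCons a p * q) = (\<lambda>g. a * ev q g + csum (conv (ev p) (ev q)) g)"
    by (simp add: ev_add ev_smult ev_pCons pCons.IH)
  also have "\<dots> = conv (ev (pCons a p)) (ev q)"
    unfolding ev_pCons conv_add_left conv_scale_left csum_conv
    by (simp add: conv_delta ev_supp)
  finally show ?case .
qed simp

lemma ev_1: "ev 1 = delta"
  by (simp add: one_pCons ev_pCons)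

lemma conv_ev_eigen:
  assumes "csum e = (\<lambda>g. w * e g)" "\<And>g. g \<notin> G \<Longrightarrow> e g = 0"
  shows "conv (ev p) e = (\<lambda>g. poly p w * e g)"
proof (induction p)
  case (pCons a p)
  show ?case
    unfolding ev_pCons conv_add_left conv_scale_left csum_conv [symmetric] pCons.IH csum_scale assms(1)
    by (simp add: conv_delta assms(2) algebra_simps)
qed simp

text \<open>The involution of the group algebra: the coefficient of \<open>conv f (adj f)\<close> at
  \<open>1\<close> is the squared norm of \<open>f\<close>.\<close>

definition adj :: "('a \<Rightarrow> complex) \<Rightarrow> 'a \<Rightarrow> complex" where
  "adj f g = cnj (f (inverse g))"

lemma cls_adj:
  assumes "cls f" shows "cls (adj f)"
  using assms sgrp_inverse_iff [OF sG] unfolding cls_def adj_def by (auto simp: cj_inverse [symmetric])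

lemma conv_adj_one: "conv f (adj f) 1 = of_real (\<Sum>x\<in>G. (norm (f x))\<^sup>2)"
  by (simp add: conv_def adj_def sGs grp_simps complex_norm_square del: of_real_power)

lemma conv_adj_zero:
  assumes "conv f (adj f) = (\<lambda>_. 0)" "cls f"
  shows "f = (\<lambda>_. 0)"
proof
  fix g
  have "complex_of_real (\<Sum>x\<in>G. (norm (f x))\<^sup>2) = 0" using conv_adj_one [of f] assms(1) by simp
  then have "(\<Sum>x\<in>G. (norm (f x))\<^sup>2) = 0" by (simp only: of_real_eq_0_iff)
  then have "f g = 0" if "g \<in> G" using that fG by (simp add: sum_nonneg_eq_0_iff)
  then show "f g = 0" using clsD(1) [OF assms(2)] by blast
qed

lemma adj_conv_adj: "adj (conv f (adj f)) = conv f (adj f)"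
proof
  fix g
  show "adj (conv f (adj f)) g = conv f (adj f) g"
  proof (cases "g \<in> G")
    case True
    have "adj (conv f (adj f)) g = (\<Sum>x\<in>G. f (g * x) * cnj (f x))"
      using True by (simp add: adj_def conv_def sGs grp_simps mult.commute)
    also have "\<dots> = (\<Sum>x\<in>G. f (g * x) * cnj (f (inverse g * (g * x))))"
      by (simp add: grp_simps)
    also have "\<dots> = (\<Sum>x\<in>G. f x * cnj (f (inverse g * x)))"
      by (rule sum_mult_left [OF True])
    also have "\<dots> = conv f (adj f) g"
      using True by (simp add: adj_def conv_def grp_simps)
    finally show ?thesis .
  qed (simp add: adj_def conv_def sgrp_inverse_iff [OF sG])
qed

lemma cls_conv:
  assumes f: "cls f" and h: "cls h" shows "cls (conv f h)"
  unfolding cls_def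
proof (intro conjI ballI allI impI)
  fix g x assume g: "g \<in> G" and x: "x \<in> G"
  have "conv f h (cj g x) = (\<Sum>y\<in>G. f y * h (inverse y * cj g x))"
    using g x by (simp add: conv_def sgrp_cj_mem [OF sG])
  also have "\<dots> = (\<Sum>y\<in>G. f (cj g y) * h (inverse (cj g y) * cj g x))"
    by (rule sum.reindex_bij_witness [of _ "cj g" "cj (inverse g)"])
      (use g in \<open>auto simp: sGs sgrp_cj_mem [OF sG]\<close>)
  also have "\<dots> = (\<Sum>y\<in>G. f y * h (inverse y * x))"
    using clsD(2) [OF f g] clsD(2) [OF h g] x
    by (intro sum.cong) (auto simp: cj_inverse [symmetric] cj_mult [symmetric] sGs)
  finally show "conv f h (cj g x) = conv f h x" using x by (simp add: conv_def)
qed (simp add: conv_def)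

text \<open>Class functions commute with their adjoints, so they generate a reduced algebra.\<close>

lemma conv_self_zero:
  assumes f: "cls f" and z: "conv f f = (\<lambda>_. 0)"
  shows "f = (\<lambda>_. 0)"
proof -
  define h where "h = conv f (adj f)"
  have h: "cls h" unfolding h_def by (intro cls_conv f cls_adj)
  have "conv h h = conv f (conv (adj f) (conv f (adj f)))" by (simp add: h_def conv_assoc)
  also have "conv (adj f) (conv f (adj f)) = conv f (conv (adj f) (adj f))"
    unfolding conv_commute [OF cls_adj [OF f], of "conv f (adj f)"] by (rule conv_assoc)
  also have "conv f \<dots> = (\<lambda>_. 0)" by (simp add: conv_assoc [symmetric] z)
  finally have "conv h (adj h) = (\<lambda>_. 0)" unfolding h_def adj_conv_adj .
  then have "h = (\<lambda>_. 0)" using h by (rule conv_adj_zero)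
  then show ?thesis unfolding h_def using f by (rule conv_adj_zero)
qed

lemma ev_power_zero: "ev (q ^ (2 ^ k)) = (\<lambda>_. 0) \<Longrightarrow> ev q = (\<lambda>_. 0)"
proof (induction k)
  case (Suc k)
  have "conv (ev (q ^ (2 ^ k))) (ev (q ^ (2 ^ k))) = ev (q ^ (2 ^ Suc k))"
    by (simp add: ev_mult [symmetric] power_add [symmetric] mult_2)
  then have "ev (q ^ (2 ^ k)) = (\<lambda>_. 0)" using Suc.prems conv_self_zero cls_ev by simp
  then show ?case by (rule Suc.IH)
qed simp

lemma ev_dvd: "p dvd q \<Longrightarrow> ev p = (\<lambda>_. 0) \<Longrightarrow> ev q = (\<lambda>_. 0)"
  by (auto elim!: dvdE simp: ev_mult)

text \<open>Sufficiently many powers of one element are dependent, which gives an annihilating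
  polynomial. The product over its distinct roots still annihilates, as non-zero class functions are
  not nilpotent. The exponent \<open>2 ^ length as\<close> suits the repeated squaring in
  \<open>ev_power_zero\<close>.\<close>

lemma exists_annihilator: "\<exists>W. finite W \<and> ev (\<Prod>w\<in>W. [:- w, 1:]) = (\<lambda>_. 0)"
proof -
  obtain c where c: "\<exists>i\<le>card G. c i \<noteq> 0" "\<forall>g\<in>G. (\<Sum>i\<le>card G. c i * ev (monom 1 i) g) = 0"
    using kernel_relation [OF fG, of "\<lambda>i. ev (monom 1 i)"] by blast
  define p where "p = (\<Sum>i\<le>card G. smult (c i) (monom 1 i))"
  have "coeff p i = c i" if "i \<le> card G" for i
  proof -
    have "coeff p i = (\<Sum>j\<le>card G. if j = i then c j else 0)"
      unfolding p_def coeff_sum by (intro sum.cong) auto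
    then show ?thesis using that by simp
  qed
  then have p0: "p \<noteq> 0" using c(1) by (metis coeff_0)
  have p: "ev p = (\<lambda>_. 0)"
  proof
    fix g
    show "ev p g = 0" using c(2) ev_supp [of g p] by (cases "g \<in> G") (simp_all add: p_def ev_sum ev_smult)
  qed
  obtain as where as: "smult (lead_coeff p) (\<Prod>a\<leftarrow>as. [:- a, 1:]) = p"
    using fundamental_theorem_algebra_factorized [of p] by blast
  define q where "q = (\<Prod>w\<in>set as. [:- w, 1:])"
  have "(\<Prod>a\<leftarrow>bs. [:- a, 1:]) dvd q ^ length bs" if "set bs \<subseteq> set as" for bs
    using that
  proof (induction bs)
    case (Cons b bs)
    have "[:- b, 1:] dvd q" unfolding q_def using Cons.prems by (intro dvd_prodI) auto
    then have "[:- b, 1:] * (\<Prod>a\<leftarrow>bs. [:- a, 1:]) dvd q * q ^ length bs"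
      using Cons by (intro mult_dvd_mono) auto
    then show ?case by simp
  qed simp
  then have "(\<Prod>a\<leftarrow>as. [:- a, 1:]) dvd q ^ length as" by simp
  moreover have "length as \<le> 2 ^ length as" by (simp add: less_imp_le)
  ultimately have "(\<Prod>a\<leftarrow>as. [:- a, 1:]) dvd q ^ (2 ^ length as)" by (meson dvd_trans le_imp_power_dvd)
  then have "p dvd q ^ (2 ^ length as)" using p0 as by (metis leading_coeff_0_iff smult_dvd_iff)
  then have "ev (q ^ (2 ^ length as)) = (\<lambda>_. 0)" using p ev_dvd by blast
  then have "ev q = (\<lambda>_. 0)" by (rule ev_power_zero)
  then show ?thesis unfolding q_def by blast
qed

lemma spectral_idempotents:
  obtains W e where "finite W"
    and "\<And>w. w \<in> W \<Longrightarrow> cls (e w)"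
    and "\<And>w. w \<in> W \<Longrightarrow> csum (e w) = (\<lambda>g. w * e w g)"
    and "\<And>w. w \<in> W \<Longrightarrow> conv (e w) (e w) = e w"
    and "\<And>g. (\<Sum>w\<in>W. e w g) = delta g"
proof -
  obtain W where fW: "finite W" and W: "ev (\<Prod>w\<in>W. [:- w, 1:]) = (\<lambda>_. 0)"
    using exists_annihilator by blast
  \<comment> \<open>Lagrange interpolation polynomials at the roots: they sum to \<open>1\<close>,
    and evaluated at the central element they become the spectral projections of
    \<open>csum\<close>.\<close>
  define l where "l w = smult (inverse (\<Prod>v\<in>W - {w}. w - v)) (\<Prod>v\<in>W - {w}. [:- v, 1:])" for w
  define e where "e w = ev (l w)" for w
  have l1: "poly (l w) w = 1" for w
    using fW by (simp add: l_def poly_prod field_simps)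
  have l0: "poly (l w) v = 0" if "v \<in> W" "v \<noteq> w" for v w
    using fW that by (auto simp: l_def poly_prod)
  have W0: "card W > 0"
  proof (rule ccontr)
    assume "\<not> card W > 0"
    then have "delta = (\<lambda>_. 0)" using W fW by (simp add: ev_1)
    then have "delta 1 = 0" by metis
    then show False by (simp add: delta_def)
  qed
  have "(\<Sum>w\<in>W. l w) = 1"
  proof (rule poly_eqI_degree [of W])
    fix v assume v: "v \<in> W"
    have "poly (\<Sum>w\<in>W. l w) v = (\<Sum>w\<in>W. if w = v then 1 else 0)"
      unfolding poly_sum by (intro sum.cong) (use l1 l0 v in auto)
    then show "poly (\<Sum>w\<in>W. l w) v = poly 1 v" using v fW by simp
  next
    have "degree (l w) \<le> card W - 1" if "w \<in> W" for w
    proof -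
      have "degree (l w) \<le> degree (\<Prod>v\<in>W - {w}. [:- v, 1:])" by (simp add: l_def degree_smult_le)
      also have "\<dots> \<le> (\<Sum>v\<in>W - {w}. degree [:- v, 1:])" by (rule degree_prod_sum_le [unfolded comp_def]) (use fW in simp)
      also have "\<dots> = card W - 1" using that fW by simp
      finally show ?thesis .
    qed
    then have "degree (\<Sum>w\<in>W. l w) \<le> card W - 1" by (rule degree_sum_le [OF fW])
    then show "degree (\<Sum>w\<in>W. l w) < card W" using W0 by simp
  qed (use W0 in simp)
  then have sum: "(\<Sum>w\<in>W. e w g) = delta g" for g
    using fun_cong [OF ev_sum [of l W], of g] by (simp add: e_def ev_1)
  have eig: "csum (e w) = (\<lambda>g. w * e w g)" if "w \<in> W" for w
  proof -
    have "(\<Prod>v\<in>W. [:- v, 1:]) = [:- w, 1:] * (\<Prod>v\<in>W - {w}. [:- v, 1:])"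
      by (rule prod.remove [OF fW that])
    then have "ev ([:- w, 1:] * l w) = (\<lambda>_. 0)"
      using W by (simp add: l_def ev_smult del: mult_pCons_left)
    moreover have "ev ([:- w, 1:] * l w) = (\<lambda>g. - w * e w g + csum (e w) g)"
      by (simp add: ev_add ev_pCons e_def ev_smult flip: smult_minus_left)
    ultimately have "- w * e w g + csum (e w) g = 0" for g by metis
    then show ?thesis by (auto simp: add_eq_0_iff)
  qed
  have idem: "conv (e w) (e w) = e w" if "w \<in> W" for w
    using conv_ev_eigen [OF eig [OF that], of "l w"] l1 [of w] ev_supp unfolding e_def by simp
  show ?thesis by (rule that [of W e]) (use fW eig idem sum cls_ev in \<open>auto simp: e_def\<close>)
qed

end

subsection \<open>Burnside's theorem on classes of prime power size\<close>

text \<open>Equality case of the triangle inequality: the real parts of \<open>a y * cnj b\<close>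
  are bounded by the squared norm of \<open>b\<close> and have it as their mean, so each attains
  it.\<close>

lemma mean_extremal:
  fixes a :: "'i \<Rightarrow> complex"
  assumes "finite K" and le: "\<And>x. x \<in> K \<Longrightarrow> norm (a x) \<le> norm b"
    and sum: "(\<Sum>x\<in>K. a x) = of_nat (card K) * b" and x: "x \<in> K"
  shows "a x = b"
proof -
  have le': "Re (a y * cnj b) \<le> (norm b)\<^sup>2" if "y \<in> K" for y
  proof -
    have "Re (a y * cnj b) \<le> norm (a y) * norm b" using complex_Re_le_cmod [of "a y * cnj b"] by (simp add: norm_mult)
    also have "\<dots> \<le> norm b * norm b" using le [OF that] by (simp add: mult_right_mono)
    finally show ?thesis by (simp add: power2_eq_square)
  qed
  have "(\<Sum>y\<in>K. (norm b)\<^sup>2 - Re (a y * cnj b)) = of_nat (card K) * (norm b)\<^sup>2 - Re ((\<Sum>y\<in>K. a y) * cnj b)"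
    by (simp add: sum_subtractf sum_distrib_right)
  also have "\<dots> = 0"
    unfolding sum mult.assoc complex_norm_square [symmetric] by (simp flip: of_real_power)
  finally have "(norm b)\<^sup>2 - Re (a x * cnj b) = 0"
    using sum_nonneg_eq_0_iff [OF assms(1), of "\<lambda>y. (norm b)\<^sup>2 - Re (a y * cnj b)"] le' x by auto
  then have "(norm (a x - b))\<^sup>2 = (norm (a x))\<^sup>2 - (norm b)\<^sup>2"
    by (simp only: cmod_power2) (simp add: power2_eq_square algebra_simps)
  also have "\<dots> \<le> 0" using le [OF x] by (simp add: power_mono)
  finally show ?thesis by simp
qed

context group_algebra
begin

text \<open>The sum is the trace of \<open>conv e\<close> followed by the two-sided translation by
  \<open>u\<close> and \<open>v\<close>. An eigenfunction with \<open>d \<noteq> 0\<close> is fixed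
  by the projection \<open>conv e\<close>, so it is an eigenfunction of the translation itself,
  whose \<open>r\<close>-th power is the identity.\<close>

lemma trace_translate:
  assumes e: "cls e" "conv e e = e" and uv: "u \<in> G" "v \<in> G" and r: "u ^ r = 1" "v ^ r = 1"
  shows "\<exists>es. set es \<subseteq> {d. d = 0 \<or> d ^ r = 1} \<and> (\<Sum>g\<in>G. e (u * g * v * inverse g)) = sum_list es"
proof (rule trace_kernel [OF fG, of "\<lambda>g h. e (u * g * v * inverse h)"])
  fix d f assume nz: "\<exists>g\<in>G. f g \<noteq> 0"
    and eig: "\<And>g. g \<in> G \<Longrightarrow> (\<Sum>h\<in>G. e (u * g * v * inverse h) * f h) = d * f g"
  define T :: "('a \<Rightarrow> complex) \<Rightarrow> 'a \<Rightarrow> complex"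
    where "T F g = (if g \<in> G then F (u * g * v) else 0)" for F g
  define F where "F g = (if g \<in> G then f g else 0)" for g
  have conv_alt: "conv e F g = (\<Sum>h\<in>G. e (g * inverse h) * F h)" if "g \<in> G" for F g
  proof -
    have "conv e F g = (\<Sum>x\<in>G. e (g * inverse (inverse x * g)) * F (inverse x * g))"
      using that by (simp add: conv_def grp_simps)
    also have "\<dots> = (\<Sum>x\<in>G. e (g * inverse (x * g)) * F (x * g))"
      by (rule sum_inverse [of "\<lambda>x. e (g * inverse (x * g)) * F (x * g)"])
    also have "\<dots> = (\<Sum>x\<in>G. e (g * inverse x) * F x)"
      by (rule sum_mult_right [OF that])
    finally show ?thesis .
  qed
  have T: "T (conv e F) = (\<lambda>g. d * F g)"
  proof
    fix g
    show "T (conv e F) g = d * F g"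
      using eig [of g] conv_alt [of "u * g * v" F] uv by (simp add: T_def F_def sGs)
  qed
  have cT: "conv e (T F) = T (conv e F)" for F
  proof
    fix g
    show "conv e (T F) g = T (conv e F) g"
    proof (cases "g \<in> G")
      case True
      have "conv e (T F) g = (\<Sum>x\<in>G. e x * F (u * (inverse x * g) * v))"
        using True by (simp add: conv_def T_def sGs)
      also have "\<dots> = (\<Sum>x\<in>G. e (cj u x) * F (u * (inverse (cj u x) * g) * v))"
        by (rule sum.reindex_bij_witness [of _ "cj u" "cj (inverse u)"])
          (use uv in \<open>auto simp: sGs sgrp_cj_mem [OF sG]\<close>)
      also have "\<dots> = (\<Sum>x\<in>G. e x * F (inverse x * (u * g * v)))"
        using clsD(2) [OF e(1) uv(1)] by (intro sum.cong) (auto simp: cj_def grp_simps)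
      also have "\<dots> = T (conv e F) g" using True uv by (simp add: T_def conv_def sGs)
      finally show ?thesis .
    qed (simp add: T_def conv_def)
  qed
  have conv_scale: "conv e (\<lambda>g. d * F g) = (\<lambda>g. d * conv e F g)"
    by (auto simp: conv_def sum_distrib_left mult_ac)
  have "(\<lambda>g. d * conv e F g) = (\<lambda>g. d * F g)"
    using cT [of "conv e F"] unfolding T conv_scale conv_assoc [symmetric] e(2) T .
  then have *: "d * conv e F g = d * F g" for g by metis
  show "d \<in> {d. d = 0 \<or> d ^ r = 1}"
  proof (cases "d = 0")
    case False
    then have cF: "conv e F = F" using * by auto
    have "F (u ^ i * g * v ^ i) = d ^ i * F g" if "g \<in> G" for i g
    proof (induction i)
      case (Suc i)
      have m: "u ^ i * g * v ^ i \<in> G" using uv that by (simp add: sGs sgrp_pow [OF sG])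
      have "F (u ^ Suc i * g * v ^ Suc i) = F (u * (u ^ i * g * v ^ i) * v)"
        by (simp add: mult.assoc power_Suc2 del: power_Suc) (simp add: power_commutes mult.assoc [symmetric])
      also have "\<dots> = d * F (u ^ i * g * v ^ i)" using fun_cong [OF T, of "u ^ i * g * v ^ i"] m by (simp add: cF T_def)
      finally show ?case using Suc by simp
    qed simp
    from this [of _ r] nz show ?thesis by (auto simp: F_def r)
  qed simp
qed

end

text \<open>A simple group with a conjugacy class of size \<open>p ^ k > 1\<close>, refuted by
  \<open>impossible\<close>.\<close>

locale prime_power_class =
  fixes G :: "'a::grp set" and z :: 'a and p k :: nat
  assumes sG: "sgrp G" and fG: "finite G"
    and simple: "\<And>N. normal_in N G \<Longrightarrow> N = {1} \<or> N = G"
    and zG: "z \<in> G" and z1: "z \<noteq> 1" and p: "prime p" and k: "k > 0"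
    and card_K: "card ((\<lambda>g. cj g z) ` G) = p ^ k"
begin

abbreviation "K \<equiv> (\<lambda>g. cj g z) ` G"

sublocale group_algebra G K
proof
  show "K \<subseteq> G" using zG by (auto simp: sgrp_cj_mem [OF sG])
  fix g x assume "g \<in> G" "x \<in> K"
  then show "cj g x \<in> K" by (auto simp: cj_cj sgrpD [OF sG])
qed (use sG fG in auto)

lemma csqrt_p: "csqrt (of_nat p) * csqrt (of_nat p) = of_nat p"
  using power2_csqrt [of "of_nat p"] by (simp only: power2_eq_square)

lemma fK: "finite K" using fG by simp

lemma zK: "z \<in> K" using sGs(1) by (intro image_eqI [of _ _ 1]) simp_all

lemma cK: "card K > 0" "card K > 1"
  using card_K p k prime_gt_1_nat [OF p] by (simp_all add: one_less_power del: One_nat_def)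

lemma csum_one: "cls f \<Longrightarrow> csum f 1 = of_nat (card K) * f z"
proof -
  assume f: "cls f"
  have "(\<Sum>x\<in>K. f (x * 1)) = (\<Sum>x\<in>K. f z)"
    by (rule sum.cong) (auto simp: clsD(2) [OF f _ zG])
  then show ?thesis using sGs(1) by (simp add: csum_def)
qed

text \<open>As \<open>f\<close> is a class function, the set \<open>N\<close> of admissible
  translations is invariant under conjugation, and simplicity applies. \<open>P\<close> and
  \<open>R\<close> cover the two uses in \<open>extremal_constant\<close>: keeping the maximal
  modulus and keeping the value.\<close>

lemma normal_stabilizer:
  assumes f: "cls f" and N: "\<And>h. h \<in> N \<longleftrightarrow> h \<in> G \<and> (\<forall>g\<in>G. P (f g) \<longrightarrow> R (f g) (f (h * g)))"
    and one: "1 \<in> N" and m: "\<And>x y. x \<in> N \<Longrightarrow> y \<in> N \<Longrightarrow> x * y \<in> N"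
    and x: "x \<in> N" "x \<noteq> 1"
  shows "N = G"
proof -
  have "sgrp N"
  proof (rule sgrp_finite_closed)
    show "finite N" by (rule finite_subset [OF _ fG]) (use N in blast)
    show "N \<noteq> {}" using one by blast
  qed (rule m)
  moreover have "cj u h \<in> N" if u: "u \<in> G" and h: "h \<in> N" for u h
  proof -
    have hG: "h \<in> G" using h N by blast
    have "P (f g) \<longrightarrow> R (f g) (f (cj u h * g))" if g: "g \<in> G" for g
    proof -
      define g' where "g' = cj (inverse u) g"
      have g'G: "g' \<in> G" using u g by (simp add: g'_def sGs sgrp_cj_mem [OF sG])
      have "cj u h * g = cj u (h * g')" by (simp add: g'_def cj_mult)
      then have "f (cj u h * g) = f (h * g')" using clsD(2) [OF f u] hG g'G by (simp add: sGs)
      moreover have "f g' = f g" unfolding g'_def using clsD(2) [OF f] u g by (simp add: sGs)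
      moreover have "P (f g') \<longrightarrow> R (f g') (f (h * g'))" using h g'G N by blast
      ultimately show ?thesis by simp
    qed
    then show ?thesis using N hG u by (auto simp: sgrp_cj_mem [OF sG])
  qed
  ultimately have "normal_in N G" using N unfolding normal_in_def by blast
  then show ?thesis using simple x by blast
qed

text \<open>Where the modulus is maximal the eigenvalue equation forces equality in the triangle
  inequality, so translation by \<open>K\<close> keeps the modulus maximal; by simplicity it is
  constant. Then \<open>y * inverse z\<close> with \<open>y \<noteq> z\<close> in \<open>K\<close>
  leaves \<open>f\<close> unchanged, and simplicity makes \<open>f\<close> constant.\<close>

lemma extremal_constant:
  assumes f: "cls f" and eig: "csum f = (\<lambda>g. w * f g)" and w: "norm w = of_nat (card K)" and g: "g \<in> G"
  shows "f g = f 1"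
proof -
  define M where "M = Max ((\<lambda>g. norm (f g)) ` G)"
  have le: "norm (f h) \<le> M" if "h \<in> G" for h unfolding M_def using fG that by (intro Max_ge) auto
  have "M \<in> (\<lambda>g. norm (f g)) ` G" unfolding M_def using fG sGs(1) by (intro Max_in) auto
  then obtain g0 where g0: "g0 \<in> G" "norm (f g0) = M" by auto
  have step: "of_nat (card K) * f (x * h) = w * f h" if h: "h \<in> G" "norm (f h) = M" and x: "x \<in> K" for h x
  proof -
    have "f (x * h) = w / of_nat (card K) * f h"
    proof (rule mean_extremal [OF fK _ _ x, of "\<lambda>x. f (x * h)"])
      show "norm (f (y * h)) \<le> norm (w / of_nat (card K) * f h)" if "y \<in> K" for y
        using le [of "y * h"] that h w cK by (simp add: norm_mult norm_divide sGs KG')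
      show "(\<Sum>x\<in>K. f (x * h)) = of_nat (card K) * (w / of_nat (card K) * f h)"
        using fun_cong [OF eig, of h] h cK by (simp add: csum_def)
    qed
    then show ?thesis using cK by simp
  qed
  have step_norm: "norm (f (x * h)) = M" if h: "h \<in> G" "norm (f h) = M" and x: "x \<in> K" for h x
    using arg_cong [OF step [OF that], of norm] w h cK by (simp add: norm_mult)
  have "{h \<in> G. \<forall>g\<in>G. norm (f g) = M \<longrightarrow> norm (f (h * g)) = M} = G" (is "?N = G")
  proof (rule normal_stabilizer [OF f, where P = "\<lambda>a. norm a = M" and R = "\<lambda>a b. norm b = M" and x = z])
    show "x * y \<in> ?N" if "x \<in> ?N" "y \<in> ?N" for x y using that by (auto simp: sGs mult.assoc)
    show "z \<in> ?N" using step_norm zK zG by blast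
  qed (use z1 sGs(1) in auto)
  then have "h * inverse g0 \<in> ?N" if "h \<in> G" for h using that g0 by (simp add: sGs)
  then have all: "norm (f h) = M" if "h \<in> G" for h using that g0 by (force simp: grp_simps)
  have "{h \<in> G. \<forall>g\<in>G. True \<longrightarrow> f (h * g) = f g} = G" (is "?N = G")
  proof -
    have "\<not> K \<subseteq> {z}" using cK(2) card_mono [of "{z}" K] by auto
    then obtain y where y: "y \<in> K" "y \<noteq> z" by blast
    show ?thesis
    proof (rule normal_stabilizer [OF f, where P = "\<lambda>a. True" and R = "\<lambda>a b. b = a" and x = "y * inverse z"])
      show "u * v \<in> ?N" if "u \<in> ?N" "v \<in> ?N" for u v using that by (auto simp: sGs mult.assoc)
      have "f (y * inverse z * g) = f g" if "g \<in> G" for g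
      proof -
        have g': "inverse z * g \<in> G" using zG that by (simp add: sGs)
        have "of_nat (card K) * f (y * (inverse z * g)) = of_nat (card K) * f (z * (inverse z * g))"
          unfolding step [OF g' all [OF g'] y(1)] step [OF g' all [OF g'] zK] ..
        then show ?thesis using cK by (simp add: grp_simps)
      qed
      then show "y * inverse z \<in> ?N" using y zG KG' by (simp add: sGs)
      show "y * inverse z \<noteq> 1" using y by (metis inverse_mult_self mult_right_cancel_grp mult_inverse_self)
    qed (use sGs(1) in auto)
  qed
  then have "g \<in> ?N" using g by simp
  then show ?thesis using sGs(1) by force
qed

lemma csum_kernel:
  assumes "g \<in> G"
  shows "csum f g = (\<Sum>h\<in>G. of_int (if h * inverse g \<in> K then 1 else 0) * f h)"
proof -
  have "(\<Sum>h\<in>G. of_int (if h * inverse g \<in> K then 1 else 0) * f h) =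
      (\<Sum>x\<in>G. of_int (if x * g * inverse g \<in> K then 1 else 0) * f (x * g))"
    by (rule sum_mult_right [OF assms, symmetric])
  also have "\<dots> = (\<Sum>x\<in>G. if x \<in> K then f (x * g) else 0)"
    by (intro sum.cong) (auto simp: grp_simps)
  also have "\<dots> = csum f g"
    using assms KG fG by (simp add: csum_def sum.If_cases Int_absorb1)
  finally show ?thesis by simp
qed

lemma csum_bound:
  assumes "\<exists>g\<in>G. f g \<noteq> 0" "\<And>g. g \<in> G \<Longrightarrow> csum f g = x * f g"
  shows "norm x \<le> of_nat (card K)"
proof -
  define M where "M = Max ((\<lambda>g. norm (f g)) ` G)"
  have le: "norm (f h) \<le> M" if "h \<in> G" for h unfolding M_def using fG that by (intro Max_ge) auto
  have "M \<in> (\<lambda>g. norm (f g)) ` G" unfolding M_def using fG sGs(1) by (intro Max_in) auto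
  then obtain g0 where g0: "g0 \<in> G" "norm (f g0) = M" by auto
  obtain g1 where "g1 \<in> G" "f g1 \<noteq> 0" using assms(1) by blast
  then have M0: "M > 0" using le [of g1] by (meson less_le_trans zero_less_norm_iff)
  have "norm x * M = norm (csum f g0)" using g0 assms(2) by (simp add: norm_mult)
  also have "\<dots> \<le> (\<Sum>x\<in>K. norm (f (x * g0)))" using g0 by (simp add: csum_def norm_sum)
  also have "\<dots> \<le> (\<Sum>x\<in>K. M)" using g0 KG' by (intro sum_mono le) (simp add: sGs)
  finally have "norm x * M \<le> of_nat (card K) * M" by simp
  then show ?thesis using M0 by simp
qed

lemma sum_conjugates: "of_nat (card K) * (\<Sum>g\<in>G. F (cj g z)) = (of_nat (card G) * (\<Sum>x\<in>K. F x) :: complex)"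
proof -
  have "(\<Sum>g\<in>G. F (cj g x)) = (\<Sum>g\<in>G. F (cj g z))" if "x \<in> K" for x
    using that sum_mult_left [of _ "\<lambda>g. F (cj g z)"] by (auto simp: cj_cj)
  then have "of_nat (card K) * (\<Sum>g\<in>G. F (cj g z)) = (\<Sum>x\<in>K. \<Sum>g\<in>G. F (cj g x))" by simp
  also have "\<dots> = (\<Sum>g\<in>G. \<Sum>x\<in>K. F (cj g x))" by (rule sum.swap)
  also have "\<dots> = (\<Sum>g\<in>G. \<Sum>x\<in>K. F x)" by (intro sum.cong refl sum_class)
  finally show ?thesis by simp
qed

text \<open>The normalised eigenvalue and all its conjugates are eigenvalues of the stochastic matrix of
  \<open>csum\<close> divided by \<open>|K|\<close>, hence of modulus at most one.\<close>

lemma small_eigenvalue: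
  assumes e: "cls e" and eig: "csum e = (\<lambda>g. w * e g)" and w: "w \<noteq> of_nat (card K)" and nz: "e h \<noteq> 0"
    and int: "algebraic_int (w / of_nat (card K))"
  shows "w = 0"
proof -
  obtain q :: "int poly" where q: "lead_coeff q = 1"
    and q_root: "\<And>x :: complex. poly (of_int_poly q) x = 0 \<longleftrightarrow>
      (\<exists>f. (\<exists>g\<in>G. f g \<noteq> 0) \<and> (\<forall>g\<in>G. (\<Sum>h\<in>G. of_int (if h * inverse g \<in> K then 1 else 0) * f h) = x * f g))"
    by (rule int_kernel_char_poly [OF fG, of "\<lambda>g h. if h * inverse g \<in> K then 1 else 0"]) blast
  have q_root: "poly (of_int_poly q) x = 0 \<longleftrightarrow> (\<exists>f. (\<exists>g\<in>G. f g \<noteq> 0) \<and> (\<forall>g\<in>G. csum f g = x * f g))" for x :: complex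
    unfolding q_root using csum_kernel by (auto cong: ball_cong)
  \<comment> \<open>Substituting \<open>card K\<close> times the variable makes the roots of
    \<open>b\<close> the normalised eigenvalues, which \<open>csum_bound\<close> keeps in the unit
    disc.\<close>
  define b where "b = pcompose q [:0, int (card K):]"
  have b0: "b \<noteq> 0" using q cK pcompose_eq_0 [of q "[:0, int (card K):]"] by (auto simp: b_def)
  have "of_int_poly b = pcompose (of_int_poly q) [:0, of_nat (card K) :: complex:]"
    unfolding b_def of_int_hom.map_poly_pcompose
    by (rule arg_cong [of _ _ "pcompose _"], intro poly_eqI) (simp add: coeff_map_poly coeff_pCons split: nat.split)
  then have b: "poly (of_int_poly b) x = poly (of_int_poly q) (of_nat (card K) * x)" for x :: complex
    by (simp add: poly_pcompose mult.commute)
  have hG: "h \<in> G" using nz clsD(1) [OF e] by blast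
  have "norm w \<le> of_nat (card K)" using csum_bound [of e w] nz hG eig by auto
  moreover have "norm w \<noteq> of_nat (card K)"
  proof
    assume "norm w = of_nat (card K)"
    then have c: "e g = e 1" if "g \<in> G" for g using extremal_constant [OF e eig] that by blast
    then have "e 1 \<noteq> 0" "e z = e 1" using nz hG zG by metis+
    moreover have "of_nat (card K) * e z = w * e 1" using csum_one [OF e] eig by simp
    ultimately show False using w by simp
  qed
  ultimately have lt: "norm w < of_nat (card K)" by simp
  have "w / of_nat (card K) = 0"
  proof (rule algebraic_int_small_zero [OF int b0])
    show "poly (of_int_poly b) (w / of_nat (card K)) = 0"
      unfolding b q_root using cK nz hG eig by (intro exI [of _ e]) auto
    show "norm r \<le> 1" if "poly (of_int_poly b) r = 0" for r :: complex
    proof -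
      have "norm (of_nat (card K) * r) \<le> of_nat (card K)"
        using that csum_bound unfolding b q_root by blast
      then show ?thesis using cK by (simp add: norm_mult)
    qed
    show "norm (w / of_nat (card K)) < 1" using lt cK by (simp add: norm_divide)
  qed
  then show ?thesis using cK by simp
qed

lemma algebraic_int_eigenvalue:
  assumes eig: "csum e = (\<lambda>g. w * e g)" and nz: "h \<in> G" "e h \<noteq> 0"
  shows "algebraic_int w"
  by (rule algebraic_int_span [where I = G and f = e and k = "\<lambda>g h. if h * inverse g \<in> K then 1 else 0", OF fG nz])
    (simp add: csum_kernel [symmetric] eig)

text \<open>With \<open>m = |G| e(1)\<close> and \<open>\<alpha> = w / |K|\<close>, the numbers \<open>m\<alpha>\<close> and \<open>m\<alpha>\<^sup>2\<close> are traces of translations by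
  \<open>z\<close> on the ideal of \<open>e\<close>, hence algebraic integers. If \<open>p\<close> does not divide \<open>m\<close>, then \<open>\<alpha>\<close> itself is one and
  vanishes; otherwise \<open>(m\<alpha>)\<^sup>2 = m \<cdot> m\<alpha>\<^sup>2\<close> is divisible by \<open>p\<close>.\<close>

lemma idempotent_value:
  assumes e: "cls e" and eig: "csum e = (\<lambda>g. w * e g)" and idem: "conv e e = e" and w: "w \<noteq> of_nat (card K)"
  shows "algebraic_int (of_nat (card G) * e z / csqrt (of_nat p))"
proof -
  let ?n = "of_nat (card G) :: complex" and ?c = "of_nat (card K) :: complex"
  have c0: "?c \<noteq> 0" using cK by simp
  have zr: "z ^ card G = 1" using pow_card_eq_one [OF sG zG] .
  have n0: "card G > 0" using card_gt_0_sgrp [OF sG fG] .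
  have root: "algebraic_int d" if "d = 0 \<or> d ^ card G = 1" for d :: complex
    using that algebraic_int_root_of_unity [OF _ n0] by auto
  have ez: "?c * e z = w * e 1" using csum_one [OF e] eig by simp
  obtain es where es: "set es \<subseteq> {d. d = 0 \<or> d ^ 1 = 1}" "(\<Sum>g\<in>G. e (1 * g * 1 * inverse g)) = sum_list es"
    using trace_translate [OF e idem sGs(1) sGs(1), of 1] by auto
  \<comment> \<open>For the identity translation all eigenvalues are \<open>0\<close> or
    \<open>1\<close>, so \<open>m\<close> is the dimension of the ideal generated by
    \<open>e\<close>.\<close>
  have "\<exists>m. sum_list es = of_nat m" if "set es \<subseteq> {0, 1}" for es :: "complex list"
    using that
  proof (induction es)
    case (Cons a es)
    then obtain m where "sum_list es = of_nat m" by auto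
    then show ?case using Cons.prems by (auto intro: exI [of _ m] exI [of _ "Suc m"])
  qed (auto intro: exI [of _ 0])
  then obtain m where m: "?n * e 1 = of_nat m" using es by (auto simp: grp_simps subset_iff)
  have int_s: "algebraic_int (?n * e z)"
  proof -
    obtain es where "set es \<subseteq> {d. d = 0 \<or> d ^ card G = 1}" "(\<Sum>g\<in>G. e (z * g * 1 * inverse g)) = sum_list es"
      using trace_translate [OF e idem zG sGs(1) zr] by auto
    moreover from this(1) have "algebraic_int (sum_list es)" by (intro algebraic_int_sum_list root) auto
    ultimately show ?thesis by (simp add: grp_simps)
  qed
  define t where "t = (\<Sum>g\<in>G. e (z * g * z * inverse g))"
  have int_t: "algebraic_int t"
  proof -
    obtain es where "set es \<subseteq> {d. d = 0 \<or> d ^ card G = 1}" "t = sum_list es"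
      using trace_translate [OF e idem zG zG zr zr] unfolding t_def by auto
    moreover from this(1) have "algebraic_int (sum_list es)" by (intro algebraic_int_sum_list root) auto
    ultimately show ?thesis by simp
  qed
  have t: "?c * t = w * (?n * e z)"
  proof -
    have "t = (\<Sum>g\<in>G. e (z * cj (inverse g) z))" by (simp add: t_def cj_def grp_simps)
    also have "\<dots> = (\<Sum>g\<in>G. e (z * cj g z))" by (rule sum_inverse)
    finally have "?c * t = ?n * (\<Sum>x\<in>K. e (z * x))" using sum_conjugates [of "\<lambda>x. e (z * x)"] by simp
    also have "(\<Sum>x\<in>K. e (z * x)) = (\<Sum>x\<in>K. e (x * z))"
      by (intro sum.cong refl cls_swap [OF e zG]) (rule KG')
    also have "\<dots> = w * e z" using fun_cong [OF eig, of z] zG by (simp add: csum_def)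
    finally show ?thesis by simp
  qed
  show ?thesis
  proof (cases "w = 0")
    case True
    then show ?thesis using ez c0 by simp
  next
    case False
    have "p dvd m"
    proof (rule ccontr)
      assume "\<not> p dvd m"
      then have "coprime p m" using p by (simp add: prime_imp_coprime)
      then have "coprime m (card K)" unfolding card_K by (simp add: coprime_commute)
      \<comment> \<open>With \<open>\<alpha> = w / ?c\<close>, both \<open>m \<alpha>\<close> and
        \<open>card K\<close> times \<open>\<alpha>\<close> are algebraic integers; coprime
        multipliers make \<open>\<alpha>\<close> an integral combination of them.\<close>
      then obtain a b where ab: "a * int m + b * int (card K) = 1"
        using bezout_int [of "int m" "int (card K)"] by auto
      have e1: "e 1 \<noteq> 0" using m \<open>\<not> p dvd m\<close> n0 by (metis dvd_0_right mult_zero_right of_nat_eq_0_iff)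
      have sm: "of_nat m * (w / ?c) = ?n * e z" proof -
        have "of_nat m * (w / ?c) = ?n * (w * e 1) / ?c" unfolding m [symmetric] by simp
        then show ?thesis unfolding ez [symmetric] using c0 by simp
      qed
      have "w / ?c = of_int (a * int m + b * int (card K)) * (w / ?c)" by (simp add: ab)
      also have "\<dots> = of_int a * (of_nat m * (w / ?c)) + of_int b * w" using c0 by (simp add: field_simps)
      also have "algebraic_int \<dots>"
        unfolding sm
        by (rule algebraic_int_add [OF algebraic_int_mult [OF algebraic_int_of_int int_s]
              algebraic_int_mult [OF algebraic_int_of_int algebraic_int_eigenvalue [OF eig sGs(1) e1]]])
      finally have "w = 0" by (rule small_eigenvalue [OF e eig w e1])
      then show False using False by simp
    qed
    then obtain m' where m': "m = p * m'" by auto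
    have "(?n * e z / csqrt (of_nat p))\<^sup>2 = (?n * e z) * (?n * e z) / of_nat p"
      unfolding power2_eq_square times_divide_times_eq csqrt_p ..
    also have "\<dots> = of_nat m' * t"
    proof -
      have "?c * ((?n * e z) * (?n * e z)) = ?c * (of_nat m * t)"
        using t ez m by (metis (no_types, lifting) mult.assoc mult.commute)
      then show ?thesis using c0 p by (simp add: m' prime_gt_0_nat field_simps)
    qed
    finally have "(?n * e z / csqrt (of_nat p))\<^sup>2 = of_nat m' * t" .
    then have "algebraic_int ((?n * e z / csqrt (of_nat p))\<^sup>2)"
      using int_t by (auto intro: algebraic_int_mult)
    then show ?thesis
      by (rule algebraic_int_root [where p = "monom 1 2"]) (auto simp: poly_monom degree_monom_eq)
  qed
qed

text \<open>The coefficients of the idempotents at \<open>z\<close> sum to zero because the unit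
  \<open>delta\<close> vanishes there. After scaling by \<open>card G\<close> the trivial idempotent
  contributes \<open>1\<close> and all others are multiples of \<open>csqrt (of_nat p)\<close> by
  \<open>idempotent_value\<close>. So the inverse of that root, and its square \<open>1/p\<close>,
  would be algebraic integers.\<close>

lemma impossible: False
proof -
  let ?n = "of_nat (card G) :: complex" and ?c = "of_nat (card K) :: complex"
  have c0: "?c \<noteq> 0" using cK by simp
  obtain W e where fW: "finite W"
    and e: "\<And>w. w \<in> W \<Longrightarrow> cls (e w)"
    and eig: "\<And>w. w \<in> W \<Longrightarrow> csum (e w) = (\<lambda>g. w * e w g)"
    and idem: "\<And>w. w \<in> W \<Longrightarrow> conv (e w) (e w) = e w"
    and sum: "\<And>g. (\<Sum>w\<in>W. e w g) = delta g"
    by (rule spectral_idempotents) blast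
  \<comment> \<open>The coefficient sum of an eigenfunction vanishes unless the eigenvalue is
    \<open>card K\<close>. As \<open>delta\<close> has coefficient sum \<open>1\<close>, this
    eigenvalue occurs in \<open>W\<close>.\<close>
  have aug: "w * (\<Sum>g\<in>G. e w g) = ?c * (\<Sum>g\<in>G. e w g)" if "w \<in> W" for w
  proof -
    have "w * (\<Sum>g\<in>G. e w g) = (\<Sum>g\<in>G. \<Sum>x\<in>K. e w (x * g))"
      unfolding sum_distrib_left
    proof (intro sum.cong refl)
      fix g assume "g \<in> G"
      then show "w * e w g = (\<Sum>x\<in>K. e w (x * g))"
        using fun_cong [OF eig [OF that], of g] by (simp add: csum_def)
    qed
    also have "\<dots> = (\<Sum>x\<in>K. \<Sum>g\<in>G. e w (x * g))" by (rule sum.swap)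
    also have "\<dots> = (\<Sum>x\<in>K. \<Sum>g\<in>G. e w g)" by (intro sum.cong refl sum_mult_left KG')
    finally show ?thesis by simp
  qed
  have "1 = (\<Sum>g\<in>G. delta g)" using fG sGs(1) by (simp add: delta_def)
  also have "\<dots> = (\<Sum>w\<in>W. \<Sum>g\<in>G. e w g)" unfolding sum [symmetric] by (rule sum.swap)
  also have "\<dots> = (\<Sum>w\<in>W. if w = ?c then \<Sum>g\<in>G. e w g else 0)" using aug by (intro sum.cong) auto
  finally have "?c \<in> W" and tot: "(\<Sum>g\<in>G. e ?c g) = 1" using fW by (auto split: if_splits)
  have "e ?c g = e ?c 1" if "g \<in> G" for g
    by (rule extremal_constant [OF e eig _ that]) (use \<open>?c \<in> W\<close> in auto)
  then have "(\<Sum>g\<in>G. e ?c g) = (\<Sum>g\<in>G. e ?c 1)" "e ?c z = e ?c 1" using zG by auto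
  then have one: "?n * e ?c z = 1" using tot by simp
  have "delta (x * 1) = 0" if "x \<in> K" for x using that z1 by (auto simp: delta_def)
  then have "0 = csum delta 1" unfolding csum_def by (simp only: sum.neutral_const if_cancel cong: sum.cong)
  also have "\<dots> = csum (\<lambda>g. \<Sum>w\<in>W. e w g) 1" by (simp add: sum)
  also have "\<dots> = (\<Sum>w\<in>W. ?c * e w z)" unfolding csum_sum using csum_one e by (intro sum.cong) auto
  finally have "(\<Sum>w\<in>W. e w z) = 0" using c0 by (simp add: sum_distrib_left [symmetric])
  then have "(\<Sum>w\<in>W. ?n * e w z / csqrt (of_nat p)) = 0"
    by (simp add: sum_distrib_left [symmetric] sum_divide_distrib [symmetric])
  then have "1 / csqrt (of_nat p) + (\<Sum>w\<in>W - {?c}. ?n * e w z / csqrt (of_nat p)) = 0"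
    using sum.remove [OF fW \<open>?c \<in> W\<close>, of "\<lambda>w. ?n * e w z / csqrt (of_nat p)"] one by simp
  then have s: "1 / csqrt (of_nat p) = - (\<Sum>w\<in>W - {?c}. ?n * e w z / csqrt (of_nat p))"
    by (simp add: eq_neg_iff_add_eq_0)
  have "algebraic_int (1 / csqrt (of_nat p))"
    unfolding s using e eig idem by (intro algebraic_int_minus algebraic_int_sum idempotent_value) auto
  then have "algebraic_int (1 / csqrt (of_nat p) * (1 / csqrt (of_nat p)))" by (intro algebraic_int_mult)
  also have "1 / csqrt (of_nat p) * (1 / csqrt (of_nat p)) = (1 / of_nat p :: complex)"
    unfolding times_divide_times_eq csqrt_p by simp
  finally have "(1 / of_nat p :: complex) \<in> \<int>" by (rule rational_algebraic_int_is_int) simp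
  then obtain i where "1 / of_nat p = (of_int i :: complex)" by (auto elim: Ints_cases)
  then have "of_int (i * int p) = (1 :: complex)" using p by (simp add: prime_gt_0_nat field_simps)
  then have "i * int p = 1" by (simp only: of_int_eq_1_iff)
  then have "int p dvd 1" by (metis dvd_triv_right)
  then show False using p prime_gt_1_nat by auto
qed

end

theorem burnside_prime_power_class:
  assumes "sgrp G" "finite G" "\<And>N. normal_in N G \<Longrightarrow> N = {1} \<or> N = G"
    and "z \<in> G" "z \<noteq> 1" "prime p" "card G = card (cizer G {z}) * p ^ k"
  shows "cizer G {z} = G"
proof (rule ccontr)
  assume n: "cizer G {z} \<noteq> G"
  have sub: "cizer G {z} \<subseteq> G" by (auto simp: cizer_def)
  have "k > 0"
  proof (rule ccontr)
    assume "\<not> k > 0"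
    then show False using card_subset_eq [OF assms(2) sub] n assms(7) by simp
  qed
  moreover have "card ((\<lambda>g. cj g z) ` G) = p ^ k"
  proof -
    have "cj (inverse g) z = z \<longleftrightarrow> cj g z = z" for g
    proof
      assume "cj (inverse g) z = z"
      then have "cj g (cj (inverse g) z) = cj g z" by (rule arg_cong)
      from trans [OF sym [OF this] cj_inv_cancel(2)] show "cj g z = z" .
    next
      assume "cj g z = z"
      then have "cj (inverse g) (cj g z) = cj (inverse g) z" by (rule arg_cong)
      from trans [OF sym [OF this] cj_inv_cancel(1)] show "cj (inverse g) z = z" .
    qed
    then have "{g \<in> G. cj (inverse g) z = z} = cizer G {z}" by (simp add: cizer_iff_cj set_eq_iff)
    moreover have "(\<lambda>g. cj (inverse g) z) ` G = (\<lambda>g. cj g z) ` inverse ` G" by (simp add: image_image)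
    moreover have "inverse ` G = G"
    proof
      show "G \<subseteq> inverse ` G"
      proof
        fix x assume "x \<in> G"
        then show "x \<in> inverse ` G"
          by (intro image_eqI [of _ _ "inverse x"]) (simp_all add: inverse_inverse_grp sgrpD(3) [OF assms(1)])
      qed
    qed (use sgrpD(3) [OF assms(1)] in blast)
    ultimately have "card G = card (cizer G {z}) * card ((\<lambda>g. cj g z) ` G)"
      using orbit_stabilizer [OF assms(1,2), of "\<lambda>g. cj (inverse g)" z] by (simp add: cj_cj inverse_mult_grp inverse_one_grp)
    then show ?thesis using assms(7) card_gt_0_sgrp [OF assms(1,2)] by simp
  qed
  ultimately interpret prime_power_class G z p k
    using assms by unfold_locales auto
  show False by (rule impossible)
qed

subsection \<open>Products of nilpotent groups\<close>

lemma cizerD: "x \<in> cizer G X \<Longrightarrow> y \<in> X \<Longrightarrow> x * y = y * x"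
  by (simp add: cizer_def)

lemma abelian_solv:
  assumes "sgrp H" "finite H" "\<And>x y. x \<in> H \<Longrightarrow> y \<in> H \<Longrightarrow> x * y = y * x"
  shows "solv H"
  by (rule nilp_solv [OF assms(1,2)]) (use assms(3) in \<open>auto simp: nilp_def\<close>)

lemma pgroup_solv:
  assumes "sgrp P" "finite P" "prime p" "card P = p ^ k"
  shows "solv P"
proof (rule nilp_solv [OF assms(1,2)])
  show "nilp P"
    unfolding nilp_def
  proof (intro ballI allI impI)
    fix x y q r assume xy: "x \<in> P" "y \<in> P" and q: "prime q" "prime r" "q \<noteq> r" "pel q x" "pel r y"
    have "x = 1 \<or> y = 1"
      using pel_distinct [OF q(1) assms(3) _ q(4) pgroup_pel [OF assms(1,4) xy(1)]]
        pel_distinct [OF q(2) assms(3) _ q(5) pgroup_pel [OF assms(1,4) xy(2)]] q(3) by blast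
    then show "x * y = y * x" by auto
  qed
qed

lemma nat_single_prime_power:
  assumes "(n::nat) > 0" "\<And>q. prime q \<Longrightarrow> q \<noteq> p \<Longrightarrow> \<not> q dvd n"
  shows "\<exists>r k. prime r \<and> n = r ^ k"
proof (cases "prime p")
  case True
  obtain m where m: "n = p ^ multiplicity p n * m" "\<not> p dvd m" using prime_decompose_nat [OF True assms(1)] .
  have "m = 1"
  proof (rule ccontr)
    assume "m \<noteq> 1"
    then obtain q where q: "prime q" "q dvd m" using prime_factor_nat by blast
    then show False using assms(2) [OF q(1)] m by (metis dvd_mult)
  qed
  then show ?thesis using True m(1) by (metis mult.right_neutral)
next
  case False
  have "n = 1"
  proof (rule ccontr)
    assume "n \<noteq> 1"
    then obtain q where "prime q" "q dvd n" using prime_factor_nat by blast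
    then show False using assms(2) False by blast
  qed
  then show ?thesis using two_is_prime_nat by (metis power_0)
qed

text \<open>A counterexample of least order among factorised groups of finite permutations. The
  factors may overlap at this stage; coprimality and simplicity are derived inside.\<close>

locale kw_minimal =
  fixes G A B :: "nat perm set"
  assumes sG: "sgrp G" and fG: "finite G" and sA: "sgrp A" and AG: "A \<subseteq> G" and sB: "sgrp B" and BG: "B \<subseteq> G"
    and nA: "nilp A" and nB: "nilp B" and dec: "\<And>g. g \<in> G \<Longrightarrow> \<exists>a\<in>A. \<exists>b\<in>B. g = a * b"
    and nsolv: "\<not> solv G"
    and IH: "\<And>G' A' B' :: nat perm set. card G' < card G \<Longrightarrow> sgrp G' \<Longrightarrow> finite G' \<Longrightarrow> sgrp A' \<Longrightarrow> A' \<subseteq> G' \<Longrightarrow>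
      sgrp B' \<Longrightarrow> B' \<subseteq> G' \<Longrightarrow> nilp A' \<Longrightarrow> nilp B' \<Longrightarrow> (\<And>g. g \<in> G' \<Longrightarrow> \<exists>a\<in>A'. \<exists>b\<in>B'. g = a * b) \<Longrightarrow> solv G'"
begin

lemma fA: "finite A" and fB: "finite B"
  using AG BG fG finite_subset by auto

lemma dec': "g \<in> G \<Longrightarrow> \<exists>b\<in>B. \<exists>a\<in>A. g = b * a"
proof -
  assume "g \<in> G"
  then have "inverse g \<in> G" by (rule sgrpD(3) [OF sG])
  then obtain a b where "a \<in> A" "b \<in> B" "inverse g = a * b" using dec by blast
  then have "inverse (inverse g) = inverse (a * b)" "inverse a \<in> A" "inverse b \<in> B"
    using sA sB by (simp_all add: sgrpD)
  then have "g = inverse b * inverse a" by (simp add: inverse_inverse_grp inverse_mult_grp)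
  then show ?thesis using \<open>inverse a \<in> A\<close> \<open>inverse b \<in> B\<close> by blast
qed

lemma swap: "kw_minimal G B A"
  by unfold_locales (use sG fG sA AG sB BG nA nB dec' nsolv IH in auto)

lemma quotient_solv:
  assumes N: "normal_in N G" "N \<noteq> {1}"
  obtains \<phi> :: "nat perm \<Rightarrow> nat perm" where "\<And>x y. x \<in> G \<Longrightarrow> y \<in> G \<Longrightarrow> \<phi> (x * y) = \<phi> x * \<phi> y"
    "\<And>x. x \<in> G \<Longrightarrow> \<phi> x = 1 \<longleftrightarrow> x \<in> N" "solv (\<phi> ` G)"
proof -
  obtain \<phi> :: "nat perm \<Rightarrow> nat perm" where hom: "\<And>x y. x \<in> G \<Longrightarrow> y \<in> G \<Longrightarrow> \<phi> (x * y) = \<phi> x * \<phi> y"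
    and ker: "\<And>x. x \<in> G \<Longrightarrow> \<phi> x = 1 \<longleftrightarrow> x \<in> N"
    using quotient_hom [OF sG fG N(1)] by metis
  note N' = normal_inD [OF N(1)]
  have "card (\<phi> ` G) \<noteq> card G"
  proof
    assume "card (\<phi> ` G) = card G"
    then have inj: "inj_on \<phi> G" by (rule eq_card_imp_inj_on [OF fG])
    have "\<phi> 1 = 1" using ker [of 1] sgrpD(1) [OF sG] sgrpD(1) [OF N'(1)] by simp
    have "x = 1" if "x \<in> N" for x
    proof -
      have "\<phi> x = \<phi> 1" using ker [of x] that N'(2) \<open>\<phi> 1 = 1\<close> by auto
      then show ?thesis using inj that N'(2) sgrpD(1) [OF sG] by (auto simp: inj_on_def)
    qed
    then show False using N(2) sgrpD(1) [OF N'(1)] by blast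
  qed
  then have "card (\<phi> ` G) < card G" using card_image_le [OF fG, of \<phi>] by simp
  moreover have img: "sgrp (\<phi> ` H)" if "sgrp H" "H \<subseteq> G" for H
    by (rule sgrp_hom_image [OF that(1) finite_subset [OF that(2) fG]]) (use hom that(2) in blast)
  moreover have "nilp (\<phi> ` A)" by (rule nilp_hom_image [OF sA fA nA]) (use hom AG in blast)
  moreover have "nilp (\<phi> ` B)" by (rule nilp_hom_image [OF sB fB nB]) (use hom BG in blast)
  moreover have "\<exists>a\<in>\<phi> ` A. \<exists>b\<in>\<phi> ` B. y = a * b" if y: "y \<in> \<phi> ` G" for y
  proof -
    obtain g where "g \<in> G" "y = \<phi> g" using y by blast
    moreover from this obtain a b where "a \<in> A" "b \<in> B" "g = a * b" using dec by blast
    ultimately show ?thesis using hom [of a b] AG BG by blast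
  qed
  ultimately have "solv (\<phi> ` G)"
    using IH [of "\<phi> ` G" "\<phi> ` A" "\<phi> ` B"] sG fG sA sB AG BG by (simp add: image_mono)
  then show ?thesis using that hom ker by blast
qed

lemma no_solv_normal:
  assumes N: "normal_in N G" "solv N"
  shows "N = {1}"
proof (rule ccontr)
  assume "N \<noteq> {1}"
  then obtain \<phi> :: "nat perm \<Rightarrow> nat perm" where hom: "\<And>x y. x \<in> G \<Longrightarrow> y \<in> G \<Longrightarrow> \<phi> (x * y) = \<phi> x * \<phi> y"
    and ker: "\<And>x. x \<in> G \<Longrightarrow> \<phi> x = 1 \<longleftrightarrow> x \<in> N" and so: "solv (\<phi> ` G)"
    using quotient_solv [OF N(1)] by metis
  have "{x \<in> G. \<phi> x = 1} = N" using ker normal_inD(2) [OF N(1)] by blast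
  then have "solv G" using solv_extension [OF sG hom so] N(2) by simp
  then show False using nsolv by simp
qed

lemma proper_superset_solv:
  assumes H: "sgrp H" "H \<subseteq> G" "H \<noteq> G" and d: "\<And>g. g \<in> H \<Longrightarrow> \<exists>a\<in>H \<inter> A. \<exists>b\<in>H \<inter> B. g = a * b"
  shows "solv H"
proof (rule IH [of H "H \<inter> A" "H \<inter> B"])
  show "card H < card G" using H(2,3) fG by (simp add: psubset_card_mono psubsetI)
  show "nilp (H \<inter> A)" "nilp (H \<inter> B)" using nilp_subset nA nB by blast+
qed (use H sA sB sgrp_Int d finite_subset [OF H(2) fG] in auto)

lemma over_A_solv:
  assumes H: "sgrp H" "H \<subseteq> G" "H \<noteq> G" "A \<subseteq> H"
  shows "solv H"
proof (rule proper_superset_solv [OF H(1-3)])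
  fix g assume g: "g \<in> H"
  then obtain a b where ab: "a \<in> A" "b \<in> B" "g = a * b" using dec H(2) by blast
  then have "b \<in> H" using g H(1,4) sgrp_mult_left_iff by blast
  then show "\<exists>a\<in>H \<inter> A. \<exists>b\<in>H \<inter> B. g = a * b" using ab H(4) by blast
qed

text \<open>For a common prime \<open>p\<close>, let \<open>P\<close> contain the
  \<open>p\<close>-part of \<open>A\<close> and be normalised by all conjugates of the
  \<open>p\<close>-part of \<open>B\<close>; the latter then lies in the core \<open>?M\<close> of
  the normalizer of \<open>P\<close>. \<open>P \<inter> ?M\<close> lies in a normal
  \<open>p\<close>-subgroup of \<open>G\<close> and is trivial, so \<open>P\<close> centralises
  \<open>?M\<close>. Now \<open>?L\<close>, the centralizer of \<open>?M\<close>, is non-trivial and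
  meets \<open>?M\<close> trivially, so \<open>?M\<close> embeds into the solvable quotient by
  \<open>?L\<close> and is a non-trivial solvable normal subgroup.\<close>

lemma coprime_cards: "coprime (card A) (card B)"
proof (rule coprime_nat_primeI)
  fix p :: nat assume p: "prime p" "p dvd card A" "p dvd card B"
  let ?P0 = "ppart A p" and ?Q0 = "ppart B p"
  have P0: "sgrp ?P0" "?P0 \<subseteq> G" "card ?P0 = p ^ multiplicity p (card A)"
    using sgrp_ppart [OF sA fA nA p(1)] card_ppart [OF sA fA nA p(1)] AG by (auto simp: ppart_def)
  have Q0: "sgrp ?Q0" "?Q0 \<subseteq> G" "card ?Q0 = p ^ multiplicity p (card B)"
    using sgrp_ppart [OF sB fB nB p(1)] card_ppart [OF sB fB nB p(1)] BG by (auto simp: ppart_def)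
  have PQ: "sgrp (?P0 * ?Q0)" by (rule sylow_product [OF sG fG sA AG nA sB BG nB dec p(1)])
  have perm: "sgrp (?P0 * cj g ` ?Q0)" if g: "g \<in> G" for g
  proof -
    obtain b a where ba: "b \<in> B" "a \<in> A" "g = b * a" using dec' [OF g] by blast
    have "cj b ` ?Q0 = ?Q0" "cj a ` ?P0 = ?P0"
      using normal_in_image [OF normal_in_ppart [OF normal_in_self [OF sB] fB nB p(1)] sB ba(1)]
        normal_in_image [OF normal_in_ppart [OF normal_in_self [OF sA] fA nA p(1)] sA ba(2)] by auto
    then have "?P0 * cj g ` ?Q0 = cj a ` (?P0 * ?Q0)"
      unfolding cj_image_mult ba(3) by (metis cj_image_cj)
    then show ?thesis using sgrp_cj [OF PQ] by simp
  qed
  obtain P where P: "sgrp P" "P \<subseteq> G" "?P0 \<subseteq> P" "\<exists>k. card P = p ^ k"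
    and norm: "\<And>g x. g \<in> G \<Longrightarrow> x \<in> cj g ` ?Q0 \<Longrightarrow> cj x ` P = P"
    by (rule maximal_permuting_pair [OF sG fG p(1) P0 Q0 perm]) auto
  let ?M = "core G (nizer G P)"
  have sN: "sgrp (nizer G P)" by (rule sgrp_nizer [OF sG])
  have M: "normal_in ?M G" by (rule core_normal [OF sG sN])
  note M' = normal_inD [OF M]
  have fM: "finite ?M" by (rule finite_subset [OF M'(2) fG])
  have MN: "cj x ` P = P" if "x \<in> ?M" for x
    using core_subset [OF sG, of "nizer G P"] that by (auto simp: nizer_def)
  have Q0M: "?Q0 \<subseteq> ?M"
  proof
    fix x assume x: "x \<in> ?Q0"
    have "cj g x \<in> nizer G P" if g: "g \<in> G" for g
      using norm [OF g, of "cj g x"] x g Q0(2) sG by (auto simp: nizer_def sgrp_cj_mem subset_iff)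
    then show "x \<in> ?M" using nizer_subset by (auto simp: core_def)
  qed
  obtain k where k: "card P = p ^ k" using P(4) by blast
  have fP: "finite P" by (rule finite_subset [OF P(2) fG])
  have X: "normal_in (P \<inter> ?M) ?M"
    using sgrp_Int [OF P(1) M'(1)] MN sgrp_cj_mem [OF M'(1)] by (auto simp: normal_in_def)
  have "card (P \<inter> ?M) dvd p ^ k" using card_dvd_sgrp [OF P(1) sgrp_Int [OF P(1) M'(1)] _ fP] k by simp
  then obtain l where "card (P \<inter> ?M) = p ^ l" using p(1) by (auto simp: divides_primepow_nat)
  then obtain N j where N: "normal_in N G" "P \<inter> ?M \<subseteq> N" "card N = p ^ j"
    using pgroup_core_normal [OF sG fG M p(1) X] by metis
  have "solv N"
    by (rule pgroup_solv [OF normal_inD(1) [OF N(1)] finite_subset [OF normal_inD(2) [OF N(1)] fG] p(1) N(3)])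
  then have "N = {1}" by (rule no_solv_normal [OF N(1)])
  then have PM: "x = 1" if "x \<in> P" "x \<in> ?M" for x using N(2) that by blast
  have comm: "x * y = y * x" if x: "x \<in> P" and y: "y \<in> ?M" for x y
  proof -
    let ?e = "inverse x * cj y x"
    have "cj y x \<in> P" using MN [OF y] x by blast
    then have "?e \<in> P" using x P(1) by (simp add: sgrpD)
    moreover have "cj x (inverse y) \<in> ?M" using M'(3) x P(2) sgrpD(3) [OF M'(1) y] by blast
    then have "cj x (inverse y) * y \<in> ?M" using y M'(1) by (simp add: sgrpD)
    then have "?e \<in> ?M" by (simp add: cj_def grp_simps)
    ultimately have "?e = 1" by (rule PM)
    then have "x * ?e = x" by simp
    then show ?thesis by (simp add: grp_simps cj_fix_iff)
  qed
  let ?L = "cizer G ?M"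
  have L: "normal_in ?L G" by (rule normal_in_cizer [OF M sG])
  note L' = normal_inD [OF L]
  have "P \<subseteq> ?L" using comm P(2) by (auto simp: cizer_def)
  obtain x0 where "x0 \<in> A" "pel p x0" "x0 \<noteq> 1" using exists_pel [OF sA fA p(1,2)] .
  then have "x0 \<in> ?L" "x0 \<noteq> 1" using P(3) \<open>P \<subseteq> ?L\<close> by (auto simp: ppart_def)
  then have "?L \<noteq> {1}" by blast
  obtain y0 where "y0 \<in> B" "pel p y0" "y0 \<noteq> 1" using exists_pel [OF sB fB p(1,3)] .
  then have "y0 \<in> ?M" "y0 \<noteq> 1" using Q0M by (auto simp: ppart_def)
  then have M1: "?M \<noteq> {1}" by blast
  have "solv (?L \<inter> ?M)"
  proof (rule abelian_solv [OF sgrp_Int [OF L'(1) M'(1)]])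
    fix x y assume xy: "x \<in> ?L \<inter> ?M" "y \<in> ?L \<inter> ?M"
    show "x * y = y * x" by (rule cizerD [OF IntD1 [OF xy(1)] IntD2 [OF xy(2)]])
  qed (use fM in simp)
  then have LM: "?L \<inter> ?M = {1}" by (rule no_solv_normal [OF normal_in_Int [OF L M]])
  obtain \<phi> :: "nat perm \<Rightarrow> nat perm" where hom: "\<And>x y. x \<in> G \<Longrightarrow> y \<in> G \<Longrightarrow> \<phi> (x * y) = \<phi> x * \<phi> y"
    and ker: "\<And>x. x \<in> G \<Longrightarrow> \<phi> x = 1 \<longleftrightarrow> x \<in> ?L" and so: "solv (\<phi> ` G)"
    using quotient_solv [OF L \<open>?L \<noteq> {1}\<close>] by metis
  have "solv ?M"
  proof (rule solv_extension [OF M'(1), of \<phi>])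
    show "\<phi> (x * y) = \<phi> x * \<phi> y" if "x \<in> ?M" "y \<in> ?M" for x y using hom that M'(2) by blast
    show "solv (\<phi> ` ?M)" by (rule solv_subset [OF so image_mono [OF M'(2)]])
    have "{x \<in> ?M. \<phi> x = 1} = {1}" using ker M'(2) LM by blast
    moreover have "solv {1 :: nat perm}" by (rule abelian_solv [OF sgrp_one]) simp_all
    ultimately show "solv {x \<in> ?M. \<phi> x = 1}" by simp
  qed
  then show False using no_solv_normal [OF M] M1 by blast
qed

lemma supplement: "normal_in N G \<Longrightarrow> N \<noteq> {1} \<Longrightarrow> N * A = G"
proof (rule ccontr)
  assume N: "normal_in N G" "N \<noteq> {1}" "N * A \<noteq> G"
  note NA = normal_in_mult [OF N(1) sG sA AG]
  have "solv (N * A)" by (rule over_A_solv [OF NA(1,2) N(3) NA(4)])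
  then have "solv N" using NA(3) solv_subset by blast
  then show False using no_solv_normal [OF N(1)] N(2) by blast
qed

text \<open>By \<open>supplement\<close> the normal subgroup together with \<open>A\<close> is all
  of \<open>G\<close>. The same holds for \<open>B\<close>, and coprimality then leaves index
  \<open>1\<close>; this is the source of simplicity.\<close>

lemma index_dvd:
  assumes "normal_in N G" "N \<noteq> {1}"
  shows "card G div card N dvd card A"
proof -
  note N = normal_inD [OF assms(1)]
  have fN: "finite N" by (rule finite_subset [OF N(2) fG])
  obtain m where m: "card G = card N * m" using card_dvd_sgrp [OF sG N(1,2) fG] by (auto simp: dvd_def)
  have pos: "card N > 0" by (rule card_gt_0_sgrp [OF N(1) fN])
  have "card G * card (N \<inter> A) = card N * card A"
    using card_mult_Int [OF N(1) sA fN fA] supplement [OF assms] by simp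
  then have "m * card (N \<inter> A) = card A" using m pos by simp
  then show ?thesis using m pos by (metis dvd_triv_left nonzero_mult_div_cancel_left not_gr_zero)
qed

lemma simple:
  assumes "normal_in N G"
  shows "N = {1} \<or> N = G"
proof (rule disjCI)
  assume "N \<noteq> G"
  show "N = {1}"
  proof (rule ccontr)
    assume N1: "N \<noteq> {1}"
    have "card G div card N dvd card A" "card G div card N dvd card B"
      using index_dvd [OF assms N1] kw_minimal.index_dvd [OF swap assms N1] by auto
    then have "is_unit (card G div card N)" by (rule coprime_common_divisor [OF coprime_cards])
    then have "card G div card N = 1" by simp
    moreover have "card N dvd card G" using card_dvd_sgrp [OF sG _ _ fG] normal_inD(1,2) [OF assms] by blast
    ultimately have "card N = card G" by (metis dvd_div_mult_self mult_1)
    then show False using \<open>N \<noteq> G\<close> card_subset_eq [OF fG normal_inD(2) [OF assms]] by blast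
  qed
qed

lemma cardG: "card G = card A * card B"
proof -
  have "A * B = G" using dec AG BG sG by (auto simp: mem_mult_iff sgrpD subset_iff)
  then show ?thesis
    using card_mult_Int [OF sA sB fA fB] coprime_Int_trivial [OF sA sB fA fB coprime_cards] by simp
qed

text \<open>If \<open>card A\<close> is a power of \<open>r\<close>, a central element of
  \<open>B\<close> has a centralizer containing \<open>B\<close>, so its class has size a power of
  \<open>r\<close>. Burnside's theorem makes it central in \<open>G\<close>, and a simple group with
  non-trivial centre is abelian.\<close>

lemma two_primes: "\<exists>q. prime q \<and> q \<noteq> p \<and> q dvd card A"
proof (rule ccontr)
  assume "\<not> (\<exists>q. prime q \<and> q \<noteq> p \<and> q dvd card A)"
  then obtain r k where r: "prime r" "card A = r ^ k"
    using nat_single_prime_power [OF card_gt_0_sgrp [OF sA fA]] by blast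
  have "card B \<noteq> 1"
  proof
    assume "card B = 1"
    then have "A = G" using cardG card_subset_eq [OF fG AG] by simp
    then show False using nilp_solv [OF sA fA nA] nsolv by simp
  qed
  then obtain q where q: "prime q" "q dvd card B" using prime_factor_nat by blast
  obtain z where z: "z \<in> B" "z \<noteq> 1" "z \<in> center B"
    using nilp_center_elem [OF sB fB nB normal_in_self [OF sB] q] by metis
  have zG: "z \<in> G" using z(1) BG by blast
  have C: "sgrp (cizer G {z})" "cizer G {z} \<subseteq> G" by (rule sgrp_cizer [OF sG], rule cizer_subset)
  have fC: "finite (cizer G {z})" by (rule finite_subset [OF C(2) fG])
  have BC: "B \<subseteq> cizer G {z}" using z(3) BG by (auto simp: cizer_def)
  obtain m where m: "card (cizer G {z}) = card B * m" using card_dvd_sgrp [OF C(1) sB BC fC] by (auto simp: dvd_def)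
  obtain n where n: "card G = card (cizer G {z}) * n" using card_dvd_sgrp [OF sG C fG] by (auto simp: dvd_def)
  have "card B * (m * n) = card G" using m n by (simp add: mult.assoc)
  also have "\<dots> = card B * r ^ k" using cardG r(2) by (simp add: mult.commute)
  finally have "card B * (m * n) = card B * r ^ k" .
  then have "m * n = r ^ k" using card_gt_0_sgrp [OF sB fB] by (metis nat_mult_eq_cancel1)
  then have "n dvd r ^ k" by (metis dvd_triv_right)
  then obtain j where "n = r ^ j" using r(1) by (auto simp: divides_primepow_nat)
  then have "card G = card (cizer G {z}) * r ^ j" using n by simp
  with simple have CG: "cizer G {z} = G" by (intro burnside_prime_power_class [OF sG fG _ zG z(2) r(1)]) blast+
  have "z * x = x * z" if "x \<in> G" for x
    by (rule cizerD [of x G "{z}", symmetric]) (use that CG in auto)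
  then have "z \<in> center G" using zG by (simp add: cizer_def)
  moreover have "normal_in (center G) G" by (rule normal_in_cizer [OF normal_in_self [OF sG] sG])
  ultimately have "center G = G" using simple z(2) by blast
  then have "x * y = y * x" if "x \<in> G" "y \<in> G" for x y using that cizerD by blast
  then have "solv G" by (rule abelian_solv [OF sG fG])
  then show False using nsolv by simp
qed

end

theorem nilp_product_solv:
  fixes G :: "nat perm set"
  assumes "sgrp G" "finite G" "sgrp A" "A \<subseteq> G" "sgrp B" "B \<subseteq> G" "nilp A" "nilp B"
    and "\<And>g. g \<in> G \<Longrightarrow> \<exists>a\<in>A. \<exists>b\<in>B. g = a * b"
  shows "solv G"
  using assms
proof (induction "card G" arbitrary: G A B rule: less_induct)
  case less
  show ?case
  proof (rule ccontr)
    assume "\<not> solv G"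
    then interpret kw_minimal G A B
      by unfold_locales (use less in auto)
    interpret S: kw_minimal G B A by (rule swap)
    have AB1: "A \<inter> B = {1}" by (rule coprime_Int_trivial [OF sA sB fA fB coprime_cards])
    interpret wielandt G A B
    proof unfold_locales
      show "fac A B G" using cardG sG AG BG by (simp add: fac_def Int_absorb1)
      show "\<exists>q. prime q \<and> q \<noteq> p \<and> q dvd card A" for p by (rule two_primes)
      show "\<exists>q. prime q \<and> q \<noteq> p \<and> q dvd card B" for p by (rule S.two_primes)
      show "solv J" if J: "fac A B J" "J \<subseteq> G" "J \<noteq> G" for J
      proof (rule proper_superset_solv [OF _ J(2,3)])
        show "sgrp J" using J(1) by (simp add: fac_def)
        fix g assume "g \<in> J"
        then show "\<exists>a\<in>J \<inter> A. \<exists>b\<in>J \<inter> B. g = a * b"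
          using fac_elem [OF J(1) finite_subset [OF J(2) fG] sA sB fA fB coprime_cards] by (metis IntI)
      qed
    qed (use sG fG sA AG sB BG nA nB coprime_cards simple in auto)
    show False by (rule impossible)
  qed
qed

subsection \<open>Two nilpotent supplements of an abelian minimal normal subgroup\<close>

text \<open>The situation modulo \<open>N\<close> under the assumption that the image of
  \<open>T\<close> is not central, refuted by \<open>impossible\<close>. Two of the factorisations
  say that \<open>D\<close> and \<open>H\<close> supplement \<open>T\<close>; the third is what
  finally fails.\<close>

locale minimal_normal_factorized =
  fixes G T D H :: "'a::grp set"
  assumes sG: "sgrp G" and fG: "finite G"
    and T: "normal_in T G" and T1: "T \<noteq> {1}" and abel: "\<And>x y. x \<in> T \<Longrightarrow> y \<in> T \<Longrightarrow> x * y = y * x"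
    and minimal: "\<And>N. normal_in N G \<Longrightarrow> N \<subseteq> T \<Longrightarrow> N = {1} \<or> N = T"
    and sD: "sgrp D" and DG: "D \<subseteq> G" and nD: "nilp D"
    and sH: "sgrp H" and HG: "H \<subseteq> G" and nH: "nilp H"
    and TD: "\<And>g. g \<in> G \<Longrightarrow> \<exists>t\<in>T. \<exists>d\<in>D. g = t * d"
    and TH: "\<And>g. g \<in> G \<Longrightarrow> \<exists>t\<in>T. \<exists>h\<in>H. g = t * h"
    and DH: "\<And>g. g \<in> G \<Longrightarrow> \<exists>d\<in>D. \<exists>h\<in>H. g = d * h"
    and noncentral: "\<not> T \<subseteq> center G"
begin

lemmas sT = normal_inD(1) [OF T] and TG = normal_inD(2) [OF T]

lemma fT: "finite T" and fD: "finite D" and fH: "finite H"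
  using TG DG HG by (auto intro: finite_subset [OF _ fG])

lemma no_central:
  assumes "x \<in> T" "x \<in> center G" shows "x = 1"
proof -
  have "normal_in (T \<inter> center G) G"
    by (intro normal_in_Int T normal_in_cizer normal_in_self sG)
  then have "T \<inter> center G = {1} \<or> T \<inter> center G = T" by (rule minimal) simp
  then show ?thesis using noncentral assms by blast
qed

text \<open>\<open>T\<close> is abelian and \<open>G = T X\<close>, so an element of
  \<open>T\<close> commuting with \<open>X\<close> is central, hence trivial by minimality.\<close>

lemma supplement_center:
  assumes TX: "\<And>g. g \<in> G \<Longrightarrow> \<exists>t\<in>T. \<exists>x\<in>X. g = t * x"
    and z: "z \<in> T" "\<And>x. x \<in> X \<Longrightarrow> z * x = x * z"
  shows "z = 1"
proof (rule no_central [OF z(1)])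
  have "z * g = g * z" if "g \<in> G" for g
  proof -
    obtain t x where g: "t \<in> T" "x \<in> X" "g = t * x" using TX \<open>g \<in> G\<close> by blast
    have "z * g = (z * t) * x" by (simp add: g mult.assoc)
    also have "\<dots> = t * (z * x)" unfolding abel [OF z(1) g(1)] by (rule mult.assoc)
    also have "\<dots> = g * z" unfolding z(2) [OF g(2)] by (simp add: g mult.assoc)
    finally show ?thesis .
  qed
  then show "z \<in> center G" using z(1) TG by (auto simp: cizer_def)
qed

lemma normal_if_supplement_normalizes:
  assumes TX: "\<And>g. g \<in> G \<Longrightarrow> \<exists>t\<in>T. \<exists>x\<in>X. g = t * x"
    and N: "sgrp N" "N \<subseteq> T" "\<And>x y. x \<in> X \<Longrightarrow> y \<in> N \<Longrightarrow> cj x y \<in> N"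
  shows "N = {1} \<or> N = T"
proof (rule minimal [OF _ N(2)])
  have "cj g y \<in> N" if g: "g \<in> G" and y: "y \<in> N" for g y
  proof -
    obtain t x where gx: "t \<in> T" "x \<in> X" "g = t * x" using TX [OF g] by blast
    have "cj t y = y" unfolding cj_fix_iff using abel [of t y] gx(1) y N(2) by blast
    then have "cj g y = cj x y" unfolding gx(3) cj_cj [symmetric] by simp
    then show ?thesis using N(3) gx(2) y by simp
  qed
  then show "normal_in N G" using N TG unfolding normal_in_def by blast
qed

text \<open>\<open>X \<inter> T\<close> is invariant under \<open>X\<close> and under the abelian
  \<open>T\<close>, so it is trivial or \<open>T\<close>. In the latter case nilpotency of
  \<open>X\<close> gives a non-trivial element of \<open>T\<close> central in \<open>X\<close>,
  which \<open>supplement_center\<close> forbids.\<close>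

lemma nilp_supplement_disjoint:
  assumes X: "sgrp X" "X \<subseteq> G" "nilp X" and TX: "\<And>g. g \<in> G \<Longrightarrow> \<exists>t\<in>T. \<exists>x\<in>X. g = t * x"
  shows "X \<inter> T = {1}"
proof -
  have fX: "finite X" using X(2) fG finite_subset by blast
  have cjT: "cj x y \<in> T" if "x \<in> X" "y \<in> T" for x y using normal_inD(3) [OF T] that X(2) by blast
  have "X \<inter> T = {1} \<or> X \<inter> T = T"
    by (rule normal_if_supplement_normalizes [OF TX])
      (use X(1) cjT in \<open>auto intro: sgrp_cj_mem sgrp_Int sT\<close>)
  moreover have "X \<inter> T \<noteq> T"
  proof
    assume "X \<inter> T = T"
    then have TX': "normal_in T X" using sT cjT unfolding normal_in_def by blast
    have "card T \<noteq> 1" using T1 sgrpD(1) [OF sT] by (auto simp: card_1_singleton_iff)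
    then obtain q where q: "prime q" "q dvd card T" using prime_factor_nat by blast
    obtain z where z: "z \<in> T" "z \<noteq> 1" "z \<in> center X"
      using nilp_center_elem [OF X(1) fX X(3) TX' q] by metis
    have "z = 1" by (rule supplement_center [OF TX z(1) cizerD [OF z(3)]])
    then show False using z(2) by simp
  qed
  ultimately show ?thesis by blast
qed

lemma card_supplement:
  assumes X: "sgrp X" "X \<subseteq> G" "nilp X" and TX: "\<And>g. g \<in> G \<Longrightarrow> \<exists>t\<in>T. \<exists>x\<in>X. g = t * x"
  shows "card G = card T * card X"
proof -
  have fX: "finite X" using X(2) fG finite_subset by blast
  have "T * X = G" using TX TG X(2) by (auto simp: mem_mult_iff sgrpD(2) [OF sG] subset_iff)
  then show ?thesis
    using card_mult_Int [OF sT X(1) fT fX] nilp_supplement_disjoint [OF X TX] by (simp add: Int_commute)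
qed

text \<open>By minimality \<open>T\<close> is a \<open>p\<close>-group. If the parts of
  \<open>D\<close> for all other primes centralised it, a non-trivial fixed point of the
  \<open>p\<close>-part of \<open>D\<close> in \<open>T\<close> would be central in
  \<open>G\<close>.\<close>

lemma noncentralizing_prime:
  obtains p q where "prime p" "\<And>x. x \<in> T \<Longrightarrow> pel p x" "prime q" "q \<noteq> p"
    "\<not> (\<forall>x\<in>T. \<forall>y\<in>ppart D q. x * y = y * x)"
proof -
  have "card T \<noteq> 1" using T1 sgrpD(1) [OF sT] by (auto simp: card_1_singleton_iff)
  then obtain p where p: "prime p" "p dvd card T" using prime_factor_nat by blast
  have nT: "nilp T" using abel by (auto simp: nilp_def)
  have "normal_in (ppart T p) G" by (rule normal_in_ppart [OF T fT nT p(1)])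
  then have "ppart T p = {1} \<or> ppart T p = T" by (rule minimal) (rule ppart_subset)
  moreover have "ppart T p \<noteq> {1}"
  proof
    assume "ppart T p = {1}"
    then have "p ^ multiplicity p (card T) = 1" using card_ppart [OF sT fT nT p(1)] by simp
    moreover have "multiplicity p (card T) > 0"
      using multiplicity_pos_iff [OF p(1) card_gt_0_sgrp [OF sT fT]] p(2) by simp
    ultimately show False using p(1) prime_gt_1_nat [OF p(1)] by simp
  qed
  ultimately have pT: "pel p x" if "x \<in> T" for x using that by (auto simp: ppart_def)
  have "\<exists>q. prime q \<and> q \<noteq> p \<and> \<not> (\<forall>x\<in>T. \<forall>y\<in>ppart D q. x * y = y * x)"
  proof (rule ccontr)
    assume n: "\<not> ?thesis"
    let ?P = "ppart D p"
    let ?F = "{w \<in> T. \<forall>g\<in>?P. cj (inverse g) w = w}"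
    have "[card ?F = card T] (mod p)"
    proof (rule pgroup_fixed_points [where act = "\<lambda>g. cj (inverse g)"])
      show "sgrp ?P" "card ?P = p ^ multiplicity p (card D)"
        by (rule sgrp_ppart [OF sD fD nD p(1)], rule card_ppart [OF sD fD nD p(1)])
      show "cj (inverse g) w \<in> T" if "g \<in> ?P" "w \<in> T" for g w
        using normal_inD(3) [OF T] that sgrpD(3) [OF sG] DG by (auto simp: ppart_def)
      show "cj (inverse (g * h)) w = cj (inverse g) (cj (inverse h) w)" for g h w
        by (simp add: cj_cj inverse_mult_grp)
    qed (use p fT in \<open>auto simp: inverse_one_grp\<close>)
    then have "p dvd card ?F" using p(2) by (rule cong_dvd_nat)
    then have "?F \<noteq> {1}" using p(1) by (auto simp: not_prime_1)
    moreover have "1 \<in> ?F" using sgrpD(1) [OF sT] by simp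
    ultimately obtain x where x: "x \<in> T" "\<And>g. g \<in> ?P \<Longrightarrow> cj (inverse g) x = x" "x \<noteq> 1" by blast
    have "D \<subseteq> cizer D {x}"
    proof (rule sgrp_prime_power_gen [OF sgrp_cizer [OF sD] sD fD])
      fix r y assume r: "prime r" and y: "y \<in> D" "pel r y"
      have "y * x = x * y"
      proof (cases "r = p")
        case True
        then have "y \<in> ?P" using y by (simp add: ppart_def)
        then have "inverse y \<in> ?P" using sgrpD(3) [OF sgrp_ppart [OF sD fD nD p(1)]] by blast
        then have "cj (inverse (inverse y)) x = x" by (rule x(2))
        then show ?thesis by (simp add: inverse_inverse_grp cj_fix_iff)
      next
        case False
        then have "\<forall>a\<in>T. \<forall>b\<in>ppart D r. a * b = b * a" using n r by blast
        moreover have "y \<in> ppart D r" using y by (simp add: ppart_def)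
        ultimately have "x * y = y * x" using x(1) by blast
        then show ?thesis by (rule sym)
      qed
      then show "y \<in> cizer D {x}" using y by (simp add: cizer_def)
    qed
    then have xD: "x * y = y * x" if "y \<in> D" for y using that by (auto simp: cizer_def)
    have "x = 1" by (rule supplement_center [OF TD x(1) xD])
    then show False using x(3) by simp
  qed
  then show ?thesis using that p pT by blast
qed

lemma sylow_ppart_supplement:
  assumes X: "sgrp X" "X \<subseteq> G" "nilp X" and TX: "\<And>g. g \<in> G \<Longrightarrow> \<exists>t\<in>T. \<exists>x\<in>X. g = t * x"
    and p: "prime p" "\<And>x. x \<in> T \<Longrightarrow> pel p x" and q: "prime q" "q \<noteq> p"
  shows "sylow_sub q (ppart X q) G"
proof -
  have fX: "finite X" using X(2) fG finite_subset by blast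
  have "card T = p ^ multiplicity p (card T)" by (rule card_pgroup [OF sT fT p])
  then have "\<not> q dvd card T" using p(1) q by (metis prime_dvd_power primes_dvd_imp_eq)
  then have "multiplicity q (card T) = 0" by (rule not_dvd_imp_multiplicity_0)
  then have "multiplicity q (card G) = multiplicity q (card X)"
    using card_supplement [OF X TX] q(1) card_gt_0_sgrp [OF sT fT] card_gt_0_sgrp [OF X(1) fX]
    by (simp add: prime_elem_multiplicity_mult_distrib)
  then show ?thesis
    using sgrp_ppart [OF X(1) fX X(3) q(1)] card_ppart [OF X(1) fX X(3) q(1)] X(2) ppart_subset [of X q]
    by (auto simp: sylow_sub_def)
qed

lemma ppart_nizer:
  assumes X: "sgrp X" "X \<subseteq> G" "nilp X" and q: "prime q"
  shows "X \<subseteq> nizer G (ppart X q)"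
proof
  have fX: "finite X" using X(2) fG finite_subset by blast
  have N: "normal_in (ppart X q) X" by (rule normal_in_ppart [OF normal_in_self [OF X(1)] fX X(3) q])
  fix x assume "x \<in> X"
  then show "x \<in> nizer G (ppart X q)" using normal_in_image [OF N X(1)] X(2) by (auto simp: nizer_def)
qed

text \<open>Both supplements are nilpotent complements, hence conjugate, because each is the normalizer of
  a Sylow subgroup; but a group is never the product of two conjugates of a proper subgroup.\<close>

lemma impossible: False
proof -
  obtain p q where p: "prime p" "\<And>x. x \<in> T \<Longrightarrow> pel p x" and q: "prime q" "q \<noteq> p"
    and nc: "\<not> (\<forall>x\<in>T. \<forall>y\<in>ppart D q. x * y = y * x)"
    using noncentralizing_prime by metis
  let ?Q = "ppart D q"
  have DT: "D \<inter> T = {1}" by (rule nilp_supplement_disjoint [OF sD DG nD TD])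
  note SD = sylow_ppart_supplement [OF sD DG nD TD p q] and SH = sylow_ppart_supplement [OF sH HG nH TH p q]
  have cDH: "card D = card H"
    using card_supplement [OF sD DG nD TD] card_supplement [OF sH HG nH TH] card_gt_0_sgrp [OF sT fT] by simp
  have sQ: "sgrp ?Q" by (rule sgrp_ppart [OF sD fD nD q(1)])
  let ?N = "nizer G ?Q"
  have sN: "sgrp ?N" by (rule sgrp_nizer [OF sG])
  have NG: "?N \<subseteq> G" by (auto simp: nizer_def)
  have fN: "finite ?N" by (rule finite_subset [OF NG fG])
  have DN: "D \<subseteq> ?N" by (rule ppart_nizer [OF sD DG nD q(1)])
  \<comment> \<open>The commutator lies in \<open>T\<close> by normality and in \<open>D\<close>
    because \<open>x\<close> normalises \<open>?Q\<close>, so it is trivial. If \<open>T\<close>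
    normalised \<open>?Q\<close>, it would centralise it, against the choice of
    \<open>q\<close>.\<close>
  have NTc: "x * y = y * x" if x: "x \<in> ?N \<inter> T" and y: "y \<in> ?Q" for x y
  proof -
    have yD: "y \<in> D" using y ppart_subset by blast
    have "cj x y \<in> ?Q" using x y by (auto simp: nizer_def)
    then have "cj x y * inverse y \<in> ?Q" using y sQ by (simp add: sgrpD)
    then have "cj x y * inverse y \<in> D" using ppart_subset by blast
    moreover have "cj x y * inverse y = inverse x * cj (inverse y) x" by (simp add: cj_def grp_simps)
    moreover have "cj (inverse y) x \<in> T" using normal_inD(3) [OF T] x yD DG sgrpD(3) [OF sG] by blast
    ultimately have "cj x y * inverse y \<in> D \<inter> T" using x sT by (simp add: sgrpD)
    then have "cj x y * inverse y = y * inverse y" using DT by (simp add: grp_simps)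
    then have "cj x y = y" by (simp only: mult_right_cancel_grp)
    then show ?thesis by (simp add: cj_fix_iff)
  qed
  have "?N \<inter> T = {1} \<or> ?N \<inter> T = T"
  proof (rule normal_if_supplement_normalizes [OF TD sgrp_Int [OF sN sT] Int_lower2])
    fix x y assume "x \<in> D" "y \<in> ?N \<inter> T"
    then show "cj x y \<in> ?N \<inter> T"
      using sgrp_cj_mem [OF sN] DN normal_inD(3) [OF T] DG by blast
  qed
  then have NT: "?N \<inter> T = {1}" using nc NTc by blast
  have le: "card ?N \<le> card D"
  proof -
    have "card (T * ?N) = card T * card ?N"
      using card_mult_Int [OF sT sN fT fN] NT by (simp add: Int_commute)
    moreover have "T * ?N \<subseteq> G" using TG NG by (auto simp: mem_mult_iff sgrpD(2) [OF sG] subset_iff)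
    ultimately have "card T * card ?N \<le> card T * card D"
      using card_mono [OF fG] card_supplement [OF sD DG nD TD] by metis
    then show ?thesis using card_gt_0_sgrp [OF sT fT] by simp
  qed
  have ND: "D = ?N" by (rule card_seteq [OF fN DN le])
  have SH': "sgrp (ppart H q)" "ppart H q \<subseteq> G" "card (ppart H q) = q ^ multiplicity q (card G)"
    using SH by (auto simp: sylow_sub_def)
  obtain g where g: "g \<in> G" "cj g ` ppart H q \<subseteq> ?Q"
    using sylow_conj [OF sG fG q(1) SD SH'] by metis
  have "cj g ` ppart H q = ?Q"
  proof (rule card_subset_eq [OF _ g(2)])
    show "finite ?Q" using fD ppart_subset finite_subset by blast
    show "card (cj g ` ppart H q) = card ?Q" using SD SH'(3) by (simp add: sylow_sub_def)
  qed
  then have Q: "?Q = cj g ` ppart H q" by simp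
  have "cj g ` H \<subseteq> ?N"
  proof
    fix y assume "y \<in> cj g ` H"
    then obtain h where h: "h \<in> H" "y = cj g h" by blast
    have "h \<in> nizer G (ppart H q)" using ppart_nizer [OF sH HG nH q(1)] h(1) by blast
    then have hh: "cj h ` ppart H q = ppart H q" "h \<in> G" by (auto simp: nizer_def)
    have "cj y ` ?Q = cj g ` cj h ` ppart H q"
      unfolding Q cj_image_cj by (simp add: h(2) cj_def grp_simps)
    then show "y \<in> ?N" using hh g(1) by (simp add: nizer_def Q h(2) sgrp_cj_mem [OF sG])
  qed
  then have gH: "cj g ` H = D"
    using ND card_subset_eq [OF fD] cDH by simp
  \<comment> \<open>The factors of \<open>inverse g\<close> normalise \<open>D\<close> and
    \<open>H\<close> respectively, so the conjugacy of \<open>H\<close> and \<open>D\<close>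
    collapses to equality.\<close>
  obtain d h where dh: "d \<in> D" "h \<in> H" "inverse g = d * h" using DH sgrpD(3) [OF sG g(1)] by blast
  have "H = cj (inverse g) ` D" unfolding gH [symmetric] by simp
  also have "\<dots> = cj h ` cj d ` D" unfolding dh(3) cj_image_cj ..
  also have "cj d ` D = D" by (rule sgrp_cj_image [OF sD dh(1)])
  finally have "cj (inverse h) ` H = D" by simp
  moreover have "cj (inverse h) ` H = H" by (rule sgrp_cj_image [OF sH sgrpD(3) [OF sH dh(2)]])
  ultimately have "H = D" by simp
  have "T \<subseteq> D"
  proof
    fix t assume "t \<in> T"
    then obtain d h where "d \<in> D" "h \<in> H" "t = d * h" using DH TG by blast
    then show "t \<in> D" using sD \<open>H = D\<close> by (simp add: sgrpD)
  qed
  then show False using DT T1 by blast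
qed

end

text \<open>Under the quotient map \<open>f\<close> maximality of \<open>N\<close> becomes
  minimality of the image of \<open>T\<close>. The product theorem shows that this image is not
  perfect, so by minimality its derived subgroup is trivial.\<close>

theorem exists_central_quotient:
  fixes G T D H :: "'a::grp set"
  assumes sG: "sgrp G" and fG: "finite G"
    and T: "normal_in T G" and T1: "T \<noteq> {1}"
    and sD: "sgrp D" and DG: "D \<subseteq> G" and nD: "nilp D"
    and sH: "sgrp H" and HG: "H \<subseteq> G" and nH: "nilp H"
    and TD: "\<And>g. g \<in> G \<Longrightarrow> \<exists>t\<in>T. \<exists>d\<in>D. g = t * d"
    and TH: "\<And>g. g \<in> G \<Longrightarrow> \<exists>t\<in>T. \<exists>h\<in>H. g = t * h"
    and DH: "\<And>g. g \<in> G \<Longrightarrow> \<exists>d\<in>D. \<exists>h\<in>H. g = d * h"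
  shows "\<exists>N. normal_in N G \<and> N \<subseteq> T \<and> N \<noteq> T \<and> (\<forall>t\<in>T. \<forall>g\<in>G. inverse t * cj g t \<in> N)"
proof -
  note sT = normal_inD(1) [OF T] and TG = normal_inD(2) [OF T]
  define \<N> where "\<N> = {N. normal_in N G \<and> N \<subseteq> T \<and> N \<noteq> T}"
  have "normal_in {1} G" using sG by (simp add: normal_in_def sgrp_one sgrpD)
  then have "{1} \<in> \<N>" using T1 sgrpD(1) [OF sT] by (auto simp: \<N>_def)
  moreover have "\<N> \<subseteq> Pow G" using TG by (auto simp: \<N>_def)
  then have "finite \<N>" using fG finite_subset by blast
  ultimately obtain N where N: "N \<in> \<N>" and max: "\<And>M. M \<in> \<N> \<Longrightarrow> N \<subseteq> M \<Longrightarrow> N = M"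
    using finite_has_maximal2 [of \<N> "{1}"] by metis
  have NG: "normal_in N G" and NT: "N \<subseteq> T" "N \<noteq> T" using N by (auto simp: \<N>_def)
  obtain f :: "'a \<Rightarrow> nat perm" where f: "\<And>x y. x \<in> G \<Longrightarrow> y \<in> G \<Longrightarrow> f (x * y) = f x * f y"
    and ker: "\<And>x. x \<in> G \<Longrightarrow> f x = 1 \<longleftrightarrow> x \<in> N" using quotient_hom [OF sG fG NG] by metis
  have finv: "f (inverse x) = inverse (f x)" if x: "x \<in> G" for x
  proof (rule inverse_unique_grp [symmetric])
    have "f (x * inverse x) = 1" using ker [of 1] sG normal_inD(1) [OF NG] by (simp add: mult_inverse_self sgrpD)
    then show "f x * f (inverse x) = 1" using f x sG by (simp add: sgrpD)
  qed
  have fcj: "f (cj g x) = cj (f g) (f x)" if "g \<in> G" "x \<in> G" for g x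
    using that f finv sG by (simp add: cj_def sgrpD)
  have im: "sgrp (f ` X)" "f ` X \<subseteq> f ` G" "nilp X \<Longrightarrow> nilp (f ` X)" if X: "sgrp X" "X \<subseteq> G" for X
  proof -
    have fX: "finite X" using X(2) fG finite_subset by blast
    have hom: "f (x * y) = f x * f y" if "x \<in> X" "y \<in> X" for x y using f that X(2) by blast
    show "sgrp (f ` X)" by (rule sgrp_hom_image [OF X(1) fX hom])
    show "nilp (f ` X)" if "nilp X" by (rule nilp_hom_image [OF X(1) fX that hom])
    show "f ` X \<subseteq> f ` G" using X(2) by blast
  qed
  have dec: "\<exists>x\<in>f ` X. \<exists>y\<in>f ` Y. g = x * y"
    if XY: "X \<subseteq> G" "Y \<subseteq> G" "\<And>g. g \<in> G \<Longrightarrow> \<exists>x\<in>X. \<exists>y\<in>Y. g = x * y" and g: "g \<in> f ` G" for X Y g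
  proof -
    obtain g' where "g' \<in> G" "g = f g'" using g by blast
    moreover obtain x y where "x \<in> X" "y \<in> Y" "g' = x * y" using XY(3) [OF \<open>g' \<in> G\<close>] by blast
    ultimately show ?thesis using f XY(1,2) by blast
  qed
  have sG': "sgrp (f ` G)" and fG': "finite (f ` G)" using im(1) [OF sG] fG by auto
  have T': "normal_in (f ` T) (f ` G)"
    unfolding normal_in_def using im [OF sT TG] fcj normal_inD(3) [OF T] TG by (auto simp flip: fcj)
  have minimal: "M = {1} \<or> M = f ` T" if M: "normal_in M (f ` G)" "M \<subseteq> f ` T" for M
  proof -
    define M' where "M' = {x \<in> T. f x \<in> M}"
    note sM = normal_inD(1) [OF M(1)]
    have "normal_in M' G"
      unfolding normal_in_def
    proof (intro conjI ballI)
      show "sgrp M'"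
        unfolding sgrp_def M'_def using sT sM TG ker [of 1] sG normal_inD(1) [OF NG] f finv
        by (auto simp: sgrpD subset_iff)
      show "cj g x \<in> M'" if "g \<in> G" "x \<in> M'" for g x
        using that normal_inD(3) [OF T] normal_inD(3) [OF M(1)] TG fcj by (auto simp: M'_def subset_iff)
    qed (use TG in \<open>auto simp: M'_def\<close>)
    moreover have "N \<subseteq> M'"
    proof
      fix t assume "t \<in> N"
      then have "t \<in> T" "f t = 1" using NT(1) TG ker by blast+
      then show "t \<in> M'" using sgrpD(1) [OF sM] by (simp add: M'_def)
    qed
    ultimately have "M' = N \<or> M' = T" using max [of M'] by (auto simp: \<N>_def M'_def)
    moreover have "M = f ` M'" using M(2) by (auto simp: M'_def)
    moreover have "f ` N = {1}"
      using ker NT(1) TG sgrpD(1) [OF normal_inD(1) [OF NG]] by (auto simp: image_iff subset_iff intro!: bexI [of _ 1])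
    ultimately show ?thesis by auto
  qed
  have T1': "f ` T \<noteq> {1}"
  proof
    assume "f ` T = {1}"
    then have "T \<subseteq> N" using ker TG by blast
    then show False using NT by blast
  qed
  have "solv (f ` G)"
    by (rule nilp_product_solv [OF sG' fG' im(1,2) [OF sD DG] im(1,2) [OF sH HG] im(3) [OF sD DG nD] im(3) [OF sH HG nH]])
      (rule dec [OF DG HG DH])
  then have "dcomm (f ` T) \<noteq> f ` T" using im(1,2) [OF sT TG] T1' unfolding solv_def by blast
  moreover have "normal_in (dcomm (f ` T)) (f ` G)"
    by (rule normal_in_dcomm [OF T' sG'])
  ultimately have "dcomm (f ` T) = {1}"
    using minimal dcomm_subset [OF im(1) [OF sT TG]] by blast
  then have abel: "x * y = y * x" if "x \<in> f ` T" "y \<in> f ` T" for x y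
  proof -
    have "inverse x * cj y x = 1" using dcomm_mem [OF that] \<open>dcomm (f ` T) = {1}\<close> by simp
    then have "x * (inverse x * cj y x) = x" by simp
    then have "cj y x = x" by (simp add: grp_simps)
    then show ?thesis by (simp add: cj_fix_iff)
  qed
  have cent: "f ` T \<subseteq> center (f ` G)"
  proof (rule ccontr)
    assume nc: "\<not> f ` T \<subseteq> center (f ` G)"
    note iD = im [OF sD DG] and iH = im [OF sH HG]
    have d: "\<exists>t\<in>f ` T. \<exists>d\<in>f ` D. g = t * d" "\<exists>t\<in>f ` T. \<exists>h\<in>f ` H. g = t * h"
        "\<exists>d\<in>f ` D. \<exists>h\<in>f ` H. g = d * h" if "g \<in> f ` G" for g
      by (rule dec [OF _ _ _ that], fact TG, fact DG, erule TD,
          rule dec [OF _ _ _ that], fact TG, fact HG, erule TH,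
          rule dec [OF _ _ _ that], fact DG, fact HG, erule DH)
    interpret minimal_normal_factorized "f ` G" "f ` T" "f ` D" "f ` H"
      by unfold_locales (fact sG' fG' T' T1' abel minimal iD(1,2) iD(3) [OF nD] iH(1,2) iH(3) [OF nH] nc d)+
    show False by (rule impossible)
  qed
  have "inverse t * cj g t \<in> N" if t: "t \<in> T" and g: "g \<in> G" for t g
  proof -
    have tG: "t \<in> G" using t TG by blast
    have "f t \<in> center (f ` G)" using cent t by blast
    then have "f t * f g = f g * f t" by (rule cizerD) (use g in blast)
    then have "cj (f g) (f t) = f t" by (simp add: cj_fix_iff)
    then have "f (inverse t * cj g t) = 1"
      using tG g f finv fcj sG by (simp add: sgrpD sgrp_cj_mem inverse_mult_self)
    then show ?thesis using ker tG g sG by (simp add: sgrpD sgrp_cj_mem)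
  qed
  then show ?thesis using NG NT by blast
qed

subsection \<open>Images of nilpotent groups\<close>

lemma (in group) lower_central_series_subgroup: "subgroup (lower_central_series G n) G"
proof (induction n)
  case (Suc n)
  then have "lower_central_series G n \<subseteq> carrier G" by (rule subgroup.subset)
  then show ?case unfolding lower_central_series.simps by (intro generate_is_subgroup) auto
qed (simp add: subgroup_self)

lemma (in group) lower_central_series_Suc_subset: "lower_central_series G (Suc n) \<subseteq> lower_central_series G n"
proof (induction n)
  case 0
  show ?case using subgroup.subset [OF lower_central_series_subgroup [of "Suc 0"]] by simp
next
  case (Suc n)
  define C where "C X = {x \<otimes> y \<otimes> inv x \<otimes> inv y | x y. x \<in> X \<and> y \<in> carrier G}" for X
  have e: "generate G (C (lower_central_series G k)) = lower_central_series G (Suc k)" for k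
    by (simp add: C_def)
  have "generate G (C (lower_central_series G (Suc n))) \<subseteq> generate G (C (lower_central_series G n))"
    by (rule mono_generate) (use Suc in \<open>auto simp: C_def simp del: lower_central_series.simps\<close>)
  then show ?case unfolding e .
qed

lemma (in group) lower_central_series_comm:
  assumes "x \<in> lower_central_series G n" "y \<in> carrier G"
  shows "x \<otimes> y \<otimes> inv x \<otimes> inv y \<in> lower_central_series G (Suc n)"
  unfolding lower_central_series.simps by (rule generate.incl) (use assms in blast)

text \<open>Modulo \<open>N\<close> the element \<open>c\<close> is central, \<open>c * y\<close> is
  a conjugate of \<open>y\<close>, and \<open>inverse x * c\<close> is a conjugate of
  \<open>inverse x\<close>. So \<open>c\<close> has both \<open>p\<close>-power and
  \<open>q\<close>-power order there and vanishes.\<close>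

lemma commutator_step:
  assumes G: "sgrp G" "finite G" and N: "normal_in N G" and xy: "x \<in> G" "y \<in> G"
    and p: "prime p" "prime q" "p \<noteq> q" "pel p x" "pel q y"
    and c: "\<And>g. g \<in> G \<Longrightarrow> c * g * inverse c * inverse g \<in> N" "c = x * y * inverse x * inverse y"
  shows "c \<in> N"
proof -
  obtain f :: "_ \<Rightarrow> nat perm" where f: "\<And>x y. x \<in> G \<Longrightarrow> y \<in> G \<Longrightarrow> f (x * y) = f x * f y"
    and ker: "\<And>x. x \<in> G \<Longrightarrow> f x = 1 \<longleftrightarrow> x \<in> N" using quotient_hom [OF G N] by metis
  have f1: "f 1 = 1" using ker [of 1] sgrpD(1) [OF G(1)] sgrpD(1) [OF normal_inD(1) [OF N]] by simp
  have finv: "f (inverse x) = inverse (f x)" if x: "x \<in> G" for x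
  proof (rule inverse_unique_grp [symmetric])
    show "f x * f (inverse x) = 1" using f [OF x sgrpD(3) [OF G(1) x]] f1 by (simp add: mult_inverse_self)
  qed
  have fpow: "f (x ^ k) = f x ^ k" if x: "x \<in> G" for x k
    by (induction k) (use f1 f x sgrp_pow [OF G(1) x] in auto)
  have cG: "c \<in> G" using c(2) xy G(1) by (simp add: sgrpD)
  have com: "f c * f g = f g * f c" if g: "g \<in> G" for g
  proof -
    have "f (c * g * inverse c * inverse g) = 1" using c(1) [OF g] ker cG g G(1) by (simp add: sgrpD)
    then have e: "f c * f g * inverse (f c) * inverse (f g) = 1"
      using f finv cG g G(1) by (simp add: sgrpD)
    have "f c * f g = (f c * f g * inverse (f c) * inverse (f g)) * (f g * f c)" by (simp add: grp_simps)
    then show ?thesis unfolding e by simp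
  qed
  have fc: "f c = f x * f y * inverse (f x) * inverse (f y)" using c(2) f finv xy G(1) by (simp add: sgrpD)
  obtain k where k: "f x ^ (p ^ k) = 1" using p(4) fpow [OF xy(1)] f1 unfolding pel_def by metis
  obtain l where l: "f y ^ (q ^ l) = 1" using p(5) fpow [OF xy(2)] f1 unfolding pel_def by metis
  have "(f c * f y) ^ (q ^ l) = f c ^ (q ^ l) * f y ^ (q ^ l)"
    by (rule power_mult_commuting [OF com [OF xy(2)]])
  moreover have "f c * f y = cj (inverse (f x)) (f y)" by (simp add: fc cj_def grp_simps)
  ultimately have "f c ^ (q ^ l) = 1" using l by (simp add: cj_pow [symmetric])
  then have cq: "pel q (f c)" by (auto simp: pel_def)
  have "f c * inverse (f x) = inverse (f x) * f c"
    using com [OF sgrpD(3) [OF G(1) xy(1)]] finv [OF xy(1)] by simp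
  then have "(inverse (f x) * f c) ^ (p ^ k) = inverse (f x) ^ (p ^ k) * f c ^ (p ^ k)"
    by (intro power_mult_commuting) simp
  moreover have "inverse (f x) * f c = cj (inverse (f y)) (inverse (f x))" by (simp add: fc cj_def grp_simps)
  moreover have "inverse (f x) ^ (p ^ k) = 1"
    using power_mult_commuting [of "f x" "inverse (f x)" "p ^ k"] k by (simp add: grp_simps)
  ultimately have "f c ^ (p ^ k) = 1" by (simp add: cj_pow [symmetric])
  then have "pel p (f c)" by (auto simp: pel_def)
  then have "f c = 1" using cq p(1-3) by (intro pel_distinct [of p q])
  then show ?thesis using ker cG by simp
qed

text \<open>Passes from the lower central series to \<open>nilp\<close>: by
  \<open>commutator_step\<close> the commutator of elements belonging to different primes descends
  through all terms of the series, the last of which is trivial.\<close>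

lemma nilp_nilpotent_group_image:
  fixes f :: "'a \<Rightarrow> 'b::grp"
  assumes M: "nilpotent_group M" and fin: "finite (carrier M)"
    and f: "\<And>a b. a \<in> carrier M \<Longrightarrow> b \<in> carrier M \<Longrightarrow> f (a \<otimes>\<^bsub>M\<^esub> b) = f a * f b"
  shows "nilp (f ` carrier M)"
proof -
  interpret group M using M by (simp add: nilpotent_group_def)
  have f1: "f \<one>\<^bsub>M\<^esub> = 1"
    using f [OF one_closed one_closed] mult_left_cancel_grp [of "f \<one>\<^bsub>M\<^esub>" "f \<one>\<^bsub>M\<^esub>" 1] by simp
  have finv: "f (inv\<^bsub>M\<^esub> a) = inverse (f a)" if "a \<in> carrier M" for a
    using f [of a "inv\<^bsub>M\<^esub> a"] that f1 by (intro inverse_unique_grp [symmetric]) simp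
  define L where "L i = f ` lower_central_series M i" for i
  have sub: "a \<in> carrier M" if "a \<in> lower_central_series M i" for a i
    using that subgroup.subset [OF lower_central_series_subgroup] by blast
  have L: "sgrp (L i)" for i
  proof (rule sgrp_finite_closed)
    show "finite (L i)" unfolding L_def using finite_subset [OF subgroup.subset [OF lower_central_series_subgroup] fin] by simp
    show "L i \<noteq> {}" unfolding L_def using subgroup.one_closed [OF lower_central_series_subgroup] by blast
    fix x y assume "x \<in> L i" "y \<in> L i"
    then obtain a b where "a \<in> lower_central_series M i" "b \<in> lower_central_series M i" "x = f a" "y = f b"
      unfolding L_def by blast
    then show "x * y \<in> L i"
      unfolding L_def using f sub subgroup.m_closed [OF lower_central_series_subgroup] by (metis image_eqI)
  qed
  have L0: "L 0 = f ` carrier M" by (simp add: L_def)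
  have com: "x * y * inverse x * inverse y \<in> L (Suc i)" if xy: "x \<in> L i" "y \<in> L 0" for x y i
  proof -
    obtain a b where ab: "a \<in> lower_central_series M i" "b \<in> carrier M" "x = f a" "y = f b"
      using xy unfolding L_def by auto
    have "x * y * inverse x * inverse y = f (a \<otimes>\<^bsub>M\<^esub> b \<otimes>\<^bsub>M\<^esub> inv\<^bsub>M\<^esub> a \<otimes>\<^bsub>M\<^esub> inv\<^bsub>M\<^esub> b)"
      using ab sub by (simp add: f finv)
    then show ?thesis unfolding L_def using lower_central_series_comm [OF ab(1,2)] by (metis image_eqI)
  qed
  have anti: "L (Suc i) \<subseteq> L i" for i
    unfolding L_def by (rule image_mono) (rule lower_central_series_Suc_subset)
  have L_sub: "L i \<subseteq> L 0" for i unfolding L_def using sub by auto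
  have normal: "normal_in (L i) (L 0)" for i
    unfolding normal_in_def
  proof (intro conjI ballI L L_sub)
    fix g x assume g: "g \<in> L 0" and x: "x \<in> L i"
    have "inverse x * inverse g * inverse (inverse x) * inverse (inverse g) \<in> L (Suc i)"
      by (rule com) (use g x L in \<open>auto simp: sgrpD\<close>)
    then have "x * (inverse x * inverse g * inverse (inverse x) * inverse (inverse g)) \<in> L i"
      using anti x L by (blast intro: sgrpD(2))
    then show "cj g x \<in> L i" by (simp add: cj_def grp_simps)
  qed
  obtain n where n: "lower_central_series M n = {\<one>\<^bsub>M\<^esub>}" using M by (auto simp: nilpotent_group_def)
  show ?thesis
    unfolding nilp_def
  proof (intro ballI allI impI)
    fix x y p q assume xy: "x \<in> f ` carrier M" "y \<in> f ` carrier M"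
      and p: "prime p" "prime q" "p \<noteq> q" "pel p x" "pel q y"
    define c where "c = x * y * inverse x * inverse y"
    have fL: "finite (L 0)" unfolding L0 using fin by simp
    have "c \<in> L i" for i
    proof (induction i)
      case 0
      show ?case using anti [of 0] com [of x 0 y] xy unfolding L0 [symmetric] c_def by blast
    next
      case (Suc i)
      show ?case
        by (rule commutator_step [OF L fL normal _ _ p com [OF Suc] c_def]) (use xy in \<open>simp_all add: L0\<close>)
    qed
    from this [of n] have "x * y * inverse x * inverse y = 1" by (simp add: L_def n f1 c_def)
    moreover have "x * y = (x * y * inverse x * inverse y) * (y * x)" by (simp add: grp_simps)
    ultimately show "x * y = y * x" by simp
  qed
qed

lemma kernel_normal:
  fixes f :: "'a \<Rightarrow> 'b::grp"
  assumes "group M" and f: "\<And>a b. a \<in> carrier M \<Longrightarrow> b \<in> carrier M \<Longrightarrow> f (a \<otimes>\<^bsub>M\<^esub> b) = f a * f b"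
    and c: "\<And>a b. a \<in> carrier M \<Longrightarrow> b \<in> carrier M \<Longrightarrow> f a * f b = f b * f a"
  shows "{a \<in> carrier M. f a = 1} \<lhd> M" "derived M (carrier M) \<subseteq> {a \<in> carrier M. f a = 1}"
proof -
  interpret group M by (fact assms(1))
  let ?K = "{a \<in> carrier M. f a = 1}"
  have f1: "f \<one>\<^bsub>M\<^esub> = 1"
    using f [OF one_closed one_closed] mult_left_cancel_grp [of "f \<one>\<^bsub>M\<^esub>" "f \<one>\<^bsub>M\<^esub>" 1] by simp
  have finv: "f (inv\<^bsub>M\<^esub> a) = inverse (f a)" if "a \<in> carrier M" for a
    using f [of a "inv\<^bsub>M\<^esub> a"] that f1 by (intro inverse_unique_grp [symmetric]) simp
  have K: "subgroup ?K M" by (rule subgroupI) (use f f1 finv in \<open>auto simp: inverse_one_grp\<close>)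
  then show "?K \<lhd> M"
    unfolding normal_inv_iff by (auto simp: f finv grp_simps)
  show "derived M (carrier M) \<subseteq> ?K"
    unfolding derived_def
  proof (rule generate_subgroup_incl [OF _ K])
    show "(\<Union>h1\<in>carrier M. \<Union>h2\<in>carrier M. {h1 \<otimes>\<^bsub>M\<^esub> h2 \<otimes>\<^bsub>M\<^esub> inv\<^bsub>M\<^esub> h1 \<otimes>\<^bsub>M\<^esub> inv\<^bsub>M\<^esub> h2}) \<subseteq> ?K"
    proof clarsimp
      fix a b assume "a \<in> carrier M" "b \<in> carrier M"
      then show "f (a \<otimes>\<^bsub>M\<^esub> b \<otimes>\<^bsub>M\<^esub> inv\<^bsub>M\<^esub> a \<otimes>\<^bsub>M\<^esub> inv\<^bsub>M\<^esub> b) = 1"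
        using c [of a b] by (simp add: f finv grp_simps)
    qed
  qed
qed

subsection \<open>Skew braces\<close>

context skew_brace
begin

abbreviation "lam \<equiv> brace_lambda B"

lemma add_simps:
  "x \<in> carrier B \<Longrightarrow> y \<in> carrier B \<Longrightarrow> x \<oplus> y \<in> carrier B"
  "\<zero> \<in> carrier B"
  "x \<in> carrier B \<Longrightarrow> \<ominus> x \<in> carrier B"
  "x \<in> carrier B \<Longrightarrow> y \<in> carrier B \<Longrightarrow> z \<in> carrier B \<Longrightarrow> (x \<oplus> y) \<oplus> z = x \<oplus> (y \<oplus> z)"
  "x \<in> carrier B \<Longrightarrow> \<zero> \<oplus> x = x" "x \<in> carrier B \<Longrightarrow> x \<oplus> \<zero> = x"
  "x \<in> carrier B \<Longrightarrow> \<ominus> x \<oplus> x = \<zero>" "x \<in> carrier B \<Longrightarrow> x \<oplus> \<ominus> x = \<zero>"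
  "x \<in> carrier B \<Longrightarrow> y \<in> carrier B \<Longrightarrow> \<ominus> x \<oplus> (x \<oplus> y) = y"
  "x \<in> carrier B \<Longrightarrow> y \<in> carrier B \<Longrightarrow> x \<oplus> (\<ominus> x \<oplus> y) = y"
  "x \<in> carrier B \<Longrightarrow> y \<in> carrier B \<Longrightarrow> \<ominus> (x \<oplus> y) = \<ominus> y \<oplus> \<ominus> x"
  "x \<in> carrier B \<Longrightarrow> \<ominus> (\<ominus> x) = x"
  "\<ominus> \<zero> = \<zero>"
proof -
  interpret add: group "add_monoid B" by (rule add_group)
  note [simp] = a_inv_def
  show c: "x \<oplus> y \<in> carrier B" if "x \<in> carrier B" "y \<in> carrier B" for x y using add.m_closed that by simp
  show "\<zero> \<in> carrier B" using add.one_closed by simp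
  show i: "\<ominus> x \<in> carrier B" if "x \<in> carrier B" for x using add.inv_closed that by simp
  show a: "(x \<oplus> y) \<oplus> z = x \<oplus> (y \<oplus> z)" if "x \<in> carrier B" "y \<in> carrier B" "z \<in> carrier B" for x y z
    using add.m_assoc that by simp
  show z: "\<zero> \<oplus> x = x" "x \<oplus> \<zero> = x" if "x \<in> carrier B" for x using add.l_one add.r_one that by simp_all
  show n: "\<ominus> x \<oplus> x = \<zero>" "x \<oplus> \<ominus> x = \<zero>" if "x \<in> carrier B" for x using add.l_inv add.r_inv that by simp_all
  show "\<ominus> x \<oplus> (x \<oplus> y) = y" "x \<oplus> (\<ominus> x \<oplus> y) = y" if "x \<in> carrier B" "y \<in> carrier B" for x y
    using a [of "\<ominus> x" x y] a [of x "\<ominus> x" y] n z i that by simp_all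
  show "\<ominus> (x \<oplus> y) = \<ominus> y \<oplus> \<ominus> x" if "x \<in> carrier B" "y \<in> carrier B" for x y
    using add.inv_mult_group that by simp
  show "\<ominus> (\<ominus> x) = x" if "x \<in> carrier B" for x using add.inv_inv that by simp
  show "\<ominus> \<zero> = \<zero>" using add.inv_one by simp
qed

lemma mult_simps:
  "x \<in> carrier B \<Longrightarrow> y \<in> carrier B \<Longrightarrow> x \<otimes> y \<in> carrier B"
  "\<one> \<in> carrier B"
  "x \<in> carrier B \<Longrightarrow> y \<in> carrier B \<Longrightarrow> z \<in> carrier B \<Longrightarrow> (x \<otimes> y) \<otimes> z = x \<otimes> (y \<otimes> z)"
  "x \<in> carrier B \<Longrightarrow> \<one> \<otimes> x = x"
  "x \<in> carrier B \<Longrightarrow> inv x \<in> carrier B"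
  "x \<in> carrier B \<Longrightarrow> inv x \<otimes> x = \<one>" "x \<in> carrier B \<Longrightarrow> x \<otimes> inv x = \<one>"
proof -
  interpret group B by (rule mult_group)
  show "x \<in> carrier B \<Longrightarrow> y \<in> carrier B \<Longrightarrow> x \<otimes> y \<in> carrier B"
    "\<one> \<in> carrier B"
    "x \<in> carrier B \<Longrightarrow> y \<in> carrier B \<Longrightarrow> z \<in> carrier B \<Longrightarrow> (x \<otimes> y) \<otimes> z = x \<otimes> (y \<otimes> z)"
    "x \<in> carrier B \<Longrightarrow> \<one> \<otimes> x = x"
    "x \<in> carrier B \<Longrightarrow> inv x \<in> carrier B"
    "x \<in> carrier B \<Longrightarrow> inv x \<otimes> x = \<one>" "x \<in> carrier B \<Longrightarrow> x \<otimes> inv x = \<one>"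
    for x y z by (simp_all add: m_assoc)
qed

lemma lam_closed: "a \<in> carrier B \<Longrightarrow> b \<in> carrier B \<Longrightarrow> lam a b \<in> carrier B"
  by (simp add: brace_lambda_def add_simps mult_simps)

lemma mult_eq_lam: "a \<in> carrier B \<Longrightarrow> b \<in> carrier B \<Longrightarrow> a \<otimes> b = a \<oplus> lam a b"
  by (simp add: brace_lambda_def add_simps mult_simps)

lemma lam_add: "a \<in> carrier B \<Longrightarrow> b \<in> carrier B \<Longrightarrow> c \<in> carrier B \<Longrightarrow> lam a (b \<oplus> c) = lam a b \<oplus> lam a c"
  by (simp add: brace_lambda_def brace_distrib add_simps mult_simps)

lemma lam_one: "b \<in> carrier B \<Longrightarrow> lam \<one> b = b"
  using zero_eq_one by (simp add: brace_lambda_def mult_simps) (simp add: add_simps flip: zero_eq_one)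

lemma lam_zero: assumes a: "a \<in> carrier B" shows "lam a \<zero> = \<zero>"
proof -
  have l: "lam a \<zero> \<in> carrier B" using a by (simp add: lam_closed add_simps)
  have "lam a \<zero> \<oplus> lam a \<zero> = lam a \<zero>" using lam_add [OF a add_simps(2) add_simps(2)] by (simp add: add_simps)
  then have "\<ominus> lam a \<zero> \<oplus> (lam a \<zero> \<oplus> lam a \<zero>) = \<ominus> lam a \<zero> \<oplus> lam a \<zero>" by simp
  then show ?thesis using l by (simp add: add_simps)
qed

lemma lam_neg:
  assumes a: "a \<in> carrier B" and b: "b \<in> carrier B" shows "lam a (\<ominus> b) = \<ominus> lam a b"
proof -
  have l: "lam a b \<in> carrier B" "lam a (\<ominus> b) \<in> carrier B" using a b by (simp_all add: lam_closed add_simps)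
  have "lam a b \<oplus> lam a (\<ominus> b) = \<zero>" using lam_add [OF a b, of "\<ominus> b"] a b by (simp add: add_simps lam_zero)
  then have "\<ominus> lam a b \<oplus> (lam a b \<oplus> lam a (\<ominus> b)) = \<ominus> lam a b \<oplus> \<zero>" by simp
  then show ?thesis using l by (simp add: add_simps)
qed

lemma lam_mult:
  assumes "a \<in> carrier B" "b \<in> carrier B" "c \<in> carrier B"
  shows "lam (a \<otimes> b) c = lam a (lam b c)"
proof -
  have "lam a (lam b c) = \<ominus> lam a b \<oplus> lam a (b \<otimes> c)"
    unfolding brace_lambda_def [of B b c] using assms by (simp add: lam_add lam_neg add_simps mult_simps)
  also have "\<dots> = \<ominus> (a \<oplus> lam a b) \<oplus> (a \<otimes> (b \<otimes> c))"
    unfolding brace_lambda_def [of B a "b \<otimes> c"] using assms by (simp add: add_simps mult_simps lam_closed)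
  also have "\<dots> = lam (a \<otimes> b) c"
    using assms by (simp add: mult_eq_lam [symmetric] mult_simps) (simp add: brace_lambda_def mult_simps)
  finally show ?thesis ..
qed

lemma lam_inv: "a \<in> carrier B \<Longrightarrow> b \<in> carrier B \<Longrightarrow> lam a (lam (inv a) b) = b"
  by (simp add: lam_mult [symmetric] mult_simps lam_one)

lemma lam_cancel:
  assumes "a \<in> carrier B" "b \<in> carrier B" "c \<in> carrier B" "lam a b = lam a c" shows "b = c"
proof -
  have "lam (inv a) (lam a b) = lam (inv a) (lam a c)" by (simp add: assms(4))
  then show ?thesis using assms(1-3) by (simp add: lam_mult [symmetric] mult_simps lam_one)
qed

end

section \<open>The permutation group of a finite skew brace\<close>

locale finite_skew_brace = skew_brace +
  assumes fin: "finite (carrier B)"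
begin

definition act :: "'a \<times> 'a \<Rightarrow> 'a \<Rightarrow> 'a" where
  "act p w = fst p \<oplus> lam (snd p) w"

lemma act_bij: "p \<in> carrier B \<times> carrier B \<Longrightarrow> bij_betw (act p) (carrier B) (carrier B)"
proof -
  assume "p \<in> carrier B \<times> carrier B"
  then obtain a b where p: "p = (a, b)" "a \<in> carrier B" "b \<in> carrier B" by auto
  have "act p ` carrier B \<subseteq> carrier B" using p by (auto simp: act_def lam_closed add_simps)
  moreover have "inj_on (act p) (carrier B)"
  proof (rule inj_onI)
    fix x y assume xy: "x \<in> carrier B" "y \<in> carrier B" "act p x = act p y"
    then have "\<ominus> a \<oplus> (a \<oplus> lam b x) = \<ominus> a \<oplus> (a \<oplus> lam b y)" by (simp add: act_def p)
    then have "lam b x = lam b y" using p xy by (simp add: add_simps lam_closed)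
    then show "x = y" using lam_cancel p xy by blast
  qed
  ultimately show ?thesis using fin by (simp add: bij_betw_def endo_inj_surj)
qed

text \<open>The composition law of the semidirect product of the additive by the multiplicative
  group. Pairs serve as names of maps, and different pairs may name the same map.\<close>

lemma act_mult:
  assumes "a \<in> carrier B" "b \<in> carrier B" "c \<in> carrier B" "d \<in> carrier B" "w \<in> carrier B"
  shows "act (a \<oplus> lam b c, b \<otimes> d) w = act (a, b) (act (c, d) w)"
  using assms by (simp add: act_def lam_add lam_mult lam_closed add_simps)

end

text \<open>The quotient is given as a map \<open>f\<close>, from whose three properties the proper
  ideal and both inclusions can be read off.\<close>

lemma (in finite_skew_brace) exists_abelian_quotient:
  assumes nil: "nilpotent_group B" and card: "card (carrier B) > 1"
  shows "\<exists>f :: 'a \<Rightarrow> nat perm. (\<forall>a\<in>carrier B. \<forall>b\<in>carrier B.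
      f (a \<oplus> b) = f a * f b \<and> f (lam a b) = f b \<and> f a * f b = f b * f a) \<and> (\<exists>a\<in>carrier B. f a \<noteq> 1)"
proof -
  let ?C = "carrier B"
  obtain \<phi> :: "'a \<times> 'a \<Rightarrow> nat perm" where
    mult: "\<And>x y z. x \<in> ?C \<times> ?C \<Longrightarrow> y \<in> ?C \<times> ?C \<Longrightarrow> z \<in> ?C \<times> ?C \<Longrightarrow>
      (\<And>w. w \<in> ?C \<Longrightarrow> act z w = act x (act y w)) \<Longrightarrow> \<phi> z = \<phi> x * \<phi> y" and
    one: "\<And>x. x \<in> ?C \<times> ?C \<Longrightarrow> \<phi> x = 1 \<longleftrightarrow> (\<forall>w\<in>?C. act x w = w)"
  proof (rule perm_embedding [of ?C "?C \<times> ?C" act])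
    fix \<phi> :: "'a \<times> 'a \<Rightarrow> nat perm"
    assume a: "\<And>x y z. x \<in> ?C \<times> ?C \<Longrightarrow> y \<in> ?C \<times> ?C \<Longrightarrow> z \<in> ?C \<times> ?C \<Longrightarrow>
        (\<And>w. w \<in> ?C \<Longrightarrow> act z w = act x (act y w)) \<Longrightarrow> \<phi> z = \<phi> x * \<phi> y"
      and b: "\<And>x. x \<in> ?C \<times> ?C \<Longrightarrow> \<phi> x = 1 \<longleftrightarrow> (\<forall>w\<in>?C. act x w = w)"
    show thesis by (rule that) (fact a, fact b)
  qed (rule fin, erule act_bij)
  have m: "\<phi> (a, b) * \<phi> (c, d) = \<phi> (a \<oplus> lam b c, b \<otimes> d)"
    if "a \<in> ?C" "b \<in> ?C" "c \<in> ?C" "d \<in> ?C" for a b c d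
    by (rule mult [symmetric]) (use that act_mult in \<open>auto simp: add_simps mult_simps lam_closed\<close>)
  define G where "G = \<phi> ` (?C \<times> ?C)"
  define t where "t a = \<phi> (a, \<one>)" for a
  define T where "T = t ` ?C"
  \<comment> \<open>\<open>\<phi> (a, a)\<close> is left multiplication by \<open>a\<close>, because
    \<open>a \<otimes> w = a \<oplus> lam a w\<close>.\<close>
  define D where "D = (\<lambda>a. \<phi> (a, a)) ` ?C"
  define l where "l a = \<phi> (\<zero>, a)" for a
  define H where "H = l ` ?C"
  note cl = add_simps mult_simps lam_closed lam_one lam_zero
  have sub: "T \<subseteq> G" "D \<subseteq> G" "H \<subseteq> G" by (auto simp: T_def D_def H_def G_def t_def l_def cl)
  have fG: "finite G" using fin by (simp add: G_def)
  have sG: "sgrp G"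
  proof (rule sgrp_finite_closed [OF fG])
    show "G \<noteq> {}" using cl(2) by (auto simp: G_def)
    show "x * y \<in> G" if "x \<in> G" "y \<in> G" for x y using that m by (force simp: G_def cl)
  qed
  have t_mult: "t (a \<oplus> b) = t a * t b" if "a \<in> ?C" "b \<in> ?C" for a b using that by (simp add: t_def m cl)
  have l_mult: "l (a \<otimes> b) = l a * l b" if "a \<in> ?C" "b \<in> ?C" for a b using that by (simp add: l_def m cl)
  have d_mult: "\<phi> (a \<otimes> b, a \<otimes> b) = \<phi> (a, a) * \<phi> (b, b)" if "a \<in> ?C" "b \<in> ?C" for a b
    using that by (simp add: m mult_eq_lam [symmetric])
  have tl: "\<phi> (a, b) = t a * l b" if "a \<in> ?C" "b \<in> ?C" for a b using that by (simp add: t_def l_def m cl)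
  have lt: "l b * t a = t (lam b a) * l b" if "a \<in> ?C" "b \<in> ?C" for a b
  proof -
    have "l b * t a = \<phi> (lam b a, b \<otimes> \<one>)" using that by (simp add: t_def l_def m cl)
    also have "b \<otimes> \<one> = b" using that group.is_monoid [OF mult_group] by (simp add: monoid.r_one)
    finally show ?thesis using that by (simp add: tl cl)
  qed
  have t1: "t a = 1 \<longleftrightarrow> a = \<zero>" if "a \<in> ?C" for a
  proof
    assume "t a = 1"
    then have "act (a, \<one>) \<zero> = \<zero>" using one [of "(a, \<one>)"] that cl(2) by (simp add: t_def cl)
    then show "a = \<zero>" using that by (simp add: act_def cl)
  next
    assume "a = \<zero>"
    then show "t a = 1" unfolding t_def by (subst one) (simp_all add: act_def cl)
  qed
  have sgrp_im: "sgrp (h ` ?C)" if "\<And>a b. a \<in> ?C \<Longrightarrow> b \<in> ?C \<Longrightarrow> h a * h b \<in> h ` ?C" for h :: "'a \<Rightarrow> nat perm"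
    by (rule sgrp_finite_closed) (use fin cl(2) that in auto)
  have sT: "sgrp T" unfolding T_def by (rule sgrp_im) (simp add: t_mult [symmetric] cl)
  have sD: "sgrp D" unfolding D_def by (rule sgrp_im) (simp add: d_mult [symmetric] cl)
  have sH: "sgrp H" unfolding H_def by (rule sgrp_im) (simp add: l_mult [symmetric] cl)
  have nD: "nilp D" unfolding D_def by (rule nilp_nilpotent_group_image [OF nil fin]) (rule d_mult)
  have nH: "nilp H" unfolding H_def by (rule nilp_nilpotent_group_image [OF nil fin]) (rule l_mult)
  have cjl: "cj (l b) (t (lam b a)) = t a" if "a \<in> ?C" "b \<in> ?C" for a b
    using lt [OF that] by (simp add: cj_def mult.assoc [symmetric]) (simp add: grp_simps flip: lt [OF that])
  have TG: "normal_in T G"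
    unfolding normal_in_def
  proof (intro conjI ballI sT sub)
    fix g x assume "g \<in> G" "x \<in> T"
    then obtain a b c where g: "a \<in> ?C" "b \<in> ?C" "c \<in> ?C" "g = t a * l b" "x = t c"
      by (auto simp: G_def T_def tl)
    have "cj (t a) x \<in> T" using sT g by (auto simp: T_def intro!: sgrp_cj_mem)
    then obtain c' where c': "c' \<in> ?C" "cj (t a) x = t c'" by (auto simp: T_def)
    have "cj g x = cj (l b) (t (lam b (lam (inv b) c')))"
      using c' g by (simp add: cj_cj [symmetric] lam_inv)
    also have "\<dots> = t (lam (inv b) c')" by (rule cjl) (use c' g in \<open>simp_all add: cl\<close>)
    finally show "cj g x \<in> T" using c' g by (simp add: T_def cl)
  qed
  have d_eq: "\<phi> (a, a) = t a * l a" if "a \<in> ?C" for a using tl that by simp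
  have TD: "\<exists>x\<in>T. \<exists>d\<in>D. g = x * d" if gG: "g \<in> G" for g
  proof -
    obtain a b where g: "a \<in> ?C" "b \<in> ?C" "g = t a * l b" using gG by (auto simp: G_def tl)
    \<comment> \<open>Since \<open>\<phi> (b, b) = t b * l b\<close>, the translation part has to be
      corrected by \<open>b\<close>.\<close>
    have "t a * l b = t (a \<oplus> \<ominus> b) * \<phi> (b, b)"
      using g by (simp add: d_eq t_mult [symmetric] mult.assoc [symmetric] cl)
    then show ?thesis using g by (auto simp: T_def D_def cl)
  qed
  have TH: "\<exists>x\<in>T. \<exists>h\<in>H. g = x * h" if "g \<in> G" for g
    using that by (auto simp: G_def T_def H_def tl) blast
  have DH: "\<exists>d\<in>D. \<exists>h\<in>H. g = d * h" if gG: "g \<in> G" for g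
  proof -
    obtain a b where g: "a \<in> ?C" "b \<in> ?C" "g = t a * l b" using gG by (auto simp: G_def tl)
    have "\<phi> (a, a) * l (inv a \<otimes> b) = t a * (l a * l (inv a \<otimes> b))"
      using g by (simp add: d_eq mult.assoc)
    also have "l a * l (inv a \<otimes> b) = l b" using g by (simp add: l_mult [symmetric] mult_simps(3) [symmetric] cl)
    finally have "g = \<phi> (a, a) * l (inv a \<otimes> b)" using g(3) by simp
    moreover have "\<phi> (a, a) \<in> D" "l (inv a \<otimes> b) \<in> H" using g by (simp_all add: D_def H_def cl)
    ultimately show ?thesis by blast
  qed
  have T1: "T \<noteq> {1}"
  proof
    assume "T = {1}"
    then have "?C \<subseteq> {\<zero>}" using t1 by (auto simp: T_def)
    then have "card ?C \<le> card {\<zero>}" by (intro card_mono) auto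
    then show False using card by simp
  qed
  obtain N where N: "normal_in N G" "N \<subseteq> T" "N \<noteq> T" and com: "\<And>x g. x \<in> T \<Longrightarrow> g \<in> G \<Longrightarrow> inverse x * cj g x \<in> N"
    using exists_central_quotient [OF sG fG TG T1 sD sub(2) nD sH sub(3) nH TD TH DH] by blast
  obtain q :: "nat perm \<Rightarrow> nat perm" where q: "\<And>x y. x \<in> G \<Longrightarrow> y \<in> G \<Longrightarrow> q (x * y) = q x * q y"
    and ker: "\<And>x. x \<in> G \<Longrightarrow> q x = 1 \<longleftrightarrow> x \<in> N" using quotient_hom [OF sG fG N(1)] by metis
  have q_cj: "q (cj g x) = q x" if "x \<in> T" "g \<in> G" for x g
  proof -
    have G: "x \<in> G" "inverse x * cj g x \<in> G" using that sub sG by (auto simp: sgrpD sgrp_cj_mem)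
    have "q (cj g x) = q (x * (inverse x * cj g x))" by (simp add: grp_simps)
    also have "\<dots> = q x" using q [OF G] ker [OF G(2)] com [OF that] by simp
    finally show ?thesis .
  qed
  have tT: "t a \<in> T" if "a \<in> ?C" for a using that by (simp add: T_def)
  have tG: "t a \<in> G" if "a \<in> ?C" for a using tT that sub by blast
  have lG: "l a \<in> G" if "a \<in> ?C" for a using that sub by (auto simp: H_def)
  \<comment> \<open>The image of \<open>T\<close> under \<open>q\<close> is central, so
    \<open>q\<close> is constant on conjugates of elements of \<open>T\<close>. Conjugation by
    \<open>l b\<close> yields invariance under \<open>lam b\<close>, and conjugation within
    \<open>T\<close> yields commutativity.\<close>
  define f where "f a = q (t a)" for a
  have f_add: "f (a \<oplus> b) = f a * f b" if "a \<in> ?C" "b \<in> ?C" for a b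
    using that by (simp add: f_def t_mult q tG)
  show ?thesis
  proof (intro exI [of _ f] conjI ballI)
    fix a b assume ab: "a \<in> ?C" "b \<in> ?C"
    show "f (a \<oplus> b) = f a * f b" by (rule f_add [OF ab])
    show "f (lam a b) = f b"
      using q_cj [OF tT [OF lam_closed [OF ab]] lG [OF ab(1)]] cjl [OF ab(2,1)] by (simp add: f_def)
    have "q (t b * cj (t b) (t a)) = f b * f a"
      using ab q_cj [OF tT tG] sG by (subst q) (simp_all add: f_def tG sgrp_cj_mem)
    moreover have "t b * cj (t b) (t a) = t a * t b" by (simp add: cj_def grp_simps)
    ultimately show "f a * f b = f b * f a" using ab by (simp add: f_def q tG)
  next
    show "\<exists>a\<in>?C. f a \<noteq> 1"
    proof (rule ccontr)
      assume "\<not> ?thesis"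
      then have "T \<subseteq> N" using ker tG by (auto simp: T_def f_def)
      then show False using N by blast
    qed
  qed
qed

theorem corollary3p4:
  fixes B :: "('a, 'm) ring_scheme"
  assumes "skew_brace B"
    and "finite (carrier B)"
    and "card (carrier B) > 1"
    and "nilpotent_group B"
  shows "brace_star_square B \<noteq> carrier B \<and> brace_derived B \<noteq> carrier B"
proof -
  interpret finite_skew_brace B
    using assms(1,2) by (simp add: finite_skew_brace_def finite_skew_brace_axioms_def)
  obtain f :: "'a \<Rightarrow> nat perm"
    where f_add: "\<And>a b. a \<in> carrier B \<Longrightarrow> b \<in> carrier B \<Longrightarrow> f (a \<oplus>\<^bsub>B\<^esub> b) = f a * f b"
      and f_lam: "\<And>a b. a \<in> carrier B \<Longrightarrow> b \<in> carrier B \<Longrightarrow> f (lam a b) = f b"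
      and com: "\<And>a b. a \<in> carrier B \<Longrightarrow> b \<in> carrier B \<Longrightarrow> f a * f b = f b * f a"
      and nt: "\<exists>a\<in>carrier B. f a \<noteq> 1"
    using exists_abelian_quotient [OF assms(4,3)] by blast
  \<comment> \<open>As \<open>f\<close> ignores \<open>lam\<close>, sum and product have the same
    image; the kernel of \<open>f\<close> is the ideal sought for both claims.\<close>
  have f_mult: "f (a \<otimes>\<^bsub>B\<^esub> b) = f a * f b" if "a \<in> carrier B" "b \<in> carrier B" for a b
    using that by (simp add: mult_eq_lam f_add f_lam lam_closed)
  define I where "I = {a \<in> carrier B. f a = 1}"
  have add: "I \<lhd> add_monoid B" "derived (add_monoid B) (carrier B) \<subseteq> I"
    using kernel_normal [OF add_group, of f] f_add com unfolding I_def by auto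
  have mult: "I \<lhd> B" "derived B (carrier B) \<subseteq> I"
    using kernel_normal [OF mult_group, of f] f_mult com unfolding I_def by auto
  have sub: "subgroup I (add_monoid B)" using add(1) by (rule normal_imp_subgroup)
  have "lam b ` I = I" if b: "b \<in> carrier B" for b
  proof
    show "lam b ` I \<subseteq> I" using b by (auto simp: I_def lam_closed f_lam)
    show "I \<subseteq> lam b ` I"
    proof
      fix a assume "a \<in> I"
      then show "a \<in> lam b ` I" using b
        by (intro image_eqI [of _ _ "lam (inv\<^bsub>B\<^esub> b) a"]) (simp_all add: I_def lam_inv lam_closed f_lam mult_simps)
    qed
  qed
  then have ideal: "brace_ideal I B"
    unfolding brace_ideal_def brace_left_ideal_def using sub add(1) mult(1) by blast
  have f0: "f \<zero>\<^bsub>B\<^esub> = 1"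
    using subgroup.one_closed [OF sub] by (simp add: I_def)
  have f_neg: "f (\<ominus>\<^bsub>B\<^esub> a) = inverse (f a)" if "a \<in> carrier B" for a
    using f_add [of a "\<ominus>\<^bsub>B\<^esub> a"] that f0 by (intro inverse_unique_grp [symmetric]) (simp add: add_simps)
  have "{(a \<otimes>\<^bsub>B\<^esub> b) \<oplus>\<^bsub>B\<^esub> (\<ominus>\<^bsub>B\<^esub> (a \<oplus>\<^bsub>B\<^esub> b)) | a b. a \<in> carrier B \<and> b \<in> carrier B} \<subseteq> I"
    by (auto simp: I_def add_simps mult_simps f_add f_mult f_neg grp_simps)
  then have "brace_derived B \<subseteq> I"
    unfolding brace_derived_def brace_genideal_def using ideal add(2) mult(2) by blast
  moreover have "brace_star_square B \<subseteq> I"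
    unfolding brace_star_square_def
  proof (rule group.generate_subgroup_incl [OF add_group _ sub])
    show "{brace_star B a b |a b. a \<in> carrier B \<and> b \<in> carrier B} \<subseteq> I"
      by (auto simp: I_def brace_star_def add_simps lam_closed f_add f_lam f_neg grp_simps)
  qed
  moreover have "\<not> carrier B \<subseteq> I" using nt by (auto simp: I_def)
  ultimately show ?thesis by blast
qed

end
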